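(* Let $I\subset\mathbb{R}$ be an interval open on the left, and let $\mathbf{f}\in L^\infty(I;H)$. If $\rho$ is a Vishik-Fursikov measure over the interval $I$, then the family of projections $\{\rho_t\}_{t\in I}$, $\rho_t=\Pi_t\rho$, is a statistical solution of the Navier-Stokes equations on $I$.
   Context: Spaces. Fix $\nu>0$ and one of two cases. Periodic case: $\Omega=\prod_{i=1}^3(0,L_i)$, $L_i>0$, and $\mathcal{V}$ is the set of restrictions to $\Omega$ of fields $\mathbf{w}\in C^\infty(\mathbb{R}^3)^3$ that are divergence-free, periodic with period $L_i$ in each direction $x_i$, and satisfy $\int_\Omega\mathbf{w}\,d\mathbf{x}=0$. No-slip case: $\Omega\subset\mathbb{R}^3$ is a bounded domain with smooth boundary (at least of class $C^2$) and $\mathcal{V}$ is the set of divergence-free fields in $C_c^\infty(\Omega)^3$. $H$ (resp. $V$) is the completion of $\mathcal{V}$ in the $L^2(\Omega)^3$ (resp. $H^1(\Omega)^3$) norm. Write $(\mathbf{u},\mathbf{v})_{L^2}=\int_\Omega\mathbf{u}\cdot\mathbf{v}\,d\mathbf{x}$, $|\mathbf{u}|_{L^2}$ for its norm, $((\mathbf{u},\mathbf{v}))_{H^1}=\int_\Omega\sum_{i=1}^3\partial_{x_i}\mathbf{u}\cdot\partial_{x_i}\mathbf{v}\,d\mathbf{x}$ and $\|\mathbf{u}\|_{H^1}$ for its norm. $H$ is identified with its dual, so $V\subset H\subset V'$, with duality product $\langle\cdot,\cdot\rangle_{V',V}$. Define $A:V\to V'$ by $\langle A\mathbf{u},\mathbf{v}\rangle_{V',V}=((\mathbf{u},\mathbf{v}))_{H^1}$,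 $b(\mathbf{u},\mathbf{v},\mathbf{w})=\int_\Omega(\mathbf{u}\cdot\nabla)\mathbf{v}\cdot\mathbf{w}\,d\mathbf{x}$, and $B:V\times V\to V'$ by $\langle B(\mathbf{u},\mathbf{v}),\mathbf{w}\rangle_{V',V}=b(\mathbf{u},\mathbf{v},\mathbf{w})$. For an interval $I\subset\mathbb{R}$, the subscript "loc" on spaces over $I$ refers to compact subintervals of $I$. $H_{\mathrm{w}}$ is $H$ with its weak topology. $\mathcal{C}_{\mathrm{loc}}(I,H_{\mathrm{w}})$ is the space of weakly continuous functions $I\to H$ with the topology of uniform weak convergence on compact subintervals of $I$. $\Pi_t\mathbf{u}=\mathbf{u}(t)$ for $t\in I$, and $\Pi_t\rho$ denotes the push-forward measure $\Pi_t\rho(E)=\rho(\Pi_t^{-1}E)$ on $H$ (Borel sets of $H$ and $H_{\mathrm{w}}$ coincide). Weak solution (always meaning Leray-Hopf weak solution) on an interval $I$, for a given $\mathbf{f}\in L^\infty(I;H)$: a function $\mathbf{u}:I\to H$ such that (i) $\mathbf{u}\in L^\infty_{\mathrm{loc}}(I;H)\cap L^2_{\mathrm{loc}}(I;V)$; (ii) $\partial_t\mathbf{u}\in L^{4/3}_{\mathrm{loc}}(I;V')$; (iii) $\mathbf{u}\in\mathcal{C}_{\mathrm{loc}}(I,H_{\mathrm{w}})$; (iv) $\frac{d\mathbf{u}}{dt}+\nu A\mathbf{u}+B(\mathbf{u},\mathbf{u})=\mathbf{f}$ in the distribution sense on $I$ with values in $V'$; (v) for almost all $t'\in I$ and all $t\in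 I$ with $t>t'$, $\frac12|\mathbf{u}(t)|_{L^2}^2+\nu\int_{t'}^t\|\mathbf{u}(s)\|_{H^1}^2ds\le\frac12|\mathbf{u}(t')|_{L^2}^2+\int_{t'}^t(\mathbf{f}(s),\mathbf{u}(s))_{L^2}ds$; (vi) if $I$ is closed and bounded on the left with left end point $t_0$, then $\mathbf{u}(t)\to\mathbf{u}(t_0)$ strongly in $H$ as $t\to t_0^+$. $\mathcal{U}_I^\sharp$ is the set of $\mathbf{u}\in\mathcal{C}_{\mathrm{loc}}(I,H_{\mathrm{w}})$ which are weak solutions on the interior $I^\circ$ of $I$. A measure is carried by a measurable set if the complement of that set has measure zero. Vishik-Fursikov measure over $I$: a Borel probability measure $\rho$ on $\mathcal{C}_{\mathrm{loc}}(I,H_{\mathrm{w}})$ such that (i) $\rho$ is carried by $\mathcal{U}_I^\sharp$; (ii) $t\mapsto\int_{\mathcal{U}_I^\sharp}|\mathbf{u}(t)|_{L^2}^2\,d\rho(\mathbf{u})$ belongs to $L^\infty_{\mathrm{loc}}(I)$; (iii) if $I$ is closed and bounded on the left with left end point $t_0$, then for every nonnegative, nondecreasing, continuously differentiable $\psi:[0,\infty)\to\mathbb{R}$ with bounded derivative, $\lim_{t\to t_0^+}\int_{\mathcal{U}_I^\sharp}\psi(|\mathbf{u}(t)|_{L^2}^2)\,d\rho(\mathbf{u})=\int_{\mathcal{U}_I^\sharp}\psi(|\mathbf{u}(t_0)|_{L^2}^2)\,d\rho(\mathbf{u})<\infty$. Cylindrical test function: $\Phi:H\to\mathbb{R}$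 of the form $\Phi(\mathbf{u})=\phi((\mathbf{u},\mathbf{v}_1)_{L^2},\dots,(\mathbf{u},\mathbf{v}_k)_{L^2})$ with $k\in\mathbb{N}$, $\phi\in C^1(\mathbb{R}^k)$ real-valued with compact support and $\mathbf{v}_1,\dots,\mathbf{v}_k\in V$; its Fréchet derivative is $\Phi'(\mathbf{u})=\sum_{j=1}^k\partial_j\phi((\mathbf{u},\mathbf{v}_1)_{L^2},\dots,(\mathbf{u},\mathbf{v}_k)_{L^2})\mathbf{v}_j$. Statistical solution over $I$: a family $\{\mu_t\}_{t\in I}$ of Borel probability measures on $H$ such that (i) $t\mapsto\int_H\Phi\,d\mu_t$ is measurable on $I$ for every bounded continuous $\Phi:H\to\mathbb{R}$; (ii) $t\mapsto\int_H|\mathbf{u}|_{L^2}^2d\mu_t(\mathbf{u})$ belongs to $L^\infty_{\mathrm{loc}}(I)$; (iii) $t\mapsto\int_H\|\mathbf{u}\|_{H^1}^2d\mu_t(\mathbf{u})$ belongs to $L^1_{\mathrm{loc}}(I)$ (with $\|\mathbf{u}\|_{H^1}=\infty$ for $\mathbf{u}\notin V$); (iv) for every cylindrical test function $\Phi$ and all $t',t\in I$, $\int_H\Phi\,d\mu_t=\int_H\Phi\,d\mu_{t'}+\int_{t'}^t\int_H\langle\mathbf{F}(s,\mathbf{u}),\Phi'(\mathbf{u})\rangle_{V',V}\,d\mu_s(\mathbf{u})\,ds$, where $\mathbf{F}(s,\mathbf{u})=\mathbf{f}(s)-\nu A\mathbf{u}-B(\mathbf{u},\mathbf{u})$; (v)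 there is $I'\subset I$ of full measure in $I$ such that for every nonnegative, nondecreasing, continuously differentiable $\psi:[0,\infty)\to\mathbb{R}$ with bounded derivative, all $t'\in I'$ and all $t\in I$ with $t\ge t'$, $\frac12\int_H\psi(|\mathbf{u}|_{L^2}^2)d\mu_t+\nu\int_{t'}^t\int_H\psi'(|\mathbf{u}|_{L^2}^2)\|\mathbf{u}\|_{H^1}^2d\mu_s\,ds\le\frac12\int_H\psi(|\mathbf{u}|_{L^2}^2)d\mu_{t'}+\int_{t'}^t\int_H\psi'(|\mathbf{u}|_{L^2}^2)(\mathbf{f}(s),\mathbf{u})_{L^2}d\mu_s\,ds$; (vi) if $I$ is closed and bounded on the left with left end point $t_0$, then $t\mapsto\int_H\psi(|\mathbf{u}|_{L^2}^2)d\mu_t(\mathbf{u})$ is continuous at $t_0$ from the right for every $\psi$ as in (v). *)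

theory Defs
  imports "HOL-Probability.Probability"
begin

section \<open>Smooth functions\<close>

text \<open>Meant for open sets: all iterated partial derivatives along the standard basis up to
  order k exist and are continuous.\<close>

primrec Ck_on :: "nat \<Rightarrow> 'a::euclidean_space set \<Rightarrow> ('a \<Rightarrow> 'b::real_normed_vector) \<Rightarrow> bool" where
  "Ck_on 0 S g \<longleftrightarrow> continuous_on S g"
| "Ck_on (Suc k) S g \<longleftrightarrow> (\<forall>x\<in>S. g differentiable (at x)) \<and>
     (\<forall>e\<in>Basis. Ck_on k S (\<lambda>x. frechet_derivative g (at x) e))"

definition smooth :: "('a::euclidean_space \<Rightarrow> 'b::real_normed_vector) \<Rightarrow> bool" where
  "smooth g \<longleftrightarrow> (\<forall>k. Ck_on k UNIV g)"

definition test_functions :: "'a::euclidean_space set \<Rightarrow> ('a \<Rightarrow> 'b::real_normed_vector) set" where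
  "test_functions S =
     {g. smooth g \<and> compact (closure {x. g x \<noteq> 0}) \<and> closure {x. g x \<noteq> 0} \<subseteq> S}"

definition partial :: "3 \<Rightarrow> (real^3 \<Rightarrow> 'b::real_normed_vector) \<Rightarrow> real^3 \<Rightarrow> 'b" where
  "partial i g x = frechet_derivative g (at x) (axis i 1)"

definition divergence_free :: "(real^3 \<Rightarrow> real^3) \<Rightarrow> bool" where
  "divergence_free w \<longleftrightarrow> (\<forall>x. (\<Sum>i\<in>UNIV. partial i w x $ i) = 0)"


section \<open>The Hilbert space of square-integrable vector fields on three-space\<close>

definition square_integrable :: "(real^3 \<Rightarrow> real^3) \<Rightarrow> bool" where
  "square_integrable g \<longleftrightarrow> g \<in> borel_measurable lborel \<and> integrable lborel (\<lambda>x. (norm (g x))\<^sup>2)"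

definition l2_eq :: "(real^3 \<Rightarrow> real^3) \<Rightarrow> (real^3 \<Rightarrow> real^3) \<Rightarrow> bool" where
  "l2_eq g h \<longleftrightarrow> square_integrable g \<and> square_integrable h \<and> (AE x in lborel. g x = h x)"

lemma square_integrable_inner:
  assumes "square_integrable g" "square_integrable h"
  shows "integrable lborel (\<lambda>x. g x \<bullet> h x)"
proof (rule Bochner_Integration.integrable_bound)
  show "integrable lborel (\<lambda>x. (norm (g x))\<^sup>2 + (norm (h x))\<^sup>2)"
    using assms by (auto simp: square_integrable_def)
  show "(\<lambda>x. g x \<bullet> h x) \<in> borel_measurable lborel"
    using assms by (auto simp: square_integrable_def)
  have "\<bar>g x \<bullet> h x\<bar> \<le> (norm (g x))\<^sup>2 + (norm (h x))\<^sup>2" for x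
  proof -
    have "\<bar>g x \<bullet> h x\<bar> \<le> norm (g x) * norm (h x)"
      by (rule Cauchy_Schwarz_ineq2)
    also have "\<dots> \<le> (norm (g x))\<^sup>2 + (norm (h x))\<^sup>2"
      using sum_squares_bound[of "norm (g x)" "norm (h x)"]
        mult_nonneg_nonneg[OF norm_ge_zero[of "g x"] norm_ge_zero[of "h x"]] by linarith
    finally show ?thesis .
  qed
  then show "AE x in lborel. norm (g x \<bullet> h x) \<le> norm ((norm (g x))\<^sup>2 + (norm (h x))\<^sup>2)"
    by (intro AE_I2) (simp add: order_trans[OF _ abs_ge_self])
qed

lemma square_integrable_0: "square_integrable (\<lambda>x. 0)"
  by (simp add: square_integrable_def)

lemma square_integrable_scaleR:
  "square_integrable g \<Longrightarrow> square_integrable (\<lambda>x. c *\<^sub>R g x)"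
  by (auto simp: square_integrable_def power_mult_distrib)

lemma square_integrable_add:
  assumes "square_integrable g" "square_integrable h"
  shows "square_integrable (\<lambda>x. g x + h x)"
proof -
  have *: "(norm (g x + h x))\<^sup>2 = (norm (g x))\<^sup>2 + 2 * (g x \<bullet> h x) + (norm (h x))\<^sup>2" for x
    by (simp add: power2_norm_eq_inner inner_add_left inner_add_right inner_commute)
  show ?thesis
    using assms square_integrable_inner[OF assms]
    unfolding square_integrable_def * by auto
qed

lemma square_integrable_uminus: "square_integrable g \<Longrightarrow> square_integrable (\<lambda>x. - g x)"
  by (auto simp: square_integrable_def)

lemma square_integrable_diff:
  "square_integrable g \<Longrightarrow> square_integrable h \<Longrightarrow> square_integrable (\<lambda>x. g x - h x)"
  using square_integrable_add[of g "\<lambda>x. - h x"] square_integrable_uminus[of h] by simp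

quotient_type l2field = "real^3 \<Rightarrow> real^3" / partial: l2_eq
proof (rule part_equivpI)
  show "\<exists>x. l2_eq x x"
    by (rule exI[of _ "\<lambda>x. 0"]) (simp add: l2_eq_def square_integrable_0)
  show "symp l2_eq"
    by (auto simp: symp_def l2_eq_def)
  show "transp l2_eq"
    unfolding transp_def l2_eq_def by auto
qed

instantiation l2field :: real_inner
begin

lift_definition zero_l2field :: l2field is "\<lambda>x. 0"
  by (simp add: l2_eq_def square_integrable_0)

lift_definition plus_l2field :: "l2field \<Rightarrow> l2field \<Rightarrow> l2field" is "\<lambda>g h x. g x + h x"
  by (auto simp: l2_eq_def square_integrable_add)

lift_definition uminus_l2field :: "l2field \<Rightarrow> l2field" is "\<lambda>g x. - g x"
  by (auto simp: l2_eq_def square_integrable_uminus)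

lift_definition minus_l2field :: "l2field \<Rightarrow> l2field \<Rightarrow> l2field" is "\<lambda>g h x. g x - h x"
  by (auto simp: l2_eq_def square_integrable_diff)

lift_definition scaleR_l2field :: "real \<Rightarrow> l2field \<Rightarrow> l2field" is "\<lambda>c g x. c *\<^sub>R g x"
  by (auto simp: l2_eq_def square_integrable_scaleR)

lift_definition inner_l2field :: "l2field \<Rightarrow> l2field \<Rightarrow> real"
  is "\<lambda>g h. \<integral>x. g x \<bullet> h x \<partial>lborel"
  by (rule integral_cong_AE) (auto simp: l2_eq_def square_integrable_def)

definition norm_l2field :: "l2field \<Rightarrow> real" where
  "norm_l2field u = sqrt (u \<bullet> u)"

definition sgn_l2field :: "l2field \<Rightarrow> l2field" where
  "sgn_l2field u = inverse (norm u) *\<^sub>R u"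

definition dist_l2field :: "l2field \<Rightarrow> l2field \<Rightarrow> real" where
  "dist_l2field u v = norm (u - v)"

definition uniformity_l2field :: "(l2field \<times> l2field) filter" where
  "uniformity_l2field = (INF e\<in>{0<..}. principal {(u, v). dist u v < e})"

definition open_l2field :: "l2field set \<Rightarrow> bool" where
  "open_l2field S \<longleftrightarrow> (\<forall>u\<in>S. \<forall>\<^sub>F (u', v) in uniformity. u' = u \<longrightarrow> v \<in> S)"

instance
proof
  fix u v w :: l2field and a b :: real
  show "u + v + w = u + (v + w)"
    by transfer (auto simp: l2_eq_def square_integrable_add add.assoc)
  show "u + v = v + u"
    by transfer (auto simp: l2_eq_def square_integrable_add add.commute)
  show "0 + u = u"
    by transfer (auto simp: l2_eq_def)
  show "- u + u = 0"
    by transfer (auto simp: l2_eq_def square_integrable_0)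
  show "u - v = u + - v"
    by transfer (auto simp: l2_eq_def square_integrable_diff)
  show "a *\<^sub>R (u + v) = a *\<^sub>R u + a *\<^sub>R v"
    by transfer (auto simp: l2_eq_def scaleR_add_right square_integrable_add square_integrable_scaleR)
  show "(a + b) *\<^sub>R u = a *\<^sub>R u + b *\<^sub>R u"
    by transfer (auto simp: l2_eq_def scaleR_add_left square_integrable_add square_integrable_scaleR)
  show "a *\<^sub>R b *\<^sub>R u = (a * b) *\<^sub>R u"
    by transfer (auto simp: l2_eq_def square_integrable_scaleR)
  show "1 *\<^sub>R u = u"
    by transfer (auto simp: l2_eq_def)
  show "sgn u = inverse (norm u) *\<^sub>R u"
    by (simp add: sgn_l2field_def)
  show "dist u v = norm (u - v)"
    by (simp add: dist_l2field_def)
  show "uniformity = (INF e\<in>{0<..}. principal {(x::l2field, y). dist x y < e})"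
    by (simp add: uniformity_l2field_def)
  show "open S \<longleftrightarrow> (\<forall>x\<in>S. \<forall>\<^sub>F (x', y) in uniformity. x' = x \<longrightarrow> y \<in> S)" for S :: "l2field set"
    by (simp add: open_l2field_def)
  show "u \<bullet> v = v \<bullet> u"
    by transfer (simp add: inner_commute)
  show "(u + v) \<bullet> w = u \<bullet> w + v \<bullet> w"
    by transfer (auto simp: l2_eq_def inner_add_left square_integrable_inner)
  show "(a *\<^sub>R u) \<bullet> v = a * (u \<bullet> v)"
    by transfer simp
  show "0 \<le> u \<bullet> u"
    by transfer (simp add: integral_nonneg_AE)
  show "u \<bullet> u = 0 \<longleftrightarrow> u = 0"
  proof (transfer, goal_cases)
    case (1 g)
    then have g: "square_integrable g"
      by (simp add: l2_eq_def)
    then have "(\<integral>x. g x \<bullet> g x \<partial>lborel) = 0 \<longleftrightarrow> (AE x in lborel. g x \<bullet> g x = 0)"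
      by (intro integral_nonneg_eq_0_iff_AE) (auto simp: square_integrable_inner)
    then show ?case
      using g by (auto simp: l2_eq_def square_integrable_0)
  qed
  show "norm u = sqrt (u \<bullet> u)"
    by (simp add: norm_l2field_def)
qed

end

text \<open>Extension by zero realises fields on a domain, and hence the space of square-integrable
  fields on it, inside \<^typ>\<open>l2field\<close>.\<close>

definition l2_restrict :: "(real^3) set \<Rightarrow> (real^3 \<Rightarrow> real^3) \<Rightarrow> l2field" where
  "l2_restrict \<Omega> w = abs_l2field (\<lambda>x. indicator \<Omega> x *\<^sub>R w x)"

definition vanishes_off :: "(real^3) set \<Rightarrow> l2field \<Rightarrow> bool" where
  "vanishes_off \<Omega> u \<longleftrightarrow> (AE x in lborel. x \<notin> \<Omega> \<longrightarrow> rep_l2field u x = 0)"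


section \<open>The two boundary conditions\<close>

definition periodic_fields :: "real^3 \<Rightarrow> (real^3 \<Rightarrow> real^3) set" where
  "periodic_fields L = {w. smooth w \<and> divergence_free w \<and>
     (\<forall>i x. w (x + (L $ i) *\<^sub>R axis i 1) = w x) \<and> (LINT x:box 0 L|lborel. w x) = 0}"

definition no_slip_fields :: "(real^3) set \<Rightarrow> (real^3 \<Rightarrow> real^3) set" where
  "no_slip_fields \<Omega> = {w \<in> test_functions \<Omega>. divergence_free w}"

text \<open>Near each boundary point, up to a rotation or reflection, the set is the strict
  supergraph of a twice continuously differentiable function.\<close>

definition C2_boundary :: "(real^3) set \<Rightarrow> bool" where
  "C2_boundary \<Omega> \<longleftrightarrow> (\<forall>p\<in>frontier \<Omega>. \<exists>r>0. \<exists>T::real^3 \<Rightarrow> real^3. \<exists>\<gamma>::real^2 \<Rightarrow> real.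
     orthogonal_transformation T \<and> Ck_on 2 UNIV \<gamma> \<and>
     \<Omega> \<inter> ball p r = {x \<in> ball p r. \<gamma> (vector [T x $ 1, T x $ 2]) < T x $ 3})"

definition flow_setting :: "(real^3) set \<Rightarrow> (real^3 \<Rightarrow> real^3) set \<Rightarrow> bool" where
  "flow_setting \<Omega> \<V> \<longleftrightarrow>
     (\<exists>L. (\<forall>i. 0 < L $ i) \<and> \<Omega> = box 0 L \<and> \<V> = periodic_fields L) \<or>
     (open \<Omega> \<and> connected \<Omega> \<and> \<Omega> \<noteq> {} \<and> bounded \<Omega> \<and> C2_boundary \<Omega> \<and> \<V> = no_slip_fields \<Omega>)"


section \<open>Weak derivatives\<close>

definition weak_partial :: "(real^3) set \<Rightarrow> 3 \<Rightarrow> l2field \<Rightarrow> l2field \<Rightarrow> bool" where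
  "weak_partial \<Omega> i u g \<longleftrightarrow> vanishes_off \<Omega> g \<and>
     (\<forall>\<phi>\<in>test_functions \<Omega> :: (real^3 \<Rightarrow> real) set.
        (LINT x:\<Omega>|lborel. partial i \<phi> x *\<^sub>R rep_l2field u x) =
        - (LINT x:\<Omega>|lborel. \<phi> x *\<^sub>R rep_l2field g x))"

definition H1 :: "(real^3) set \<Rightarrow> l2field set" where
  "H1 \<Omega> = {u. vanishes_off \<Omega> u \<and> (\<forall>i. \<exists>g. weak_partial \<Omega> i u g)}"

text \<open>The three weak partial derivatives; only meaningful on \<^const>\<open>H1\<close>. The inner product of
  \<^typ>\<open>l2field^3\<close> is the sum of the inner products of the components.\<close>

definition weak_grad :: "(real^3) set \<Rightarrow> l2field \<Rightarrow> l2field^3" where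
  "weak_grad \<Omega> u = (\<chi> i. THE g. weak_partial \<Omega> i u g)"


section \<open>Functions on intervals and auxiliary classes\<close>

text \<open>Moments of measures may a priori be infinite, hence local classes for functions with values
  in the extended nonnegative reals.\<close>

definition Linf_loc :: "real set \<Rightarrow> (real \<Rightarrow> ennreal) \<Rightarrow> bool" where
  "Linf_loc I g \<longleftrightarrow> g \<in> borel_measurable (lebesgue_on I) \<and>
     (\<forall>a b. {a..b} \<subseteq> I \<longrightarrow> (\<exists>C::real. AE t in lebesgue_on {a..b}. g t \<le> ennreal C))"

definition L1_loc :: "real set \<Rightarrow> (real \<Rightarrow> ennreal) \<Rightarrow> bool" where
  "L1_loc I g \<longleftrightarrow> g \<in> borel_measurable (lebesgue_on I) \<and>
     (\<forall>a b. {a..b} \<subseteq> I \<longrightarrow> (\<integral>\<^sup>+t\<in>{a..b}. g t \<partial>lebesgue) < \<infinity>)"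

definition left_endpoint_in :: "real set \<Rightarrow> real \<Rightarrow> bool" where
  "left_endpoint_in I t0 \<longleftrightarrow> t0 \<in> I \<and> (\<forall>t\<in>I. t0 \<le> t)"

definition interval_open_left :: "real set \<Rightarrow> bool" where
  "interval_open_left I \<longleftrightarrow> is_interval I \<and> I \<noteq> {} \<and> \<not> (\<exists>t0. left_endpoint_in I t0)"

definition borel_of :: "'a topology \<Rightarrow> 'a measure" where
  "borel_of T = sigma (topspace T) {U. openin T U}"

definition carried_by :: "'a measure \<Rightarrow> 'a set \<Rightarrow> bool" where
  "carried_by M S \<longleftrightarrow> S \<in> sets M \<and> emeasure M (space M - S) = 0"

text \<open>The functions \<open>\<psi>\<close> on the half-line used in the energy inequalities, paired with their
  derivatives (one-sided at zero).\<close>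

definition energy_function :: "(real \<Rightarrow> real) \<Rightarrow> (real \<Rightarrow> real) \<Rightarrow> bool" where
  "energy_function \<psi> \<psi>' \<longleftrightarrow> (\<forall>x\<ge>0. 0 \<le> \<psi> x) \<and> mono_on {0..} \<psi> \<and>
     (\<forall>x\<ge>0. (\<psi> has_real_derivative \<psi>' x) (at x within {0..})) \<and>
     continuous_on {0..} \<psi>' \<and> bounded (\<psi>' ` {0..})"

text \<open>The \<open>j\<close>-th partial derivative for functions on \<^term>\<open>Euclidean_space k\<close>, whose points are
  the sequences that vanish from index \<open>k\<close> on.\<close>

definition coord_deriv :: "((nat \<Rightarrow> real) \<Rightarrow> real) \<Rightarrow> nat \<Rightarrow> (nat \<Rightarrow> real) \<Rightarrow> real" where
  "coord_deriv \<phi> j x = deriv (\<lambda>s. \<phi> (x(j := s))) (x j)"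

definition C1_compact_support :: "nat \<Rightarrow> ((nat \<Rightarrow> real) \<Rightarrow> real) \<Rightarrow> bool" where
  "C1_compact_support k \<phi> \<longleftrightarrow>
     continuous_map (Euclidean_space k) euclideanreal \<phi> \<and>
     (\<forall>j<k. (\<forall>x\<in>topspace (Euclidean_space k).
               (\<lambda>s. \<phi> (x(j := s))) differentiable (at (x j))) \<and>
            continuous_map (Euclidean_space k) euclideanreal (coord_deriv \<phi> j)) \<and>
     compactin (Euclidean_space k)
       (Euclidean_space k closure_of {x \<in> topspace (Euclidean_space k). \<phi> x \<noteq> 0})"

definition coords :: "nat \<Rightarrow> (nat \<Rightarrow> l2field) \<Rightarrow> l2field \<Rightarrow> nat \<Rightarrow> real" where
  "coords k v u = (\<lambda>j. if j < k then u \<bullet> v j else 0)"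

definition cyl :: "((nat \<Rightarrow> real) \<Rightarrow> real) \<Rightarrow> nat \<Rightarrow> (nat \<Rightarrow> l2field) \<Rightarrow> l2field \<Rightarrow> real" where
  "cyl \<phi> k v u = \<phi> (coords k v u)"

definition cyl_deriv :: "((nat \<Rightarrow> real) \<Rightarrow> real) \<Rightarrow> nat \<Rightarrow> (nat \<Rightarrow> l2field) \<Rightarrow> l2field \<Rightarrow> l2field" where
  "cyl_deriv \<phi> k v u = (\<Sum>j<k. coord_deriv \<phi> j (coords k v u) *\<^sub>R v j)"


section \<open>Navier-Stokes equations\<close>

locale navier_stokes =
  fixes \<Omega> :: "(real^3) set" and \<V> :: "(real^3 \<Rightarrow> real^3) set"
    and \<nu> :: real and f :: "real \<Rightarrow> l2field"
begin

text \<open>The ambient spaces are complete, so the completions are closures.\<close>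

definition H :: "l2field set" where
  "H = closure (l2_restrict \<Omega> ` \<V>)"

definition V :: "l2field set" where
  "V = {u \<in> H1 \<Omega>. \<forall>e>0. \<exists>w\<in>\<V>.
      sqrt ((norm (u - l2_restrict \<Omega> w))\<^sup>2 + (norm (weak_grad \<Omega> (u - l2_restrict \<Omega> w)))\<^sup>2) < e}"

definition V_inner :: "l2field \<Rightarrow> l2field \<Rightarrow> real" where
  "V_inner u v = weak_grad \<Omega> u \<bullet> weak_grad \<Omega> v"

definition V_norm :: "l2field \<Rightarrow> real" where
  "V_norm u = sqrt (V_inner u u)"

definition V_norm_sq :: "l2field \<Rightarrow> ennreal" where
  "V_norm_sq u = (if u \<in> V then ennreal ((V_norm u)\<^sup>2) else \<infinity>)"

definition V_dual :: "(l2field \<Rightarrow> real) set" where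
  "V_dual = {l \<in> extensional V.
     (\<forall>u\<in>V. \<forall>v\<in>V. \<forall>a b. l (a *\<^sub>R u + b *\<^sub>R v) = a * l u + b * l v) \<and>
     (\<exists>C. \<forall>v\<in>V. \<bar>l v\<bar> \<le> C * V_norm v)}"

definition V_dual_norm :: "(l2field \<Rightarrow> real) \<Rightarrow> real" where
  "V_dual_norm l = (SUP v\<in>{v \<in> V. V_norm v \<le> 1}. \<bar>l v\<bar>)"

definition A :: "l2field \<Rightarrow> l2field \<Rightarrow> real" where
  "A u = (\<lambda>v\<in>V. V_inner u v)"

definition b :: "l2field \<Rightarrow> l2field \<Rightarrow> l2field \<Rightarrow> real" where
  "b u v w = (LINT x:\<Omega>|lborel.
     (\<Sum>i\<in>UNIV. (rep_l2field u x $ i) *\<^sub>R rep_l2field (weak_grad \<Omega> v $ i) x) \<bullet> rep_l2field w x)"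

definition B :: "l2field \<Rightarrow> l2field \<Rightarrow> l2field \<Rightarrow> real" where
  "B u v = (\<lambda>w\<in>V. b u v w)"

definition F :: "real \<Rightarrow> l2field \<Rightarrow> l2field \<Rightarrow> real" where
  "F s u = (\<lambda>v\<in>V. f s \<bullet> v - \<nu> * A u v - B u u v)"

definition Linf_H :: "real set \<Rightarrow> (real \<Rightarrow> l2field) \<Rightarrow> bool" where
  "Linf_H I g \<longleftrightarrow> g \<in> borel_measurable (lebesgue_on I) \<and> (AE t in lebesgue_on I. g t \<in> H) \<and>
     (\<exists>C. AE t in lebesgue_on I. norm (g t) \<le> C)"

definition Linf_loc_H :: "real set \<Rightarrow> (real \<Rightarrow> l2field) \<Rightarrow> bool" where
  "Linf_loc_H I g \<longleftrightarrow> g \<in> borel_measurable (lebesgue_on I) \<and> (AE t in lebesgue_on I. g t \<in> H) \<and>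
     Linf_loc I (\<lambda>t. ennreal (norm (g t)))"

text \<open>The norm of \<open>V\<close> is the norm of the gradient, so measurability into \<open>V\<close> is measurability
  of the gradient.\<close>

definition L2_loc_V :: "real set \<Rightarrow> (real \<Rightarrow> l2field) \<Rightarrow> bool" where
  "L2_loc_V I g \<longleftrightarrow> (AE t in lebesgue_on I. g t \<in> V) \<and>
     (\<lambda>t. weak_grad \<Omega> (g t)) \<in> borel_measurable (lebesgue_on I) \<and>
     L1_loc I (\<lambda>t. ennreal ((V_norm (g t))\<^sup>2))"

text \<open>Bochner measurability: almost everywhere limit of simple functions in the dual norm.\<close>

definition V_dual_measurable :: "real set \<Rightarrow> (real \<Rightarrow> l2field \<Rightarrow> real) \<Rightarrow> bool" where
  "V_dual_measurable I g \<longleftrightarrow> (\<forall>t\<in>I. g t \<in> V_dual) \<and>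
     (\<exists>S :: nat \<Rightarrow> real \<Rightarrow> l2field \<Rightarrow> real.
        (\<forall>n. finite (S n ` I) \<and> S n ` I \<subseteq> V_dual \<and> (\<forall>l. {t \<in> I. S n t = l} \<in> sets lebesgue)) \<and>
        (AE t in lebesgue_on I. (\<lambda>n. V_dual_norm (\<lambda>v. S n t v - g t v)) \<longlonglongrightarrow> 0))"

definition Lp_loc_V_dual :: "real \<Rightarrow> real set \<Rightarrow> (real \<Rightarrow> l2field \<Rightarrow> real) \<Rightarrow> bool" where
  "Lp_loc_V_dual p I g \<longleftrightarrow> V_dual_measurable I g \<and>
     L1_loc I (\<lambda>t. ennreal (V_dual_norm (g t) powr p))"

text \<open>Identities between distributions with values in the dual of \<open>V\<close> are tested against
  scalar functions of time and elements of \<open>V\<close>.\<close>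

definition distrib_time_deriv :: "real set \<Rightarrow> (real \<Rightarrow> l2field) \<Rightarrow> (real \<Rightarrow> l2field \<Rightarrow> real) \<Rightarrow> bool" where
  "distrib_time_deriv I u g \<longleftrightarrow> (\<forall>\<phi>\<in>test_functions (interior I) :: (real \<Rightarrow> real) set. \<forall>v\<in>V.
     (LINT s:I|lebesgue. deriv \<phi> s * (u s \<bullet> v)) = - (LINT s:I|lebesgue. \<phi> s * g s v))"

definition weakly_continuous :: "real set \<Rightarrow> (real \<Rightarrow> l2field) \<Rightarrow> bool" where
  "weakly_continuous I u \<longleftrightarrow> (\<forall>t\<in>I. u t \<in> H) \<and> (\<forall>v\<in>H. continuous_on I (\<lambda>t. u t \<bullet> v))"

definition weak_solution :: "real set \<Rightarrow> (real \<Rightarrow> l2field) \<Rightarrow> bool" where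
  "weak_solution I u \<longleftrightarrow>
     Linf_loc_H I u \<and> L2_loc_V I u \<and>
     (\<exists>g. Lp_loc_V_dual (4/3) I g \<and> distrib_time_deriv I u g) \<and>
     weakly_continuous I u \<and>
     distrib_time_deriv I u (\<lambda>s. F s (u s)) \<and>
     (AE t' in lebesgue_on I. \<forall>t\<in>I. t > t' \<longrightarrow>
        (norm (u t))\<^sup>2 / 2 + \<nu> * (LINT s:{t'..t}|lebesgue. (V_norm (u s))\<^sup>2)
        \<le> (norm (u t'))\<^sup>2 / 2 + (LINT s:{t'..t}|lebesgue. f s \<bullet> u s)) \<and>
     (\<forall>t0. left_endpoint_in I t0 \<longrightarrow> (u \<longlongrightarrow> u t0) (at t0 within I))"

text \<open>Paths are extensional (constantly \<^const>\<open>undefined\<close> off the interval), so that they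
  correspond to functions on the interval.\<close>

definition paths :: "real set \<Rightarrow> (real \<Rightarrow> l2field) set" where
  "paths I = {u \<in> extensional I. weakly_continuous I u}"

text \<open>Uniform convergence on compact subintervals with respect to each seminorm
  \<open>u \<mapsto> \<bar>u \<bullet> v\<bar>\<close> defining the weak topology of \<^const>\<open>H\<close>.\<close>

definition path_topology :: "real set \<Rightarrow> (real \<Rightarrow> l2field) topology" where
  "path_topology I = topology_generated_by
     {{u \<in> paths I. \<forall>t\<in>{c..d}. \<bar>(u t - w t) \<bullet> v\<bar> < e} | w c d v e.
        w \<in> paths I \<and> c \<le> d \<and> {c..d} \<subseteq> I \<and> v \<in> H \<and> e > 0}"

definition U_sharp :: "real set \<Rightarrow> (real \<Rightarrow> l2field) set" where
  "U_sharp I = {u \<in> paths I. weak_solution (interior I) u}"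

definition Vishik_Fursikov_measure :: "real set \<Rightarrow> (real \<Rightarrow> l2field) measure \<Rightarrow> bool" where
  "Vishik_Fursikov_measure I \<rho> \<longleftrightarrow>
     prob_space \<rho> \<and> sets \<rho> = sets (borel_of (path_topology I)) \<and>
     carried_by \<rho> (U_sharp I) \<and>
     Linf_loc I (\<lambda>t. \<integral>\<^sup>+u\<in>U_sharp I. ennreal ((norm (u t))\<^sup>2) \<partial>\<rho>) \<and>
     (\<forall>t0 \<psi> \<psi>'. left_endpoint_in I t0 \<and> energy_function \<psi> \<psi>' \<longrightarrow>
        ((\<lambda>t. \<integral>\<^sup>+u\<in>U_sharp I. ennreal (\<psi> ((norm (u t))\<^sup>2)) \<partial>\<rho>) \<longlongrightarrow>
           (\<integral>\<^sup>+u\<in>U_sharp I. ennreal (\<psi> ((norm (u t0))\<^sup>2)) \<partial>\<rho>)) (at t0 within I) \<and>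
        (\<integral>\<^sup>+u\<in>U_sharp I. ennreal (\<psi> ((norm (u t0))\<^sup>2)) \<partial>\<rho>) < \<infinity>)"

text \<open>The norm and the weak topology of \<^const>\<open>H\<close> have the same Borel sets.\<close>

definition borel_H :: "l2field measure" where
  "borel_H = restrict_space borel H"

definition proj :: "(real \<Rightarrow> l2field) measure \<Rightarrow> real \<Rightarrow> l2field measure" where
  "proj \<rho> t = distr \<rho> borel_H (\<lambda>u. u t)"

text \<open>The functional \<open>F s u\<close> is only defined for \<open>u\<close> in \<open>V\<close>; off \<open>V\<close>, which is a null set
  for almost every time because the mean of \<^const>\<open>V_norm_sq\<close> is locally integrable, the
  integrand is set to zero. Real-valued
  integrals are required to exist; those with nonnegative integrand are taken in
  the extended reals.\<close>

definition statistical_solution :: "real set \<Rightarrow> (real \<Rightarrow> l2field measure) \<Rightarrow> bool" where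
  "statistical_solution I \<mu> \<longleftrightarrow>
     (\<forall>t\<in>I. prob_space (\<mu> t) \<and> sets (\<mu> t) = sets borel_H) \<and>
     (\<forall>\<Phi> :: l2field \<Rightarrow> real. continuous_on H \<Phi> \<and> bounded (\<Phi> ` H) \<longrightarrow>
        (\<lambda>t. \<integral>u. \<Phi> u \<partial>\<mu> t) \<in> borel_measurable (lebesgue_on I)) \<and>
     Linf_loc I (\<lambda>t. \<integral>\<^sup>+u. ennreal ((norm u)\<^sup>2) \<partial>\<mu> t) \<and>
     L1_loc I (\<lambda>t. \<integral>\<^sup>+u. V_norm_sq u \<partial>\<mu> t) \<and>
     (\<forall>k \<phi> v. C1_compact_support k \<phi> \<and> (\<forall>j<k. v j \<in> V) \<longrightarrow>
        (let G = (\<lambda>s u. if u \<in> V then F s u (cyl_deriv \<phi> k v u) else 0) in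
         (AE s in lebesgue_on I. integrable (\<mu> s) (G s)) \<and>
         (\<forall>t'\<in>I. \<forall>t\<in>I.
            interval_lebesgue_integrable lebesgue (ereal t') (ereal t) (\<lambda>s. \<integral>u. G s u \<partial>\<mu> s) \<and>
            (\<integral>u. cyl \<phi> k v u \<partial>\<mu> t) =
              (\<integral>u. cyl \<phi> k v u \<partial>\<mu> t') + (LINT s=ereal t'..ereal t|lebesgue. (\<integral>u. G s u \<partial>\<mu> s))))) \<and>
     (\<exists>I' \<subseteq> I. negligible (I - I') \<and>
        (\<forall>\<psi> \<psi>'. energy_function \<psi> \<psi>' \<longrightarrow>
           (let K = (\<lambda>s u. \<psi>' ((norm u)\<^sup>2) * (f s \<bullet> u)) in
            (AE s in lebesgue_on I. integrable (\<mu> s) (K s)) \<and>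
            (\<forall>t'\<in>I'. \<forall>t\<in>I. t' \<le> t \<longrightarrow>
               set_integrable lebesgue {t'..t} (\<lambda>s. \<integral>u. K s u \<partial>\<mu> s) \<and>
               ereal (1/2) * enn2ereal (\<integral>\<^sup>+u. ennreal (\<psi> ((norm u)\<^sup>2)) \<partial>\<mu> t) +
               ereal \<nu> * enn2ereal (\<integral>\<^sup>+s\<in>{t'..t}.
                   (\<integral>\<^sup>+u. ennreal (\<psi>' ((norm u)\<^sup>2)) * V_norm_sq u \<partial>\<mu> s) \<partial>lebesgue)
               \<le> ereal (1/2) * enn2ereal (\<integral>\<^sup>+u. ennreal (\<psi> ((norm u)\<^sup>2)) \<partial>\<mu> t') +
                 ereal (LINT s:{t'..t}|lebesgue. (\<integral>u. K s u \<partial>\<mu> s)))))) \<and>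
     (\<forall>t0 \<psi> \<psi>'. left_endpoint_in I t0 \<and> energy_function \<psi> \<psi>' \<longrightarrow>
        (\<integral>\<^sup>+u. ennreal (\<psi> ((norm u)\<^sup>2)) \<partial>\<mu> t0) < \<infinity> \<and>
        ((\<lambda>t. \<integral>\<^sup>+u. ennreal (\<psi> ((norm u)\<^sup>2)) \<partial>\<mu> t) \<longlongrightarrow>
           (\<integral>\<^sup>+u. ennreal (\<psi> ((norm u)\<^sup>2)) \<partial>\<mu> t0)) (at t0 within I))"

end

end

theory Submission
  imports Defs "HOL-Real_Asymp.Real_Asymp"
begin

text \<open>Tested against \<open>v \<in> V\<close>, the equation satisfied by almost every path integrates to
  \<open>u t \<bullet> v - u t' \<bullet> v = \<integral> F s (u s) v ds\<close>; the chain rule turns this into the corresponding identity for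
  cylindrical functions, and averaging over the paths gives the Liouville equation. Fubini's theorem
  applies because the energy inequality bounds the mean of the dissipation on compact time intervals,
  while Ladyzhenskaya's inequality bounds \<open>b u u v\<close> by a multiple of \<open>|u|\<^sup>2 + |\<nabla>u|\<^sup>2\<close>. By Fubini, almost
  every time is a good initial time of the energy inequality for almost every path. Along good times
  the energy of a path is a nonincreasing function plus an integral, so that the inequality survives
  composition with a nondecreasing \<open>\<psi>\<close>, and can then be averaged. At a right end point of the interval
  all identities follow by weak continuity; a left end point does not occur.\<close>

text \<open>Measurability is the main obstacle. Two maps that are not continuous for the L2 norm
  must be shown Borel: the gradient, an unbounded operator, and the map from \<open>u\<close> to
  \<open>b u u v\<close>. The first uses that the graph of the gradient over \<open>V\<close> is a
  closed subspace of a Hilbert space, the second a truncation of \<open>v\<close>. Separability of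
  L2 then reduces strong measurability to that of inner products, which is what the topology of the
  path space offers. The definition of a Vishik-Fursikov measure says nothing about the mean
  dissipation, and the good times of the energy inequality form a set that depends on the path; with
  rational final times the inequality becomes a measurable condition on pairs of a time and a path,
  so that the exceptional sets can be sliced the other way. Both chain rules, for \<phi> and for
  \<psi>, are proved by bisection: an estimate on short intervals whose error is a small constant
  times an integral, hence additive. For \<psi> the estimate has to be one-sided, since the energy
  of a path may jump down.\<close>

lemma square_integrable_rep: "square_integrable (rep_l2field u)"
  using Quotient3_rep_reflp[OF Quotient3_l2field, of u] by (simp add: l2_eq_def)

lemma abs_rep_l2field: "abs_l2field (rep_l2field u) = u"
  by (rule Quotient3_abs_rep[OF Quotient3_l2field])

lemma rep_abs_l2field:
  assumes "square_integrable g"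
  shows "AE x in lborel. rep_l2field (abs_l2field g) x = g x"
proof -
  have "l2_eq g g" using assms by (simp add: l2_eq_def)
  from Quotient3_rep_abs[OF Quotient3_l2field, of g, OF this] show ?thesis
    by (simp add: l2_eq_def)
qed

lemma rep_measurable [measurable]: "rep_l2field u \<in> borel_measurable borel"
  using square_integrable_rep[of u] by (simp add: square_integrable_def)

lemma abs_l2field_eqI:
  assumes "square_integrable g" "square_integrable h" "AE x in lborel. g x = h x"
  shows "abs_l2field g = abs_l2field h"
proof -
  have "l2_eq g h" using assms by (simp add: l2_eq_def)
  then show ?thesis by (metis Quotient3_rel_abs[OF Quotient3_l2field])
qed

lemma l2field_eqI: "(AE x in lborel. rep_l2field u x = rep_l2field v x) \<Longrightarrow> u = v"
  by (metis abs_l2field_eqI abs_rep_l2field square_integrable_rep)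

lemma inner_abs_l2field:
  assumes "square_integrable g" "square_integrable h"
  shows "abs_l2field g \<bullet> abs_l2field h = (\<integral>x. g x \<bullet> h x \<partial>lborel)"
  by (rule inner_l2field.abs_eq) (use assms in \<open>auto simp: l2_eq_def\<close>)

lemma inner_l2field_rep: "u \<bullet> v = (\<integral>x. rep_l2field u x \<bullet> rep_l2field v x \<partial>lborel)"
  using inner_abs_l2field[OF square_integrable_rep[of u] square_integrable_rep[of v]]
  by (simp add: abs_rep_l2field)

lemma add_abs_l2field:
  assumes "square_integrable g" "square_integrable h"
  shows "abs_l2field g + abs_l2field h = abs_l2field (\<lambda>x. g x + h x)"
  by (rule plus_l2field.abs_eq) (use assms in \<open>auto simp: l2_eq_def\<close>)

lemma diff_abs_l2field:
  assumes "square_integrable g" "square_integrable h"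
  shows "abs_l2field g - abs_l2field h = abs_l2field (\<lambda>x. g x - h x)"
  by (rule minus_l2field.abs_eq) (use assms in \<open>auto simp: l2_eq_def\<close>)

lemma scaleR_abs_l2field:
  assumes "square_integrable g"
  shows "c *\<^sub>R abs_l2field g = abs_l2field (\<lambda>x. c *\<^sub>R g x)"
  by (rule scaleR_l2field.abs_eq) (use assms in \<open>auto simp: l2_eq_def\<close>)

lemma zero_abs_l2field: "0 = abs_l2field (\<lambda>x. 0)"
  by (simp add: zero_l2field_def)

lemma rep_zero_l2field: "AE x in lborel. rep_l2field 0 x = 0"
  using rep_abs_l2field[OF square_integrable_0] by (simp add: zero_abs_l2field)

lemma rep_add_l2field: "AE x in lborel. rep_l2field (u + v) x = rep_l2field u x + rep_l2field v x"
  using rep_abs_l2field[OF square_integrable_add[OF square_integrable_rep[of u] square_integrable_rep[of v]]]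
    add_abs_l2field[OF square_integrable_rep[of u] square_integrable_rep[of v]]
  by (simp add: abs_rep_l2field)

lemma rep_diff_l2field: "AE x in lborel. rep_l2field (u - v) x = rep_l2field u x - rep_l2field v x"
  using rep_abs_l2field[OF square_integrable_diff[OF square_integrable_rep[of u] square_integrable_rep[of v]]]
    diff_abs_l2field[OF square_integrable_rep[of u] square_integrable_rep[of v]]
  by (simp add: abs_rep_l2field)

lemma rep_scaleR_l2field: "AE x in lborel. rep_l2field (c *\<^sub>R u) x = c *\<^sub>R rep_l2field u x"
  using rep_abs_l2field[OF square_integrable_scaleR[OF square_integrable_rep[of u]], of c]
    scaleR_abs_l2field[OF square_integrable_rep[of u], of c]
  by (simp add: abs_rep_l2field)

lemma norm_abs_l2field:
  assumes "square_integrable g"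
  shows "(norm (abs_l2field g))\<^sup>2 = (\<integral>x. (norm (g x))\<^sup>2 \<partial>lborel)"
  using inner_abs_l2field[OF assms assms] by (simp add: power2_norm_eq_inner)

lemma norm_l2field_rep: "(norm u)\<^sup>2 = (\<integral>x. (norm (rep_l2field u x))\<^sup>2 \<partial>lborel)"
  using norm_abs_l2field[OF square_integrable_rep[of u]] by (simp add: abs_rep_l2field)

lemma nn_integral_norm_abs_l2field:
  assumes "square_integrable g"
  shows "(\<integral>\<^sup>+x. ennreal ((norm (g x))\<^sup>2) \<partial>lborel) = ennreal ((norm (abs_l2field g))\<^sup>2)"
  using assms by (subst nn_integral_eq_integral) (auto simp: square_integrable_def norm_abs_l2field)

lemma nn_integral_norm_l2field:
  "(\<integral>\<^sup>+x. ennreal ((norm (rep_l2field u x))\<^sup>2) \<partial>lborel) = ennreal ((norm u)\<^sup>2)"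
  using nn_integral_norm_abs_l2field[OF square_integrable_rep[of u]] by (simp add: abs_rep_l2field)

text \<open>Limits obtained from Fatou's lemma come with a bound on an extended integral, and this
  is how they are recognised as square integrable.\<close>

lemma square_integrable_nn:
  assumes "g \<in> borel_measurable borel" "(\<integral>\<^sup>+x. ennreal ((norm (g x))\<^sup>2) \<partial>lborel) < \<infinity>"
  shows "square_integrable g"
  unfolding square_integrable_def
proof
  show "g \<in> borel_measurable lborel" using assms by simp
  show "integrable lborel (\<lambda>x. (norm (g x))\<^sup>2)"
    by (rule integrableI_bounded) (use assms in auto)
qed

lemma square_integrable_bound:
  fixes k :: "real^3 \<Rightarrow> real^3"
  assumes "square_integrable k" "g \<in> borel_measurable borel" "\<And>x. norm (g x) \<le> C * norm (k x)"
  shows "square_integrable g"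
  unfolding square_integrable_def
proof
  show "g \<in> borel_measurable lborel" using assms by simp
  have "integrable lborel (\<lambda>x. C\<^sup>2 * (norm (k x))\<^sup>2)"
    using assms by (auto simp: square_integrable_def)
  then show "integrable lborel (\<lambda>x. (norm (g x))\<^sup>2)"
  proof (rule Bochner_Integration.integrable_bound)
    have "(norm (g x))\<^sup>2 \<le> C\<^sup>2 * (norm (k x))\<^sup>2" for x
      using power_mono[OF assms(3)[of x], of 2] by (simp add: power_mult_distrib)
    then show "AE x in lborel. norm ((norm (g x))\<^sup>2) \<le> norm (C\<^sup>2 * (norm (k x))\<^sup>2)"
      by simp
  qed (use assms in simp)
qed

lemma square_integrable_indicator:
  assumes "A \<in> sets borel" "bounded A"
  shows "square_integrable (\<lambda>x. indicator A x *\<^sub>R c)"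
proof -
  have eq: "(norm (indicator A x *\<^sub>R c))\<^sup>2 = (norm c)\<^sup>2 * indicator A x" for x :: "real^3"
    by (simp add: indicator_def)
  have "emeasure lborel A < \<infinity>"
    using emeasure_bounded_finite[OF assms(2)] by simp
  then show ?thesis
    unfolding square_integrable_def eq using assms by auto
qed

section \<open>Completeness and separability of \<open>L\<^sup>2\<close>\<close>

lemma tendsto_of_norm_diff:
  fixes l :: "'a::real_normed_vector"
  assumes "((\<lambda>n. norm (l - X n)) \<longlongrightarrow> 0) F"
  shows "(X \<longlongrightarrow> l) F"
proof -
  have "((\<lambda>n. norm (X n - l)) \<longlongrightarrow> 0) F" using assms by (simp add: norm_minus_commute)
  then have "((\<lambda>n. X n - l) \<longlongrightarrow> 0) F" by (rule tendsto_norm_zero_cancel)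
  then show ?thesis by (rule LIM_zero_cancel)
qed

text \<open>The rate is fixed so that squared distances, at most 4^-n, remain summable after
  multiplication by 2^n; this gives pointwise convergence in the completeness proof.\<close>

lemma fast_Cauchy_subseq:
  fixes X :: "nat \<Rightarrow> 'a::metric_space"
  assumes "Cauchy X"
  obtains r :: "nat \<Rightarrow> nat" where "strict_mono r" "\<And>n m. n \<le> m \<Longrightarrow> dist (X (r m)) (X (r n)) < (1/2)^n"
proof -
  have "\<forall>n. \<exists>N. \<forall>m\<ge>N. \<forall>k\<ge>N. dist (X m) (X k) < (1/2)^n"
    using assms unfolding Cauchy_def by simp
  then obtain N where N: "\<And>n m k. m \<ge> N n \<Longrightarrow> k \<ge> N n \<Longrightarrow> dist (X m) (X k) < (1/2)^n"
    by metis
  \<comment> \<open>The partial sums dominate \<open>N n\<close>, and the added \<open>n\<close>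
    makes \<open>r\<close> strictly increasing.\<close>
  define r where "r n = (\<Sum>i\<le>n. N i) + n" for n
  have sm: "strict_mono r"
    by (auto simp: strict_mono_Suc_iff r_def)
  have ge: "r n \<ge> N n" for n
    unfolding r_def using member_le_sum[of n "{..n}" N] by auto
  have "dist (X (r m)) (X (r n)) < (1/2)^n" if "n \<le> m" for n m
    by (rule N) (use ge[of n] strict_mono_leD[OF sm that] in linarith)+
  with sm show ?thesis by (rule that)
qed

text \<open>Riesz-Fischer: a rapidly convergent subsequence converges almost everywhere, and Fatou's
  lemma turns the pointwise limit into a limit in norm. Completeness enters later through
  \<open>nested_closed_convex\<close>.\<close>

instance l2field :: complete_space
proof
  fix X :: "nat \<Rightarrow> l2field"
  assume "Cauchy X"
  then obtain r :: "nat \<Rightarrow> nat" where r: "strict_mono r"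
    "\<And>n m. n \<le> m \<Longrightarrow> dist (X (r m)) (X (r n)) < (1/2)^n"
    using fast_Cauchy_subseq by blast
  define g where "g n = rep_l2field (X (r n))" for n
  have gm [measurable]: "g n \<in> borel_measurable borel" for n
    by (simp add: g_def)
  have dn: "(\<integral>\<^sup>+x. ennreal ((norm (g m x - g n x))\<^sup>2) \<partial>lborel) \<le> ennreal (((1/2)^n)\<^sup>2)" if "n \<le> m" for n m
  proof -
    have "(\<integral>\<^sup>+x. ennreal ((norm (g m x - g n x))\<^sup>2) \<partial>lborel) = ennreal ((norm (X (r m) - X (r n)))\<^sup>2)"
      unfolding nn_integral_norm_l2field[symmetric] g_def
      by (rule nn_integral_cong_AE) (use rep_diff_l2field[of "X (r m)" "X (r n)"] in auto)
    also have "\<dots> \<le> ennreal (((1/2)^n)\<^sup>2)"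
      by (intro ennreal_leI power_mono) (use r(2)[OF that] in \<open>auto simp: dist_norm less_imp_le\<close>)
    finally show ?thesis .
  qed
  have "(\<integral>\<^sup>+x. (\<Sum>n. ennreal (2^n * (norm (g (Suc n) x - g n x))\<^sup>2)) \<partial>lborel)
      = (\<Sum>n. \<integral>\<^sup>+x. ennreal (2^n * (norm (g (Suc n) x - g n x))\<^sup>2) \<partial>lborel)"
    by (rule nn_integral_suminf) measurable
  also have "\<dots> = (\<Sum>n. ennreal (2^n) * (\<integral>\<^sup>+x. ennreal ((norm (g (Suc n) x - g n x))\<^sup>2) \<partial>lborel))"
    by (subst nn_integral_cmult[symmetric]) (auto simp: ennreal_mult)
  also have "\<dots> \<le> (\<Sum>n. ennreal (2^n) * ennreal (((1/2)^n)\<^sup>2))"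
    by (intro suminf_le mult_left_mono dn) auto
  also have "\<dots> = (\<Sum>n. ennreal ((1/2)^n))"
    by (simp add: ennreal_mult[symmetric] power2_eq_square power_one_over)
  also have "\<dots> < \<infinity>"
    by (subst suminf_ennreal2) (auto simp: summable_geometric)
  finally have "AE x in lborel. (\<Sum>n. ennreal (2^n * (norm (g (Suc n) x - g n x))\<^sup>2)) \<noteq> \<infinity>"
    by (intro nn_integral_PInf_AE) auto
  \<comment> \<open>For an increment of size d, the inequality 2 d <= 2^-n + 2^n d^2, a square
    rearranged, converts the weighted sum of squares into absolute summability of the increments at
    almost every point.\<close>
  then have conv: "AE x in lborel. convergent (\<lambda>n. g n x)"
  proof (rule AE_mp, intro AE_I2 impI)
    fix x assume "(\<Sum>n. ennreal (2^n * (norm (g (Suc n) x - g n x))\<^sup>2)) \<noteq> \<infinity>"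
    then have "summable (\<lambda>n. 2^n * (norm (g (Suc n) x - g n x))\<^sup>2)"
      by (intro summable_suminf_not_top) auto
    then have sm: "summable (\<lambda>n. (1/2)^n + 2^n * (norm (g (Suc n) x - g n x))\<^sup>2)"
      by (intro summable_add) (auto simp: summable_geometric)
    have "norm (g (Suc n) x - g n x) \<le> (1/2)^n + 2^n * (norm (g (Suc n) x - g n x))\<^sup>2" for n
    proof -
      define d where "d = norm (g (Suc n) x - g n x)"
      have "0 \<le> (1/2)^n * (1 - 2^n * d)\<^sup>2" by simp
      also have "\<dots> = (1/2)^n - 2 * d + 2^n * d\<^sup>2"
        by (simp add: power2_eq_square algebra_simps power_one_over divide_simps)
      finally have "2 * d \<le> (1/2)^n + 2^n * d\<^sup>2" by simp
      moreover have "d \<ge> 0" by (simp add: d_def)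
      ultimately show ?thesis unfolding d_def by linarith
    qed
    then have "summable (\<lambda>n. norm (g (Suc n) x - g n x))"
      by (intro summable_comparison_test'[OF sm]) auto
    then have "summable (\<lambda>n. g (Suc n) x - g n x)"
      by (rule summable_norm_cancel)
    then have "convergent (\<lambda>n. \<Sum>i<n. g (Suc i) x - g i x)"
      by (simp add: summable_iff_convergent)
    moreover have "(\<Sum>i<n. g (Suc i) x - g i x) = g n x - g 0 x" for n
      using sum_lessThan_telescope[of "\<lambda>n. g n x" n] by simp
    ultimately have "convergent (\<lambda>n. g n x - g 0 x)" by simp
    then obtain l where "(\<lambda>n. g n x - g 0 x) \<longlonglongrightarrow> l" by (auto simp: convergent_def)
    then have "(\<lambda>n. (g n x - g 0 x) + g 0 x) \<longlonglongrightarrow> l + g 0 x" by (intro tendsto_add tendsto_const)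
    then show "convergent (\<lambda>n. g n x)" by (auto simp: convergent_def)
  qed
  define G where "G x = lim (\<lambda>n. g n x)" for x
  have Gm [measurable]: "G \<in> borel_measurable borel"
    unfolding G_def by measurable
  have Glim: "AE x in lborel. (\<lambda>n. g n x) \<longlonglongrightarrow> G x"
    using conv by (auto simp: G_def convergent_LIMSEQ_iff)
  have Gd: "(\<integral>\<^sup>+x. ennreal ((norm (G x - g n x))\<^sup>2) \<partial>lborel) \<le> ennreal (((1/2)^n)\<^sup>2)" for n
  proof -
    have "(\<integral>\<^sup>+x. ennreal ((norm (G x - g n x))\<^sup>2) \<partial>lborel)
       = (\<integral>\<^sup>+x. liminf (\<lambda>m. ennreal ((norm (g m x - g n x))\<^sup>2)) \<partial>lborel)"
    proof (rule nn_integral_cong_AE, use Glim in eventually_elim)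
      fix x assume "(\<lambda>n. g n x) \<longlonglongrightarrow> G x"
      then have "(\<lambda>m. ennreal ((norm (g m x - g n x))\<^sup>2)) \<longlonglongrightarrow> ennreal ((norm (G x - g n x))\<^sup>2)"
        by (intro tendsto_intros)
      then show "ennreal ((norm (G x - g n x))\<^sup>2) = liminf (\<lambda>m. ennreal ((norm (g m x - g n x))\<^sup>2))"
        by (intro lim_imp_Liminf[symmetric]) auto
    qed
    also have "\<dots> \<le> liminf (\<lambda>m. \<integral>\<^sup>+x. ennreal ((norm (g m x - g n x))\<^sup>2) \<partial>lborel)"
      by (rule nn_integral_liminf) measurable
    also have "\<dots> \<le> limsup (\<lambda>m. \<integral>\<^sup>+x. ennreal ((norm (g m x - g n x))\<^sup>2) \<partial>lborel)"
      by (rule Liminf_le_Limsup) simp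
    also have "\<dots> \<le> ennreal (((1/2)^n)\<^sup>2)"
      by (rule Limsup_bounded) (use dn in \<open>auto simp: eventually_sequentially\<close>)
    finally show ?thesis .
  qed
  have sqd: "square_integrable (\<lambda>x. G x - g n x)" for n
    by (rule square_integrable_nn) (auto intro: le_less_trans[OF Gd])
  have sqG: "square_integrable G"
    using square_integrable_add[OF sqd[of 0] square_integrable_rep[of "X (r 0)"]] by (simp add: g_def)
  have "norm (X (r n) - abs_l2field G) \<le> (1/2)^n" for n
  proof -
    have "abs_l2field (\<lambda>x. G x - g n x) = abs_l2field G - X (r n)"
      using diff_abs_l2field[OF sqG square_integrable_rep[of "X (r n)"]]
      by (simp add: g_def abs_rep_l2field)
    then have "ennreal ((norm (X (r n) - abs_l2field G))\<^sup>2) \<le> ennreal (((1/2)^n)\<^sup>2)"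
      using Gd[of n] nn_integral_norm_abs_l2field[OF sqd[of n]] by (simp add: norm_minus_commute)
    then have "(norm (X (r n) - abs_l2field G))\<^sup>2 \<le> ((1/2)^n)\<^sup>2"
      by (subst (asm) ennreal_le_iff) auto
    then show ?thesis by (rule power2_le_imp_le) simp
  qed
  then have "\<forall>\<^sub>F n in sequentially. norm (X (r n) - abs_l2field G) \<le> (1/2)^n" by simp
  moreover have "(\<lambda>n. (1/2)^n :: real) \<longlonglongrightarrow> 0" by (rule LIMSEQ_realpow_zero) auto
  ultimately have "(\<lambda>n. X (r n) - abs_l2field G) \<longlonglongrightarrow> 0" by (rule Lim_null_comparison)
  then have "(\<lambda>n. X (r n)) \<longlonglongrightarrow> abs_l2field G" by (rule LIM_zero_cancel)
  then have "X \<longlonglongrightarrow> abs_l2field G"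
    using Cauchy_converges_subseq[OF \<open>Cauchy X\<close> r(1), of "abs_l2field G"] by (simp add: o_def)
  then show "convergent X" by (auto simp: convergent_def)
qed

section \<open>Separability of L2\<close>

lemma subspace_closure:
  fixes S :: "'a::real_normed_vector set"
  assumes "subspace S"
  shows "subspace (closure S)"
proof (rule subspaceI)
  show "0 \<in> closure S" using subspace_0[OF assms] closure_subset by blast
next
  fix x y assume "x \<in> closure S" "y \<in> closure S"
  then obtain a b where "\<And>n. a n \<in> S" "a \<longlonglongrightarrow> x" "\<And>n. b n \<in> S" "b \<longlonglongrightarrow> y"
    unfolding closure_sequential by blast
  then show "x + y \<in> closure S"
    unfolding closure_sequential
    by (intro exI[of _ "\<lambda>n. a n + b n"]) (auto intro!: tendsto_add subspace_add[OF assms])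
next
  fix c x assume "x \<in> closure S"
  then obtain a where "\<And>n. a n \<in> S" "a \<longlonglongrightarrow> x"
    unfolding closure_sequential by blast
  then show "c *\<^sub>R x \<in> closure S"
    unfolding closure_sequential
    by (intro exI[of _ "\<lambda>n. c *\<^sub>R a n"]) (auto intro!: tendsto_scaleR tendsto_const subspace_scale[OF assms])
qed

text \<open>Combinations with rational coefficients, coded as lists of pairs, are countable; the
  induction over the span approximates one coefficient at a time, with half of the error left for
  the remaining terms.\<close>

lemma countable_dense_span:
  fixes S :: "'a::real_normed_vector set"
  assumes "countable S"
  obtains D where "countable D" "span S \<subseteq> closure D"
proof -
  define D where "D = (\<lambda>xs. \<Sum>(q,a)\<leftarrow>xs. q *\<^sub>R a) ` lists (\<rat> \<times> S)"
  have c: "countable D"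
    unfolding D_def using assms by (intro countable_image countable_lists countable_SIGMA countable_rat)
  have "x \<in> closure D" if "x \<in> span S" for x
    using that
  proof (induction rule: span_induct_alt)
    case base
    have "0 \<in> D" unfolding D_def by (rule image_eqI[of _ _ "[]"]) auto
    then show ?case using closure_subset by blast
  next
    case (step c x y)
    show ?case
      unfolding closure_approachable
    proof (intro allI impI)
      fix e :: real assume e: "e > 0"
      obtain d where d: "d \<in> D" "dist d y < e/2"
        using step.IH e unfolding closure_approachable by (meson half_gt_zero)
      \<comment> \<open>Positive also for \<open>x = 0\<close>, so that it can be a divisor.\<close>
      define k where "k = norm x + 1"
      have k: "k > 0" "norm x < k" by (auto simp: k_def add_nonneg_pos)
      have "c \<in> closure \<rat>" by (simp add: Rats_closure_real)
      then obtain q where q: "q \<in> \<rat>" "dist q c < e/2/k"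
        unfolding closure_approachable using e k by (meson divide_pos_pos half_gt_zero)
      obtain xs where xs: "xs \<in> lists (\<rat> \<times> S)" "d = (\<Sum>(q,a)\<leftarrow>xs. q *\<^sub>R a)"
        using d by (auto simp: D_def)
      have "q *\<^sub>R x + d \<in> D"
        unfolding D_def by (rule image_eqI[of _ _ "(q,x) # xs"]) (use xs q step in auto)
      moreover have "dist (q *\<^sub>R x + d) (c *\<^sub>R x + y) < e"
      proof -
        have "norm ((q - c) *\<^sub>R x) \<le> \<bar>q - c\<bar> * k"
          using k by (simp add: mult_left_mono)
        also have "\<dots> < e/2" using q k by (simp add: dist_real_def field_simps)
        finally have "norm ((q - c) *\<^sub>R x) < e/2" .
        moreover have "(q *\<^sub>R x + d) - (c *\<^sub>R x + y) = (q - c) *\<^sub>R x + (d - y)"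
          by (simp add: algebra_simps)
        moreover have "norm (d - y) < e/2" using d by (simp add: dist_norm)
        ultimately show ?thesis
          using norm_triangle_ineq[of "(q - c) *\<^sub>R x" "d - y"] by (simp only: dist_norm)
      qed
      ultimately show "\<exists>z\<in>D. dist z (c *\<^sub>R x + y) < e" by blast
    qed
  qed
  then show ?thesis using that c by blast
qed

lemma second_countable_of_dense:
  fixes D :: "'a::metric_space set"
  assumes "countable D" "closure D = UNIV"
  shows "\<exists>B::'a set set. countable B \<and> open = generate_topology B"
proof -
  define B where "B = (\<lambda>(d, n). ball d (1 / real (Suc n))) ` (D \<times> UNIV)"
  have "countable B" unfolding B_def using assms by auto
  moreover have "topological_basis B"
  proof (rule topological_basisI)
    fix U and x :: 'a assume "open U" "x \<in> U"
    then obtain e where e: "e > 0" "ball x e \<subseteq> U" by (meson openE)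
    obtain n where n: "1 / real (Suc n) < e / 2"
      using nat_approx_posE[of "e/2"] e by auto
    have "x \<in> closure D" using assms by simp
    then obtain d where d: "d \<in> D" "dist d x < 1 / real (Suc n)"
      unfolding closure_approachable by (metis of_nat_0_less_iff zero_less_Suc zero_less_divide_1_iff)
    have "ball d (1 / real (Suc n)) \<subseteq> ball x e"
    proof
      fix y assume "y \<in> ball d (1 / real (Suc n))"
      then show "y \<in> ball x e" using d n dist_triangle[of x y d] by (simp add: dist_commute)
    qed
    then show "\<exists>B'\<in>B. x \<in> B' \<and> B' \<subseteq> U"
      using d e by (intro bexI[of _ "ball d (1 / real (Suc n))"]) (auto simp: B_def)
  qed (auto simp: B_def)
  ultimately show ?thesis using topological_basis_imp_subbasis by blast
qed

text \<open>Finite intersections of a countable basis. Stability under intersections is what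
  induction over Dynkin systems needs, countability is what separability needs, and the empty
  intersection supplies \<open>UNIV\<close>.\<close>

lemma countable_generator_borel:
  obtains E :: "'a::second_countable_topology set set"
  where "countable E" "Int_stable E" "UNIV \<in> E" "sets borel = sigma_sets UNIV E"
proof -
  obtain B :: "'a set set" where B: "countable B" "topological_basis B"
    using ex_countable_basis by auto
  define E where "E = Inter ` {F. finite F \<and> F \<subseteq> B}"
  have "countable E"
    unfolding E_def using B by (intro countable_image countable_Collect_finite_subset)
  moreover have "Int_stable E"
  proof (rule Int_stableI)
    fix a b assume "a \<in> E" "b \<in> E"
    then obtain F G where "a = \<Inter>F" "b = \<Inter>G" "finite F" "finite G" "F \<subseteq> B" "G \<subseteq> B"
      by (auto simp: E_def)
    then show "a \<inter> b \<in> E"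
      unfolding E_def by (intro image_eqI[of _ _ "F \<union> G"]) auto
  qed
  moreover have "UNIV \<in> E"
    unfolding E_def by (rule image_eqI[of _ _ "{}"]) auto
  moreover have "sets borel = sigma_sets UNIV E"
  proof
    have "sets borel = sigma_sets UNIV B"
      by (subst borel_eq_countable_basis[OF B]) simp
    also have "\<dots> \<subseteq> sigma_sets UNIV E"
    proof (rule sigma_sets_subseteq, rule subsetI)
      fix b assume "b \<in> B" then show "b \<in> E"
        unfolding E_def by (intro image_eqI[of _ _ "{b}"]) auto
    qed
    finally show "sets borel \<subseteq> sigma_sets UNIV E" .
    have "E \<subseteq> sets (borel :: 'a measure)"
    proof
      fix a assume "a \<in> E"
      then obtain F where F: "a = \<Inter>F" "finite F" "F \<subseteq> B" by (auto simp: E_def)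
      have "open a" unfolding F(1)
        by (intro open_Inter F(2)) (use F(3) B(2) topological_basis_open in auto)
      then show "a \<in> sets borel" by simp
    qed
    then show "sigma_sets UNIV E \<subseteq> sets (borel :: 'a measure)"
      using sets.sigma_sets_subset[of E borel] by simp
  qed
  ultimately show ?thesis by (rule that)
qed

lemma abs_l2field_sum:
  assumes "finite T" "\<And>i. i \<in> T \<Longrightarrow> square_integrable (k i)"
  shows "square_integrable (\<lambda>x. \<Sum>i\<in>T. k i x)"
    "abs_l2field (\<lambda>x. \<Sum>i\<in>T. k i x) = (\<Sum>i\<in>T. abs_l2field (k i))"
proof -
  have "square_integrable (\<lambda>x. \<Sum>i\<in>T. k i x) \<and> abs_l2field (\<lambda>x. \<Sum>i\<in>T. k i x) = (\<Sum>i\<in>T. abs_l2field (k i))"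
    using assms
  proof (induction T rule: finite_induct)
    case empty
    then show ?case by (simp add: square_integrable_0 zero_abs_l2field)
  next
    case (insert a T)
    then show ?case by (simp add: square_integrable_add add_abs_l2field[symmetric])
  qed
  then show "square_integrable (\<lambda>x. \<Sum>i\<in>T. k i x)"
    "abs_l2field (\<lambda>x. \<Sum>i\<in>T. k i x) = (\<Sum>i\<in>T. abs_l2field (k i))" by auto
qed

text \<open>The sets \<open>A\<close> that satisfy the conclusion form a Dynkin system: complements
  use subspace differences, disjoint unions use closedness and dominated convergence. The bounded
  window \<open>W\<close> keeps every indicator square integrable, in particular those of
  complements.\<close>

lemma closed_subspace_of_indicators:
  fixes C :: "l2field set" and E :: "(real^3) set set"
  assumes C: "closed C" "subspace C" and W: "bounded W" "W \<in> sets borel"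
    and E: "Int_stable E" "UNIV \<in> E" "sets borel = sigma_sets UNIV E"
    and base: "\<And>A. A \<in> E \<Longrightarrow> abs_l2field (\<lambda>x. indicator (A \<inter> W) x *\<^sub>R e) \<in> C"
    and A: "A \<in> sets borel"
  shows "abs_l2field (\<lambda>x. indicator (A \<inter> W) x *\<^sub>R e) \<in> C"
proof -
  have sq: "square_integrable (\<lambda>x. indicator (A \<inter> W) x *\<^sub>R e)" if "A \<in> sets borel" for A
    using that W by (intro square_integrable_indicator) (auto intro: bounded_subset)
  have "E \<subseteq> Pow UNIV" "A \<in> sigma_sets UNIV E" using A E by auto
  with E(1) show ?thesis
  proof (induction rule: sigma_sets_induct_disjoint)
    case (basic A)
    then show ?case by (rule base)
  next
    case empty
    then show ?case using C(2) by (simp add: zero_abs_l2field[symmetric] subspace_0)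
  next
    case (compl A)
    then have Am: "A \<in> sets borel" using E by simp
    have "abs_l2field (\<lambda>x. indicator ((UNIV - A) \<inter> W) x *\<^sub>R e) =
        abs_l2field (\<lambda>x. indicator (UNIV \<inter> W) x *\<^sub>R e - indicator (A \<inter> W) x *\<^sub>R e)"
      by (rule arg_cong[where f=abs_l2field]) (auto simp: fun_eq_iff indicator_def)
    also have "\<dots> = abs_l2field (\<lambda>x. indicator (UNIV \<inter> W) x *\<^sub>R e) - abs_l2field (\<lambda>x. indicator (A \<inter> W) x *\<^sub>R e)"
      by (intro diff_abs_l2field[symmetric] sq Am) simp
    also have "\<dots> \<in> C" using base[OF E(2)] compl C(2) by (intro subspace_diff)
    finally show ?case .
  next
    case (union A)
    then have Am: "A i \<in> sets borel" for i using E by (auto simp: range_subsetD)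
    define U where "U = (\<Union>i. A i)"
    have Um: "U \<in> sets borel" unfolding U_def using Am by auto
    define h where "h n x = (\<Sum>i<n. indicator (A i \<inter> W) x *\<^sub>R e)" for n x
    have hC: "abs_l2field (h n) \<in> C" for n
      unfolding h_def using union Am C(2)
      by (subst abs_l2field_sum) (auto intro!: subspace_sum sq)
    have hsq: "square_integrable (h n)" for n
      unfolding h_def using Am by (intro abs_l2field_sum sq) auto
    have h_eq: "h n x = indicator ((\<Union>i<n. A i) \<inter> W) x *\<^sub>R e" for n x
    proof -
      have "indicat_real ((\<Union>i<n. A i) \<inter> W) x = (\<Sum>i<n. indicator (A i \<inter> W) x)"
      proof (cases "x \<in> W")
        case True
        have "indicat_real (\<Union>i<n. A i) x = (\<Sum>i<n. indicator (A i) x)"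
          using union(1) by (intro indicator_UN_disjoint) (auto simp: disjoint_family_on_def)
        with True show ?thesis by (simp add: indicator_inter_arith)
      qed simp
      then show ?thesis by (simp add: h_def scaleR_sum_left)
    qed
    have "(\<lambda>n. \<integral>x. (norm (indicator (U \<inter> W) x *\<^sub>R e - h n x))\<^sup>2 \<partial>lborel) \<longlonglongrightarrow> (\<integral>x. 0 \<partial>(lborel::(real^3) measure))"
    proof (rule integral_dominated_convergence)
      show "integrable lborel (\<lambda>x. (norm (indicator (U \<inter> W) x *\<^sub>R e))\<^sup>2)"
        using sq[OF Um] by (simp add: square_integrable_def)
      show "AE x in lborel. (\<lambda>n. (norm (indicator (U \<inter> W) x *\<^sub>R e - h n x))\<^sup>2) \<longlonglongrightarrow> 0"
      proof (rule AE_I2)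
        fix x
        show "(\<lambda>n. (norm (indicator (U \<inter> W) x *\<^sub>R e - h n x))\<^sup>2) \<longlonglongrightarrow> 0"
        proof (cases "x \<in> U \<inter> W")
          case True
          then obtain i where "x \<in> A i" by (auto simp: U_def)
          then have "\<forall>\<^sub>F n in sequentially. (norm (indicator (U \<inter> W) x *\<^sub>R e - h n x))\<^sup>2 = 0"
            using True by (intro eventually_sequentiallyI[of "Suc i"]) (auto simp: h_eq indicator_def)
          then show ?thesis by (rule tendsto_eventually)
        next
          case False
          then have "(norm (indicator (U \<inter> W) x *\<^sub>R e - h n x))\<^sup>2 = 0" for n
            by (auto simp: h_eq indicator_def U_def)
          then show ?thesis by simp
        qed
      qed
      show "AE x in lborel. norm ((norm (indicator (U \<inter> W) x *\<^sub>R e - h n x))\<^sup>2) \<le> (norm (indicator (U \<inter> W) x *\<^sub>R e))\<^sup>2" for n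
        by (intro AE_I2) (auto simp: h_eq indicator_def U_def)
      have [measurable]: "h n \<in> borel_measurable borel" for n
        using hsq by (simp add: square_integrable_def)
      have [measurable]: "U \<inter> W \<in> sets borel" using Um W by simp
      show "(\<lambda>x. (norm (indicator (U \<inter> W) x *\<^sub>R e - h n x))\<^sup>2) \<in> borel_measurable lborel" for n
        by measurable
    qed auto
    then have "(\<lambda>n. (norm (abs_l2field (\<lambda>x. indicator (U \<inter> W) x *\<^sub>R e) - abs_l2field (h n)))\<^sup>2) \<longlonglongrightarrow> 0"
      using hsq sq[OF Um] by (simp add: diff_abs_l2field norm_abs_l2field square_integrable_diff)
    then have "(\<lambda>n. norm (abs_l2field (\<lambda>x. indicator (U \<inter> W) x *\<^sub>R e) - abs_l2field (h n))) \<longlonglongrightarrow> 0"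
      using tendsto_real_sqrt[of _ 0 sequentially] by fastforce
    then have "(\<lambda>n. abs_l2field (h n)) \<longlonglongrightarrow> abs_l2field (\<lambda>x. indicator (U \<inter> W) x *\<^sub>R e)"
      by (rule tendsto_of_norm_diff)
    then have "abs_l2field (\<lambda>x. indicator (U \<inter> W) x *\<^sub>R e) \<in> C"
      by (rule closed_sequentially[OF C(1) hC])
    then show ?case by (simp add: U_def)
  qed
qed

text \<open>Simple functions cut off by balls are finite combinations of the given indicator fields,
  and they converge in L2 to an arbitrary representative.\<close>

lemma l2field_in_closed_subspace:
  fixes C :: "l2field set"
  assumes C: "closed C" "subspace C"
    and base: "\<And>A n e. A \<in> sets borel \<Longrightarrow> e \<in> Basis \<Longrightarrow> abs_l2field (\<lambda>x. indicator (A \<inter> ball 0 (real n)) x *\<^sub>R e) \<in> C"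
  shows "u \<in> C"
proof -
  define g where "g = rep_l2field u"
  have gm [measurable]: "g \<in> borel_measurable borel" by (simp add: g_def)
  obtain s where s: "\<And>i. simple_function borel (s i)" "\<And>x. (\<lambda>i. s i x) \<longlonglongrightarrow> g x"
    "\<And>i x. dist (s i x) 0 \<le> 2 * dist (g x) 0"
    using borel_measurable_implies_sequence_metric[OF gm, of 0] by (auto simp: space_borel)
  have sm [measurable]: "s i \<in> borel_measurable borel" for i
    using s(1) by (rule borel_measurable_simple_function)
  define h where "h i x = indicator (ball 0 (real i)) x *\<^sub>R s i x" for i x
  have hm [measurable]: "h i \<in> borel_measurable borel" for i
    unfolding h_def by (intro borel_measurable_scaleR borel_measurable_indicator sm) auto
  have hb: "norm (h i x) \<le> 2 * norm (g x)" for i x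
    using s(3)[of i x] by (auto simp: h_def indicator_def)
  have hsq: "square_integrable (h i)" for i
    by (rule square_integrable_bound[where C=2 and k=g]) (use hb square_integrable_rep in \<open>auto simp: g_def\<close>)
  have hC: "abs_l2field (h i) \<in> C" for i
  proof -
    define A where "A c = s i -` {c}" for c
    have Am: "A c \<in> sets borel" for c
      unfolding A_def using measurable_sets[OF sm[of i], of "{c}"] by simp
    have fin: "finite (range (s i))"
      using s(1)[of i] by (simp add: simple_function_def space_borel)
    define k where "k = (\<lambda>(c, e) x. (c \<bullet> e) *\<^sub>R (indicator (A c \<inter> ball 0 (real i)) x *\<^sub>R e))"
    have sq0: "square_integrable (\<lambda>x. indicator (A c \<inter> ball 0 (real i)) x *\<^sub>R e)" for c e
      using Am by (intro square_integrable_indicator) (auto intro: bounded_subset)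
    have ksq: "square_integrable (k p)" for p
      unfolding k_def by (simp only: case_prod_beta) (intro square_integrable_scaleR sq0)
    have kC: "abs_l2field (k p) \<in> C" if "p \<in> range (s i) \<times> Basis" for p
    proof -
      have "abs_l2field (k p) = (fst p \<bullet> snd p) *\<^sub>R abs_l2field (\<lambda>x. indicator (A (fst p) \<inter> ball 0 (real i)) x *\<^sub>R snd p)"
        unfolding k_def by (subst scaleR_abs_l2field[OF sq0]) (simp add: case_prod_beta)
      also have "\<dots> \<in> C" using that Am by (intro subspace_scale[OF C(2)] base) auto
      finally show ?thesis .
    qed
    have "h i x = (\<Sum>p\<in>range (s i) \<times> Basis. k p x)" for x
    proof -
      have "(\<Sum>p\<in>range (s i) \<times> Basis. k p x) = (\<Sum>c\<in>range (s i). \<Sum>e\<in>Basis. k (c, e) x)"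
        by (simp add: sum.cartesian_product)
      also have "\<dots> = (\<Sum>c\<in>range (s i). if c = s i x then (\<Sum>e\<in>Basis. k (c, e) x) else 0)"
        by (intro sum.cong refl) (auto simp: k_def A_def indicator_def)
      also have "\<dots> = (\<Sum>e\<in>Basis. k (s i x, e) x)"
        using fin by (subst sum.delta) auto
      also have "\<dots> = (\<Sum>e\<in>Basis. (h i x \<bullet> e) *\<^sub>R e)"
        by (intro sum.cong refl) (auto simp: k_def A_def h_def indicator_def)
      also have "\<dots> = h i x" by (rule euclidean_representation)
      finally show ?thesis by simp
    qed
    then have "h i = (\<lambda>x. \<Sum>p\<in>range (s i) \<times> Basis. k p x)" by auto
    then have "abs_l2field (h i) = (\<Sum>p\<in>range (s i) \<times> Basis. abs_l2field (k p))"
      using fin ksq by (simp add: abs_l2field_sum)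
    also have "\<dots> \<in> C" using kC by (intro subspace_sum C)
    finally show ?thesis .
  qed
  have gsq: "square_integrable g" by (simp add: g_def square_integrable_rep)
  have "(\<lambda>n. \<integral>x. (norm (g x - h n x))\<^sup>2 \<partial>lborel) \<longlonglongrightarrow> (\<integral>x. 0 \<partial>(lborel::(real^3) measure))"
  proof (rule integral_dominated_convergence)
    \<comment> \<open>The approximants are bounded by twice \<open>g\<close>, so the difference is
      at most three times \<open>g\<close>, and 9 is the square of 3.\<close>
    show "integrable lborel (\<lambda>x. 9 * (norm (g x))\<^sup>2)"
      using gsq by (simp add: square_integrable_def)
    show "AE x in lborel. (\<lambda>n. (norm (g x - h n x))\<^sup>2) \<longlonglongrightarrow> 0"
    proof (rule AE_I2)
      fix x :: "real^3"
      obtain N where N: "norm x < real N" using reals_Archimedean2 by blast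
      have "\<forall>\<^sub>F n in sequentially. s n x = h n x"
        using N by (intro eventually_sequentiallyI[of N]) (auto simp: h_def indicator_def)
      with s(2)[of x] have "(\<lambda>n. h n x) \<longlonglongrightarrow> g x" by (rule Lim_transform_eventually)
      then have "(\<lambda>n. (norm (g x - h n x))\<^sup>2) \<longlonglongrightarrow> (norm (g x - g x))\<^sup>2"
        by (intro tendsto_intros)
      then show "(\<lambda>n. (norm (g x - h n x))\<^sup>2) \<longlonglongrightarrow> 0" by simp
    qed
    have "norm (g x - h n x) \<le> 3 * norm (g x)" for n x
      using norm_triangle_ineq4[of "g x" "h n x"] hb[of n x] by linarith
    then have "(norm (g x - h n x))\<^sup>2 \<le> (3 * norm (g x))\<^sup>2" for n x
      by (intro power_mono) auto
    then show "AE x in lborel. norm ((norm (g x - h n x))\<^sup>2) \<le> 9 * (norm (g x))\<^sup>2" for n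
      by (simp add: power_mult_distrib)
  qed auto
  then have "(\<lambda>n. (norm (abs_l2field g - abs_l2field (h n)))\<^sup>2) \<longlonglongrightarrow> 0"
    using hsq gsq by (simp add: diff_abs_l2field norm_abs_l2field square_integrable_diff)
  then have "(\<lambda>n. norm (abs_l2field g - abs_l2field (h n))) \<longlonglongrightarrow> 0"
    using tendsto_real_sqrt[of _ 0 sequentially] by fastforce
  then have "(\<lambda>n. abs_l2field (h n)) \<longlonglongrightarrow> abs_l2field g"
    by (rule tendsto_of_norm_diff)
  then have "abs_l2field g \<in> C"
    by (rule closed_sequentially[OF C(1) hC])
  then show ?thesis by (simp add: g_def abs_rep_l2field)
qed

text \<open>Countably many indicator fields, over a countable generator, balls of integer radius and
  the unit vectors, span a dense subspace. The instance makes \<open>borel_measurable_weakI\<close>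
  applicable to fields.\<close>

instance l2field :: second_countable_topology
proof
  obtain E :: "(real^3) set set" where E: "countable E" "Int_stable E" "UNIV \<in> E" "sets borel = sigma_sets UNIV E"
    by (rule countable_generator_borel)
  define S where "S = (\<lambda>(A, n, e). abs_l2field (\<lambda>x. indicator (A \<inter> ball 0 (real n)) x *\<^sub>R e)) ` (E \<times> UNIV \<times> Basis)"
  have "countable (Basis :: (real^3) set)" by (rule countable_finite) simp
  with E(1) have "countable S" unfolding S_def
    by (intro countable_image countable_SIGMA) simp_all
  then obtain D where D: "countable D" "span S \<subseteq> closure D" by (rule countable_dense_span)
  have cs: "closed (closure (span S))" "subspace (closure (span S))"
    by (rule closed_closure, intro subspace_closure subspace_span)
  have "u \<in> closure (span S)" for u
  proof (rule l2field_in_closed_subspace[OF cs])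
    fix A :: "(real^3) set" and n :: nat and e :: "real^3" assume "A \<in> sets borel" "e \<in> Basis"
    have "abs_l2field (\<lambda>x. indicator (A' \<inter> ball 0 (real n)) x *\<^sub>R e) \<in> closure (span S)" if "A' \<in> E" for A'
    proof -
      have "abs_l2field (\<lambda>x. indicator (A' \<inter> ball 0 (real n)) x *\<^sub>R e) \<in> S"
        unfolding S_def using that \<open>e \<in> Basis\<close> by (intro image_eqI[of _ _ "(A', n, e)"]) auto
      then show ?thesis using span_base closure_subset by blast
    qed
    then show "abs_l2field (\<lambda>x. indicator (A \<inter> ball 0 (real n)) x *\<^sub>R e) \<in> closure (span S)"
      by (rule closed_subspace_of_indicators[OF cs bounded_ball borel_open[OF open_ball] E(2-4) _ \<open>A \<in> sets borel\<close>])
  qed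
  moreover have "closure (span S) \<subseteq> closure D" using D(2) by (simp add: closure_minimal)
  ultimately have "closure D = UNIV" by auto
  with D(1) show "\<exists>B::l2field set set. countable B \<and> open = generate_topology B"
    by (rule second_countable_of_dense)
qed

section \<open>Hilbert space tools\<close>

text \<open>Stands in for weak compactness: near-minimisers of the norm over a decreasing sequence of
  closed convex sets form a Cauchy sequence by the parallelogram law.\<close>

lemma nested_closed_convex:
  fixes C :: "nat \<Rightarrow> 'a::{real_inner, complete_space} set"
  assumes closed: "\<And>n. closed (C n)" and conv: "\<And>n. convex (C n)" and ne: "\<And>n. C n \<noteq> {}"
    and dec: "\<And>n. C (Suc n) \<subseteq> C n" and bdd: "bounded (C 0)"
  shows "(\<Inter>n. C n) \<noteq> {}"
proof -
  have anti: "C m \<subseteq> C n" if "n \<le> m" for n m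
    using that by (rule lift_Suc_antimono_le[of C, OF dec])
  define d where "d n = Inf (norm ` C n)" for n
  have bb: "bdd_below (norm ` C n)" for n by (auto intro!: bdd_belowI[of _ 0])
  have d_le: "d n \<le> norm x" if "x \<in> C n" for n x
    unfolding d_def using that bb by (intro cInf_lower) auto
  have d_mono: "d n \<le> d m" if "n \<le> m" for n m
    unfolding d_def using anti[OF that] ne bb by (intro cInf_superset_mono) auto
  have d_nn: "d n \<ge> 0" for n
    unfolding d_def using ne by (intro cInf_greatest) auto
  obtain R where R: "\<And>x. x \<in> C 0 \<Longrightarrow> norm x \<le> R" using bdd by (auto simp: bounded_iff)
  have dR: "d n \<le> R" for n
  proof -
    obtain x where "x \<in> C n" using ne by blast
    then show ?thesis using d_le R anti[of 0 n] by force
  qed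
  have "convergent d"
    using d_mono dR d_nn by (intro Bseq_monoseq_convergent) (auto simp: monoseq_def intro!: BseqI'[of _ R])
  then have "Cauchy (\<lambda>n. (d n)\<^sup>2)" 
    by (intro convergent_Cauchy) (auto simp: convergent_def intro: tendsto_power)
  have "\<exists>x\<in>C n. norm x < d n + 1 / real (Suc n)" for n
    using cInf_lessD[of "norm ` C n" "d n + 1 / real (Suc n)"] ne by (auto simp: d_def)
  then obtain x where x: "\<And>n. x n \<in> C n" "\<And>n. norm (x n) < d n + 1 / real (Suc n)" by metis
  \<comment> \<open>The midpoint of \<open>x m\<close> and \<open>x n\<close> lies in
    \<open>C n\<close>, hence has norm at least \<open>d n\<close>, and the parallelogram law bounds
    the difference. Four error terms of size (2 R + 1) / (n + 1) add up to the last summand.\<close>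
  have key: "(norm (x m - x n))\<^sup>2 \<le> 4 * ((d m)\<^sup>2 - (d n)\<^sup>2) + (8 * R + 4) / real (Suc n)" if "n \<le> m" for n m
  proof -
    have sq: "(norm (x k))\<^sup>2 \<le> (d k)\<^sup>2 + (2 * R + 1) / real (Suc k)" for k
    proof -
      have "(norm (x k))\<^sup>2 \<le> (d k + 1 / real (Suc k))\<^sup>2"
        using x(2)[of k] by (intro power_mono) auto
      also have "\<dots> = (d k)\<^sup>2 + (2 * d k + 1 / real (Suc k)) / real (Suc k)"
        by (simp add: power2_eq_square algebra_simps add_divide_distrib)
      also have "\<dots> \<le> (d k)\<^sup>2 + (2 * R + 1) / real (Suc k)"
        using dR[of k] by (intro add_left_mono divide_right_mono add_mono) auto
      finally show ?thesis .
    qed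
    have "(1/2) *\<^sub>R x m + (1/2) *\<^sub>R x n \<in> C n"
      using x anti[OF that] by (intro convexD[OF conv]) auto
    then have "d n \<le> norm ((1/2) *\<^sub>R (x m + x n))"
      using d_le by (simp add: scaleR_add_right)
    then have "(d n)\<^sup>2 \<le> (norm ((1/2) *\<^sub>R (x m + x n)))\<^sup>2" using d_nn by (intro power_mono) auto
    then have a: "4 * (d n)\<^sup>2 \<le> (norm (x m + x n))\<^sup>2" by (simp add: power_mult_distrib power2_eq_square)
    have "(norm (x m + x n))\<^sup>2 + (norm (x m - x n))\<^sup>2 = 2 * (norm (x m))\<^sup>2 + 2 * (norm (x n))\<^sup>2"
      by (simp add: power2_norm_eq_inner inner_simps inner_commute)
    with a have "(norm (x m - x n))\<^sup>2 \<le> 2 * (norm (x m))\<^sup>2 + 2 * (norm (x n))\<^sup>2 - 4 * (d n)\<^sup>2" by linarith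
    also have "\<dots> \<le> 2 * ((d m)\<^sup>2 + (2 * R + 1) / real (Suc m)) + 2 * ((d n)\<^sup>2 + (2 * R + 1) / real (Suc n)) - 4 * (d n)\<^sup>2"
      by (intro diff_right_mono add_mono mult_left_mono sq) auto
    also have "\<dots> \<le> 2 * ((d m)\<^sup>2 + (2 * R + 1) / real (Suc n)) + 2 * ((d n)\<^sup>2 + (2 * R + 1) / real (Suc n)) - 4 * (d n)\<^sup>2"
    proof -
      have "R \<ge> 0" using dR[of 0] d_nn[of 0] by linarith
      then have "(2 * R + 1) / real (Suc m) \<le> (2 * R + 1) / real (Suc n)"
        using that by (intro divide_left_mono) auto
      then show ?thesis by (intro diff_right_mono add_mono mult_left_mono order_refl) auto
    qed
    also have "\<dots> = 2 * ((d m)\<^sup>2 - (d n)\<^sup>2) + (8 * R + 4) / real (Suc n)"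
    proof -
      have "(8 * R + 4) / real (Suc n) = 4 * ((2 * R + 1) / real (Suc n))" by simp
      then show ?thesis by (auto simp: algebra_simps simp del: of_nat_Suc)
    qed
    also have "\<dots> \<le> 4 * ((d m)\<^sup>2 - (d n)\<^sup>2) + (8 * R + 4) / real (Suc n)"
      using power_mono[OF d_mono[OF that] d_nn, of 2] by (intro add_right_mono mult_right_mono) auto
    finally show ?thesis .
  qed
  have "Cauchy x"
  proof (rule CauchyI)
    fix e :: real assume e: "e > 0"
    then have e2: "e\<^sup>2 / 16 > 0" by simp
    obtain N1 where N1: "\<And>m n. m \<ge> N1 \<Longrightarrow> n \<ge> N1 \<Longrightarrow> norm ((d m)\<^sup>2 - (d n)\<^sup>2) < e\<^sup>2/16"
      using CauchyD[OF \<open>Cauchy (\<lambda>n. (d n)\<^sup>2)\<close> e2] by metis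
    have "(\<lambda>n. (8 * R + 4) / real (Suc n)) \<longlonglongrightarrow> 0" by real_asymp
    then have "\<forall>\<^sub>F n in sequentially. (8 * R + 4) / real (Suc n) < e\<^sup>2/16"
      using e2 by (rule order_tendstoD)
    then obtain N2 where N2: "\<And>n. n \<ge> N2 \<Longrightarrow> (8 * R + 4) / real (Suc n) < e\<^sup>2/16"
      by (auto simp: eventually_sequentially)
    have main: "norm (x m - x n) < e" if "n \<le> m" "n \<ge> max N1 N2" for m n
    proof -
      have "(norm (x m - x n))\<^sup>2 < e\<^sup>2"
      proof -
        define c where "c = (8 * R + 4) / real (Suc n)"
        define a where "a = (d m)\<^sup>2 - (d n)\<^sup>2"
        have "(norm (x m - x n))\<^sup>2 \<le> 4 * a + c" "\<bar>a\<bar> < e\<^sup>2/16" "c < e\<^sup>2/16"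
          using key[OF that(1)] N1[of m n] N2[of n] that by (auto simp: c_def a_def)
        then show ?thesis using e2 by linarith
      qed
      then show ?thesis using e by (simp add: power2_less_imp_less)
    qed
    then show "\<exists>M. \<forall>m\<ge>M. \<forall>n\<ge>M. norm (x m - x n) < e"
      by (intro exI[of _ "max N1 N2"] allI impI) (metis nle_le norm_minus_commute)
  qed
  then obtain l where l: "x \<longlonglongrightarrow> l" using Cauchy_convergent convergentD by blast
  have "l \<in> C n" for n
  proof (rule Lim_in_closed_set[OF closed _ _ l])
    show "\<forall>\<^sub>F k in sequentially. x k \<in> C n"
      using x(1) anti by (intro eventually_sequentiallyI[of n]) auto
  qed simp
  then show ?thesis by blast
qed

text \<open>Test vectors may be taken from a dense part of the set in which \<open>z\<close> itself
  lies: letting them tend to \<open>z\<close> recovers the bound of \<open>z \<bullet> z\<close> by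
  \<open>r * norm z\<close>.\<close>

lemma norm_le_iff_inner_dense:
  fixes z :: "'a::real_inner"
  assumes "D \<subseteq> H" "H \<subseteq> closure D" "z \<in> H" "r \<ge> 0"
  shows "norm z \<le> r \<longleftrightarrow> (\<forall>d\<in>D. z \<bullet> d \<le> r * norm d)"
proof
  assume "norm z \<le> r"
  then show "\<forall>d\<in>D. z \<bullet> d \<le> r * norm d"
    using norm_cauchy_schwarz[of z] by (meson mult_right_mono norm_ge_zero order_trans)
next
  assume *: "\<forall>d\<in>D. z \<bullet> d \<le> r * norm d"
  have "z \<in> closure D" using assms by blast
  then obtain s where s: "\<And>n. s n \<in> D" "s \<longlonglongrightarrow> z" by (auto simp: closure_sequential)
  have "(\<lambda>n. z \<bullet> s n) \<longlonglongrightarrow> z \<bullet> z" "(\<lambda>n. r * norm (s n)) \<longlonglongrightarrow> r * norm z"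
    by (intro tendsto_intros s)+
  then have "z \<bullet> z \<le> r * norm z"
    using * s by (intro LIMSEQ_le) auto
  then have "norm z * norm z \<le> r * norm z" by (simp add: dot_square_norm power2_eq_square)
  then show "norm z \<le> r"
    using \<open>r \<ge> 0\<close> by (cases "z = 0") auto
qed

text \<open>A form of Pettis' theorem. By separability, membership in a closed ball centred in
  \<open>H\<close> is a countable conjunction of scalar conditions, and an open set meets
  \<open>H\<close> in a countable union of such balls. Tests from \<open>H\<close> suffice because
  the values lie in the subspace \<open>H\<close>.\<close>

lemma borel_measurable_weakI:
  fixes h :: "'b \<Rightarrow> 'a::{real_inner, second_countable_topology}"
  assumes H: "subspace H" and hH: "\<And>x. x \<in> space M \<Longrightarrow> h x \<in> H"
    and weak: "\<And>v. v \<in> H \<Longrightarrow> (\<lambda>x. h x \<bullet> v) \<in> borel_measurable M"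
  shows "h \<in> borel_measurable M"
proof -
  obtain D where D: "countable D" "D \<subseteq> H" "H \<subseteq> closure D"
    by (rule separable)
  have ball: "{x \<in> space M. dist (h x) d \<le> r} \<in> sets M" if "d \<in> H" "r \<ge> 0" for d r
  proof -
    have "{x \<in> space M. dist (h x) d \<le> r} = {x \<in> space M. \<forall>e\<in>D. h x \<bullet> e - d \<bullet> e \<le> r * norm e}"
      using norm_le_iff_inner_dense[OF D(2,3) subspace_diff[OF H hH that(1)] that(2)]
      by (auto simp: dist_norm inner_diff_left)
    also have "\<dots> \<in> sets M"
    proof (rule sets.sets_Collect_countable_All'[OF _ D(1)])
      fix e assume "e \<in> D"
      then have [measurable]: "(\<lambda>x. h x \<bullet> e) \<in> borel_measurable M" using weak D by auto
      show "{x \<in> space M. h x \<bullet> e - d \<bullet> e \<le> r * norm e} \<in> sets M" by measurable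
    qed
    finally show ?thesis .
  qed
  show ?thesis
  proof (rule borel_measurableI)
    fix S :: "'a set" assume S: "open S"
    define J where "J = {(d, r). d \<in> D \<and> r \<in> \<rat> \<and> r \<ge> 0 \<and> cball d r \<subseteq> S}"
    have "countable J"
      by (rule countable_subset[of _ "D \<times> \<rat>"]) (use D in \<open>auto simp: J_def intro: countable_rat\<close>)
    have "h -` S \<inter> space M = (\<Union>(d, r)\<in>J. {x \<in> space M. dist (h x) d \<le> r})"
    proof (intro equalityI subsetI)
      fix x assume x: "x \<in> h -` S \<inter> space M"
      then obtain e where e: "e > 0" "ball (h x) e \<subseteq> S" using S by (auto elim: openE)
      obtain q where q: "q \<in> \<rat>" "0 < q" "q < e / 2"
        using Rats_dense_in_real[of 0 "e/2"] e by auto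
      have "h x \<in> closure D" using D hH x by blast
      then obtain d where d: "d \<in> D" "dist d (h x) < q"
        using q unfolding closure_approachable by blast
      have "cball d q \<subseteq> ball (h x) e"
      proof
        fix y assume "y \<in> cball d q"
        then show "y \<in> ball (h x) e"
          using d q dist_triangle[of "h x" y d] by (simp add: dist_commute)
      qed
      then show "x \<in> (\<Union>(d, r)\<in>J. {x \<in> space M. dist (h x) d \<le> r})"
        using x d q e by (intro UN_I[of "(d, q)"]) (auto simp: J_def dist_commute)
    qed (auto simp: J_def dist_commute)
    also have "\<dots> \<in> sets M"
      using \<open>countable J\<close> D by (intro sets.countable_UN') (auto simp: J_def intro!: ball)
    finally show "h -` S \<inter> space M \<in> sets M" .
  qed
qed

section \<open>Smooth test functions\<close>

text \<open>Replaces the chosen \<open>frechet_derivative\<close> by any explicit derivative, so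
  that inductions on the order can use the ordinary rules.\<close>

lemma Ck_on_SucI:
  assumes "\<And>x. (g has_derivative g' x) (at x)" "\<And>e. e \<in> Basis \<Longrightarrow> Ck_on k UNIV (\<lambda>x. g' x e)"
  shows "Ck_on (Suc k) UNIV g"
proof -
  have "frechet_derivative g (at x) = g' x" for x
    using frechet_derivative_at[OF assms(1)] by simp
  then show ?thesis using assms by (auto simp: differentiable_def)
qed

lemma Ck_on_SucD:
  assumes "Ck_on (Suc k) UNIV g"
  shows "(g has_derivative frechet_derivative g (at x)) (at x)"
    "e \<in> Basis \<Longrightarrow> Ck_on k UNIV (\<lambda>x. frechet_derivative g (at x) e)"
  using assms by (auto simp: frechet_derivative_works)

text \<open>\<open>Ck_on\<close> asks for continuity only at the last order; differentiability
  supplies it at the lower ones. The product rule needs this, since it keeps one factor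
  undifferentiated.\<close>

lemma Ck_on_mono_Suc: "Ck_on (Suc k) UNIV g \<Longrightarrow> Ck_on k UNIV g"
proof (induction k arbitrary: g)
  case 0
  then show ?case
    by (auto intro!: differentiable_imp_continuous_on simp: differentiable_on_def)
next
  case (Suc k)
  show ?case
    by (rule Ck_on_SucI[OF Ck_on_SucD(1)[OF Suc.prems]])
       (intro Suc.IH Ck_on_SucD(2)[OF Suc.prems])
qed

lemma Ck_on_const: "Ck_on k UNIV (\<lambda>x. c)"
proof (induction k arbitrary: c)
  case (Suc k)
  show ?case by (rule Ck_on_SucI[OF has_derivative_const]) (rule Suc.IH)
qed simp

lemma Ck_on_add: "Ck_on k UNIV g \<Longrightarrow> Ck_on k UNIV h \<Longrightarrow> Ck_on k UNIV (\<lambda>x. g x + h x)"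
proof (induction k arbitrary: g h)
  case 0
  then show ?case by (auto intro: continuous_on_add)
next
  case (Suc k)
  show ?case
    by (rule Ck_on_SucI[OF has_derivative_add[OF Ck_on_SucD(1)[OF Suc.prems(1)] Ck_on_SucD(1)[OF Suc.prems(2)]]])
       (intro Suc.IH Ck_on_SucD(2)[OF Suc.prems(1)] Ck_on_SucD(2)[OF Suc.prems(2)])
qed

lemma Ck_on_scaleR:
  fixes g :: "'a::euclidean_space \<Rightarrow> real"
  shows "Ck_on k UNIV g \<Longrightarrow> Ck_on k UNIV h \<Longrightarrow> Ck_on k UNIV (\<lambda>x. g x *\<^sub>R h x)"
proof (induction k arbitrary: g h)
  case 0
  then show ?case by (auto intro: continuous_on_scaleR)
next
  case (Suc k)
  show ?case
    by (rule Ck_on_SucI[OF has_derivative_scaleR[OF Ck_on_SucD(1)[OF Suc.prems(1)] Ck_on_SucD(1)[OF Suc.prems(2)]]])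
       (intro Suc.IH Ck_on_add Ck_on_SucD(2)[OF Suc.prems(1)] Ck_on_SucD(2)[OF Suc.prems(2)]
          Ck_on_mono_Suc[OF Suc.prems(1)] Ck_on_mono_Suc[OF Suc.prems(2)])
qed

text \<open>The case of the chain rule that the cut-off functions below call for: one-variable
  profiles of affine arguments. Linearity of the derivative pulls out the constant
  \<open>e \<bullet> d\<close>, which leaves a function of the same form for the induction.\<close>

lemma Ck_on_affine:
  fixes g :: "real \<Rightarrow> 'b::real_normed_vector" and d :: "'a::euclidean_space"
  shows "Ck_on k UNIV g \<Longrightarrow> Ck_on k UNIV (\<lambda>x. g (c + x \<bullet> d))"
proof (induction k arbitrary: g)
  case 0
  then show ?case by (auto intro!: continuous_on_compose2[of UNIV g] continuous_intros)
next
  case (Suc k)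
  let ?D = "\<lambda>y. frechet_derivative g (at y)"
  show ?case
  proof (rule Ck_on_SucI)
    fix x
    have "((\<lambda>x. c + x \<bullet> d) has_derivative (\<lambda>h. h \<bullet> d)) (at x)"
      by (auto intro!: derivative_eq_intros)
    from has_derivative_compose[OF this Ck_on_SucD(1)[OF Suc.prems]]
    show "((\<lambda>x. g (c + x \<bullet> d)) has_derivative (\<lambda>h. ?D (c + x \<bullet> d) (h \<bullet> d))) (at x)" .
  next
    fix e :: 'a assume "e \<in> Basis"
    have "linear (?D y)" for y
      using has_derivative_linear[OF Ck_on_SucD(1)[OF Suc.prems]] .
    then have "?D y (e \<bullet> d) = (e \<bullet> d) *\<^sub>R ?D y 1" for y
      using linear_scale[of "?D y" "e \<bullet> d" 1] by simp
    moreover have "Ck_on k UNIV (\<lambda>x. ?D (c + x \<bullet> d) 1)"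
      by (rule Suc.IH) (rule Ck_on_SucD(2)[OF Suc.prems], simp)
    ultimately show "Ck_on k UNIV (\<lambda>x. ?D (c + x \<bullet> d) (e \<bullet> d))"
      by (simp add: Ck_on_scaleR[OF Ck_on_const])
  qed
qed

lemma smooth_const: "smooth (\<lambda>x. c)" by (simp add: smooth_def Ck_on_const)

lemma smooth_add: "smooth g \<Longrightarrow> smooth h \<Longrightarrow> smooth (\<lambda>x. g x + h x)"
  by (simp add: smooth_def Ck_on_add)

lemma smooth_scaleR:
  fixes g :: "'a::euclidean_space \<Rightarrow> real"
  shows "smooth g \<Longrightarrow> smooth h \<Longrightarrow> smooth (\<lambda>x. g x *\<^sub>R h x)"
  by (simp add: smooth_def Ck_on_scaleR)

lemma smooth_mult:
  fixes g :: "'a::euclidean_space \<Rightarrow> real"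
  shows "smooth g \<Longrightarrow> smooth h \<Longrightarrow> smooth (\<lambda>x. g x * h x)"
  using smooth_scaleR[of g h] by simp

lemma smooth_prod:
  fixes g :: "'i \<Rightarrow> 'a::euclidean_space \<Rightarrow> real"
  assumes "\<And>i. i \<in> S \<Longrightarrow> smooth (g i)"
  shows "smooth (\<lambda>x. \<Prod>i\<in>S. g i x)"
  using assms by (induction S rule: infinite_finite_induct) (simp_all add: smooth_const smooth_mult)

lemma smooth_affine:
  fixes g :: "real \<Rightarrow> 'b::real_normed_vector" and d :: "'a::euclidean_space"
  shows "smooth g \<Longrightarrow> smooth (\<lambda>x. g (c + x \<bullet> d))"
  by (simp add: smooth_def Ck_on_affine)

lemma smooth_has_derivative:
  "smooth g \<Longrightarrow> (g has_derivative frechet_derivative g (at x)) (at x)"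
  unfolding smooth_def by (meson Ck_on_SucD(1))

lemma smooth_derivative: "smooth g \<Longrightarrow> e \<in> Basis \<Longrightarrow> smooth (\<lambda>x. frechet_derivative g (at x) e)"
  unfolding smooth_def by (intro allI Ck_on_SucD(2)) blast+

lemma smooth_continuous: "smooth g \<Longrightarrow> continuous_on S g"
  unfolding smooth_def by (metis Ck_on.simps(1) continuous_on_subset subset_UNIV)

lemma smooth_real_antiderivative:
  fixes g :: "real \<Rightarrow> real"
  assumes "\<And>x. (G has_real_derivative g x) (at x)" "smooth g"
  shows "smooth G"
  unfolding smooth_def
proof
  fix k show "Ck_on k UNIV G"
  proof (rule Ck_on_mono_Suc, rule Ck_on_SucI)
    show "(G has_derivative (\<lambda>h. g x * h)) (at x)" for x
      using assms(1)[of x] by (simp add: has_field_derivative_def)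
    show "Ck_on k UNIV (\<lambda>x. g x * e)" if "e \<in> Basis" for e
      using that assms(2) by (simp add: smooth_def)
  qed
qed

section \<open>Bumps built from exp(-1/t)\<close>

definition exp_bump :: "real poly \<Rightarrow> real \<Rightarrow> real" where
  "exp_bump p t = (if t > 0 then poly p (1/t) * exp (- 1/t) else 0)"

lemma poly_div_exp_tendsto_0: "((\<lambda>s. poly p s * exp (- s)) \<longlongrightarrow> (0::real)) at_top"
proof -
  have "((\<lambda>s. \<Sum>i\<le>degree p. coeff p i * (s ^ i / exp s)) \<longlongrightarrow> (\<Sum>i\<le>degree p. coeff p i * 0)) at_top"
    by (intro tendsto_sum tendsto_mult tendsto_const tendsto_power_div_exp_0)
  moreover have "poly p s * exp (- s) = (\<Sum>i\<le>degree p. coeff p i * (s ^ i / exp s))" for s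
    by (simp add: poly_altdef exp_minus sum_distrib_right divide_inverse mult.assoc)
  ultimately show ?thesis by simp
qed

text \<open>With x = 1/t, the derivative of p(x) exp(-x) is x^2 (p - p')(x) exp(-x), and the two
  \<open>pCons 0\<close> are the factor x^2. The family over all polynomials is thus closed under
  differentiation, so that smoothness is a plain induction. At zero the difference quotient is again
  a polynomial times an exponential and tends to zero.\<close>

lemma exp_bump_has_derivative:
  "(exp_bump p has_real_derivative exp_bump (pCons 0 (pCons 0 (p - pderiv p))) t) (at t)"
proof -
  consider "t > 0" | "t < 0" | "t = 0" by linarith
  then show ?thesis
  proof cases
    case 1
    have "((\<lambda>t. poly p (1/t) * exp (- 1/t)) has_real_derivative exp_bump (pCons 0 (pCons 0 (p - pderiv p))) t) (at t)"
      using 1 by (auto intro!: derivative_eq_intros DERIV_chain'[of "\<lambda>t. 1/t" _ t UNIV "poly p"] poly_DERIV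
          simp: exp_bump_def power2_eq_square field_simps)
    then show ?thesis
      by (rule has_field_derivative_transform_within_open[of _ _ _ "{0<..}"]) (use 1 in \<open>auto simp: exp_bump_def\<close>)
  next
    case 2
    have "((\<lambda>t. 0) has_real_derivative exp_bump (pCons 0 (pCons 0 (p - pderiv p))) t) (at t)"
      using 2 by (simp add: exp_bump_def)
    then show ?thesis
      by (rule has_field_derivative_transform_within_open[of _ _ _ "{..<0}"]) (use 2 in \<open>auto simp: exp_bump_def\<close>)
  next
    case 3
    have "((\<lambda>y. exp_bump p y / y) \<longlongrightarrow> 0) (at_right 0)"
    proof (rule Lim_transform_eventually)
      show "((\<lambda>y. poly (pCons 0 p) (inverse y) * exp (- inverse y)) \<longlongrightarrow> 0) (at_right 0)"
        by (rule filterlim_compose[OF poly_div_exp_tendsto_0 filterlim_inverse_at_top_right])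
      show "\<forall>\<^sub>F y in at_right 0. poly (pCons 0 p) (inverse y) * exp (- inverse y) = exp_bump p y / y"
        using eventually_at_right_less[of "0::real"]
        by eventually_elim (simp add: exp_bump_def field_simps)
    qed
    moreover have "((\<lambda>y. exp_bump p y / y) \<longlongrightarrow> 0) (at_left 0)"
    proof (rule tendsto_eventually)
      show "\<forall>\<^sub>F y in at_left 0. exp_bump p y / y = 0"
        unfolding eventually_at_filter by (auto simp: exp_bump_def)
    qed
    ultimately have "((\<lambda>y. exp_bump p y / y) \<longlongrightarrow> 0) (at 0)" by (rule filterlim_split_at[rotated])
    then show ?thesis using 3 by (simp add: has_field_derivative_iff exp_bump_def)
  qed
qed

lemma smooth_exp_bump: "smooth (exp_bump p)"
  unfolding smooth_def
proof
  fix k show "Ck_on k UNIV (exp_bump p)"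
  proof (induction k arbitrary: p)
    case 0
    show ?case
      using exp_bump_has_derivative by (auto intro!: continuous_at_imp_continuous_on DERIV_isCont)
  next
    case (Suc k)
    show ?case
    proof (rule Ck_on_SucI)
      show "(exp_bump p has_derivative (\<lambda>h. exp_bump (pCons 0 (pCons 0 (p - pderiv p))) x * h)) (at x)" for x
        using exp_bump_has_derivative by (simp add: has_field_derivative_def)
      show "Ck_on k UNIV (\<lambda>x. exp_bump (pCons 0 (pCons 0 (p - pderiv p))) x * e)" if "e \<in> Basis" for e
        using that Suc.IH by simp
    qed
  qed
qed

definition bump :: "real \<Rightarrow> real" where "bump = exp_bump [:1:]"

lemma smooth_bump: "smooth bump" by (simp add: bump_def smooth_exp_bump)

lemma bump_simps: "t \<le> 0 \<Longrightarrow> bump t = 0" "t > 0 \<Longrightarrow> bump t > 0" "0 \<le> bump t" "bump t \<le> 1"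
  by (auto simp: bump_def exp_bump_def)

lemma bump_tendsto: "t > 0 \<Longrightarrow> (\<lambda>n. bump (real n * t)) \<longlonglongrightarrow> 1"
proof -
  assume t: "t > 0"
  have "(\<lambda>n. exp (- 1 / (real n * t))) \<longlonglongrightarrow> 1" using t by real_asymp
  moreover have "\<forall>\<^sub>F n in sequentially. exp (- 1 / (real n * t)) = bump (real n * t)"
    using t by (intro eventually_sequentiallyI[of 1]) (auto simp: bump_def exp_bump_def)
  ultimately show ?thesis by (rule Lim_transform_eventually)
qed

text \<open>Scaling by \<open>n\<close> lets the factors rise to one inside the box while they stay
  zero outside: a smooth approximation of the indicator of the box from below.\<close>

definition box_bump :: "'a::euclidean_space \<Rightarrow> 'a \<Rightarrow> nat \<Rightarrow> 'a \<Rightarrow> real" where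
  "box_bump l u n x = (\<Prod>b\<in>Basis. bump (real n * ((x - l) \<bullet> b)) * bump (real n * ((u - x) \<bullet> b)))"

lemma smooth_box_bump: "smooth (box_bump l u n)"
proof -
  have "smooth (\<lambda>x. bump (real n * ((x - l) \<bullet> b)))" for b :: 'a
    using smooth_affine[OF smooth_bump, of "- real n * (l \<bullet> b)" "real n *\<^sub>R b"] by (simp add: algebra_simps)
  moreover have "smooth (\<lambda>x. bump (real n * ((u - x) \<bullet> b)))" for b :: 'a
    using smooth_affine[OF smooth_bump, of "real n * (u \<bullet> b)" "- real n *\<^sub>R b"] by (simp add: algebra_simps)
  ultimately show ?thesis
    unfolding box_bump_def[abs_def] by (intro smooth_prod smooth_mult)
qed

lemma box_bump_outside: "x \<notin> box l u \<Longrightarrow> box_bump l u n x = 0"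
proof -
  assume "x \<notin> box l u"
  then obtain b where b: "b \<in> Basis" "x \<bullet> b \<le> l \<bullet> b \<or> u \<bullet> b \<le> x \<bullet> b"
    by (auto simp: mem_box not_less)
  then have "real n * ((x - l) \<bullet> b) \<le> 0 \<or> real n * ((u - x) \<bullet> b) \<le> 0"
    by (auto simp: inner_diff_left mult_le_0_iff)
  then have "bump (real n * ((x - l) \<bullet> b)) * bump (real n * ((u - x) \<bullet> b)) = 0"
    by (auto simp: bump_simps)
  with b show ?thesis unfolding box_bump_def by (intro prod_zero) auto
qed

lemma box_bump_bounds: "0 \<le> box_bump l u n x" "box_bump l u n x \<le> 1"
  unfolding box_bump_def by (auto intro!: prod_nonneg prod_le_1 mult_le_one simp: bump_simps)

lemma box_bump_tendsto: "(\<lambda>n. box_bump l u n x) \<longlonglongrightarrow> indicator (box l u) x"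
proof (cases "x \<in> box l u")
  case True
  then have "(\<lambda>n. box_bump l u n x) \<longlonglongrightarrow> (\<Prod>b\<in>(Basis::'a set). 1 * 1)"
    unfolding box_bump_def
    by (intro tendsto_prod tendsto_mult bump_tendsto) (auto simp: mem_box inner_diff_left)
  then show ?thesis using True by simp
qed (simp add: box_bump_outside)

lemma box_bump_test_function:
  assumes "cbox l u \<subseteq> S"
  shows "box_bump l u n \<in> test_functions S"
proof -
  have "{x. box_bump l u n x \<noteq> 0} \<subseteq> cbox l u"
    using box_bump_outside box_subset_cbox by blast
  then have "closure {x. box_bump l u n x \<noteq> 0} \<subseteq> cbox l u"
    by (intro closure_minimal) auto
  moreover from this have "compact (closure {x. box_bump l u n x \<noteq> 0})"
    using compact_Int_closed[OF compact_cbox[of l u] closed_closure] by (metis inf_absorb2)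
  ultimately show ?thesis
    using assms smooth_box_bump[of l u n] by (auto simp: test_functions_def)
qed

lemma smooth_borel_measurable [measurable_dest]: 
  fixes g :: "'a::euclidean_space \<Rightarrow> 'b::real_normed_vector"
  shows "smooth g \<Longrightarrow> g \<in> borel_measurable borel"
  by (intro borel_measurable_continuous_onI smooth_continuous)

section \<open>Integrals of derivatives with compact support\<close>

lemma derivative_zero_outside:
  assumes "closed K" "\<And>x. x \<notin> K \<Longrightarrow> g x = 0" "x \<notin> K"
  shows "frechet_derivative g (at x) = (\<lambda>h. 0)"
proof -
  have "((\<lambda>x. 0) has_derivative (\<lambda>h. 0)) (at x)" by (rule has_derivative_const)
  then have "(g has_derivative (\<lambda>h. 0)) (at x)"
    by (rule has_derivative_transform_within_open[of _ _ _ _ "- K"]) (use assms in auto)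
  then show ?thesis using frechet_derivative_at by metis
qed

lemma continuous_compact_support_bounded:
  fixes g :: "'a::euclidean_space \<Rightarrow> 'b::euclidean_space"
  assumes "continuous_on UNIV g" "compact K" "\<And>x. x \<notin> K \<Longrightarrow> g x = 0"
  obtains M where "M \<ge> 0" "\<And>x. norm (g x) \<le> M * indicator K x" "\<And>x. norm (g x) \<le> M"
    "integrable lborel g" "integrable lborel (\<lambda>x. (norm (g x))\<^sup>2)"
proof -
  have "compact (g ` K)" using assms by (intro compact_continuous_image) (auto intro: continuous_on_subset)
  then have "bounded (g ` K)" by (rule compact_imp_bounded)
  then obtain M where "\<forall>y\<in>g ` K. norm y \<le> M" unfolding bounded_iff ..
  then have M: "norm (g x) \<le> M" if "x \<in> K" for x using that by blast
  define N where "N = max M 0"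
  have b: "norm (g x) \<le> N * indicator K x" for x
    using M[of x] assms(3)[of x] by (auto simp: N_def indicator_def)
  have b': "norm (g x) \<le> N" for x
    using M[of x] assms(3)[of x] by (cases "x \<in> K") (auto simp: N_def)
  have gm: "g \<in> borel_measurable borel" using assms by (intro borel_measurable_continuous_onI)
  have K: "K \<in> sets borel" "emeasure lborel K < \<infinity>"
    using borel_compact[OF assms(2)] emeasure_compact_finite[OF assms(2)] by auto
  have i1: "integrable lborel g"
  proof (rule Bochner_Integration.integrable_bound)
    show "integrable lborel (\<lambda>x. N * indicator K x :: real)" using K by auto
    show "AE x in lborel. norm (g x) \<le> norm (N * indicator K x :: real)"
      using b by (auto intro: order_trans[OF _ abs_ge_self])
  qed (use gm in simp)
  have i2: "integrable lborel (\<lambda>x. (norm (g x))\<^sup>2)"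
  proof (rule Bochner_Integration.integrable_bound)
    show "integrable lborel (\<lambda>x. N\<^sup>2 * indicator K x :: real)" using K by auto
    have "(norm (g x))\<^sup>2 \<le> N\<^sup>2 * indicator K x" for x
      using power_mono[OF b[of x], of 2] by (auto simp: power_mult_distrib indicator_def split: if_splits)
    then show "AE x in lborel. norm ((norm (g x))\<^sup>2) \<le> norm (N\<^sup>2 * indicator K x :: real)"
      by (auto intro: order_trans[OF _ abs_ge_self])
  qed (use gm in simp)
  show ?thesis by (rule that[of N]) (use b b' i1 i2 in \<open>auto simp: N_def\<close>)
qed

text \<open>Every difference quotient in direction \<open>e\<close> has integral zero by translation
  invariance. The mean value theorem bounds the quotients by one constant on one ball, and dominated
  convergence passes to the derivative.\<close>

lemma integral_directional_derivative_zero: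
  fixes g :: "'a::euclidean_space \<Rightarrow> 'b::euclidean_space"
  assumes diff: "\<And>x. g differentiable (at x)"
    and cont: "continuous_on UNIV (\<lambda>x. frechet_derivative g (at x) e)"
    and K: "compact K" "\<And>x. x \<notin> K \<Longrightarrow> g x = 0"
  shows "(\<integral>x. frechet_derivative g (at x) e \<partial>lborel) = 0"
proof -
  define D where "D x = frechet_derivative g (at x) e" for x
  have D0: "D x = 0" if "x \<notin> K" for x
    unfolding D_def using derivative_zero_outside[OF compact_imp_closed[OF K(1)] K(2) that] by simp
  obtain M where M: "M \<ge> 0" "\<And>x. norm (D x) \<le> M"
    using continuous_compact_support_bounded[OF cont[folded D_def] K(1) D0] by metis
  have gc: "continuous_on UNIV g"
    using diff by (intro differentiable_imp_continuous_on) (auto simp: differentiable_on_def)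
  have gi: "integrable lborel g"
    using continuous_compact_support_bounded[OF gc K] by metis
  have gm [measurable]: "g \<in> borel_measurable borel" using gc by (rule borel_measurable_continuous_onI)
  have Dm [measurable]: "D \<in> borel_measurable borel" using cont unfolding D_def by (rule borel_measurable_continuous_onI)
  have hd: "(g has_derivative frechet_derivative g (at x)) (at x)" for x
    using diff frechet_derivative_works by blast
  have vd: "((\<lambda>s. g (x + s *\<^sub>R e)) has_derivative (\<lambda>h. h *\<^sub>R D (x + s *\<^sub>R e))) (at s)" for x s
  proof -
    have "((\<lambda>s. x + s *\<^sub>R e) has_derivative (\<lambda>h. h *\<^sub>R e)) (at s)"
      by (auto intro!: derivative_eq_intros)
    from has_derivative_compose[OF this hd]
    have "((\<lambda>s. g (x + s *\<^sub>R e)) has_derivative (\<lambda>h. frechet_derivative g (at (x + s *\<^sub>R e)) (h *\<^sub>R e))) (at s)" .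
    moreover have "frechet_derivative g (at y) (h *\<^sub>R e) = h *\<^sub>R D y" for y h
      unfolding D_def using linear_scale[OF has_derivative_linear[OF hd[of y]]] by simp
    ultimately show ?thesis by simp
  qed
  define h where "h n = 1 / real (Suc n)" for n
  have h: "h n > 0" "h n \<le> 1" "h \<longlonglongrightarrow> 0" for n
    unfolding h_def by (simp, simp, real_asymp)
  define Q where "Q n x = (1 / h n) *\<^sub>R (g (x + h n *\<^sub>R e) - g x)" for n x
  obtain R where "\<forall>x\<in>K. norm x \<le> R"
    using compact_imp_bounded[OF K(1)] unfolding bounded_iff ..
  then have R: "norm x \<le> R" if "x \<in> K" for x using that ..
  \<comment> \<open>The steps \<open>h n\<close> are at most one, so a point outside this ball and
    its translate both miss \<open>K\<close>, and the quotient vanishes there.\<close>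
  define B where "B = cball (0::'a) (R + norm e)"
  have Qb: "norm (Q n x) \<le> M * indicator B x" for n x
  proof (cases "x \<in> B")
    case True
    have "\<exists>s\<in>{0<..<h n}. norm (g (x + h n *\<^sub>R e) - g (x + 0 *\<^sub>R e)) \<le> norm ((h n - 0) *\<^sub>R D (x + s *\<^sub>R e))"
      by (rule mvt_general[OF h(1)[of n], of "\<lambda>s. g (x + s *\<^sub>R e)" "\<lambda>s h. h *\<^sub>R D (x + s *\<^sub>R e)"])
         (rule has_derivative_continuous_on[OF has_derivative_at_withinI[OF vd]], rule vd)
    then obtain s where "norm (g (x + h n *\<^sub>R e) - g x) \<le> h n * norm (D (x + s *\<^sub>R e))"
      using h(1)[of n] by auto
    also have "\<dots> \<le> h n * M" using M(2) h(1)[of n] by (intro mult_left_mono) auto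
    finally have "(1 / h n) * norm (g (x + h n *\<^sub>R e) - g x) \<le> M"
      using h(1)[of n] by (simp add: pos_divide_le_eq mult.commute)
    then show ?thesis using True h(1)[of n] by (simp add: Q_def)
  next
    case False
    then have nx: "norm x > R + norm e" by (simp add: B_def)
    have "x \<notin> K" using R[of x] nx norm_ge_zero[of e] by force
    moreover have "x + h n *\<^sub>R e \<notin> K"
    proof
      assume "x + h n *\<^sub>R e \<in> K"
      then have "norm (x + h n *\<^sub>R e) \<le> R" by (rule R)
      moreover have "norm (h n *\<^sub>R e) \<le> norm e" using h(1,2)[of n] by (simp add: mult_left_le_one_le)
      ultimately show False using nx norm_triangle_ineq4[of "x + h n *\<^sub>R e" "h n *\<^sub>R e"] by simp
    qed
    ultimately show ?thesis using False K(2) by (simp add: Q_def)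
  qed
  have "(\<lambda>n. \<integral>x. Q n x \<partial>lborel) \<longlonglongrightarrow> (\<integral>x. D x \<partial>lborel)"
  proof (rule integral_dominated_convergence)
    show "integrable lborel (\<lambda>x. M * indicator B x :: real)"
      unfolding B_def by (intro integrable_mult_right integrable_real_indicator) (use emeasure_bounded_finite[OF bounded_cball] in auto)
    show "AE x in lborel. norm (Q n x) \<le> M * indicator B x" for n using Qb by simp
    show "AE x in lborel. (\<lambda>n. Q n x) \<longlonglongrightarrow> D x"
    proof (rule AE_I2)
      fix x
      have "((\<lambda>s. norm (g (x + s *\<^sub>R e) - g x - s *\<^sub>R D x) / norm s) \<longlongrightarrow> 0) (at 0)"
        using vd[of x 0] by (simp add: has_derivative_at)
      moreover have "filterlim h (at 0) sequentially"
        using h(3) by (rule filterlim_atI) (use h(1) in \<open>simp add: less_imp_neq[symmetric]\<close>)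
      ultimately have lim: "(\<lambda>n. norm (g (x + h n *\<^sub>R e) - g x - h n *\<^sub>R D x) / norm (h n)) \<longlonglongrightarrow> 0"
        by (rule filterlim_compose)
      have "norm (g (x + h n *\<^sub>R e) - g x - h n *\<^sub>R D x) / norm (h n) = norm (Q n x - D x)" for n
      proof -
        have "Q n x - D x = (1 / h n) *\<^sub>R (g (x + h n *\<^sub>R e) - g x - h n *\<^sub>R D x)"
          using h(1)[of n] by (simp add: Q_def scaleR_diff_right)
        then show ?thesis using h(1)[of n] by simp
      qed
      with lim have "(\<lambda>n. norm (Q n x - D x)) \<longlonglongrightarrow> 0" by simp
      then show "(\<lambda>n. Q n x) \<longlonglongrightarrow> D x" by (rule LIM_zero_cancel[OF tendsto_norm_zero_cancel])
    qed
  qed (auto simp: Q_def)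
  moreover have "(\<integral>x. Q n x \<partial>lborel) = 0" for n
  proof -
    have tr: "integrable lborel (\<lambda>x. g (h n *\<^sub>R e + x))" "(\<integral>x. g (h n *\<^sub>R e + x) \<partial>lborel) = (\<integral>x. g x \<partial>lborel)"
    proof -
      have eq: "lborel = distr lborel borel ((+) (h n *\<^sub>R e))" by (rule lborel_distr_plus[symmetric])
      show "integrable lborel (\<lambda>x. g (h n *\<^sub>R e + x))"
        using gi by (subst (asm) eq) (simp add: integrable_distr_eq)
      show "(\<integral>x. g (h n *\<^sub>R e + x) \<partial>lborel) = (\<integral>x. g x \<partial>lborel)"
        by (subst (2) eq) (simp add: integral_distr)
    qed
    then show ?thesis using gi by (simp add: Q_def add.commute)
  qed
  ultimately show ?thesis by (simp add: D_def LIMSEQ_const_iff)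
qed

section \<open>The fundamental lemma of the calculus of variations\<close>

text \<open>Orthogonality to indicators of boxes extends to all Borel subsets of the box by the
  Dynkin argument; the set where a coordinate of \<open>u\<close> is positive, or negative, is then
  an admissible test set.\<close>

lemma vanishes_on_box:
  fixes u :: l2field
  assumes "\<And>c d e. cbox c d \<subseteq> cbox a b \<Longrightarrow> e \<in> Basis \<Longrightarrow> u \<bullet> abs_l2field (\<lambda>x. indicator (box c d) x *\<^sub>R e) = 0"
  shows "AE x in lborel. x \<in> box a b \<longrightarrow> rep_l2field u x = 0"
proof -
  define E where "E = insert UNIV (range (\<lambda>(c, d). box c d :: (real^3) set))"
  have E1: "Int_stable E"
  proof (rule Int_stableI)
    fix X Y assume "X \<in> E" "Y \<in> E"
    then show "X \<inter> Y \<in> E" unfolding E_def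
      by (elim insertE rangeE) (simp_all add: box_Int_box image_iff split: prod.splits, blast+)
  qed
  have E3: "sets borel = sigma_sets UNIV E"
  proof
    have "sets borel = sigma_sets UNIV (range (\<lambda>(c, d). box c d :: (real^3) set))"
      by (subst borel_eq_box) simp
    also have "\<dots> \<subseteq> sigma_sets UNIV E" by (intro sigma_sets_subseteq) (auto simp: E_def)
    finally show "sets borel \<subseteq> sigma_sets UNIV E" .
    have "E \<subseteq> sets borel" by (auto simp: E_def)
    then show "sigma_sets UNIV E \<subseteq> sets borel" using sets.sigma_sets_subset[of E borel] by simp
  qed
  define C where "C = {v. u \<bullet> v = 0}"
  have C: "closed C" "subspace C"
    unfolding C_def
    by (intro closed_Collect_eq continuous_intros) (auto simp: subspace_def inner_add_right)
  define W where "W = box a b"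
  have base: "abs_l2field (\<lambda>x. indicator (A \<inter> W) x *\<^sub>R e) \<in> C" if "A \<in> E" "e \<in> Basis" for A e
  proof -
    \<comment> \<open>Only a nonempty open box has the closed box with the same corners as its
      closure, hence the separate empty case.\<close>
    have "\<exists>c d. A \<inter> W = box c d \<and> cbox c d \<subseteq> cbox a b \<or> A \<inter> W = {}"
    proof (cases "A \<inter> W = {}")
      case False
      from that(1) have "\<exists>c d. A \<inter> W = box c d"
        unfolding E_def W_def by (elim insertE rangeE) (simp_all add: box_Int_box split: prod.splits, blast+)
      then obtain c d where cd: "A \<inter> W = box c d" by blast
      then have "box c d \<subseteq> cbox a b" unfolding W_def using box_subset_cbox[of a b] by blast
      then have "closure (box c d) \<subseteq> cbox a b" by (rule closure_minimal[OF _ closed_cbox])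
      moreover have "closure (box c d) = cbox c d" using False cd by (intro closure_box) simp
      ultimately have "cbox c d \<subseteq> cbox a b" by simp
      then show ?thesis using cd by blast
    qed auto
    then show ?thesis
    proof (elim exE disjE conjE)
      fix c d assume "A \<inter> W = box c d" "cbox c d \<subseteq> cbox a b"
      then show ?thesis unfolding C_def using assms that by auto
    next
      assume "A \<inter> W = {}"
      then show ?thesis by (simp add: C_def zero_abs_l2field[symmetric])
    qed
  qed
  have all: "u \<bullet> abs_l2field (\<lambda>x. indicator (A \<inter> W) x *\<^sub>R e) = 0" if "A \<in> sets borel" "e \<in> Basis" for A e
    using closed_subspace_of_indicators[OF C _ _ E1 _ E3 base[OF _ that(2)] that(1)] by (auto simp: C_def W_def E_def)
  have sgn: "AE x in lborel. x \<in> W \<longrightarrow> s * (rep_l2field u x \<bullet> e) \<le> 0" if e: "e \<in> Basis" and s: "s \<noteq> 0" for e s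
  proof -
    define A where "A = {x. s * (rep_l2field u x \<bullet> e) > 0}"
    have Am [measurable]: "A \<in> sets borel" unfolding A_def by measurable
    have Wm [measurable]: "W \<in> sets borel" by (simp add: W_def)
    have sq: "square_integrable (\<lambda>x. indicator (A \<inter> W) x *\<^sub>R e)"
      by (rule square_integrable_indicator) (auto simp: W_def intro: bounded_subset[OF bounded_box])
    have "u \<bullet> abs_l2field (\<lambda>x. indicator (A \<inter> W) x *\<^sub>R e) = (\<integral>x. rep_l2field u x \<bullet> (indicator (A \<inter> W) x *\<^sub>R e) \<partial>lborel)"
      using inner_abs_l2field[OF square_integrable_rep[of u] sq] by (simp add: abs_rep_l2field)
    then have "(\<integral>x. rep_l2field u x \<bullet> (indicator (A \<inter> W) x *\<^sub>R e) \<partial>lborel) = 0"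
      using all[OF Am e] by simp
    then have "(\<integral>x. s * (rep_l2field u x \<bullet> (indicator (A \<inter> W) x *\<^sub>R e)) \<partial>lborel) = 0" by simp
    moreover have "integrable lborel (\<lambda>x. s * (rep_l2field u x \<bullet> (indicator (A \<inter> W) x *\<^sub>R e)))"
      by (intro integrable_mult_right square_integrable_inner square_integrable_rep sq)
    moreover have "AE x in lborel. 0 \<le> s * (rep_l2field u x \<bullet> (indicator (A \<inter> W) x *\<^sub>R e))"
      by (auto simp: A_def indicator_def)
    ultimately have "AE x in lborel. s * (rep_l2field u x \<bullet> (indicator (A \<inter> W) x *\<^sub>R e)) = 0"
      using integral_nonneg_eq_0_iff_AE by blast
    then show ?thesis by eventually_elim (auto simp: A_def indicator_def not_less split: if_splits)
  qed
  have "AE x in lborel. \<forall>e\<in>Basis. x \<in> W \<longrightarrow> rep_l2field u x \<bullet> e = 0"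
  proof (rule AE_finite_allI)
    fix e :: "real^3" assume "e \<in> Basis"
    then show "AE x in lborel. x \<in> W \<longrightarrow> rep_l2field u x \<bullet> e = 0"
      using sgn[of e 1] sgn[of e "-1"] by (auto elim: eventually_elim2)
  qed simp
  then show ?thesis by eventually_elim (auto simp: W_def intro: euclidean_eqI)
qed

lemma test_function_compact_support:
  assumes "\<phi> \<in> test_functions S"
  obtains K where "compact K" "K \<subseteq> S" "\<And>x. x \<notin> K \<Longrightarrow> \<phi> x = 0"
proof (rule that[of "closure {x. \<phi> x \<noteq> 0}"])
  show "compact (closure {x. \<phi> x \<noteq> 0})" "closure {x. \<phi> x \<noteq> 0} \<subseteq> S"
    using assms by (simp_all add: test_functions_def)
  show "\<phi> x = 0" if "x \<notin> closure {x. \<phi> x \<noteq> 0}" for x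
    using that closure_subset[of "{x. \<phi> x \<noteq> 0}"] by blast
qed

lemma square_integrable_test:
  fixes \<phi> :: "real^3 \<Rightarrow> real"
  assumes "continuous_on UNIV \<phi>" "compact K" "\<And>x. x \<notin> K \<Longrightarrow> \<phi> x = 0"
  shows "square_integrable (\<lambda>x. \<phi> x *\<^sub>R (e :: real^3))"
  unfolding square_integrable_def
proof
  have c: "continuous_on UNIV (\<lambda>x. \<phi> x *\<^sub>R e)" using assms by (intro continuous_intros)
  show "(\<lambda>x. \<phi> x *\<^sub>R e) \<in> borel_measurable lborel" using borel_measurable_continuous_onI[OF c] by simp
  show "integrable lborel (\<lambda>x. (norm (\<phi> x *\<^sub>R e))\<^sup>2)"
    by (rule continuous_compact_support_bounded[OF c assms(2)]) (use assms(3) in auto)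
qed

lemma test_function_derivative_props:
  fixes \<phi> :: "real^3 \<Rightarrow> real"
  assumes "\<phi> \<in> test_functions \<Omega>"
  shows "square_integrable (\<lambda>x. \<phi> x *\<^sub>R e)" "square_integrable (\<lambda>x. partial i \<phi> x *\<^sub>R e)"
    "x \<notin> \<Omega> \<Longrightarrow> \<phi> x = 0" "x \<notin> \<Omega> \<Longrightarrow> partial i \<phi> x = 0"
proof -
  obtain K where K: "compact K" "K \<subseteq> \<Omega>" "\<And>x. x \<notin> K \<Longrightarrow> \<phi> x = 0"
    using test_function_compact_support[OF assms] by blast
  have sm: "smooth \<phi>" using assms by (simp add: test_functions_def)
  have p0: "partial i \<phi> x = 0" if "x \<notin> K" for x
    unfolding partial_def using derivative_zero_outside[OF compact_imp_closed[OF K(1)] K(3) that] by simp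
  have "smooth (partial i \<phi>)"
    unfolding partial_def[abs_def] by (intro smooth_derivative sm) simp
  then show "square_integrable (\<lambda>x. partial i \<phi> x *\<^sub>R e)"
    by (intro square_integrable_test[OF _ K(1)] smooth_continuous p0)
  show "square_integrable (\<lambda>x. \<phi> x *\<^sub>R e)"
    by (intro square_integrable_test[OF _ K(1)] smooth_continuous sm K(3))
  show "x \<notin> \<Omega> \<Longrightarrow> \<phi> x = 0" "x \<notin> \<Omega> \<Longrightarrow> partial i \<phi> x = 0" using K p0 by auto
qed

text \<open>Smooth bumps approximate the indicators of boxes inside \<Omega>, so that
  \<open>vanishes_on_box\<close> applies to each closed box in \<Omega>. Countably many of these
  cover the open set, and their boundaries are null.\<close>

lemma fundamental_lemma:
  assumes "open \<Omega>"
    and "\<And>\<phi> e. \<phi> \<in> test_functions \<Omega> \<Longrightarrow> e \<in> Basis \<Longrightarrow> u \<bullet> abs_l2field (\<lambda>x. \<phi> x *\<^sub>R e) = 0"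
  shows "AE x in lborel. x \<in> \<Omega> \<longrightarrow> rep_l2field u x = 0"
proof -
  have box: "AE x in lborel. x \<in> box a b \<longrightarrow> rep_l2field u x = 0" if "cbox a b \<subseteq> \<Omega>" for a b
  proof (rule vanishes_on_box)
    fix c d e :: "real^3" assume cd: "cbox c d \<subseteq> cbox a b" and e: "e \<in> Basis"
    have tf: "box_bump c d n \<in> test_functions \<Omega>" for n
      using cd that by (intro box_bump_test_function) auto
    have sq: "square_integrable (\<lambda>x. indicator (box c d) x *\<^sub>R e)"
      by (rule square_integrable_indicator) (auto intro: bounded_box)
    have "(\<lambda>n. \<integral>x. rep_l2field u x \<bullet> (box_bump c d n x *\<^sub>R e) \<partial>lborel) \<longlonglongrightarrow>
        (\<integral>x. rep_l2field u x \<bullet> (indicator (box c d) x *\<^sub>R e) \<partial>lborel)"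
    proof (rule integral_dominated_convergence)
      show "integrable lborel (\<lambda>x. norm (rep_l2field u x \<bullet> (indicator (box c d) x *\<^sub>R e)))"
        by (intro integrable_norm square_integrable_inner square_integrable_rep sq)
      show "AE x in lborel. (\<lambda>n. rep_l2field u x \<bullet> (box_bump c d n x *\<^sub>R e)) \<longlonglongrightarrow> rep_l2field u x \<bullet> (indicator (box c d) x *\<^sub>R e)"
        by (intro AE_I2 tendsto_intros box_bump_tendsto)
      show "AE x in lborel. norm (rep_l2field u x \<bullet> (box_bump c d n x *\<^sub>R e)) \<le> norm (rep_l2field u x \<bullet> (indicator (box c d) x *\<^sub>R e))" for n
        by (intro AE_I2) (auto simp: indicator_def box_bump_outside abs_mult box_bump_bounds mult_left_le_one_le)
      show "(\<lambda>x. rep_l2field u x \<bullet> (box_bump c d n x *\<^sub>R e)) \<in> borel_measurable lborel" for n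
        using smooth_borel_measurable[OF smooth_box_bump[of c d n]] by simp
    qed simp
    moreover have "(\<integral>x. rep_l2field u x \<bullet> (box_bump c d n x *\<^sub>R e) \<partial>lborel) = 0" for n
      using assms(2)[OF tf e] inner_abs_l2field[OF square_integrable_rep[of u] test_function_derivative_props(1)[OF tf]]
      by (simp add: abs_rep_l2field)
    ultimately show "u \<bullet> abs_l2field (\<lambda>x. indicator (box c d) x *\<^sub>R e) = 0"
      using inner_abs_l2field[OF square_integrable_rep[of u] sq] by (simp add: abs_rep_l2field LIMSEQ_const_iff)
  qed
  obtain \<D> where D: "countable \<D>" "\<And>X. X \<in> \<D> \<Longrightarrow> X \<subseteq> \<Omega>" "\<And>X. X \<in> \<D> \<Longrightarrow> \<exists>a b. X = cbox a b" "\<Union>\<D> = \<Omega>"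
    using open_countable_Union_open_cbox[OF assms(1)] by (metis PowD subsetD)
  have "AE x in lborel. \<forall>X\<in>\<D>. x \<in> X \<longrightarrow> rep_l2field u x = 0"
  proof (rule AE_ball_countable[THEN iffD2, OF D(1)], rule ballI)
    fix X assume X: "X \<in> \<D>"
    then obtain a b where ab: "X = cbox a b" using D(3) by blast
    have "(cbox a b - box a b) \<in> null_sets lborel"
      using negligible_frontier_interval[of a b] negligible_iff_null_sets
      by (metis frontier_cbox null_sets_completion_iff sets.Diff sets_lborel borel_closed borel_open closed_cbox open_box negligible_frontier_interval)
    then have "AE x in lborel. x \<notin> cbox a b - box a b" by (rule AE_not_in)
    with box[of a b] D(2)[OF X] ab show "AE x in lborel. x \<in> X \<longrightarrow> rep_l2field u x = 0"
      by (auto elim: eventually_elim2)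
  qed
  then show ?thesis by eventually_elim (use D(4) in auto)
qed

section \<open>Weak gradients\<close>

lemma mult_le_sum_squares: "x * y \<le> x\<^sup>2 + y\<^sup>2" for x y :: real
proof -
  have "2 * x * y \<le> x\<^sup>2 + y\<^sup>2" "0 \<le> x\<^sup>2 + y\<^sup>2" by (rule sum_squares_bound) simp
  then show ?thesis by linarith
qed

lemma integral_test_field:
  assumes sq: "\<And>e. square_integrable (\<lambda>x. \<phi> x *\<^sub>R e)" and off: "\<And>x. x \<notin> \<Omega> \<Longrightarrow> \<phi> x = 0"
  shows "(LINT x:\<Omega>|lborel. \<phi> x *\<^sub>R rep_l2field u x) \<bullet> e = u \<bullet> abs_l2field (\<lambda>x. \<phi> x *\<^sub>R e)"
proof -
  \<comment> \<open>A unit vector, used to read off measurability and square integrability of the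
    scalar factor from the hypothesis, which speaks of vector fields.\<close>
  define a :: "real^3" where "a = axis 1 1"
  have a: "a \<bullet> a = 1" by (simp add: a_def inner_axis_axis)
  have "(\<lambda>x. (\<phi> x *\<^sub>R a) \<bullet> a) \<in> borel_measurable borel"
    using sq[of a] by (intro borel_measurable_inner) (auto simp: square_integrable_def)
  then have [measurable]: "\<phi> \<in> borel_measurable borel" by (simp add: a)
  have int: "integrable lborel (\<lambda>x. \<phi> x *\<^sub>R rep_l2field u x)"
  proof (rule Bochner_Integration.integrable_bound)
    show "integrable lborel (\<lambda>x. (norm (\<phi> x *\<^sub>R a))\<^sup>2 + (norm (rep_l2field u x))\<^sup>2)"
      using sq[of a] square_integrable_rep[of u] by (auto simp: square_integrable_def)
    have "norm (\<phi> x *\<^sub>R rep_l2field u x) \<le> (norm (\<phi> x *\<^sub>R a))\<^sup>2 + (norm (rep_l2field u x))\<^sup>2" for x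
    proof -
      have "norm a = 1" using a by (simp add: norm_eq_sqrt_inner)
      then show ?thesis
        using mult_le_sum_squares[of "\<bar>\<phi> x\<bar>" "norm (rep_l2field u x)"] by simp
    qed
    then show "AE x in lborel. norm (\<phi> x *\<^sub>R rep_l2field u x) \<le> norm ((norm (\<phi> x *\<^sub>R a))\<^sup>2 + (norm (rep_l2field u x))\<^sup>2)"
      by (intro AE_I2) (metis abs_ge_self order_trans real_norm_def)
  qed measurable
  have "(LINT x:\<Omega>|lborel. \<phi> x *\<^sub>R rep_l2field u x) = (\<integral>x. \<phi> x *\<^sub>R rep_l2field u x \<partial>lborel)"
  proof -
    have "indicator \<Omega> x *\<^sub>R (\<phi> x *\<^sub>R r) = \<phi> x *\<^sub>R r" for x and r :: "real^3"
      using off[of x] by (cases "x \<in> \<Omega>") auto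
    then show ?thesis unfolding set_lebesgue_integral_def by (simp only:)
  qed
  then have "(LINT x:\<Omega>|lborel. \<phi> x *\<^sub>R rep_l2field u x) \<bullet> e = (\<integral>x. (\<phi> x *\<^sub>R rep_l2field u x) \<bullet> e \<partial>lborel)"
    using integral_inner_left[OF int, of e] by simp
  also have "\<dots> = (\<integral>x. rep_l2field u x \<bullet> (\<phi> x *\<^sub>R e) \<partial>lborel)" by simp
  also have "\<dots> = u \<bullet> abs_l2field (\<lambda>x. \<phi> x *\<^sub>R e)"
    using inner_abs_l2field[OF square_integrable_rep[of u] sq[of e]] by (simp add: abs_rep_l2field)
  finally show ?thesis .
qed

text \<open>Replaces the vector identity of the definition by scalar ones between inner products
  with fixed elements of L2; linearity, closedness and uniqueness are then inherited from the inner
  product.\<close>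

lemma weak_partial_iff:
  "weak_partial \<Omega> i u g \<longleftrightarrow> vanishes_off \<Omega> g \<and> (\<forall>\<phi>\<in>test_functions \<Omega>. \<forall>e.
     u \<bullet> abs_l2field (\<lambda>x. partial i \<phi> x *\<^sub>R e) = - (g \<bullet> abs_l2field (\<lambda>x. \<phi> x *\<^sub>R e)))"
proof -
  have "(LINT x:\<Omega>|lborel. partial i \<phi> x *\<^sub>R rep_l2field u x) = - (LINT x:\<Omega>|lborel. \<phi> x *\<^sub>R rep_l2field g x) \<longleftrightarrow>
    (\<forall>e. u \<bullet> abs_l2field (\<lambda>x. partial i \<phi> x *\<^sub>R e) = - (g \<bullet> abs_l2field (\<lambda>x. \<phi> x *\<^sub>R e)))"
    if "\<phi> \<in> test_functions \<Omega>" for \<phi> :: "real^3 \<Rightarrow> real"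
  proof -
    note p = test_function_derivative_props[OF that]
    have "(LINT x:\<Omega>|lborel. partial i \<phi> x *\<^sub>R rep_l2field u x) = - (LINT x:\<Omega>|lborel. \<phi> x *\<^sub>R rep_l2field g x) \<longleftrightarrow>
      (\<forall>e. (LINT x:\<Omega>|lborel. partial i \<phi> x *\<^sub>R rep_l2field u x) \<bullet> e = - ((LINT x:\<Omega>|lborel. \<phi> x *\<^sub>R rep_l2field g x) \<bullet> e))"
      (is "?a = ?b \<longleftrightarrow> ?r")
    proof
      assume r: "?r"
      show "?a = ?b"
        by (rule vector_eq_ldot[THEN iffD1]) (use r in \<open>simp add: inner_commute[of _ ?a] inner_commute[of _ "LINT x:\<Omega>|lborel. \<phi> x *\<^sub>R rep_l2field g x"]\<close>)
    qed simp
    moreover have "(LINT x:\<Omega>|lborel. partial i \<phi> x *\<^sub>R rep_l2field u x) \<bullet> e = u \<bullet> abs_l2field (\<lambda>x. partial i \<phi> x *\<^sub>R e)" for e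
      by (rule integral_test_field[OF p(2) p(4)])
    moreover have "(LINT x:\<Omega>|lborel. \<phi> x *\<^sub>R rep_l2field g x) \<bullet> e = g \<bullet> abs_l2field (\<lambda>x. \<phi> x *\<^sub>R e)" for e
      by (rule integral_test_field[OF p(1) p(3)])
    ultimately show ?thesis by presburger
  qed
  then show ?thesis unfolding weak_partial_def by blast
qed

text \<open>As an orthogonal complement the condition is visibly closed. In the converse direction
  the test vector is the part of \<open>u\<close> that lives off \<Omega>.\<close>

lemma vanishes_off_iff:
  assumes "\<Omega> \<in> sets borel"
  shows "vanishes_off \<Omega> u \<longleftrightarrow> (\<forall>v. vanishes_off (- \<Omega>) v \<longrightarrow> u \<bullet> v = 0)"
proof (intro iffI allI impI)
  fix v assume "vanishes_off \<Omega> u" "vanishes_off (- \<Omega>) v"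
  then have "AE x in lborel. rep_l2field u x \<bullet> rep_l2field v x = 0"
    unfolding vanishes_off_def by eventually_elim auto
  then have "(\<integral>x. rep_l2field u x \<bullet> rep_l2field v x \<partial>lborel) = 0"
    by (rule integral_eq_zero_AE)
  then show "u \<bullet> v = 0" by (simp add: inner_l2field_rep)
next
  assume *: "\<forall>v. vanishes_off (- \<Omega>) v \<longrightarrow> u \<bullet> v = 0"
  define g where "g x = indicator (- \<Omega>) x *\<^sub>R rep_l2field u x" for x
  have [measurable]: "- \<Omega> \<in> sets borel" using assms by auto
  have gm: "g \<in> borel_measurable borel" unfolding g_def by measurable
  have sq: "square_integrable g"
    by (rule square_integrable_bound[OF square_integrable_rep[of u] gm, of 1]) (auto simp: g_def indicator_def)
  have "vanishes_off (- \<Omega>) (abs_l2field g)"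
    unfolding vanishes_off_def using rep_abs_l2field[OF sq] by eventually_elim (auto simp: g_def)
  then have "u \<bullet> abs_l2field g = 0" using * by blast
  then have "(\<integral>x. rep_l2field u x \<bullet> g x \<partial>lborel) = 0"
    using inner_abs_l2field[OF square_integrable_rep[of u] sq] by (simp add: abs_rep_l2field)
  moreover have "rep_l2field u x \<bullet> g x = g x \<bullet> g x" for x by (auto simp: g_def indicator_def)
  ultimately have "(\<integral>x. g x \<bullet> g x \<partial>lborel) = 0" by simp
  then have "AE x in lborel. g x \<bullet> g x = 0"
    using integral_nonneg_eq_0_iff_AE[OF square_integrable_inner[OF sq sq]] by simp
  then show "vanishes_off \<Omega> u"
    unfolding vanishes_off_def by eventually_elim (auto simp: g_def indicator_def split: if_splits)
qed

lemma vanishes_off_add: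
  assumes "vanishes_off \<Omega> u" "vanishes_off \<Omega> v"
  shows "vanishes_off \<Omega> (u + v)"
  using assms rep_add_l2field[of u v] unfolding vanishes_off_def by eventually_elim auto

lemma vanishes_off_scaleR:
  assumes "vanishes_off \<Omega> u"
  shows "vanishes_off \<Omega> (c *\<^sub>R u)"
  using assms rep_scaleR_l2field[of c u] unfolding vanishes_off_def by eventually_elim auto

lemma vanishes_off_closed:
  assumes "\<Omega> \<in> sets borel" "\<And>n. vanishes_off \<Omega> (U n)" "U \<longlonglongrightarrow> u"
  shows "vanishes_off \<Omega> u"
  unfolding vanishes_off_iff[OF assms(1)]
proof (intro allI impI)
  fix v assume v: "vanishes_off (- \<Omega>) v"
  have "(\<lambda>n. U n \<bullet> v) \<longlonglongrightarrow> u \<bullet> v" by (intro tendsto_intros assms)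
  moreover have "U n \<bullet> v = 0" for n using assms(2)[of n] v by (simp add: vanishes_off_iff[OF assms(1)])
  ultimately show "u \<bullet> v = 0" by (simp add: LIMSEQ_const_iff)
qed

lemma weak_partial_add:
  "weak_partial \<Omega> i u g \<Longrightarrow> weak_partial \<Omega> i v h \<Longrightarrow> weak_partial \<Omega> i (u + v) (g + h)"
  by (simp add: weak_partial_iff vanishes_off_add inner_add_left)

lemma weak_partial_scaleR:
  "weak_partial \<Omega> i u g \<Longrightarrow> weak_partial \<Omega> i (c *\<^sub>R u) (c *\<^sub>R g)"
  by (simp add: weak_partial_iff vanishes_off_scaleR)

lemma weak_partial_closed:
  assumes "\<Omega> \<in> sets borel" "\<And>n. weak_partial \<Omega> i (U n) (G n)" "U \<longlonglongrightarrow> u" "G \<longlonglongrightarrow> g"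
  shows "weak_partial \<Omega> i u g"
  unfolding weak_partial_iff
proof (intro conjI ballI allI)
  show "vanishes_off \<Omega> g"
    by (rule vanishes_off_closed[OF assms(1) _ assms(4)]) (use assms(2) in \<open>simp add: weak_partial_def\<close>)
next
  fix \<phi> :: "real^3 \<Rightarrow> real" and e assume "\<phi> \<in> test_functions \<Omega>"
  then have eq: "U n \<bullet> abs_l2field (\<lambda>x. partial i \<phi> x *\<^sub>R e) = - (G n \<bullet> abs_l2field (\<lambda>x. \<phi> x *\<^sub>R e))" for n
    using assms(2)[of n] by (simp add: weak_partial_iff)
  have "(\<lambda>n. U n \<bullet> abs_l2field (\<lambda>x. partial i \<phi> x *\<^sub>R e)) \<longlonglongrightarrow> u \<bullet> abs_l2field (\<lambda>x. partial i \<phi> x *\<^sub>R e)"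
    by (intro tendsto_intros assms)
  moreover have "(\<lambda>n. - (G n \<bullet> abs_l2field (\<lambda>x. \<phi> x *\<^sub>R e))) \<longlonglongrightarrow> - (g \<bullet> abs_l2field (\<lambda>x. \<phi> x *\<^sub>R e))"
    by (intro tendsto_intros assms)
  ultimately show "u \<bullet> abs_l2field (\<lambda>x. partial i \<phi> x *\<^sub>R e) = - (g \<bullet> abs_l2field (\<lambda>x. \<phi> x *\<^sub>R e))"
    unfolding eq by (rule LIMSEQ_unique)
qed

text \<open>The difference of two candidates is a weak derivative of zero: it vanishes on \<Omega>
  by the fundamental lemma and off \<Omega> by definition. This justifies the definite description
  in \<open>weak_grad\<close>.\<close>

lemma weak_partial_unique:
  assumes "open \<Omega>" "weak_partial \<Omega> i u g" "weak_partial \<Omega> i u h"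
  shows "g = h"
proof -
  have "weak_partial \<Omega> i (u + (-1) *\<^sub>R u) (g + (-1) *\<^sub>R h)"
    by (intro weak_partial_add weak_partial_scaleR assms)
  then have d: "weak_partial \<Omega> i 0 (g - h)" by simp
  then have "(g - h) \<bullet> abs_l2field (\<lambda>x. \<phi> x *\<^sub>R e) = 0" if "\<phi> \<in> test_functions \<Omega>" for \<phi> e
    using that by (simp add: weak_partial_iff)
  then have "AE x in lborel. x \<in> \<Omega> \<longrightarrow> rep_l2field (g - h) x = 0"
    by (intro fundamental_lemma assms)
  moreover have "AE x in lborel. x \<notin> \<Omega> \<longrightarrow> rep_l2field (g - h) x = 0"
    using d by (simp add: weak_partial_def vanishes_off_def)
  ultimately have "AE x in lborel. rep_l2field (g - h) x = rep_l2field 0 x"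
    using rep_zero_l2field by eventually_elim auto
  then have "g - h = 0" by (rule l2field_eqI)
  then show ?thesis by simp
qed

lemma weak_partial_weak_grad:
  assumes "open \<Omega>" "u \<in> H1 \<Omega>"
  shows "weak_partial \<Omega> i u (weak_grad \<Omega> u $ i)"
proof -
  obtain g where "weak_partial \<Omega> i u g" using assms by (auto simp: H1_def)
  then have "weak_partial \<Omega> i u (THE g. weak_partial \<Omega> i u g)"
    by (rule theI) (use weak_partial_unique[OF assms(1)] \<open>weak_partial \<Omega> i u g\<close> in blast)
  then show ?thesis by (simp add: weak_grad_def)
qed

lemma weak_grad_eqI:
  assumes "open \<Omega>" "\<And>i. weak_partial \<Omega> i u (p $ i)"
  shows "weak_grad \<Omega> u = p"
  unfolding weak_grad_def vec_eq_iff
  using assms weak_partial_unique[OF assms(1)] by (auto intro!: the_equality)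

text \<open>The gradient is a closed operator: convergence of fields and gradients together
  identifies the limits, although the gradient is not continuous.\<close>

lemma H1_closed:
  assumes "open \<Omega>" "\<And>n. U n \<in> H1 \<Omega>" "U \<longlonglongrightarrow> u" "(\<lambda>n. weak_grad \<Omega> (U n)) \<longlonglongrightarrow> p"
  shows "u \<in> H1 \<Omega>" "weak_grad \<Omega> u = p"
proof -
  have wp: "weak_partial \<Omega> i u (p $ i)" for i
    by (rule weak_partial_closed[OF _ weak_partial_weak_grad[OF assms(1,2)] assms(3)])
       (use assms in \<open>auto intro: tendsto_vec_nth\<close>)
  then show "weak_grad \<Omega> u = p" by (intro weak_grad_eqI assms)
  have "vanishes_off \<Omega> u"
    by (rule vanishes_off_closed[OF _ _ assms(3)]) (use assms in \<open>auto simp: H1_def\<close>)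
  then show "u \<in> H1 \<Omega>" using wp by (auto simp: H1_def)
qed

lemma H1_add:
  assumes "open \<Omega>" "u \<in> H1 \<Omega>" "v \<in> H1 \<Omega>"
  shows "u + v \<in> H1 \<Omega>" "weak_grad \<Omega> (u + v) = weak_grad \<Omega> u + weak_grad \<Omega> v"
proof -
  have wp: "weak_partial \<Omega> i (u + v) ((weak_grad \<Omega> u + weak_grad \<Omega> v) $ i)" for i
    using weak_partial_add[OF weak_partial_weak_grad[OF assms(1,2)] weak_partial_weak_grad[OF assms(1,3)]] by simp
  then show "weak_grad \<Omega> (u + v) = weak_grad \<Omega> u + weak_grad \<Omega> v" by (intro weak_grad_eqI assms)
  show "u + v \<in> H1 \<Omega>" using wp assms by (auto simp: H1_def vanishes_off_add)
qed

lemma H1_scaleR: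
  assumes "open \<Omega>" "u \<in> H1 \<Omega>"
  shows "c *\<^sub>R u \<in> H1 \<Omega>" "weak_grad \<Omega> (c *\<^sub>R u) = c *\<^sub>R weak_grad \<Omega> u"
proof -
  have wp: "weak_partial \<Omega> i (c *\<^sub>R u) ((c *\<^sub>R weak_grad \<Omega> u) $ i)" for i
    using weak_partial_scaleR[OF weak_partial_weak_grad[OF assms(1,2)]] by simp
  then show "weak_grad \<Omega> (c *\<^sub>R u) = c *\<^sub>R weak_grad \<Omega> u" by (intro weak_grad_eqI assms)
  show "c *\<^sub>R u \<in> H1 \<Omega>" using wp assms by (auto simp: H1_def vanishes_off_scaleR)
qed

section \<open>Smooth fields on a bounded domain and their classical gradients\<close>

lemma continuous_bounded_on_bounded:
  fixes w :: "'a::euclidean_space \<Rightarrow> 'b::real_normed_vector"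
  assumes "bounded \<Omega>" "continuous_on UNIV w"
  obtains M where "M \<ge> 0" "\<And>x. x \<in> \<Omega> \<Longrightarrow> norm (w x) \<le> M"
proof -
  have "compact (w ` closure \<Omega>)"
    using assms by (intro compact_continuous_image) (auto simp: compact_closure intro: continuous_on_subset)
  then have "bounded (w ` closure \<Omega>)" by (rule compact_imp_bounded)
  then obtain M where M: "\<forall>y\<in>w ` closure \<Omega>. norm y \<le> M" unfolding bounded_iff ..
  show ?thesis
  proof (rule that[of "max M 0"])
    fix x assume "x \<in> \<Omega>"
    then have "x \<in> closure \<Omega>" using closure_subset by blast
    then show "norm (w x) \<le> max M 0" using M by (auto simp: le_max_iff_disj)
  qed simp
qed

lemma set_integrable_bounded_continuous:
  fixes w :: "'a::euclidean_space \<Rightarrow> 'b::euclidean_space"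
  assumes "\<Omega> \<in> sets borel" "bounded \<Omega>" "continuous_on UNIV w"
  shows "set_integrable lborel \<Omega> w"
proof -
  obtain M where M: "M \<ge> 0" "\<And>x. x \<in> \<Omega> \<Longrightarrow> norm (w x) \<le> M"
    using continuous_bounded_on_bounded[OF assms(2,3)] by blast
  have [measurable]: "w \<in> borel_measurable borel" by (rule borel_measurable_continuous_onI[OF assms(3)])
  have [measurable]: "\<Omega> \<in> sets borel" by fact
  show ?thesis unfolding set_integrable_def
  proof (rule Bochner_Integration.integrable_bound)
    show "integrable lborel (\<lambda>x. M * indicator \<Omega> x :: real)"
      using emeasure_bounded_finite[OF assms(2)] assms(1) by auto
    show "AE x in lborel. norm (indicator \<Omega> x *\<^sub>R w x) \<le> norm (M * indicator \<Omega> x :: real)"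
      using M by (auto simp: indicator_def)
  qed measurable
qed

lemma square_integrable_restrict:
  assumes "\<Omega> \<in> sets borel" "bounded \<Omega>" "continuous_on UNIV w"
  shows "square_integrable (\<lambda>x. indicator \<Omega> x *\<^sub>R (w x :: real^3))"
proof -
  obtain M where M: "M \<ge> 0" "\<And>x. x \<in> \<Omega> \<Longrightarrow> norm (w x) \<le> M"
    using continuous_bounded_on_bounded[OF assms(2,3)] by blast
  have [measurable]: "w \<in> borel_measurable borel" by (rule borel_measurable_continuous_onI[OF assms(3)])
  have [measurable]: "\<Omega> \<in> sets borel" by fact
  show ?thesis
    by (rule square_integrable_bound[OF square_integrable_indicator[OF assms(1,2), of "axis 1 1"], of _ M])
       (use M in \<open>auto simp: indicator_def norm_eq_sqrt_inner[of "axis _ _"] inner_axis_axis\<close>)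
qed

lemma smooth_partial:
  "smooth w \<Longrightarrow> smooth (partial i w)"
  unfolding partial_def[abs_def] by (rule smooth_derivative) simp_all

text \<open>The product of a component of \<open>w\<close> with a test function has compact support
  in \<Omega>, so its derivative integrates to zero over the whole space and the boundary of
  \<Omega> never enters.\<close>

lemma weak_partial_smooth:
  assumes "open \<Omega>" "bounded \<Omega>" "smooth w"
  shows "weak_partial \<Omega> i (l2_restrict \<Omega> w) (l2_restrict \<Omega> (partial i w))"
    "vanishes_off \<Omega> (l2_restrict \<Omega> w)"
proof -
  have om: "\<Omega> \<in> sets borel" using assms by simp
  have sq: "square_integrable (\<lambda>x. indicator \<Omega> x *\<^sub>R v x)" if "smooth v" for v :: "real^3 \<Rightarrow> real^3"
    by (intro square_integrable_restrict[OF om assms(2)] smooth_continuous that)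
  have off: "vanishes_off \<Omega> (l2_restrict \<Omega> v)" if "smooth v" for v
    unfolding vanishes_off_def l2_restrict_def using rep_abs_l2field[OF sq[OF that]]
    by eventually_elim auto
  show "vanishes_off \<Omega> (l2_restrict \<Omega> w)" by (rule off[OF assms(3)])
  show "weak_partial \<Omega> i (l2_restrict \<Omega> w) (l2_restrict \<Omega> (partial i w))"
    unfolding weak_partial_iff
  proof (intro conjI ballI allI off smooth_partial assms)
    fix \<phi> :: "real^3 \<Rightarrow> real" and e :: "real^3" assume \<phi>: "\<phi> \<in> test_functions \<Omega>"
    note p = test_function_derivative_props[OF \<phi>]
    obtain K where K: "compact K" "K \<subseteq> \<Omega>" "\<And>x. x \<notin> K \<Longrightarrow> \<phi> x = 0"
      using test_function_compact_support[OF \<phi>] by blast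
    have sm: "smooth \<phi>" using \<phi> by (simp add: test_functions_def)
    define g where "g x = \<phi> x * (w x \<bullet> e)" for x
    have dg: "(g has_derivative (\<lambda>h. \<phi> x * (frechet_derivative w (at x) h \<bullet> e) + frechet_derivative \<phi> (at x) h * (w x \<bullet> e))) (at x)" for x
      unfolding g_def
      by (rule has_derivative_mult[OF smooth_has_derivative[OF sm] has_derivative_inner_left[OF smooth_has_derivative[OF assms(3)]]])
    have fg: "frechet_derivative g (at x) (axis i 1) = \<phi> x * (partial i w x \<bullet> e) + partial i \<phi> x * (w x \<bullet> e)" for x
      unfolding partial_def using frechet_derivative_at[OF dg[of x], symmetric] by simp
    have "(\<integral>x. frechet_derivative g (at x) (axis i 1) \<partial>lborel) = 0"
    proof (rule integral_directional_derivative_zero[OF _ _ K(1)])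
      show "g differentiable (at x)" for x using dg by (auto simp: differentiable_def)
      show "continuous_on UNIV (\<lambda>x. frechet_derivative g (at x) (axis i 1))"
        unfolding fg by (intro continuous_intros smooth_continuous smooth_partial sm assms)
      show "g x = 0" if "x \<notin> K" for x using K(3)[OF that] by (simp add: g_def)
    qed
    moreover have "l2_restrict \<Omega> v \<bullet> abs_l2field (\<lambda>x. \<psi> x *\<^sub>R e) = (\<integral>x. \<psi> x * (v x \<bullet> e) \<partial>lborel)
        \<and> integrable lborel (\<lambda>x. \<psi> x * (v x \<bullet> e))"
      if "smooth v" and s: "square_integrable (\<lambda>x. \<psi> x *\<^sub>R e)" and "\<And>x. x \<notin> \<Omega> \<Longrightarrow> \<psi> x = 0" for v \<psi>
    proof -
      have eq: "(\<lambda>x. (indicator \<Omega> x *\<^sub>R v x) \<bullet> (\<psi> x *\<^sub>R e)) = (\<lambda>x. \<psi> x * (v x \<bullet> e))"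
        using that(3) by (auto simp: indicator_def fun_eq_iff)
      show ?thesis
        using square_integrable_inner[OF sq[OF that(1)] s] inner_abs_l2field[OF sq[OF that(1)] s]
        unfolding eq l2_restrict_def by blast
    qed
    ultimately show "l2_restrict \<Omega> w \<bullet> abs_l2field (\<lambda>x. partial i \<phi> x *\<^sub>R e) =
        - (l2_restrict \<Omega> (partial i w) \<bullet> abs_l2field (\<lambda>x. \<phi> x *\<^sub>R e))"
      using p smooth_partial[OF assms(3), of i] assms(3) by (simp add: fg)
  qed
qed

lemma H1_smooth:
  assumes "open \<Omega>" "bounded \<Omega>" "smooth w"
  shows "l2_restrict \<Omega> w \<in> H1 \<Omega>" "weak_grad \<Omega> (l2_restrict \<Omega> w) = (\<chi> i. l2_restrict \<Omega> (partial i w))"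
  using weak_partial_smooth[OF assms] weak_grad_eqI[OF assms(1), of "l2_restrict \<Omega> w" "\<chi> i. l2_restrict \<Omega> (partial i w)"]
  by (auto simp: H1_def)

lemma partial_add:
  "smooth w \<Longrightarrow> smooth v \<Longrightarrow> partial i (\<lambda>x. w x + v x) x = partial i w x + partial i v x"
  unfolding partial_def
  using frechet_derivative_at[OF has_derivative_add[OF smooth_has_derivative[of w x] smooth_has_derivative[of v x]], symmetric]
  by simp

lemma partial_scaleR:
  "smooth w \<Longrightarrow> partial i (\<lambda>x. c *\<^sub>R w x) x = c *\<^sub>R partial i w x"
  unfolding partial_def
  using frechet_derivative_at[OF has_derivative_scaleR_right[OF smooth_has_derivative[of w x], of c], symmetric]
  by simp

lemma smooth_linear_combination:
  "smooth w \<Longrightarrow> smooth v \<Longrightarrow> smooth (\<lambda>x. a *\<^sub>R w x + c *\<^sub>R v x)"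
  by (intro smooth_add smooth_scaleR[OF smooth_const])

lemma divergence_free_linear_combination:
  assumes "smooth w" "smooth v" "divergence_free w" "divergence_free v"
  shows "divergence_free (\<lambda>x. a *\<^sub>R w x + c *\<^sub>R v x)"
proof -
  have "partial i (\<lambda>x. a *\<^sub>R w x + c *\<^sub>R v x) x = a *\<^sub>R partial i w x + c *\<^sub>R partial i v x" for i x
    using assms by (subst partial_add) (auto simp: partial_scaleR intro: smooth_scaleR[OF smooth_const])
  then show ?thesis
    using assms by (simp add: divergence_free_def sum.distrib sum_distrib_left[symmetric])
qed

lemma test_functions_linear_combination:
  fixes w v :: "'a::euclidean_space \<Rightarrow> 'b::real_normed_vector"
  assumes "w \<in> test_functions S" "v \<in> test_functions S"
  shows "(\<lambda>x. a *\<^sub>R w x + c *\<^sub>R v x) \<in> test_functions S"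
proof -
  define K where "K = closure {x. w x \<noteq> 0} \<union> closure {x. v x \<noteq> 0}"
  have K: "compact K" "K \<subseteq> S" using assms by (auto simp: K_def test_functions_def)
  have "{x. a *\<^sub>R w x + c *\<^sub>R v x \<noteq> 0} \<subseteq> {x. w x \<noteq> 0} \<union> {x. v x \<noteq> 0}" by auto
  also have "\<dots> \<subseteq> K" unfolding K_def by (intro Un_mono closure_subset)
  finally have sub: "closure {x. a *\<^sub>R w x + c *\<^sub>R v x \<noteq> 0} \<subseteq> K"
    by (rule closure_minimal[OF _ compact_imp_closed[OF K(1)]])
  then have "K \<inter> closure {x. a *\<^sub>R w x + c *\<^sub>R v x \<noteq> 0} = closure {x. a *\<^sub>R w x + c *\<^sub>R v x \<noteq> 0}" by blast
  with compact_Int_closed[OF K(1) closed_closure[of "{x. a *\<^sub>R w x + c *\<^sub>R v x \<noteq> 0}"]]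
  have "compact (closure {x. a *\<^sub>R w x + c *\<^sub>R v x \<noteq> 0})" by (simp only:)
  moreover have "smooth (\<lambda>x. a *\<^sub>R w x + c *\<^sub>R v x)"
    using assms by (intro smooth_linear_combination) (simp_all add: test_functions_def)
  moreover have "closure {x. a *\<^sub>R w x + c *\<^sub>R v x \<noteq> 0} \<subseteq> S" using sub K(2) by (rule order_trans)
  ultimately show ?thesis by (simp add: test_functions_def)
qed

section \<open>The spaces \<open>H\<close> and \<open>V\<close>\<close>

locale flow = navier_stokes \<Omega> \<V> \<nu> f for \<Omega> \<V> \<nu> f +
  assumes setting: "flow_setting \<Omega> \<V>"
begin

lemma open_domain: "open \<Omega>" and bounded_domain: "bounded \<Omega>"
  using setting by (auto simp: flow_setting_def bounded_box open_box)

lemma domain_measurable [measurable]: "\<Omega> \<in> sets borel"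
  using open_domain by simp

lemma test_fields_smooth: "w \<in> \<V> \<Longrightarrow> smooth w"
proof -
  assume "w \<in> \<V>"
  moreover have "(\<exists>L. \<V> = periodic_fields L) \<or> \<V> = no_slip_fields \<Omega>"
    using setting unfolding flow_setting_def by blast
  ultimately show ?thesis
    by (elim disjE exE) (simp_all add: periodic_fields_def no_slip_fields_def test_functions_def)
qed

lemma test_fields_linear_combination:
  assumes "w \<in> \<V>" "v \<in> \<V>"
  shows "(\<lambda>x. a *\<^sub>R w x + c *\<^sub>R v x) \<in> \<V>"
proof -
  note sm = test_fields_smooth[OF assms(1)] test_fields_smooth[OF assms(2)]
  consider L where "\<V> = periodic_fields L" | "\<V> = no_slip_fields \<Omega>"
    using setting unfolding flow_setting_def by blast
  then show ?thesis
  proof cases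
    case 1
    have i: "set_integrable lborel (box 0 L) (\<lambda>x. c *\<^sub>R w x)" if "smooth w" for c :: real and w :: "real^3 \<Rightarrow> real^3"
      by (intro set_integrable_bounded_continuous continuous_intros smooth_continuous that) (auto intro: bounded_box)
    have "(LINT x:box 0 L|lborel. a *\<^sub>R w x + c *\<^sub>R v x) = 0"
      using assms 1 by (subst set_integral_add[OF i[OF sm(1)] i[OF sm(2)]]) (simp add: periodic_fields_def)
    then show ?thesis
      using assms smooth_linear_combination[OF sm] divergence_free_linear_combination[OF sm] unfolding 1
      by (simp add: periodic_fields_def)
  next
    case 2
    then show ?thesis
      using assms test_functions_linear_combination[of w \<Omega> v] divergence_free_linear_combination[OF sm]
      by (simp add: no_slip_fields_def)
  qed
qed

lemma test_fields_zero: "(\<lambda>x. 0) \<in> \<V>"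
proof -
  have "smooth (\<lambda>x. 0 :: real^3)" by (rule smooth_const)
  moreover have "divergence_free (\<lambda>x. 0)" by (simp add: divergence_free_def partial_def)
  moreover have "(\<exists>L. \<V> = periodic_fields L) \<or> \<V> = no_slip_fields \<Omega>"
    using setting unfolding flow_setting_def by blast
  ultimately show ?thesis
    by (elim disjE exE) (simp_all add: periodic_fields_def no_slip_fields_def test_functions_def)
qed

lemma square_integrable_test_field:
  "w \<in> \<V> \<Longrightarrow> square_integrable (\<lambda>x. indicator \<Omega> x *\<^sub>R w x)"
  by (intro square_integrable_restrict bounded_domain smooth_continuous test_fields_smooth) simp_all

lemma l2_restrict_linear_combination:
  assumes "w \<in> \<V>" "v \<in> \<V>"
  shows "l2_restrict \<Omega> (\<lambda>x. a *\<^sub>R w x + c *\<^sub>R v x) = a *\<^sub>R l2_restrict \<Omega> w + c *\<^sub>R l2_restrict \<Omega> v"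
proof -
  note sq = square_integrable_test_field[OF assms(1)] square_integrable_test_field[OF assms(2)]
  have "a *\<^sub>R l2_restrict \<Omega> w + c *\<^sub>R l2_restrict \<Omega> v
    = abs_l2field (\<lambda>x. a *\<^sub>R (indicator \<Omega> x *\<^sub>R w x) + c *\<^sub>R (indicator \<Omega> x *\<^sub>R v x))"
    unfolding l2_restrict_def
    by (simp only: scaleR_abs_l2field[OF sq(1)] scaleR_abs_l2field[OF sq(2)]
        add_abs_l2field[OF square_integrable_scaleR[OF sq(1)] square_integrable_scaleR[OF sq(2)]])
  also have "\<dots> = l2_restrict \<Omega> (\<lambda>x. a *\<^sub>R w x + c *\<^sub>R v x)"
    unfolding l2_restrict_def by (rule arg_cong[where f=abs_l2field]) (simp add: fun_eq_iff scaleR_add_right mult.commute)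
  finally show ?thesis by simp
qed

lemma test_field_H1: "w \<in> \<V> \<Longrightarrow> l2_restrict \<Omega> w \<in> H1 \<Omega>"
  by (intro H1_smooth open_domain bounded_domain test_fields_smooth)

lemma subspace_test: "subspace (l2_restrict \<Omega> ` \<V>)"
proof (rule subspaceI)
  have "l2_restrict \<Omega> (\<lambda>x. 0) = 0" by (simp add: l2_restrict_def zero_abs_l2field)
  then show "0 \<in> l2_restrict \<Omega> ` \<V>" using test_fields_zero by (metis image_eqI)
next
  fix x y assume "x \<in> l2_restrict \<Omega> ` \<V>" "y \<in> l2_restrict \<Omega> ` \<V>"
  then obtain w v where wv: "w \<in> \<V>" "v \<in> \<V>" "x = l2_restrict \<Omega> w" "y = l2_restrict \<Omega> v" by blast
  have "x + y = l2_restrict \<Omega> (\<lambda>x. 1 *\<^sub>R w x + 1 *\<^sub>R v x)"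
    unfolding wv(3,4) l2_restrict_linear_combination[OF wv(1,2)] by simp
  then show "x + y \<in> l2_restrict \<Omega> ` \<V>" using test_fields_linear_combination[OF wv(1,2)] by blast
next
  fix c x assume "x \<in> l2_restrict \<Omega> ` \<V>"
  then obtain w where w: "w \<in> \<V>" "x = l2_restrict \<Omega> w" by blast
  have "c *\<^sub>R x = l2_restrict \<Omega> (\<lambda>x. c *\<^sub>R w x + 0 *\<^sub>R w x)"
    unfolding w(2) l2_restrict_linear_combination[OF w(1,1)] by simp
  then show "c *\<^sub>R x \<in> l2_restrict \<Omega> ` \<V>" using test_fields_linear_combination[OF w(1,1)] by blast
qed

lemma subspace_H: "subspace H"
  unfolding H_def by (rule subspace_closure[OF subspace_test])

text \<open>The completion in the H1 norm, realised as a closed subspace of the product of L2 with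
  L2^3. This makes Hilbert space arguments available for pairs of a field and its gradient.\<close>

definition graph :: "(l2field \<times> (l2field^3)) set" where
  "graph = closure ((\<lambda>u. (u, weak_grad \<Omega> u)) ` l2_restrict \<Omega> ` \<V>)"

text \<open>Limits of test fields stay in \<open>H1\<close> since the weak gradient is a closed
  operator; conversely the quantity made small in the definition of \<open>V\<close> is exactly the
  product distance between pairs.\<close>

lemma graph_iff: "(u, p) \<in> graph \<longleftrightarrow> u \<in> V \<and> weak_grad \<Omega> u = p"
proof -
  have *: "u \<in> H1 \<Omega> \<and> weak_grad \<Omega> u = p" if "(u, p) \<in> graph" for u p
  proof -
    obtain s where s: "\<And>n. s n \<in> (\<lambda>u. (u, weak_grad \<Omega> u)) ` l2_restrict \<Omega> ` \<V>" "s \<longlonglongrightarrow> (u, p)"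
      using \<open>(u, p) \<in> graph\<close> unfolding graph_def closure_sequential by blast
    have "(\<lambda>n. fst (s n)) \<longlonglongrightarrow> u" "(\<lambda>n. snd (s n)) \<longlonglongrightarrow> p"
      using tendsto_fst[OF s(2)] tendsto_snd[OF s(2)] by simp_all
    moreover have "snd (s n) = weak_grad \<Omega> (fst (s n))" "fst (s n) \<in> H1 \<Omega>" for n
      using s(1)[of n] test_field_H1 by auto
    ultimately show ?thesis using H1_closed[OF open_domain, of "\<lambda>n. fst (s n)"] by simp
  qed
  have V: "u \<in> V \<longleftrightarrow> u \<in> H1 \<Omega> \<and> (u, weak_grad \<Omega> u) \<in> graph" for u
  proof -
    have "sqrt ((norm (u - l2_restrict \<Omega> w))\<^sup>2 + (norm (weak_grad \<Omega> (u - l2_restrict \<Omega> w)))\<^sup>2)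
        = dist (l2_restrict \<Omega> w, weak_grad \<Omega> (l2_restrict \<Omega> w)) (u, weak_grad \<Omega> u)"
      if "u \<in> H1 \<Omega>" "w \<in> \<V>" for w
    proof -
      have "weak_grad \<Omega> (u + (-1) *\<^sub>R l2_restrict \<Omega> w) = weak_grad \<Omega> u + (-1) *\<^sub>R weak_grad \<Omega> (l2_restrict \<Omega> w)"
        using H1_add(2)[OF open_domain that(1) H1_scaleR(1)[OF open_domain test_field_H1[OF that(2)], of "-1"]]
          H1_scaleR(2)[OF open_domain test_field_H1[OF that(2)], of "-1"] by simp
      then show ?thesis by (simp add: dist_norm norm_Pair norm_minus_commute)
    qed
    then show ?thesis
      unfolding V_def graph_def closure_approachable by (auto 0 3 simp: Bex_def)
  qed
  show ?thesis using * V by blast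
qed

lemma subspace_graph: "subspace graph"
  unfolding graph_def
proof (rule subspace_closure, rule subspaceI)
  let ?g = "\<lambda>u. (u, weak_grad \<Omega> u)" and ?T = "l2_restrict \<Omega> ` \<V>"
  have T: "u \<in> H1 \<Omega>" if "u \<in> ?T" for u using that test_field_H1 by auto
  have sc: "?g (c *\<^sub>R x) = c *\<^sub>R ?g x" if "x \<in> ?T" for c x
    using H1_scaleR[OF open_domain T[OF that]] by simp
  show "0 \<in> ?g ` ?T"
  proof (rule image_eqI)
    show "0 \<in> ?T" by (rule subspace_0[OF subspace_test])
    from sc[OF this, of 0] have "weak_grad \<Omega> 0 = 0" by simp
    then show "0 = ?g 0" by (simp add: zero_prod_def)
  qed
  show "x + y \<in> ?g ` ?T" if "x \<in> ?g ` ?T" "y \<in> ?g ` ?T" for x y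
  proof -
    from that(1) obtain a where a: "x = ?g a" "a \<in> ?T" by (rule imageE)
    from that(2) obtain b where b: "y = ?g b" "b \<in> ?T" by (rule imageE)
    have "x + y = ?g (a + b)" using a(1) b(1) H1_add[OF open_domain T[OF a(2)] T[OF b(2)]] by simp
    then show ?thesis by (rule image_eqI) (rule subspace_add[OF subspace_test a(2) b(2)])
  qed
  show "c *\<^sub>R x \<in> ?g ` ?T" if "x \<in> ?g ` ?T" for c x
  proof -
    from that obtain a where a: "x = ?g a" "a \<in> ?T" by (rule imageE)
    have "c *\<^sub>R x = ?g (c *\<^sub>R a)" using a(1) sc[OF a(2), of c] by simp
    then show ?thesis by (rule image_eqI) (rule subspace_scale[OF subspace_test a(2)])
  qed
qed

lemma closed_graph: "closed graph" by (simp add: graph_def)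

lemma V_add: "u \<in> V \<Longrightarrow> v \<in> V \<Longrightarrow> u + v \<in> V \<and> weak_grad \<Omega> (u + v) = weak_grad \<Omega> u + weak_grad \<Omega> v"
  using subspace_add[OF subspace_graph, of "(u, weak_grad \<Omega> u)" "(v, weak_grad \<Omega> v)"] by (simp add: graph_iff)

lemma V_scaleR: "u \<in> V \<Longrightarrow> c *\<^sub>R u \<in> V \<and> weak_grad \<Omega> (c *\<^sub>R u) = c *\<^sub>R weak_grad \<Omega> u"
  using subspace_scale[OF subspace_graph, of "(u, weak_grad \<Omega> u)" c] by (simp add: graph_iff)

lemma V_zero: "0 \<in> V \<and> weak_grad \<Omega> 0 = 0"
  using subspace_0[OF subspace_graph] by (simp add: graph_iff zero_prod_def)

lemma subspace_V: "subspace V"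
  using V_add V_scaleR V_zero by (auto simp: subspace_def)

lemma V_subset_H: "V \<subseteq> H"
proof
  fix u assume "u \<in> V"
  then have "(u, weak_grad \<Omega> u) \<in> graph" by (simp add: graph_iff)
  then obtain s where s: "\<And>n. s n \<in> (\<lambda>u. (u, weak_grad \<Omega> u)) ` l2_restrict \<Omega> ` \<V>" "s \<longlonglongrightarrow> (u, weak_grad \<Omega> u)"
    unfolding graph_def closure_sequential by blast
  have "(\<lambda>n. fst (s n)) \<longlonglongrightarrow> u" using tendsto_fst[OF s(2)] by simp
  moreover have "fst (s n) \<in> l2_restrict \<Omega> ` \<V>" for n using s(1)[of n] by auto
  ultimately show "u \<in> H" unfolding H_def closure_sequential by (intro exI[of _ "\<lambda>n. fst (s n)"]) auto
qed

text \<open>The gradient on \<open>V\<close> is an unbounded operator with closed graph, so that preimages of balls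
  are closed by weak compactness; this makes it a Borel map on \<open>V\<close>.\<close>

lemma closed_grad_preimage:
  assumes "closed K" "convex K" "bounded K"
  shows "closed {u \<in> V. weak_grad \<Omega> u \<in> K}"
  unfolding closed_sequential_limits
proof (intro allI impI, elim conjE)
  fix U u assume U: "\<forall>n. U n \<in> {u \<in> V. weak_grad \<Omega> u \<in> K}" and lim: "U \<longlonglongrightarrow> u"
  \<comment> \<open>The balls around \<open>u\<close> shrink, so a common point of all these sets
    must be a pair with first entry \<open>u\<close>; its second entry is then the gradient of
    \<open>u\<close> and lies in \<open>K\<close>.\<close>
  define C where "C n = graph \<inter> (cball u (1 / real (Suc n)) \<times> K)" for n
  have "(\<Inter>n. C n) \<noteq> {}"
  proof (rule nested_closed_convex)
    show "closed (C n)" for n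
      unfolding C_def using assms by (intro closed_Int closed_graph closed_Times) auto
    show "convex (C n)" for n
      unfolding C_def by (intro convex_Int subspace_imp_convex[OF subspace_graph] convex_Times convex_cball assms)
    show "C n \<noteq> {}" for n
    proof -
      obtain m where "dist (U m) u < 1 / real (Suc n)"
        using lim unfolding lim_sequentially by (metis order_refl of_nat_0_less_iff zero_less_Suc zero_less_divide_1_iff)
      then have "(U m, weak_grad \<Omega> (U m)) \<in> C n"
        using U by (auto simp: C_def graph_iff dist_commute)
      then show ?thesis by blast
    qed
    have "cball u (1 / real (Suc (Suc n))) \<subseteq> cball u (1 / real (Suc n))" for n
      by (rule subset_cball) (simp add: frac_le)
    then show "C (Suc n) \<subseteq> C n" for n unfolding C_def by blast
    show "bounded (C 0)"
      unfolding C_def using assms by (intro bounded_Int disjI2 bounded_Times) auto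
  qed
  then obtain v p where vp: "\<And>n. (v, p) \<in> C n" by auto
  have "dist u v \<le> 1 / real (Suc n)" for n using vp[of n] by (auto simp: C_def)
  moreover have "(\<lambda>n. 1 / real (Suc n)) \<longlonglongrightarrow> 0" by real_asymp
  ultimately have "dist u v \<le> 0" by (intro LIMSEQ_le_const) auto
  then have "v = u" by simp
  then show "u \<in> {u \<in> V. weak_grad \<Omega> u \<in> K}" using vp[of 0] by (auto simp: C_def graph_iff)
qed

text \<open>Intersecting with balls of integer radius reduces to the bounded case, at the price of a
  countable union: the preimage is still Borel but no longer known to be closed.\<close>

lemma grad_preimage_borel:
  assumes "closed K" "convex K"
  shows "{u \<in> V. weak_grad \<Omega> u \<in> K} \<in> sets borel"
proof -
  have "{u \<in> V. weak_grad \<Omega> u \<in> K} = (\<Union>n::nat. {u \<in> V. weak_grad \<Omega> u \<in> K \<inter> cball 0 (real n)})"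
    using real_arch_simple by auto
  also have "\<dots> \<in> sets borel"
    using assms by (intro sets.countable_UN borel_closed closed_grad_preimage image_subsetI closed_Int convex_Int bounded_Int) auto
  finally show ?thesis .
qed

lemma V_borel [measurable]: "V \<in> sets borel"
  using grad_preimage_borel[of UNIV] by simp

text \<open>Half-spaces are closed and convex, so each inner product with a component of the
  gradient is Borel, and weak measurability is enough in a separable space.\<close>

lemma grad_borel [measurable]: "(\<lambda>u. weak_grad \<Omega> u $ i) \<in> borel_measurable (restrict_space borel V)"
proof (rule borel_measurable_weakI[OF subspace_UNIV])
  fix v
  show "(\<lambda>u. weak_grad \<Omega> u $ i \<bullet> v) \<in> borel_measurable (restrict_space borel V)"
  proof (rule borel_measurableI_le)
    fix r :: real
    have "closed {p :: l2field^3. p $ i \<bullet> v \<le> r}"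
      by (intro closed_Collect_le continuous_intros)
    moreover have "convex {p :: l2field^3. p $ i \<bullet> v \<le> r}"
    proof (rule convexI)
      fix x y :: "l2field^3" and a b :: real
      assume xy: "x \<in> {p. p $ i \<bullet> v \<le> r}" "y \<in> {p. p $ i \<bullet> v \<le> r}" and ab: "0 \<le> a" "0 \<le> b" "a + b = 1"
      have "a * (x $ i \<bullet> v) + b * (y $ i \<bullet> v) \<le> a * r + b * r"
        using xy ab by (intro add_mono mult_left_mono) auto
      also have "\<dots> = r" using ab by (simp add: distrib_right[symmetric])
      finally show "a *\<^sub>R x + b *\<^sub>R y \<in> {p. p $ i \<bullet> v \<le> r}" by (simp add: inner_add_left)
    qed
    ultimately have "{u \<in> V. weak_grad \<Omega> u \<in> {p. p $ i \<bullet> v \<le> r}} \<in> sets borel"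
      by (rule grad_preimage_borel)
    then show "{u \<in> space (restrict_space borel V). weak_grad \<Omega> u $ i \<bullet> v \<le> r} \<in> sets (restrict_space borel V)"
      by (subst sets_restrict_space_iff) (auto simp: space_restrict_space Int_def conj_commute)
  qed
qed simp

lemma V_norm_sq_eq: "u \<in> V \<Longrightarrow> V_norm_sq u = ennreal (\<Sum>i\<in>UNIV. (norm (weak_grad \<Omega> u $ i))\<^sup>2)"
  by (simp add: V_norm_sq_def V_norm_def V_inner_def inner_vec_def power2_norm_eq_inner sum_nonneg)

lemma V_norm_sq_borel [measurable]: "V_norm_sq \<in> borel_measurable borel"
proof -
  have "(\<lambda>u. ennreal (\<Sum>i\<in>UNIV. (norm (weak_grad \<Omega> u $ i))\<^sup>2)) \<in> borel_measurable (restrict_space borel V)"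
    by measurable
  then have "(\<lambda>u. if u \<in> V then ennreal (\<Sum>i\<in>UNIV. (norm (weak_grad \<Omega> u $ i))\<^sup>2) else \<infinity>) \<in> borel_measurable borel"
    by (intro measurable_If_restrict_space_iff[THEN iffD2]) auto
  moreover have "V_norm_sq = (\<lambda>u. if u \<in> V then ennreal (\<Sum>i\<in>UNIV. (norm (weak_grad \<Omega> u $ i))\<^sup>2) else \<infinity>)"
    by (rule ext) (auto simp: V_norm_sq_eq, simp add: V_norm_sq_def)
  ultimately show ?thesis by simp
qed

end

section \<open>A Ladyzhenskaya inequality\<close>

definition vec3 :: "real \<Rightarrow> real \<Rightarrow> real \<Rightarrow> real^3" where
  "vec3 x y z = x *\<^sub>R axis 1 1 + y *\<^sub>R axis 2 1 + z *\<^sub>R axis 3 1"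

lemma vec3_nth [simp]: "vec3 x y z $ 1 = x" "vec3 x y z $ 2 = y" "vec3 x y z $ 3 = z"
  by (simp_all add: vec3_def axis_def)

lemma vec3_measurable [measurable (raw)]:
  assumes [measurable]: "X \<in> borel_measurable M" "Y \<in> borel_measurable M" "Z \<in> borel_measurable M"
  shows "(\<lambda>\<omega>. vec3 (X \<omega>) (Y \<omega>) (Z \<omega>)) \<in> borel_measurable M"
  unfolding vec3_def by measurable

lemma Basis_real3: "(Basis :: (real^3) set) = {axis 1 1, axis 2 1, axis 3 1}"
  by (auto simp: Basis_vec_def UNIV_3)

text \<open>The image of the product measure under \<open>vec3\<close> agrees with Lebesgue measure
  on boxes. The variable \<open>z\<close> is outermost because the estimates below are made plane by
  plane.\<close>

lemma nn_integral_lborel_vec3: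
  assumes [measurable]: "f \<in> borel_measurable borel"
  shows "(\<integral>\<^sup>+p. f p \<partial>lborel) = (\<integral>\<^sup>+z. \<integral>\<^sup>+y. \<integral>\<^sup>+x. f (vec3 x y z) \<partial>lborel \<partial>lborel \<partial>lborel)"
proof -
  let ?L = "lborel :: real measure"
  let ?P = "?L \<Otimes>\<^sub>M (?L \<Otimes>\<^sub>M ?L)"
  define J where "J = (\<lambda>(z, y, x). vec3 x y z)"
  have sf: "sigma_finite_measure (?L \<Otimes>\<^sub>M ?L)" unfolding lborel_prod by (rule sigma_finite_lborel)
  have J [measurable]: "J \<in> borel_measurable ?P"
    unfolding J_def by measurable
  have "lborel = distr ?P borel J"
  proof (rule lborel_eqI)
    fix l u :: "real^3" assume lu: "\<And>b. b \<in> Basis \<Longrightarrow> l \<bullet> b \<le> u \<bullet> b"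
    have le: "l $ i \<le> u $ i" for i
      using lu[of "axis i 1"] by (simp add: inner_axis)
    have "J -` box l u \<inter> space ?P = {l $ 3 <..< u $ 3} \<times> ({l $ 2 <..< u $ 2} \<times> {l $ 1 <..< u $ 1})"
      by (auto simp: J_def mem_box_cart forall_3 space_pair_measure)
    then have "emeasure (distr ?P borel J) (box l u) = emeasure ?P ({l $ 3 <..< u $ 3} \<times> ({l $ 2 <..< u $ 2} \<times> {l $ 1 <..< u $ 1}))"
      by (simp add: emeasure_distr)
    also have "\<dots> = ennreal (u $ 3 - l $ 3) * (ennreal (u $ 2 - l $ 2) * ennreal (u $ 1 - l $ 1))"
      using le by (subst sigma_finite_measure.emeasure_pair_measure_Times[OF sf]) (auto simp: lborel.emeasure_pair_measure_Times)
    also have "\<dots> = ennreal (\<Prod>b\<in>Basis. (u - l) \<bullet> b)"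
    proof -
      have "(\<Prod>b\<in>Basis. (u - l) \<bullet> b) = (u $ 3 - l $ 3) * ((u $ 2 - l $ 2) * (u $ 1 - l $ 1))"
        by (simp add: Basis_real3 axis_eq_axis inner_axis)
      then show ?thesis using le by (simp add: ennreal_mult)
    qed
    finally show "emeasure (distr ?P borel J) (box l u) = ennreal (\<Prod>b\<in>Basis. (u - l) \<bullet> b)" .
  qed simp
  then have "(\<integral>\<^sup>+p. f p \<partial>lborel) = (\<integral>\<^sup>+p. f p \<partial>distr ?P borel J)"
    by (rule arg_cong)
  also have "\<dots> = (\<integral>\<^sup>+p. f (J p) \<partial>?P)"
    by (rule nn_integral_distr) measurable
  also have "\<dots> = (\<integral>\<^sup>+z. \<integral>\<^sup>+p. f (J (z, p)) \<partial>(?L \<Otimes>\<^sub>M ?L) \<partial>?L)"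
    by (rule sigma_finite_measure.nn_integral_fst[OF sf, symmetric]) measurable
  also have "\<dots> = (\<integral>\<^sup>+z. \<integral>\<^sup>+y. \<integral>\<^sup>+x. f (J (z, y, x)) \<partial>lborel \<partial>lborel \<partial>lborel)"
    by (intro nn_integral_cong lborel.nn_integral_fst[symmetric]) measurable
  finally show ?thesis by (simp add: J_def)
qed

text \<open>In a plane of constant z one factor q^2 is bounded by an integral along x and the other
  by one along y; the product separates and gives \<open>C\<^sup>2 * (R z)\<^sup>2\<close>. The
  third direction bounds the planar integrals of q^2 by \<open>C * S\<close> uniformly in z, and
  Cauchy-Schwarz yields (R z)^2 <= C S T(z), which is integrable in z. The intended q is |w|, and
  t^2 is |w|^2 plus the squared gradient.\<close>

lemma ladyzhenskaya_slices:
  fixes q t :: "real^3 \<Rightarrow> ennreal"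
  assumes [measurable]: "q \<in> borel_measurable borel" "t \<in> borel_measurable borel" and qt: "\<And>p. q p \<le> t p"
    and s1: "\<And>x y z. (q (vec3 x y z))\<^sup>2 \<le> C * (\<integral>\<^sup>+s. q (vec3 s y z) * t (vec3 s y z) \<partial>lborel)"
    and s2: "\<And>x y z. (q (vec3 x y z))\<^sup>2 \<le> C * (\<integral>\<^sup>+s. q (vec3 x s z) * t (vec3 x s z) \<partial>lborel)"
    and s3: "\<And>x y z. (q (vec3 x y z))\<^sup>2 \<le> C * (\<integral>\<^sup>+s. q (vec3 x y s) * t (vec3 x y s) \<partial>lborel)"
  shows "(\<integral>\<^sup>+p. (q p)^4 \<partial>lborel) \<le> C^3 * (\<integral>\<^sup>+p. (t p)\<^sup>2 \<partial>lborel)\<^sup>2"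
proof -
  define S where "S = (\<integral>\<^sup>+p. (t p)\<^sup>2 \<partial>lborel)"
  define T where "T z = (\<integral>\<^sup>+y. \<integral>\<^sup>+x. (t (vec3 x y z))\<^sup>2 \<partial>lborel \<partial>lborel)" for z
  define R where "R z = (\<integral>\<^sup>+y. \<integral>\<^sup>+x. q (vec3 x y z) * t (vec3 x y z) \<partial>lborel \<partial>lborel)" for z
  have S: "S = (\<integral>\<^sup>+z. T z \<partial>lborel)"
    unfolding S_def T_def by (rule nn_integral_lborel_vec3) measurable
  have swap: "(\<integral>\<^sup>+y. \<integral>\<^sup>+x. \<integral>\<^sup>+s. q (vec3 x y s) * t (vec3 x y s) \<partial>lborel \<partial>lborel \<partial>lborel) = (\<integral>\<^sup>+s. R s \<partial>lborel)"
  proof -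
    have "(\<integral>\<^sup>+y. \<integral>\<^sup>+x. \<integral>\<^sup>+s. q (vec3 x y s) * t (vec3 x y s) \<partial>lborel \<partial>lborel \<partial>lborel)
      = (\<integral>\<^sup>+y. \<integral>\<^sup>+s. \<integral>\<^sup>+x. q (vec3 x y s) * t (vec3 x y s) \<partial>lborel \<partial>lborel \<partial>lborel)"
      by (intro nn_integral_cong lborel_pair.Fubini') measurable
    also have "\<dots> = (\<integral>\<^sup>+s. R s \<partial>lborel)"
      unfolding R_def by (intro lborel_pair.Fubini') measurable
    finally show ?thesis .
  qed
  have RS: "(\<integral>\<^sup>+s. R s \<partial>lborel) \<le> S"
    unfolding S R_def T_def power2_eq_square
    by (intro nn_integral_mono mult_right_mono qt) simp
  have slice: "(\<integral>\<^sup>+y. \<integral>\<^sup>+x. (q (vec3 x y z))\<^sup>2 \<partial>lborel \<partial>lborel) \<le> C * S" for z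
  proof -
    have "(\<integral>\<^sup>+y. \<integral>\<^sup>+x. (q (vec3 x y z))\<^sup>2 \<partial>lborel \<partial>lborel)
      \<le> (\<integral>\<^sup>+y. \<integral>\<^sup>+x. C * (\<integral>\<^sup>+s. q (vec3 x y s) * t (vec3 x y s) \<partial>lborel) \<partial>lborel \<partial>lborel)"
      by (intro nn_integral_mono s3)
    also have "\<dots> = C * (\<integral>\<^sup>+y. \<integral>\<^sup>+x. \<integral>\<^sup>+s. q (vec3 x y s) * t (vec3 x y s) \<partial>lborel \<partial>lborel \<partial>lborel)"
      by (simp add: nn_integral_cmult)
    also have "\<dots> \<le> C * S" unfolding swap by (intro mult_left_mono RS) simp
    finally show ?thesis .
  qed
  have R2: "(R z)\<^sup>2 \<le> (C * S) * T z" for z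
  proof -
    let ?P = "lborel \<Otimes>\<^sub>M lborel :: (real \<times> real) measure"
    have "(R z)\<^sup>2 = (\<integral>\<^sup>+p. q (vec3 (snd p) (fst p) z) * t (vec3 (snd p) (fst p) z) \<partial>?P)\<^sup>2"
      unfolding R_def by (subst lborel.nn_integral_fst[symmetric]) simp_all
    also have "\<dots> \<le> (\<integral>\<^sup>+p. (q (vec3 (snd p) (fst p) z))\<^sup>2 \<partial>?P) * (\<integral>\<^sup>+p. (t (vec3 (snd p) (fst p) z))\<^sup>2 \<partial>?P)"
      by (rule Cauchy_Schwarz_nn_integral) measurable
    also have "(\<integral>\<^sup>+p. (q (vec3 (snd p) (fst p) z))\<^sup>2 \<partial>?P) = (\<integral>\<^sup>+y. \<integral>\<^sup>+x. (q (vec3 x y z))\<^sup>2 \<partial>lborel \<partial>lborel)"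
      by (subst lborel.nn_integral_fst[symmetric]) simp_all
    also have "(\<integral>\<^sup>+p. (t (vec3 (snd p) (fst p) z))\<^sup>2 \<partial>?P) = T z"
      unfolding T_def by (subst lborel.nn_integral_fst[symmetric]) simp_all
    also have "(\<integral>\<^sup>+y. \<integral>\<^sup>+x. (q (vec3 x y z))\<^sup>2 \<partial>lborel \<partial>lborel) * T z \<le> (C * S) * T z"
      by (intro mult_right_mono slice) simp
    finally show ?thesis .
  qed
  have plane: "(\<integral>\<^sup>+y. \<integral>\<^sup>+x. (q (vec3 x y z))^4 \<partial>lborel \<partial>lborel) \<le> C\<^sup>2 * (R z)\<^sup>2" for z
  proof -
    have "(\<integral>\<^sup>+y. \<integral>\<^sup>+x. (q (vec3 x y z))^4 \<partial>lborel \<partial>lborel)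
      \<le> (\<integral>\<^sup>+y. \<integral>\<^sup>+x. (C * (\<integral>\<^sup>+s. q (vec3 s y z) * t (vec3 s y z) \<partial>lborel)) *
          (C * (\<integral>\<^sup>+s. q (vec3 x s z) * t (vec3 x s z) \<partial>lborel)) \<partial>lborel \<partial>lborel)"
    proof (intro nn_integral_mono)
      fix x y
      have "(q (vec3 x y z))^4 = (q (vec3 x y z))\<^sup>2 * (q (vec3 x y z))\<^sup>2"
        by (simp add: power_add[symmetric])
      also have "\<dots> \<le> (C * (\<integral>\<^sup>+s. q (vec3 s y z) * t (vec3 s y z) \<partial>lborel)) *
          (C * (\<integral>\<^sup>+s. q (vec3 x s z) * t (vec3 x s z) \<partial>lborel))"
        by (intro mult_mono s1 s2) simp_all
      finally show "(q (vec3 x y z))^4 \<le> (C * (\<integral>\<^sup>+s. q (vec3 s y z) * t (vec3 s y z) \<partial>lborel)) *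
          (C * (\<integral>\<^sup>+s. q (vec3 x s z) * t (vec3 x s z) \<partial>lborel))" .
    qed
    also have "\<dots> = (C * R z) * (C * (\<integral>\<^sup>+x. \<integral>\<^sup>+s. q (vec3 x s z) * t (vec3 x s z) \<partial>lborel \<partial>lborel))"
      unfolding R_def by (simp add: nn_integral_cmult nn_integral_multc)
    also have "(\<integral>\<^sup>+x. \<integral>\<^sup>+s. q (vec3 x s z) * t (vec3 x s z) \<partial>lborel \<partial>lborel) = R z"
      unfolding R_def by (rule lborel_pair.Fubini') measurable
    finally show ?thesis by (simp add: power2_eq_square algebra_simps)
  qed
  have "(\<integral>\<^sup>+p. (q p)^4 \<partial>lborel) = (\<integral>\<^sup>+z. \<integral>\<^sup>+y. \<integral>\<^sup>+x. (q (vec3 x y z))^4 \<partial>lborel \<partial>lborel \<partial>lborel)"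
    by (rule nn_integral_lborel_vec3) measurable
  also have "\<dots> \<le> (\<integral>\<^sup>+z. (C\<^sup>2 * (C * S)) * T z \<partial>lborel)"
  proof (rule nn_integral_mono)
    fix z
    have "C\<^sup>2 * (R z)\<^sup>2 \<le> C\<^sup>2 * ((C * S) * T z)" by (intro mult_left_mono R2) simp
    with plane[of z] show "(\<integral>\<^sup>+y. \<integral>\<^sup>+x. (q (vec3 x y z))^4 \<partial>lborel \<partial>lborel) \<le> (C\<^sup>2 * (C * S)) * T z"
      by (simp add: mult.assoc)
  qed
  also have "\<dots> = (C\<^sup>2 * (C * S)) * S"
    unfolding S by (rule nn_integral_cmult) (simp add: T_def)
  also have "\<dots> = C^3 * S\<^sup>2" by (simp add: power2_eq_square power3_eq_cube algebra_simps)
  finally show ?thesis by (simp add: S_def)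
qed

text \<open>The minimum over the interval is at most the mean, and the integral of the derivative
  bounds the rise above the minimum. No boundary values enter, so the bound serves periodic fields
  as well as compactly supported ones.\<close>

lemma pointwise_bound_by_integral:
  fixes \<phi> :: "real \<Rightarrow> real"
  assumes ab: "a < b" and d: "\<And>s. (\<phi> has_real_derivative \<phi>' s) (at s)" and c: "continuous_on UNIV \<phi>'"
    and nn: "\<And>s. 0 \<le> \<phi> s" and s: "a \<le> s" "s \<le> b"
  shows "ennreal (\<phi> s) \<le> (\<integral>\<^sup>+r. ennreal ((\<phi> r / (b - a) + \<bar>\<phi>' r\<bar>) * indicator {a<..<b} r) \<partial>lborel)"
proof -
  have c\<phi>: "continuous_on UNIV \<phi>" using d by (auto intro!: continuous_at_imp_continuous_on DERIV_isCont)
  have cs: "isCont \<phi> s" "isCont \<phi>' s" "isCont (\<lambda>s. \<bar>\<phi>' s\<bar>) s" for s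
    using c c\<phi> by (auto simp: continuous_on_eq_continuous_at intro: continuous_intros)
  obtain m where m: "m \<in> {a..b}" "\<And>r. r \<in> {a..b} \<Longrightarrow> \<phi> m \<le> \<phi> r"
    using continuous_attains_inf[of "{a..b}" \<phi>] ab continuous_on_subset[OF c\<phi>] by auto
  define A where "A = (LBINT r. \<phi> r * indicator {a..b} r)"
  define B where "B = (LBINT r. \<bar>\<phi>' r\<bar> * indicator {a..b} r)"
  have iA: "integrable lborel (\<lambda>r. \<phi> r * indicator {a..b} r)"
    and iB: "integrable lborel (\<lambda>r. \<bar>\<phi>' r\<bar> * indicator {a..b} r)"
    by (intro borel_integrable_atLeastAtMost cs)+
  have "\<phi> m * (b - a) = (LBINT r. \<phi> m * indicator {a..b} r)" using ab by simp
  also have "\<dots> \<le> A"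
    unfolding A_def
  proof (rule integral_mono[OF _ iA])
    show "integrable lborel (\<lambda>r. \<phi> m * indicator {a..b} r)"
      by (intro integrable_mult_right integrable_real_indicator) (use ab in auto)
    show "\<phi> m * indicator {a..b} r \<le> \<phi> r * indicator {a..b} r" for r
      using m(2)[of r] by (auto simp: indicator_def)
  qed
  finally have mA: "\<phi> m \<le> A / (b - a)" using ab by (simp add: pos_le_divide_eq)
  have "\<phi> s - \<phi> m \<le> B"
  proof -
    have *: "\<bar>\<phi> v - \<phi> u\<bar> \<le> B" if "a \<le> u" "u \<le> v" "v \<le> b" for u v
    proof -
      have iu: "integrable lborel (\<lambda>r. \<phi>' r * indicator {u..v} r)"
        by (intro borel_integrable_atLeastAtMost cs)
      have "\<phi> v - \<phi> u = (LBINT r. \<phi>' r * indicator {u..v} r)"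
        by (rule integral_FTC_Icc_real[symmetric]) (use that d cs in auto)
      also have "\<bar>\<dots>\<bar> \<le> (LBINT r. \<bar>\<phi>' r * indicator {u..v} r\<bar>)" by (rule integral_abs_bound)
      also have "\<dots> \<le> B"
        unfolding B_def using that iu iB by (intro integral_mono integrable_abs) (auto simp: indicator_def)
      finally show ?thesis .
    qed
    show ?thesis
      using *[of m s] *[of s m] m(1) s by (cases "m \<le> s") auto
  qed
  then have "\<phi> s \<le> A / (b - a) + B" using mA by linarith
  also have "\<dots> = (LBINT r. (\<phi> r / (b - a) + \<bar>\<phi>' r\<bar>) * indicator {a..b} r)"
    unfolding A_def B_def using iA iB
    by (subst Bochner_Integration.integral_divide_zero[symmetric], subst Bochner_Integration.integral_add[symmetric])
       (auto simp: algebra_simps intro!: Bochner_Integration.integral_cong)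
  finally have le: "\<phi> s \<le> (LBINT r. (\<phi> r / (b - a) + \<bar>\<phi>' r\<bar>) * indicator {a..b} r)" .
  have "integrable lborel (\<lambda>r. (\<phi> r / (b - a) + \<bar>\<phi>' r\<bar>) * indicator {a..b} r)"
    by (intro borel_integrable_atLeastAtMost continuous_intros cs) (use ab in auto)
  then have "ennreal (LBINT r. (\<phi> r / (b - a) + \<bar>\<phi>' r\<bar>) * indicator {a..b} r)
    = (\<integral>\<^sup>+r. ennreal ((\<phi> r / (b - a) + \<bar>\<phi>' r\<bar>) * indicator {a..b} r) \<partial>lborel)"
    using nn ab by (intro nn_integral_eq_integral[symmetric]) (auto simp: indicator_def)
  also have "\<dots> = (\<integral>\<^sup>+r. ennreal ((\<phi> r / (b - a) + \<bar>\<phi>' r\<bar>) * indicator {a<..<b} r) \<partial>lborel)"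
  proof (rule nn_integral_cong_AE)
    have "AE r in lborel. r \<noteq> a" "AE r in lborel. r \<noteq> b" by (rule AE_lborel_singleton)+
    then show "AE r in lborel. ennreal ((\<phi> r / (b - a) + \<bar>\<phi>' r\<bar>) * indicator {a..b} r) =
        ennreal ((\<phi> r / (b - a) + \<bar>\<phi>' r\<bar>) * indicator {a<..<b} r)"
      by eventually_elim (auto simp: indicator_def)
  qed
  finally show ?thesis using le ennreal_leI by metis
qed

definition grad_norm_sq :: "(real^3 \<Rightarrow> real^3) \<Rightarrow> real^3 \<Rightarrow> real" where
  "grad_norm_sq w p = (norm (w p))\<^sup>2 + (\<Sum>i\<in>UNIV. (norm (partial i w p))\<^sup>2)"

text \<open>The derivative of |w|^2 along a line is at most 2 |w| times the root of
  \<open>grad_norm_sq\<close>, and the mean term contributes the factor 1/(b - a); their sum is the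
  lower bound imposed on \<open>C\<close>.\<close>

lemma smooth_line_bound:
  fixes w :: "real^3 \<Rightarrow> real^3"
  assumes w: "smooth w" and l: "a < b" "1 / (b - a) + 2 \<le> C" and s: "a \<le> s" "s \<le> b"
  shows "ennreal ((norm (w (c + s *\<^sub>R axis i 1)))\<^sup>2) \<le>
    ennreal C * (\<integral>\<^sup>+r. ennreal (norm (w (c + r *\<^sub>R axis i 1)) * sqrt (grad_norm_sq w (c + r *\<^sub>R axis i 1)) * indicator {a<..<b} r) \<partial>lborel)"
proof -
  define P where "P r = c + r *\<^sub>R axis i (1::real)" for r
  define \<phi> where "\<phi> r = (norm (w (P r)))\<^sup>2" for r
  define \<phi>' where "\<phi>' r = 2 * (w (P r) \<bullet> partial i w (P r))" for r
  have Pc: "continuous_on UNIV P" unfolding P_def by (intro continuous_intros)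
  have wc: "continuous_on UNIV (\<lambda>r. w (P r))" "continuous_on UNIV (\<lambda>r. partial i w (P r))" for i
    by (rule continuous_on_compose2[OF smooth_continuous[OF w, of UNIV] Pc], simp)
       (rule continuous_on_compose2[OF smooth_continuous[OF smooth_partial[OF w], of UNIV] Pc], simp)
  have hd: "((\<lambda>r. w (P r)) has_derivative (\<lambda>h. h *\<^sub>R partial i w (P r))) (at r)" for r
  proof -
    have "(P has_derivative (\<lambda>h. h *\<^sub>R axis i 1)) (at r)"
      unfolding P_def by (auto intro!: derivative_eq_intros)
    from has_derivative_compose[OF this smooth_has_derivative[OF w]]
    have "((\<lambda>r. w (P r)) has_derivative (\<lambda>h. frechet_derivative w (at (P r)) (h *\<^sub>R axis i 1))) (at r)" .
    then show ?thesis
      using linear_scale[OF has_derivative_linear[OF smooth_has_derivative[OF w, of "P r"]], of _ "axis i 1"]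
      by (simp add: partial_def)
  qed
  have d: "(\<phi> has_real_derivative \<phi>' r) (at r)" for r
  proof -
    have "((\<lambda>r. w (P r) \<bullet> w (P r)) has_derivative (\<lambda>h. w (P r) \<bullet> (h *\<^sub>R partial i w (P r)) + (h *\<^sub>R partial i w (P r)) \<bullet> w (P r))) (at r)"
      by (rule has_derivative_inner[OF hd hd])
    moreover have "(\<lambda>h. w (P r) \<bullet> (h *\<^sub>R partial i w (P r)) + (h *\<^sub>R partial i w (P r)) \<bullet> w (P r)) = (*) (\<phi>' r)"
      by (auto simp: \<phi>'_def inner_commute fun_eq_iff)
    ultimately show ?thesis by (simp add: \<phi>_def[abs_def] has_field_derivative_def power2_norm_eq_inner)
  qed
  have "ennreal (\<phi> s) \<le> (\<integral>\<^sup>+r. ennreal ((\<phi> r / (b - a) + \<bar>\<phi>' r\<bar>) * indicator {a<..<b} r) \<partial>lborel)"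
    by (rule pointwise_bound_by_integral[OF l(1) d _ _ s])
       (auto simp: \<phi>'_def[abs_def] \<phi>_def intro!: continuous_intros wc)
  also have "\<dots> \<le> (\<integral>\<^sup>+r. ennreal C * ennreal (norm (w (P r)) * sqrt (grad_norm_sq w (P r)) * indicator {a<..<b} r) \<partial>lborel)"
  proof (rule nn_integral_mono)
    fix r
    let ?n = "norm (w (P r))" and ?g = "sqrt (grad_norm_sq w (P r))"
    have C0: "0 \<le> C" using l by (smt (verit) divide_nonneg_pos)
    have "?n\<^sup>2 \<le> grad_norm_sq w (P r)"
      by (simp add: grad_norm_sq_def sum_nonneg)
    then have n: "?n \<le> ?g" by (rule real_le_rsqrt)
    have "(norm (partial i w (P r)))\<^sup>2 \<le> (\<Sum>i\<in>UNIV. (norm (partial i w (P r)))\<^sup>2)"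
      by (rule member_le_sum) auto
    then have "(norm (partial i w (P r)))\<^sup>2 \<le> grad_norm_sq w (P r)"
      by (simp add: grad_norm_sq_def add_increasing)
    then have g: "norm (partial i w (P r)) \<le> ?g" by (rule real_le_rsqrt)
    have "\<bar>\<phi>' r\<bar> \<le> 2 * (?n * ?g)"
      unfolding \<phi>'_def abs_mult using Cauchy_Schwarz_ineq2[of "w (P r)" "partial i w (P r)"] mult_left_mono[OF g, of ?n]
      by simp
    moreover have "\<phi> r / (b - a) \<le> (1 / (b - a)) * (?n * ?g)"
      using l(1) mult_left_mono[OF n, of ?n] by (simp add: \<phi>_def power2_eq_square divide_right_mono)
    ultimately have "\<phi> r / (b - a) + \<bar>\<phi>' r\<bar> \<le> (1 / (b - a) + 2) * (?n * ?g)" by (simp add: distrib_right)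
    also have "\<dots> \<le> C * (?n * ?g)"
      using l(2) n by (intro mult_right_mono mult_nonneg_nonneg order_trans[OF norm_ge_zero n]) auto
    finally have "(\<phi> r / (b - a) + \<bar>\<phi>' r\<bar>) * indicator {a<..<b} r \<le> C * (?n * ?g * indicator {a<..<b} r)"
      by (auto simp: indicator_def)
    then show "ennreal ((\<phi> r / (b - a) + \<bar>\<phi>' r\<bar>) * indicator {a<..<b} r) \<le> ennreal C * ennreal (?n * ?g * indicator {a<..<b} r)"
      using C0 by (simp add: ennreal_mult'[symmetric] ennreal_leI)
  qed
  also have "\<dots> = ennreal C * (\<integral>\<^sup>+r. ennreal (norm (w (P r)) * sqrt (grad_norm_sq w (P r)) * indicator {a<..<b} r) \<partial>lborel)"
  proof (rule nn_integral_cmult)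
    have "continuous_on UNIV (\<lambda>r. norm (w (P r)) * sqrt (grad_norm_sq w (P r)))"
      unfolding grad_norm_sq_def by (intro continuous_intros wc)
    then have [measurable]: "(\<lambda>r. norm (w (P r)) * sqrt (grad_norm_sq w (P r))) \<in> borel_measurable borel"
      by (rule borel_measurable_continuous_onI)
    show "(\<lambda>r. ennreal (norm (w (P r)) * sqrt (grad_norm_sq w (P r)) * indicator {a<..<b} r)) \<in> borel_measurable lborel"
      by measurable
  qed
  finally show ?thesis by (simp add: \<phi>_def P_def)
qed

text \<open>A line parallel to an axis through a point of the box meets the box in one fixed
  interval. Cutting off with the indicator therefore turns \<open>smooth_line_bound\<close> into
  estimates over whole lines, the hypotheses of \<open>ladyzhenskaya_slices\<close>.\<close>

lemma ladyzhenskaya_box: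
  fixes w :: "real^3 \<Rightarrow> real^3"
  assumes w: "smooth w" and ab: "\<And>i. a $ i < b $ i" and C: "\<And>i. 1 / (b $ i - a $ i) + 2 \<le> C"
  shows "(\<integral>\<^sup>+p. ennreal (indicator (box a b) p * (norm (w p))^4) \<partial>lborel) \<le>
    ennreal C ^ 3 * (\<integral>\<^sup>+p. ennreal (indicator (box a b) p * grad_norm_sq w p) \<partial>lborel)\<^sup>2"
proof -
  define q where "q p = ennreal (indicator (box a b) p * norm (w p))" for p
  define t where "t p = ennreal (indicator (box a b) p * sqrt (grad_norm_sq w p))" for p
  have g0: "0 \<le> grad_norm_sq w p" for p by (simp add: grad_norm_sq_def sum_nonneg)
  have [measurable]: "w \<in> borel_measurable borel" "partial i w \<in> borel_measurable borel" for i
    by (intro smooth_borel_measurable w smooth_partial)+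
  have [measurable]: "grad_norm_sq w \<in> borel_measurable borel"
    unfolding grad_norm_sq_def[abs_def] by measurable
  have qm: "q \<in> borel_measurable borel" "t \<in> borel_measurable borel"
    unfolding q_def[abs_def] t_def[abs_def] by measurable
  have qt: "q p \<le> t p" for p
    unfolding q_def t_def
    by (intro ennreal_leI mult_left_mono real_le_rsqrt) (simp_all add: grad_norm_sq_def sum_nonneg)
  have line: "(q p)\<^sup>2 \<le> ennreal C * (\<integral>\<^sup>+s. q (p + (s - p $ i) *\<^sub>R axis i 1) * t (p + (s - p $ i) *\<^sub>R axis i 1) \<partial>lborel)" for p i
  proof (cases "p \<in> box a b")
    case True
    define c where "c = p - (p $ i) *\<^sub>R axis i 1"
    have P: "p + (s - p $ i) *\<^sub>R axis i 1 = c + s *\<^sub>R axis i 1" for s by (simp add: c_def algebra_simps)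
    have p: "a $ i \<le> p $ i" "p $ i \<le> b $ i" using True by (auto simp: mem_box_cart less_imp_le)
    have ind: "indicat_real (box a b) (c + s *\<^sub>R axis i 1) = indicator {a $ i <..< b $ i} s" for s
    proof -
      have "(c + s *\<^sub>R axis i 1) $ j = (if j = i then s else p $ j)" for j
        by (auto simp: c_def axis_def)
      then show ?thesis using True by (auto simp: mem_box_cart indicator_def split: if_splits)
    qed
    have "(q p)\<^sup>2 = ennreal ((norm (w (c + (p $ i) *\<^sub>R axis i 1)))\<^sup>2)"
      using True by (simp add: q_def c_def ennreal_power)
    also have "\<dots> \<le> ennreal C * (\<integral>\<^sup>+r. ennreal (norm (w (c + r *\<^sub>R axis i 1)) * sqrt (grad_norm_sq w (c + r *\<^sub>R axis i 1)) * indicator {a $ i<..<b $ i} r) \<partial>lborel)"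
      by (rule smooth_line_bound[OF w ab C p])
    also have "(\<lambda>r. ennreal (norm (w (c + r *\<^sub>R axis i 1)) * sqrt (grad_norm_sq w (c + r *\<^sub>R axis i 1)) * indicator {a $ i<..<b $ i} r))
       = (\<lambda>s. q (p + (s - p $ i) *\<^sub>R axis i 1) * t (p + (s - p $ i) *\<^sub>R axis i 1))"
    proof
      fix r
      show "ennreal (norm (w (c + r *\<^sub>R axis i 1)) * sqrt (grad_norm_sq w (c + r *\<^sub>R axis i 1)) * indicator {a $ i<..<b $ i} r)
         = q (p + (r - p $ i) *\<^sub>R axis i 1) * t (p + (r - p $ i) *\<^sub>R axis i 1)"
        unfolding P q_def t_def ind using g0
        by (cases "r \<in> {a $ i<..<b $ i}") (simp_all add: ennreal_mult[symmetric])
    qed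
    finally show ?thesis .
  qed (simp add: q_def)
  have v: "vec3 x y z + (s - x) *\<^sub>R axis 1 1 = vec3 s y z" "vec3 x y z + (s - y) *\<^sub>R axis 2 1 = vec3 x s z"
    "vec3 x y z + (s - z) *\<^sub>R axis 3 1 = vec3 x y s" for x y z s
    by (simp_all add: vec3_def algebra_simps)
  have "(\<integral>\<^sup>+p. (q p)^4 \<partial>lborel) \<le> ennreal C^3 * (\<integral>\<^sup>+p. (t p)\<^sup>2 \<partial>lborel)\<^sup>2"
    by (rule ladyzhenskaya_slices[OF qm qt])
       (use line[of "vec3 _ _ _" 1] line[of "vec3 _ _ _" 2] line[of "vec3 _ _ _" 3] in \<open>simp_all add: v\<close>)
  moreover have "(q p)^4 = ennreal (indicator (box a b) p * (norm (w p))^4)" for p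
    by (auto simp: q_def ennreal_power indicator_def)
  moreover have "(t p)\<^sup>2 = ennreal (indicator (box a b) p * grad_norm_sq w p)" for p
    using g0 by (auto simp: t_def ennreal_power indicator_def)
  ultimately show ?thesis by simp
qed

context flow
begin

text \<open>The L2 part is kept beside the gradient because both will have locally integrable means
  over the paths.\<close>

definition N_sq :: "l2field \<Rightarrow> real" where
  "N_sq u = (norm u)\<^sup>2 + (\<Sum>i\<in>UNIV. (norm (weak_grad \<Omega> u $ i))\<^sup>2)"

lemma N_sq_nonneg: "0 \<le> N_sq u" by (simp add: N_sq_def sum_nonneg)

text \<open>For periodic fields the box is the domain itself. A no-slip test field vanishes with its
  derivatives off a compact subset of \<Omega>, so it can be treated on a larger box.\<close>

lemma ladyzhenskaya_test_fields:
  obtains C where "C > 0" "\<And>w. w \<in> \<V> \<Longrightarrow> (\<integral>\<^sup>+p. ennreal ((norm (rep_l2field (l2_restrict \<Omega> w) p))^4) \<partial>lborel)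
      \<le> ennreal (C * (N_sq (l2_restrict \<Omega> w))\<^sup>2)"
proof -
  have "\<exists>a b. (\<forall>i. a $ i < b $ i) \<and> \<Omega> \<subseteq> box a b \<and> (\<forall>w\<in>\<V>. \<forall>p\<in>box a b - \<Omega>. w p = 0 \<and> (\<forall>i. partial i w p = 0))"
  proof -
    consider L where "\<forall>i. 0 < L $ i" "\<Omega> = box 0 L" | "\<V> = no_slip_fields \<Omega>"
      using setting unfolding flow_setting_def by blast
    then show ?thesis
    proof cases
      case 1
      then show ?thesis by (intro exI[of _ 0] exI[of _ L]) simp
    next
      case 2
      obtain x where x: "\<Omega> \<subseteq> box (- x) x" using bounded_subset_box_symmetric[OF bounded_domain] .
      \<comment> \<open>The maximum with 1 keeps every side of the box nondegenerate.\<close>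
      define y where "y = (\<chi> i. max (x $ i) 1)"
      have "box (- x) x \<subseteq> box (- y) y"
        by (auto simp: mem_box_cart y_def less_max_iff_disj min_less_iff_disj) (smt (verit))
      moreover have "(- y) $ i < y $ i" for i by (simp add: y_def)
      moreover have "w p = 0 \<and> (\<forall>i. partial i w p = 0)" if "w \<in> \<V>" "p \<notin> \<Omega>" for w p
      proof -
        have "w \<in> test_functions \<Omega>" using that 2 by (simp add: no_slip_fields_def)
        then obtain K where K: "compact K" "K \<subseteq> \<Omega>" "\<And>x. x \<notin> K \<Longrightarrow> w x = 0"
          using test_function_compact_support by blast
        have "p \<notin> K" using K(2) that(2) by blast
        then show ?thesis
          using K(3) derivative_zero_outside[of K w p, OF compact_imp_closed[OF K(1)] K(3)] by (simp add: partial_def)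
      qed
      ultimately show ?thesis using x by (intro exI[of _ "- y"] exI[of _ y]) blast
    qed
  qed
  then obtain a b where ab: "\<And>i. a $ i < b $ i" "\<Omega> \<subseteq> box a b"
    "\<And>w p i. w \<in> \<V> \<Longrightarrow> p \<in> box a b \<Longrightarrow> p \<notin> \<Omega> \<Longrightarrow> w p = 0"
    "\<And>w p i. w \<in> \<V> \<Longrightarrow> p \<in> box a b \<Longrightarrow> p \<notin> \<Omega> \<Longrightarrow> partial i w p = 0" by blast
  define C where "C = (\<Sum>i\<in>UNIV. 1 / (b $ i - a $ i)) + 2"
  have Ci: "1 / (b $ i - a $ i) + 2 \<le> C" for i
    unfolding C_def using ab(1) by (intro add_right_mono member_le_sum) (auto simp: less_imp_le)
  have C0: "C > 0" unfolding C_def using ab(1) by (intro add_nonneg_pos sum_nonneg) (auto simp: less_imp_le)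
  have "(\<integral>\<^sup>+p. ennreal ((norm (rep_l2field (l2_restrict \<Omega> w) p))^4) \<partial>lborel) \<le> ennreal (C^3 * (N_sq (l2_restrict \<Omega> w))\<^sup>2)"
    if w: "w \<in> \<V>" for w
  proof -
    note sm = test_fields_smooth[OF w]
    have sqp: "square_integrable (\<lambda>x. indicator \<Omega> x *\<^sub>R partial i w x)" for i
      by (intro square_integrable_restrict bounded_domain smooth_continuous smooth_partial sm) simp
    note sq = square_integrable_test_field[OF w]
    have "(\<integral>\<^sup>+p. ennreal ((norm (rep_l2field (l2_restrict \<Omega> w) p))^4) \<partial>lborel)
      = (\<integral>\<^sup>+p. ennreal (indicator (box a b) p * (norm (w p))^4) \<partial>lborel)"
    proof (rule nn_integral_cong_AE)
      show "AE p in lborel. ennreal ((norm (rep_l2field (l2_restrict \<Omega> w) p))^4) = ennreal (indicator (box a b) p * (norm (w p))^4)"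
        using rep_abs_l2field[OF sq] unfolding l2_restrict_def
      proof eventually_elim
        case (elim p)
        have "indicator \<Omega> p * norm (w p) = indicator (box a b) p * norm (w p)"
          using ab(2) ab(3)[OF w, of p] by (auto simp: indicator_def)
        then show ?case using elim by (auto simp: indicator_def split: if_splits)
      qed
    qed
    also have "\<dots> \<le> ennreal C ^ 3 * (\<integral>\<^sup>+p. ennreal (indicator (box a b) p * grad_norm_sq w p) \<partial>lborel)\<^sup>2"
      by (rule ladyzhenskaya_box[OF sm ab(1) Ci])
    also have "(\<integral>\<^sup>+p. ennreal (indicator (box a b) p * grad_norm_sq w p) \<partial>lborel) = ennreal (N_sq (l2_restrict \<Omega> w))"
    proof -
      have eq: "indicator (box a b) p * grad_norm_sq w p =
        (norm (indicator \<Omega> p *\<^sub>R w p))\<^sup>2 + (\<Sum>i\<in>UNIV. (norm (indicator \<Omega> p *\<^sub>R partial i w p))\<^sup>2)" for p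
      proof (cases "p \<in> \<Omega>")
        case True
        then show ?thesis using ab(2) by (auto simp: grad_norm_sq_def)
      next
        case False
        then show ?thesis using ab(3)[OF w, of p] ab(4)[OF w, of p] by (cases "p \<in> box a b") (simp_all add: grad_norm_sq_def)
      qed
      have int: "integrable lborel (\<lambda>p. (norm (indicator \<Omega> p *\<^sub>R w p))\<^sup>2)" "integrable lborel (\<lambda>p. (norm (indicator \<Omega> p *\<^sub>R partial i w p))\<^sup>2)" for i
        using sq sqp[of i] unfolding square_integrable_def by blast+
      have "(\<integral>\<^sup>+p. ennreal (indicator (box a b) p * grad_norm_sq w p) \<partial>lborel) =
        ennreal (\<integral>p. (norm (indicator \<Omega> p *\<^sub>R w p))\<^sup>2 + (\<Sum>i\<in>UNIV. (norm (indicator \<Omega> p *\<^sub>R partial i w p))\<^sup>2) \<partial>lborel)"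
        unfolding eq by (rule nn_integral_eq_integral) (intro Bochner_Integration.integrable_add Bochner_Integration.integrable_sum int, simp add: sum_nonneg)
      also have "(\<integral>p. (norm (indicator \<Omega> p *\<^sub>R w p))\<^sup>2 + (\<Sum>i\<in>UNIV. (norm (indicator \<Omega> p *\<^sub>R partial i w p))\<^sup>2) \<partial>lborel)
        = (\<integral>p. (norm (indicator \<Omega> p *\<^sub>R w p))\<^sup>2 \<partial>lborel) + (\<Sum>i\<in>UNIV. \<integral>p. (norm (indicator \<Omega> p *\<^sub>R partial i w p))\<^sup>2 \<partial>lborel)"
        by (subst Bochner_Integration.integral_add[OF int(1) Bochner_Integration.integrable_sum[OF int(2)]],
            subst Bochner_Integration.integral_sum[OF int(2)]) (rule refl)
      also have "\<dots> = N_sq (l2_restrict \<Omega> w)"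
        unfolding N_sq_def H1_smooth(2)[OF open_domain bounded_domain sm]
        by (simp add: l2_restrict_def norm_abs_l2field[OF sq] norm_abs_l2field[OF sqp])
      finally show ?thesis .
    qed
    also have "ennreal C ^ 3 * (ennreal (N_sq (l2_restrict \<Omega> w)))\<^sup>2 = ennreal (C^3 * (N_sq (l2_restrict \<Omega> w))\<^sup>2)"
      using C0 N_sq_nonneg by (simp add: ennreal_power ennreal_mult[symmetric])
    finally show ?thesis .
  qed
  then show ?thesis using C0 by (intro that[of "C^3"]) auto
qed

text \<open>Test fields are dense in \<open>V\<close> and the right-hand side is continuous in the
  H1 norm; on the left Fatou's lemma is applied along a subsequence that converges almost
  everywhere.\<close>

lemma ladyzhenskaya_V:
  obtains C where "C > 0" "\<And>u. u \<in> V \<Longrightarrow> (\<integral>\<^sup>+p. ennreal ((norm (rep_l2field u p))^4) \<partial>lborel) \<le> ennreal (C * (N_sq u)\<^sup>2)"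
proof -
  obtain C where C: "C > 0" "\<And>w. w \<in> \<V> \<Longrightarrow> (\<integral>\<^sup>+p. ennreal ((norm (rep_l2field (l2_restrict \<Omega> w) p))^4) \<partial>lborel)
      \<le> ennreal (C * (N_sq (l2_restrict \<Omega> w))\<^sup>2)" using ladyzhenskaya_test_fields by blast
  have "(\<integral>\<^sup>+p. ennreal ((norm (rep_l2field u p))^4) \<partial>lborel) \<le> ennreal (C * (N_sq u)\<^sup>2)" if u: "u \<in> V" for u
  proof -
    have "(u, weak_grad \<Omega> u) \<in> graph" using u by (simp add: graph_iff)
    then obtain s where s: "\<And>n. s n \<in> (\<lambda>u. (u, weak_grad \<Omega> u)) ` l2_restrict \<Omega> ` \<V>" "s \<longlonglongrightarrow> (u, weak_grad \<Omega> u)"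
      unfolding graph_def closure_sequential by blast
    define v where "v n = fst (s n)" for n
    have sv: "s n = (v n, weak_grad \<Omega> (v n))" "v n \<in> l2_restrict \<Omega> ` \<V>" for n
      using s(1)[of n] by (auto simp: v_def)
    have lim: "v \<longlonglongrightarrow> u" "(\<lambda>n. weak_grad \<Omega> (v n)) \<longlonglongrightarrow> weak_grad \<Omega> u"
      using tendsto_fst[OF s(2)] tendsto_snd[OF s(2)] by (simp_all add: sv)
    have Nlim: "(\<lambda>n. N_sq (v n)) \<longlonglongrightarrow> N_sq u"
      unfolding N_sq_def by (intro tendsto_intros lim)
    have vb: "(\<integral>\<^sup>+p. ennreal ((norm (rep_l2field (v n) p))^4) \<partial>lborel) \<le> ennreal (C * (N_sq (v n))\<^sup>2)" for n
      using sv(2)[of n] C(2) by auto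
    \<comment> \<open>Convergence in L2 is read as convergence in L1 of the squared pointwise
      distances, which provides the subsequence.\<close>
    have "(\<lambda>n. (norm (v n - u))\<^sup>2) \<longlonglongrightarrow> (norm (u - u))\<^sup>2" by (intro tendsto_intros lim)
    then have L: "(\<lambda>n. \<integral>x. norm ((norm (rep_l2field (v n - u) x))\<^sup>2) \<partial>lborel) \<longlonglongrightarrow> 0"
      by (simp add: norm_l2field_rep)
    have "\<exists>r. strict_mono r \<and> (AE x in lborel. (\<lambda>n. (norm (rep_l2field (v (r n) - u) x))\<^sup>2) \<longlonglongrightarrow> 0)"
      by (rule tendsto_L1_AE_subseq[OF _ L]) (use square_integrable_rep in \<open>auto simp: square_integrable_def\<close>)
    then obtain r where r: "strict_mono r" "AE x in lborel. (\<lambda>n. (norm (rep_l2field (v (r n) - u) x))\<^sup>2) \<longlonglongrightarrow> 0" by blast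
    have "AE x in lborel. \<forall>n. rep_l2field (v (r n) - u) x = rep_l2field (v (r n)) x - rep_l2field u x"
      unfolding AE_all_countable by (auto intro: rep_diff_l2field)
    with r(2) have ae: "AE x in lborel. (\<lambda>n. rep_l2field (v (r n)) x) \<longlonglongrightarrow> rep_l2field u x"
    proof eventually_elim
      case (elim x)
      then have "(\<lambda>n. (norm (rep_l2field (v (r n)) x - rep_l2field u x))\<^sup>2) \<longlonglongrightarrow> 0" by simp
      then have "(\<lambda>n. norm (rep_l2field (v (r n)) x - rep_l2field u x)) \<longlonglongrightarrow> 0"
        using tendsto_real_sqrt[of _ 0 sequentially] by fastforce
      then show ?case by (rule LIM_zero_cancel[OF tendsto_norm_zero_cancel])
    qed
    have "(\<integral>\<^sup>+p. ennreal ((norm (rep_l2field u p))^4) \<partial>lborel)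
        = (\<integral>\<^sup>+p. liminf (\<lambda>n. ennreal ((norm (rep_l2field (v (r n)) p))^4)) \<partial>lborel)"
    proof (rule nn_integral_cong_AE, use ae in eventually_elim)
      fix p assume "(\<lambda>n. rep_l2field (v (r n)) p) \<longlonglongrightarrow> rep_l2field u p"
      then have "(\<lambda>n. ennreal ((norm (rep_l2field (v (r n)) p))^4)) \<longlonglongrightarrow> ennreal ((norm (rep_l2field u p))^4)"
        by (intro tendsto_intros)
      then show "ennreal ((norm (rep_l2field u p))^4) = liminf (\<lambda>n. ennreal ((norm (rep_l2field (v (r n)) p))^4))"
        by (intro lim_imp_Liminf[symmetric]) auto
    qed
    also have "\<dots> \<le> liminf (\<lambda>n. \<integral>\<^sup>+p. ennreal ((norm (rep_l2field (v (r n)) p))^4) \<partial>lborel)"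
      by (rule nn_integral_liminf) measurable
    also have "\<dots> \<le> liminf (\<lambda>n. ennreal (C * (N_sq (v (r n)))\<^sup>2))"
      by (rule Liminf_mono) (simp add: vb)
    also have "\<dots> = ennreal (C * (N_sq u)\<^sup>2)"
    proof (rule lim_imp_Liminf)
      have "(\<lambda>n. N_sq (v (r n))) \<longlonglongrightarrow> N_sq u" using LIMSEQ_subseq_LIMSEQ[OF Nlim r(1)] by (simp add: o_def)
      then show "(\<lambda>n. ennreal (C * (N_sq (v (r n)))\<^sup>2)) \<longlonglongrightarrow> ennreal (C * (N_sq u)\<^sup>2)"
        by (intro tendsto_intros)
    qed simp
    finally show ?thesis .
  qed
  with C(1) show ?thesis by (rule that)
qed

end

section \<open>The trilinear form\<close>

context flow
begin

definition b_integrand :: "l2field \<Rightarrow> l2field \<Rightarrow> real^3 \<Rightarrow> real" where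
  "b_integrand u w x = indicator \<Omega> x * ((\<Sum>i\<in>UNIV. (rep_l2field u x $ i) *\<^sub>R rep_l2field (weak_grad \<Omega> u $ i) x) \<bullet> rep_l2field w x)"

lemma b_eq_integral: "b u u w = (\<integral>x. b_integrand u w x \<partial>lborel)"
  by (simp add: b_def set_lebesgue_integral_def b_integrand_def)

lemma vec_nth_borel [measurable]: "(\<lambda>x :: real^3. x $ i) \<in> borel_measurable borel"
  by (intro borel_measurable_continuous_onI continuous_intros)

lemma b_integrand_measurable [measurable]: "b_integrand u w \<in> borel_measurable borel"
proof -
  have [measurable]: "(\<lambda>x. rep_l2field u x $ i) \<in> borel_measurable borel" for i
    using measurable_compose[OF rep_measurable vec_nth_borel] .
  show ?thesis unfolding b_integrand_def[abs_def] by measurable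
qed

text \<open>Young's inequality applied twice to a product of three factors. The weight
  \<open>m\<close> distributes the fourth powers between \<open>u\<close> and \<open>w\<close>; in
  \<open>b_bound\<close> it becomes \<open>N_sq u\<close>.\<close>

definition b_majorant :: "real \<Rightarrow> l2field \<Rightarrow> l2field \<Rightarrow> real^3 \<Rightarrow> real" where
  "b_majorant m u w x = (\<Sum>i\<in>UNIV. (norm (rep_l2field (weak_grad \<Omega> u $ i) x))\<^sup>2
     + ((norm (rep_l2field u x))^4 / m + m * (norm (rep_l2field w x))^4))"

text \<open>The vector \<open>z\<close> stands for the value of \<open>w\<close> or of one of its
  truncations, so that one integrable majorant covers all of them.\<close>

lemma b_majorant_bound:
  fixes z :: "real^3"
  assumes "m > 0" "norm z \<le> norm (rep_l2field w x)"
  shows "\<bar>indicator \<Omega> x * ((\<Sum>i\<in>UNIV. (rep_l2field u x $ i) *\<^sub>R rep_l2field (weak_grad \<Omega> u $ i) x) \<bullet> z)\<bar> \<le> b_majorant m u w x"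
proof -
  let ?u = "norm (rep_l2field u x)" and ?w = "norm (rep_l2field w x)" and ?p = "\<lambda>i. norm (rep_l2field (weak_grad \<Omega> u $ i) x)"
  have "\<bar>indicator \<Omega> x * ((\<Sum>i\<in>UNIV. (rep_l2field u x $ i) *\<^sub>R rep_l2field (weak_grad \<Omega> u $ i) x) \<bullet> z)\<bar>
    \<le> \<bar>(\<Sum>i\<in>UNIV. (rep_l2field u x $ i) *\<^sub>R rep_l2field (weak_grad \<Omega> u $ i) x) \<bullet> z\<bar>"
    by (simp add: indicator_def)
  also have "\<dots> \<le> norm (\<Sum>i\<in>UNIV. (rep_l2field u x $ i) *\<^sub>R rep_l2field (weak_grad \<Omega> u $ i) x) * norm z"
    by (rule Cauchy_Schwarz_ineq2)
  also have "\<dots> \<le> (\<Sum>i\<in>UNIV. ?u * ?p i) * ?w"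
  proof (rule mult_mono[OF _ assms(2)])
    show "norm (\<Sum>i\<in>UNIV. (rep_l2field u x $ i) *\<^sub>R rep_l2field (weak_grad \<Omega> u $ i) x) \<le> (\<Sum>i\<in>UNIV. ?u * ?p i)"
      by (rule sum_norm_le) (simp add: mult_right_mono component_le_norm_cart)
  qed (auto intro!: sum_nonneg)
  also have "\<dots> = (\<Sum>i\<in>UNIV. ?p i * (?u * ?w))"
    unfolding sum_distrib_right by (rule sum.cong) (simp_all add: ac_simps)
  also have "\<dots> \<le> b_majorant m u w x"
    unfolding b_majorant_def
  proof (rule sum_mono)
    fix i :: 3
    have "?p i * (?u * ?w) \<le> (?p i)\<^sup>2 + (?u * ?w)\<^sup>2" by (rule mult_le_sum_squares)
    also have "(?u * ?w)\<^sup>2 = (?u\<^sup>2 / sqrt m) * (sqrt m * ?w\<^sup>2)"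
      using assms by (simp add: power_mult_distrib)
    also have "\<dots> \<le> (?u\<^sup>2 / sqrt m)\<^sup>2 + (sqrt m * ?w\<^sup>2)\<^sup>2" by (rule mult_le_sum_squares)
    also have "\<dots> = ?u^4 / m + m * ?w^4"
      using assms by (simp add: power_mult_distrib power_divide power_mult[symmetric])
    finally show "?p i * (?u * ?w) \<le> (?p i)\<^sup>2 + (?u^4 / m + m * ?w^4)" by simp
  qed
  finally show ?thesis .
qed

lemma rep_norm4:
  obtains C where "C > 0" "\<And>u. u \<in> V \<Longrightarrow> integrable lborel (\<lambda>x. (norm (rep_l2field u x))^4)"
    "\<And>u. u \<in> V \<Longrightarrow> (\<integral>x. (norm (rep_l2field u x))^4 \<partial>lborel) \<le> C * (N_sq u)\<^sup>2"
proof -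
  obtain C where C: "C > 0" "\<And>u. u \<in> V \<Longrightarrow> (\<integral>\<^sup>+p. ennreal ((norm (rep_l2field u p))^4) \<partial>lborel) \<le> ennreal (C * (N_sq u)\<^sup>2)"
    using ladyzhenskaya_V by blast
  have i: "integrable lborel (\<lambda>x. (norm (rep_l2field u x))^4)" if "u \<in> V" for u
    by (rule integrableI_bounded) (use C(2)[OF that] in \<open>auto intro: le_less_trans\<close>)
  have "(\<integral>x. (norm (rep_l2field u x))^4 \<partial>lborel) \<le> C * (N_sq u)\<^sup>2" if "u \<in> V" for u
  proof -
    have "ennreal (\<integral>x. (norm (rep_l2field u x))^4 \<partial>lborel) \<le> ennreal (C * (N_sq u)\<^sup>2)"
      using C(2)[OF that] nn_integral_eq_integral[OF i[OF that]] by simp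
    then show ?thesis using C(1) by (subst (asm) ennreal_le_iff) auto
  qed
  with C(1) i show ?thesis by (rule that)
qed

lemma b_majorant_integrable:
  assumes "u \<in> V" "w \<in> V"
  shows "integrable lborel (b_majorant m u w)"
proof -
  have 1: "integrable lborel (\<lambda>x. (norm (rep_l2field v x))\<^sup>2)" for v
    using square_integrable_rep[of v] by (simp add: square_integrable_def)
  have 2: "integrable lborel (\<lambda>x. (norm (rep_l2field v x))^4)" if "v \<in> V" for v
    using rep_norm4 that by blast
  show ?thesis
    unfolding b_majorant_def[abs_def]
    by (intro Bochner_Integration.integrable_sum Bochner_Integration.integrable_add 1 integrable_mult_right
        integrable_divide_zero impI 2 assms)
qed

lemma b_integrand_integrable:
  assumes "u \<in> V" "w \<in> V"
  shows "integrable lborel (b_integrand u w)"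
proof (rule Bochner_Integration.integrable_bound[OF b_majorant_integrable[OF assms, of 1]])
  show "AE x in lborel. norm (b_integrand u w x) \<le> norm (b_majorant 1 u w x)"
    using b_majorant_bound[of 1 _ w _ u]
    by (intro AE_I2) (auto simp: b_integrand_def intro: order_trans[OF _ abs_ge_self])
qed simp

text \<open>Integrating the majorant gives N + 3 (C N^2 / m + m W), with N = \<open>N_sq u\<close>
  and \<open>W\<close> the integral of |w|^4. The choice m = N makes this linear in N, and linear
  growth is what the mean energy and dissipation can control.\<close>

lemma b_bound:
  assumes w: "w \<in> V"
  obtains C where "C \<ge> 0" "\<And>u. u \<in> V \<Longrightarrow> \<bar>b u u w\<bar> \<le> C * N_sq u"
proof -
  obtain C where C: "C > 0" "\<And>u. u \<in> V \<Longrightarrow> integrable lborel (\<lambda>x. (norm (rep_l2field u x))^4)"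
    "\<And>u. u \<in> V \<Longrightarrow> (\<integral>x. (norm (rep_l2field u x))^4 \<partial>lborel) \<le> C * (N_sq u)\<^sup>2"
    using rep_norm4 by blast
  define W where "W = (\<integral>x. (norm (rep_l2field w x))^4 \<partial>lborel)"
  have W0: "0 \<le> W" unfolding W_def by simp
  have main: "\<bar>b u u w\<bar> \<le> N_sq u + 3 * (C * (N_sq u)\<^sup>2 / m + m * W)" if u: "u \<in> V" and m: "m > 0" for u m
  proof -
    have 1: "integrable lborel (\<lambda>x. (norm (rep_l2field v x))\<^sup>2)" for v
      using square_integrable_rep[of v] by (simp add: square_integrable_def)
    have 2: "integrable lborel (\<lambda>x. (norm (rep_l2field u x))^4 / m + m * (norm (rep_l2field w x))^4)"
      by (intro Bochner_Integration.integrable_add integrable_mult_right integrable_divide_zero impI C(2) u w)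
    have "\<bar>b u u w\<bar> \<le> (\<integral>x. \<bar>b_integrand u w x\<bar> \<partial>lborel)"
      unfolding b_eq_integral by (rule integral_abs_bound)
    also have "\<dots> \<le> (\<integral>x. b_majorant m u w x \<partial>lborel)"
      using b_majorant_bound[OF m, of _ w _ u]
      by (intro integral_mono integrable_abs b_integrand_integrable b_majorant_integrable u w) (auto simp: b_integrand_def)
    also have "\<dots> = (\<Sum>i\<in>UNIV. (norm (weak_grad \<Omega> u $ i))\<^sup>2 + (\<integral>x. (norm (rep_l2field u x))^4 / m + m * (norm (rep_l2field w x))^4 \<partial>lborel))"
      unfolding b_majorant_def norm_l2field_rep
      by (subst Bochner_Integration.integral_sum[OF Bochner_Integration.integrable_add[OF 1 2]])
         (simp only: Bochner_Integration.integral_add[OF 1 2])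
    also have "(\<integral>x. (norm (rep_l2field u x))^4 / m + m * (norm (rep_l2field w x))^4 \<partial>lborel)
        = (\<integral>x. (norm (rep_l2field u x))^4 \<partial>lborel) / m + m * W"
      unfolding W_def
      by (subst Bochner_Integration.integral_add)
         (auto intro!: integrable_mult_right integrable_divide_zero C(2) u w)
    also have "(\<Sum>i\<in>UNIV. (norm (weak_grad \<Omega> u $ i))\<^sup>2 + ((\<integral>x. (norm (rep_l2field u x))^4 \<partial>lborel) / m + m * W))
        = (\<Sum>i\<in>UNIV. (norm (weak_grad \<Omega> u $ i))\<^sup>2) + 3 * ((\<integral>x. (norm (rep_l2field u x))^4 \<partial>lborel) / m + m * W)"
      by (simp add: sum.distrib)
    also have "\<dots> \<le> N_sq u + 3 * (C * (N_sq u)\<^sup>2 / m + m * W)"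
      using C(3)[OF u] m by (intro add_mono mult_left_mono divide_right_mono order_refl) (auto simp: N_sq_def)
    finally show ?thesis .
  qed
  have "\<bar>b u u w\<bar> \<le> (1 + 3 * (C + W)) * N_sq u" if u: "u \<in> V" for u
  proof (cases "N_sq u = 0")
    \<comment> \<open>The weight m = N must be positive; when N is zero, \<open>u\<close> vanishes
      and the form with it.\<close>
    case True
    have "norm u = 0" using True sum_nonneg[of UNIV "\<lambda>i. (norm (weak_grad \<Omega> u $ i))\<^sup>2"]
      by (auto simp: N_sq_def add_nonneg_eq_0_iff)
    then have u0: "u = 0" by simp
    have "AE x in lborel. b_integrand u w x = 0"
      using rep_zero_l2field unfolding u0 by eventually_elim (simp add: b_integrand_def)
    then have "b u u w = 0" unfolding b_eq_integral by (rule integral_eq_zero_AE)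
    then show ?thesis using True by simp
  next
    case False
    then have n: "N_sq u > 0" using N_sq_nonneg[of u] by linarith
    have "C * (N_sq u)\<^sup>2 / N_sq u = C * N_sq u" using n by (simp add: power2_eq_square)
    then show ?thesis using main[OF u n] by (simp add: algebra_simps)
  qed
  then show ?thesis using C(1) W0 by (intro that[of "1 + 3 * (C + W)"]) auto
qed

section \<open>Linearity, bounds and measurability of the right-hand side \<open>F\<close>\<close>

lemma b_linear:
  assumes "u \<in> V" "w \<in> V" "v \<in> V"
  shows "b u u (a *\<^sub>R w + c *\<^sub>R v) = a * b u u w + c * b u u v"
proof -
  have "AE x in lborel. rep_l2field (a *\<^sub>R w + c *\<^sub>R v) x = a *\<^sub>R rep_l2field w x + c *\<^sub>R rep_l2field v x"
    using rep_add_l2field[of "a *\<^sub>R w" "c *\<^sub>R v"] rep_scaleR_l2field[of a w] rep_scaleR_l2field[of c v]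
    by eventually_elim simp
  then have "AE x in lborel. b_integrand u (a *\<^sub>R w + c *\<^sub>R v) x = a * b_integrand u w x + c * b_integrand u v x"
    by eventually_elim (simp add: b_integrand_def inner_add_right algebra_simps)
  then have "b u u (a *\<^sub>R w + c *\<^sub>R v) = (\<integral>x. a * b_integrand u w x + c * b_integrand u v x \<partial>lborel)"
    unfolding b_eq_integral by (intro integral_cong_AE) simp_all
  also have "\<dots> = a * b u u w + c * b u u v"
    unfolding b_eq_integral
    by (subst Bochner_Integration.integral_add) (simp_all add: b_integrand_integrable assms)
  finally show ?thesis .
qed

lemma V_inner_linear:
  assumes "w \<in> V" "v \<in> V"
  shows "V_inner u (a *\<^sub>R w + c *\<^sub>R v) = a * V_inner u w + c * V_inner u v"
  using V_scaleR[OF assms(1), of a] V_scaleR[OF assms(2), of c] V_add[of "a *\<^sub>R w" "c *\<^sub>R v"]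
  by (simp add: V_inner_def inner_add_right)

lemma F_eq: "v \<in> V \<Longrightarrow> F s u v = f s \<bullet> v - \<nu> * V_inner u v - b u u v"
  by (simp add: F_def A_def B_def)

lemma F_linear:
  assumes "u \<in> V" "w \<in> V" "v \<in> V"
  shows "F s u (a *\<^sub>R w + c *\<^sub>R v) = a * F s u w + c * F s u v"
proof -
  have "a *\<^sub>R w + c *\<^sub>R v \<in> V"
    using assms by (intro subspace_add[OF subspace_V] subspace_scale[OF subspace_V])
  then show ?thesis
    using b_linear[OF assms, of a c] V_inner_linear[OF assms(2,3), of u a c] assms
    by (simp add: F_eq inner_add_right algebra_simps)
qed

lemma F_sum:
  fixes k :: nat
  assumes "u \<in> V" "\<And>j. j < k \<Longrightarrow> v j \<in> V"
  shows "F s u (\<Sum>j<k. c j *\<^sub>R v j) = (\<Sum>j<k. c j * F s u (v j))"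
  using assms(2)
proof (induction k)
  case 0
  have "F s u (0 *\<^sub>R 0 + 0 *\<^sub>R 0) = 0"
    using V_zero by (subst F_linear[OF assms(1)]) auto
  then show ?case by simp
next
  case (Suc k)
  have "(\<Sum>j<k. c j *\<^sub>R v j) \<in> V"
    using Suc.prems by (intro subspace_sum[OF subspace_V] subspace_scale[OF subspace_V]) auto
  then have "F s u (1 *\<^sub>R (\<Sum>j<k. c j *\<^sub>R v j) + c k *\<^sub>R v k) = 1 * F s u (\<Sum>j<k. c j *\<^sub>R v j) + c k * F s u (v k)"
    using Suc.prems by (intro F_linear assms(1)) auto
  then show ?case using Suc by simp
qed

lemma norm_weak_grad_sq: "(norm (weak_grad \<Omega> u))\<^sup>2 = (\<Sum>i\<in>UNIV. (norm (weak_grad \<Omega> u $ i))\<^sup>2)"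
  by (simp add: power2_norm_eq_inner inner_vec_def)

text \<open>The constant depends on the force only through \<open>M\<close>. The bound on
  \<open>f s\<close> is asked for at each time because the force is bounded only almost
  everywhere.\<close>

lemma F_bound:
  assumes v: "v \<in> V" and \<nu>: "\<nu> > 0"
  obtains C where "C \<ge> 0" "\<And>s u. u \<in> V \<Longrightarrow> norm (f s) \<le> M \<Longrightarrow> \<bar>F s u v\<bar> \<le> C * (1 + N_sq u)"
proof -
  obtain C where C: "C \<ge> 0" "\<And>u. u \<in> V \<Longrightarrow> \<bar>b u u v\<bar> \<le> C * N_sq u" using b_bound[OF v] by blast
  define K where "K = \<bar>M\<bar> * norm v + \<nu> * (1 + (norm (weak_grad \<Omega> v))\<^sup>2) + C"
  have "\<bar>F s u v\<bar> \<le> K * (1 + N_sq u)" if u: "u \<in> V" and M: "norm (f s) \<le> M" for s u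
  proof -
    have n: "0 \<le> N_sq u" by (rule N_sq_nonneg)
    have g: "(norm (weak_grad \<Omega> u))\<^sup>2 \<le> N_sq u" by (simp add: N_sq_def norm_weak_grad_sq)
    have "\<bar>f s \<bullet> v\<bar> \<le> norm (f s) * norm v" by (rule Cauchy_Schwarz_ineq2)
    also have "\<dots> \<le> \<bar>M\<bar> * norm v" using M by (intro mult_right_mono) auto
    also have "\<dots> \<le> \<bar>M\<bar> * norm v * (1 + N_sq u)" using n by (simp add: mult_left_mono algebra_simps)
    finally have 1: "\<bar>f s \<bullet> v\<bar> \<le> \<bar>M\<bar> * norm v * (1 + N_sq u)" .
    have "\<bar>V_inner u v\<bar> \<le> norm (weak_grad \<Omega> u) * norm (weak_grad \<Omega> v)"
      unfolding V_inner_def by (rule Cauchy_Schwarz_ineq2)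
    also have "\<dots> \<le> (norm (weak_grad \<Omega> u))\<^sup>2 + (norm (weak_grad \<Omega> v))\<^sup>2" by (rule mult_le_sum_squares)
    also have "\<dots> \<le> N_sq u + (norm (weak_grad \<Omega> v))\<^sup>2" using g by simp
    also have "\<dots> \<le> (1 + (norm (weak_grad \<Omega> v))\<^sup>2) * (1 + N_sq u)"
      using n mult_nonneg_nonneg[OF zero_le_power2[of "norm (weak_grad \<Omega> v)"] n] by (simp add: algebra_simps)
    finally have "\<nu> * \<bar>V_inner u v\<bar> \<le> \<nu> * ((1 + (norm (weak_grad \<Omega> v))\<^sup>2) * (1 + N_sq u))"
      using \<nu> by (intro mult_left_mono) auto
    then have 2: "\<bar>\<nu> * V_inner u v\<bar> \<le> \<nu> * (1 + (norm (weak_grad \<Omega> v))\<^sup>2) * (1 + N_sq u)"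
      using \<nu> by (simp add: abs_mult mult.assoc)
    have 3: "\<bar>b u u v\<bar> \<le> C * (1 + N_sq u)" using C(2)[OF u] C(1) by (simp add: algebra_simps)
    have "\<bar>F s u v\<bar> \<le> \<bar>f s \<bullet> v\<bar> + \<bar>\<nu> * V_inner u v\<bar> + \<bar>b u u v\<bar>" unfolding F_eq[OF v] by linarith
    also have "\<dots> \<le> \<bar>M\<bar> * norm v * (1 + N_sq u) + \<nu> * (1 + (norm (weak_grad \<Omega> v))\<^sup>2) * (1 + N_sq u) + C * (1 + N_sq u)"
      using 1 2 3 by (intro add_mono)
    also have "\<dots> = K * (1 + N_sq u)" by (simp add: K_def distrib_right)
    finally show ?thesis .
  qed
  moreover have "K \<ge> 0" using C(1) \<nu> by (simp add: K_def)
  ultimately show ?thesis using that by blast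
qed

text \<open>Truncating the last argument makes the form continuous on \<open>L\<^sup>2 \<times> L\<^sup>2\<close> in the velocity and its
  gradient.\<close>

lemma truncated_multiplier:
  fixes w :: l2field and i :: 3
  defines "T \<equiv> \<lambda>(n::nat) u. abs_l2field (\<lambda>x. (indicator \<Omega> x * (rep_l2field u x $ i)) *\<^sub>R
      (if norm (rep_l2field w x) \<le> real n then rep_l2field w x else 0))"
  shows "square_integrable (\<lambda>x. (indicator \<Omega> x * (rep_l2field u x $ i)) *\<^sub>R
      (if norm (rep_l2field w x) \<le> real n then rep_l2field w x else 0))" (is "square_integrable (?g u)")
    and "T n \<in> borel_measurable borel"
proof -
  define z where "z x = (if norm (rep_l2field w x) \<le> real n then rep_l2field w x else 0)" for x
  have zm [measurable]: "z \<in> borel_measurable borel" unfolding z_def[abs_def] by measurable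
  have zb: "norm (z x) \<le> real n" for x by (simp add: z_def)
  define g where "g u x = (indicator \<Omega> x * (rep_l2field u x $ i)) *\<^sub>R z x" for u x
  have [measurable]: "(\<lambda>x. rep_l2field u x $ i) \<in> borel_measurable borel" for u
    using measurable_compose[OF rep_measurable vec_nth_borel] .
  have gb: "norm (g u x) \<le> real n * norm (rep_l2field u x)" for u x
  proof -
    have "norm (g u x) \<le> \<bar>rep_l2field u x $ i\<bar> * norm (z x)" by (simp add: g_def indicator_def)
    also have "\<dots> \<le> norm (rep_l2field u x) * real n"
      by (intro mult_mono component_le_norm_cart zb) auto
    finally show ?thesis by (simp add: mult.commute)
  qed
  have sq: "square_integrable (g u)" for u
  proof (rule square_integrable_bound[OF square_integrable_rep[of u] _ gb])
    show "g u \<in> borel_measurable borel" unfolding g_def[abs_def] by measurable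
  qed
  then show "square_integrable (?g u)" by (simp add: g_def[abs_def] z_def[abs_def])
  have T: "T n u = abs_l2field (g u)" for u by (simp add: T_def g_def[abs_def] z_def[abs_def])
  have "bounded_linear (T n)"
  proof (rule bounded_linear_intro)
    fix u v :: l2field
    have "AE x in lborel. g (u + v) x = g u x + g v x"
      using rep_add_l2field[of u v] by eventually_elim (simp add: g_def algebra_simps)
    then show "T n (u + v) = T n u + T n v"
      unfolding T add_abs_l2field[OF sq sq] by (intro abs_l2field_eqI sq square_integrable_add)
  next
    fix r :: real and u :: l2field
    have "AE x in lborel. g (r *\<^sub>R u) x = r *\<^sub>R g u x"
      using rep_scaleR_l2field[of r u] by eventually_elim (simp add: g_def)
    then show "T n (r *\<^sub>R u) = r *\<^sub>R T n u"
      unfolding T scaleR_abs_l2field[OF sq] by (intro abs_l2field_eqI sq square_integrable_scaleR)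
  next
    fix u :: l2field
    have "(norm (T n u))\<^sup>2 = (\<integral>x. (norm (g u x))\<^sup>2 \<partial>lborel)" unfolding T by (rule norm_abs_l2field[OF sq])
    also have "\<dots> \<le> (\<integral>x. (real n)\<^sup>2 * (norm (rep_l2field u x))\<^sup>2 \<partial>lborel)"
    proof (rule integral_mono)
      show "integrable lborel (\<lambda>x. (norm (g u x))\<^sup>2)" using sq[of u] by (simp add: square_integrable_def)
      show "integrable lborel (\<lambda>x. (real n)\<^sup>2 * (norm (rep_l2field u x))\<^sup>2)"
        using square_integrable_rep[of u] by (auto simp: square_integrable_def)
      show "(norm (g u x))\<^sup>2 \<le> (real n)\<^sup>2 * (norm (rep_l2field u x))\<^sup>2" for x
        using power_mono[OF gb[of u x], of 2] by (simp add: power_mult_distrib)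
    qed
    also have "\<dots> = (norm u * real n)\<^sup>2" by (simp add: norm_l2field_rep power_mult_distrib)
    finally show "norm (T n u) \<le> norm u * real n" by (rule power2_le_imp_le) simp
  qed
  then show "T n \<in> borel_measurable borel"
    by (intro borel_measurable_continuous_onI linear_continuous_on)
qed

text \<open>With \<open>w\<close> truncated, the form is a sum of inner products of gradient
  components with bounded linear images of \<open>u\<close>, hence Borel on \<open>V\<close>. The
  truncations converge for each \<open>u\<close> by dominated convergence with
  \<open>b_majorant\<close>.\<close>

lemma b_borel:
  assumes w: "w \<in> V"
  shows "(\<lambda>u. b u u w) \<in> borel_measurable (restrict_space borel V)"
proof -
  define z where "z n x = (if norm (rep_l2field w x) \<le> real n then rep_l2field w x else 0)" for n :: nat and x
  define T where "T i n u = abs_l2field (\<lambda>x. (indicator \<Omega> x * (rep_l2field u x $ i)) *\<^sub>R z n x)" for i :: 3 and n u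
  have sq: "square_integrable (\<lambda>x. (indicator \<Omega> x * (rep_l2field u x $ i)) *\<^sub>R z n x)" for i n u
    using truncated_multiplier(1)[of u i w n] by (simp add: z_def)
  have Tm: "T i n \<in> borel_measurable borel" for i n
    using truncated_multiplier(2)[of i w n] by (simp add: T_def[abs_def] z_def)
  define bn where "bn n u = (\<Sum>i\<in>UNIV. (weak_grad \<Omega> u $ i) \<bullet> T i n u)" for n u
  have bnm: "bn n \<in> borel_measurable (restrict_space borel V)" for n
    unfolding bn_def[abs_def]
    by (intro borel_measurable_sum borel_measurable_inner grad_borel measurable_restrict_space1 Tm)
  show ?thesis
  proof (rule borel_measurable_LIMSEQ_real[OF _ bnm])
    fix u assume "u \<in> space (restrict_space borel V)"
    then have u: "u \<in> V" by (simp add: space_restrict_space)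
    define h where "h n x = indicator \<Omega> x * ((\<Sum>i\<in>UNIV. (rep_l2field u x $ i) *\<^sub>R rep_l2field (weak_grad \<Omega> u $ i) x) \<bullet> z n x)" for n x
    have hi: "integrable lborel (\<lambda>x. rep_l2field (weak_grad \<Omega> u $ i) x \<bullet> ((indicator \<Omega> x * (rep_l2field u x $ i)) *\<^sub>R z n x))" for i n
      by (intro square_integrable_inner square_integrable_rep sq)
    have hsum: "h n x = (\<Sum>i\<in>UNIV. rep_l2field (weak_grad \<Omega> u $ i) x \<bullet> ((indicator \<Omega> x * (rep_l2field u x $ i)) *\<^sub>R z n x))" for n x
      by (simp add: h_def inner_sum_left sum_distrib_left mult.assoc)
    have bnh: "bn n u = (\<integral>x. h n x \<partial>lborel)" for n
    proof -
      have "(weak_grad \<Omega> u $ i) \<bullet> T i n u = (\<integral>x. rep_l2field (weak_grad \<Omega> u $ i) x \<bullet> ((indicator \<Omega> x * (rep_l2field u x $ i)) *\<^sub>R z n x) \<partial>lborel)" for i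
        using inner_abs_l2field[OF square_integrable_rep[of "weak_grad \<Omega> u $ i"] sq[of u i n]]
        by (simp add: abs_rep_l2field T_def)
      then show ?thesis unfolding bn_def hsum by (subst Bochner_Integration.integral_sum[OF hi]) simp
    qed
    have hm: "h n \<in> borel_measurable lborel" for n
      unfolding hsum[abs_def] by (intro borel_measurable_sum borel_measurable_integrable hi)
    show "(\<lambda>n. bn n u) \<longlonglongrightarrow> b u u w"
      unfolding bnh b_eq_integral
    proof (rule integral_dominated_convergence[OF _ hm b_majorant_integrable[OF u w, of 1]])
      show "AE x in lborel. norm (h n x) \<le> b_majorant 1 u w x" for n
        using b_majorant_bound[of 1 "z n _" w _ u] by (intro AE_I2) (auto simp: h_def z_def)
      show "AE x in lborel. (\<lambda>n. h n x) \<longlonglongrightarrow> b_integrand u w x"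
      proof (rule AE_I2)
        fix x :: "real^3"
        obtain N where N: "norm (rep_l2field w x) \<le> real N" using real_arch_simple by blast
        have "\<forall>\<^sub>F n in sequentially. b_integrand u w x = h n x"
          using N by (intro eventually_sequentiallyI[of N]) (auto simp: h_def z_def b_integrand_def)
        then show "(\<lambda>n. h n x) \<longlonglongrightarrow> b_integrand u w x"
          by (rule Lim_transform_eventually[OF tendsto_const])
      qed
    qed simp
  qed
qed

lemma V_inner_borel: "(\<lambda>u. V_inner u v) \<in> borel_measurable (restrict_space borel V)"
  unfolding V_inner_def inner_vec_def
  by (intro borel_measurable_sum borel_measurable_inner grad_borel) simp

end

section \<open>Chain rules for integrals of locally integrable functions\<close>

lemma set_integral_Ioc_add:
  fixes g :: "real \<Rightarrow> real"
  assumes "set_integrable lebesgue {a..b} g" "a \<le> s" "s \<le> t" "t \<le> r" "r \<le> b"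
  shows "(LINT x:{s<..r}|lebesgue. g x) = (LINT x:{s<..t}|lebesgue. g x) + (LINT x:{t<..r}|lebesgue. g x)"
proof -
  have "{s<..t} \<union> {t<..r} = {s<..r}" using assms by auto
  moreover have "(LINT x:{s<..t} \<union> {t<..r}|lebesgue. g x) = (LINT x:{s<..t}|lebesgue. g x) + (LINT x:{t<..r}|lebesgue. g x)"
    by (rule set_integral_Un) (use assms in \<open>auto intro: set_integrable_subset[OF assms(1)]\<close>)
  ultimately show ?thesis by simp
qed

lemma set_integrable_mult_bounded:
  fixes g h :: "real \<Rightarrow> real"
  assumes "set_integrable lebesgue A g" "set_borel_measurable lebesgue A h" "\<And>x. x \<in> A \<Longrightarrow> \<bar>h x\<bar> \<le> M"
  shows "set_integrable lebesgue A (\<lambda>x. h x * g x)"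
proof -
  have eq: "(\<lambda>x. indicator A x *\<^sub>R (h x * g x)) = (\<lambda>x. (indicator A x *\<^sub>R h x) * (indicator A x *\<^sub>R g x))"
    by (auto simp: fun_eq_iff indicator_def)
  show ?thesis
    unfolding set_integrable_def
  proof (rule Bochner_Integration.integrable_bound)
    show "integrable lebesgue (\<lambda>x. M * (indicator A x *\<^sub>R g x))"
      using assms(1) by (simp add: set_integrable_def)
    show "(\<lambda>x. indicator A x *\<^sub>R (h x * g x)) \<in> borel_measurable lebesgue"
      unfolding eq using assms(1,2) by (intro borel_measurable_times) (auto simp: set_integrable_def set_borel_measurable_def)
    show "AE x in lebesgue. norm (indicator A x *\<^sub>R (h x * g x)) \<le> norm (M * (indicator A x *\<^sub>R g x))"
    proof (rule AE_I2)
      fix x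
      show "norm (indicator A x *\<^sub>R (h x * g x)) \<le> norm (M * (indicator A x *\<^sub>R g x))"
      proof (cases "x \<in> A")
        case True
        have "\<bar>h x\<bar> \<le> \<bar>M\<bar>" using assms(3)[OF True] by simp
        then show ?thesis using True by (simp add: abs_mult mult_right_mono)
      qed simp
    qed
  qed
qed

lemma set_borel_measurable_continuous_lebesgue:
  fixes h :: "real \<Rightarrow> real"
  assumes "continuous_on {a..b} h"
  shows "set_borel_measurable lebesgue {a..b} h"
proof -
  have "(\<lambda>x. indicator {a..b} x *\<^sub>R h x) \<in> borel_measurable borel"
    by (rule borel_measurable_continuous_on_indicator[OF _ assms]) simp
  then show ?thesis by (simp add: set_borel_measurable_def measurable_completion)
qed

text \<open>The mean value theorem is applied to one coordinate at a time.\<close>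

definition hybrid :: "nat \<Rightarrow> (real \<Rightarrow> nat \<Rightarrow> real) \<Rightarrow> nat \<Rightarrow> real \<times> real \<times> real \<Rightarrow> nat \<Rightarrow> real" where
  "hybrid k x j = (\<lambda>(s, t, \<theta>) i. if i < k then
     (if i < j then x t i else if i = j then x s i + \<theta> * (x t i - x s i) else x s i) else 0)"

text \<open>The hypothesis on \<phi> speaks of partial derivatives, which suffice for steps parallel
  to the axes. In \<open>Z j\<close> the first \<open>j\<close> coordinates are already taken at
  time \<open>t\<close>, and step \<open>j\<close> moves coordinate \<open>j\<close> alone.\<close>

lemma C1_increment:
  assumes \<phi>: "C1_compact_support k \<phi>"
    and x0: "\<And>j t. k \<le> j \<Longrightarrow> x t j = 0"
  obtains \<theta> where "\<And>j. j < k \<Longrightarrow> \<theta> j \<in> {0..1}"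
    "\<phi> (x t) - \<phi> (x s) = (\<Sum>j<k. coord_deriv \<phi> j (hybrid k x j (s, t, \<theta> j)) * (x t j - x s j))"
proof -
  define Z where "Z j = (\<lambda>i. if i < k then if i < j then x t i else x s i else 0)" for j
  have "\<exists>\<theta>\<in>{0..1}. \<phi> (Z (Suc j)) - \<phi> (Z j) = coord_deriv \<phi> j (hybrid k x j (s, t, \<theta>)) * (x t j - x s j)"
    if j: "j < k" for j
  proof -
    let ?y = "\<lambda>\<theta>. (Z j)(j := x s j + \<theta> * (x t j - x s j))"
    have hy: "hybrid k x j (s, t, \<theta>) = ?y \<theta>" for \<theta>
      using j by (auto simp: hybrid_def Z_def fun_eq_iff)
    have top: "?y \<theta> \<in> topspace (Euclidean_space k)" for \<theta>
      using j by (auto simp: Z_def topspace_Euclidean_space)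
    have D: "((\<lambda>\<sigma>. \<phi> ((Z j)(j := \<sigma>))) has_real_derivative coord_deriv \<phi> j (?y \<theta>)) (at (x s j + \<theta> * (x t j - x s j)))" for \<theta>
    proof -
      have "(\<lambda>\<sigma>. \<phi> ((?y \<theta>)(j := \<sigma>))) differentiable (at ((?y \<theta>) j))"
        using \<phi> j top unfolding C1_compact_support_def by blast
      then show ?thesis
        by (simp add: coord_deriv_def DERIV_deriv_iff_real_differentiable)
    qed
    have "\<exists>z>0. z < 1 \<and> \<phi> (?y 1) - \<phi> (?y 0) = (1 - 0) * (coord_deriv \<phi> j (?y z) * (x t j - x s j))"
    proof (rule MVT2)
      fix \<theta> :: real
      have "((\<lambda>\<theta>. x s j + \<theta> * (x t j - x s j)) has_real_derivative (x t j - x s j)) (at \<theta>)"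
        by (auto intro!: derivative_eq_intros)
      from DERIV_chain2[OF D this]
      show "((\<lambda>\<theta>. \<phi> (?y \<theta>)) has_real_derivative coord_deriv \<phi> j (?y \<theta>) * (x t j - x s j)) (at \<theta>)" .
    qed simp
    moreover have "?y 1 = Z (Suc j)" "?y 0 = Z j" using j by (auto simp: Z_def fun_eq_iff)
    ultimately show ?thesis unfolding hy by (metis atLeastAtMost_iff less_imp_le mult_1 diff_zero)
  qed
  then obtain \<theta> where \<theta>: "\<And>j. j < k \<Longrightarrow> \<theta> j \<in> {0..1}"
    "\<And>j. j < k \<Longrightarrow> \<phi> (Z (Suc j)) - \<phi> (Z j) = coord_deriv \<phi> j (hybrid k x j (s, t, \<theta> j)) * (x t j - x s j)"
    by metis
  have Zs: "Z 0 = x s" "Z k = x t" using x0 by (auto simp: Z_def fun_eq_iff not_less)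
  have "\<phi> (x t) - \<phi> (x s) = (\<Sum>j<k. \<phi> (Z (Suc j)) - \<phi> (Z j))"
    using sum_lessThan_telescope[of "\<lambda>j. \<phi> (Z j)" k] by (simp add: Zs)
  also have "\<dots> = (\<Sum>j<k. coord_deriv \<phi> j (hybrid k x j (s, t, \<theta> j)) * (x t j - x s j))"
    by (rule sum.cong) (auto simp: \<theta>)
  finally show ?thesis using that \<theta>(1) by blast
qed

text \<open>The coordinates are indefinite integrals and need not be differentiable everywhere. On a
  short interval the increment of \<phi> is an integral with coefficients frozen at intermediate
  points; uniform continuity makes the error at most \<open>e\<close> times the integral of the sum
  of the |g j|. Such an estimate adds up over adjacent intervals, so bisection extends it to the
  whole interval, and then \<open>e\<close> tends to zero.\<close>

lemma chain_rule_C1: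
  fixes x :: "real \<Rightarrow> nat \<Rightarrow> real" and g :: "nat \<Rightarrow> real \<Rightarrow> real"
  assumes \<phi>: "C1_compact_support k \<phi>" and ab: "a \<le> b"
    and gi: "\<And>j. j < k \<Longrightarrow> set_integrable lebesgue {a..b} (g j)"
    and xg: "\<And>j s t. j < k \<Longrightarrow> a \<le> s \<Longrightarrow> s \<le> t \<Longrightarrow> t \<le> b \<Longrightarrow> x t j - x s j = (LINT r:{s<..t}|lebesgue. g j r)"
    and xc: "\<And>j. j < k \<Longrightarrow> continuous_on {a..b} (\<lambda>t. x t j)"
    and x0: "\<And>j t. k \<le> j \<Longrightarrow> x t j = 0"
  shows "\<phi> (x b) - \<phi> (x a) = (LINT r:{a<..b}|lebesgue. \<Sum>j<k. coord_deriv \<phi> j (x r) * g j r)"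
proof -
  let ?X = "{a..b} \<times> {a..b} \<times> {0..1::real}"
  let ?\<psi> = "\<lambda>j. coord_deriv \<phi> j"
  have hyb_r: "hybrid k x j (r, r, \<theta>) = x r" for j r \<theta>
    using x0 by (auto simp: hybrid_def fun_eq_iff)
  have hc: "continuous_on ?X (\<lambda>p. ?\<psi> j (hybrid k x j p))" if j: "j < k" for j
  proof -
    have "continuous_map (top_of_set ?X) (Euclidean_space k) (hybrid k x j)"
    proof -
      have eq: "hybrid k x j = (\<lambda>p i. if i < k then (if i < j then x (fst (snd p)) i else if i = j then x (fst p) i + snd (snd p) * (x (fst (snd p)) i - x (fst p) i) else x (fst p) i) else 0)"
        by (auto simp: hybrid_def fun_eq_iff)
      have c1: "continuous_on ?X (\<lambda>p. x (fst (snd p)) i)" if "i < k" for i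
        by (rule continuous_on_compose2[OF xc[OF that]]) (auto intro!: continuous_intros)
      have c2: "continuous_on ?X (\<lambda>p. x (fst p) i)" if "i < k" for i
        by (rule continuous_on_compose2[OF xc[OF that]]) (auto intro!: continuous_intros)
      have "continuous_on ?X (\<lambda>p. if i < j then x (fst (snd p)) i else if i = j then x (fst p) i + snd (snd p) * (x (fst (snd p)) i - x (fst p) i) else x (fst p) i)"
        if "i < k" for i
        using c1[OF that] c2[OF that] by (cases "i < j"; cases "i = j") (auto intro!: continuous_intros)
      then show ?thesis
        unfolding eq continuous_map_componentwise_Euclidean_space continuous_map_iff_continuous by blast
    qed
    moreover have "continuous_map (Euclidean_space k) euclideanreal (?\<psi> j)"
      using \<phi> j by (simp add: C1_compact_support_def)
    ultimately have "continuous_map (top_of_set ?X) euclideanreal (?\<psi> j \<circ> hybrid k x j)"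
      by (rule continuous_map_compose)
    then show ?thesis by (simp add: o_def)
  qed
  have \<psi>c: "continuous_on {a..b} (\<lambda>r. ?\<psi> j (x r))" if j: "j < k" for j
  proof -
    have "continuous_on {a..b} (\<lambda>r. ?\<psi> j (hybrid k x j (r, r, 0)))"
      by (rule continuous_on_compose2[OF hc[OF j]]) (auto intro!: continuous_intros)
    then show ?thesis by (simp add: hyb_r)
  qed
  have hi: "set_integrable lebesgue {a..b} (\<lambda>r. ?\<psi> j (x r) * g j r)" if j: "j < k" for j
  proof -
    have "compact ((\<lambda>r. ?\<psi> j (x r)) ` {a..b})" by (intro compact_continuous_image \<psi>c j) simp
    then have "bounded ((\<lambda>r. ?\<psi> j (x r)) ` {a..b})" by (rule compact_imp_bounded)
    then obtain M where M: "\<forall>y\<in>(\<lambda>r. ?\<psi> j (x r)) ` {a..b}. norm y \<le> M" unfolding bounded_iff ..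
    show ?thesis
      by (rule set_integrable_mult_bounded[OF gi[OF j] set_borel_measurable_continuous_lebesgue[OF \<psi>c[OF j]], of M])
         (use M in auto)
  qed
  have hsi: "set_integrable lebesgue A (\<lambda>r. \<Sum>j<k. ?\<psi> j (x r) * g j r)" if "A \<subseteq> {a..b}" "A \<in> sets lebesgue" for A
    unfolding set_integrable_def scaleR_sum_right
    using set_integrable_subset[OF hi that(2,1)] by (intro Bochner_Integration.integrable_sum) (auto simp: set_integrable_def)
  have gsi: "set_integrable lebesgue A (\<lambda>r. \<Sum>j<k. \<bar>g j r\<bar>)" if "A \<subseteq> {a..b}" "A \<in> sets lebesgue" for A
    unfolding set_integrable_def scaleR_sum_right
    using set_integrable_abs[OF set_integrable_subset[OF gi that(2,1)]] by (intro Bochner_Integration.integrable_sum) (auto simp: set_integrable_def)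
  define h where "h r = (\<Sum>j<k. ?\<psi> j (x r) * g j r)" for r
  define G where "G r = (\<Sum>j<k. \<bar>g j r\<bar>)" for r
  have le: "\<bar>\<phi> (x b) - \<phi> (x a) - (LINT r:{a<..b}|lebesgue. h r)\<bar> \<le> e * (LINT r:{a<..b}|lebesgue. G r)" if e: "e > 0" for e
  proof -
    have "\<exists>d>0. \<forall>p\<in>?X. \<forall>q\<in>?X. dist q p < d \<longrightarrow> dist (?\<psi> j (hybrid k x j q)) (?\<psi> j (hybrid k x j p)) < e" if j: "j < k" for j
    proof -
      have "compact ?X" by (intro compact_Times) auto
      then show ?thesis
        using compact_uniformly_continuous[OF hc[OF j]] e unfolding uniformly_continuous_on_def by blast
    qed
    then obtain d where d: "\<And>j. j < k \<Longrightarrow> d j > 0"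
      "\<And>j p q. j < k \<Longrightarrow> p \<in> ?X \<Longrightarrow> q \<in> ?X \<Longrightarrow> dist q p < d j \<Longrightarrow> dist (?\<psi> j (hybrid k x j q)) (?\<psi> j (hybrid k x j p)) < e"
      by metis
    \<comment> \<open>The inserted 1 keeps the set nonempty when \<open>k = 0\<close>.\<close>
    define \<delta> where "\<delta> = Min (insert 1 (d ` {..<k}))"
    have \<delta>: "\<delta> > 0" "\<And>j. j < k \<Longrightarrow> \<delta> \<le> d j" using d(1) by (auto simp: \<delta>_def)
    define P where "P s t \<longleftrightarrow> (a \<le> s \<and> s \<le> t \<and> t \<le> b \<longrightarrow>
      \<bar>\<phi> (x t) - \<phi> (x s) - (LINT r:{s<..t}|lebesgue. h r)\<bar> \<le> e * (LINT r:{s<..t}|lebesgue. G r))" for s t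
    have "P a b"
      using ab
    proof (induction rule: Bolzano)
      case (trans s t r)
      show ?case unfolding P_def
      proof (intro impI, elim conjE)
        assume st: "a \<le> s" "s \<le> r" "r \<le> b"
        have H: "(LINT q:{s<..r}|lebesgue. h q) = (LINT q:{s<..t}|lebesgue. h q) + (LINT q:{t<..r}|lebesgue. h q)"
          using hsi[of "{a..b}"] trans st by (intro set_integral_Ioc_add[of a b]) (auto simp: h_def)
        have G: "(LINT q:{s<..r}|lebesgue. G q) = (LINT q:{s<..t}|lebesgue. G q) + (LINT q:{t<..r}|lebesgue. G q)"
          using gsi[of "{a..b}"] trans st by (intro set_integral_Ioc_add[of a b]) (auto simp: G_def)
        have "\<bar>\<phi> (x t) - \<phi> (x s) - (LINT q:{s<..t}|lebesgue. h q)\<bar> \<le> e * (LINT q:{s<..t}|lebesgue. G q)"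
          "\<bar>\<phi> (x r) - \<phi> (x t) - (LINT q:{t<..r}|lebesgue. h q)\<bar> \<le> e * (LINT q:{t<..r}|lebesgue. G q)"
          using trans st by (auto simp: P_def)
        then show "\<bar>\<phi> (x r) - \<phi> (x s) - (LINT q:{s<..r}|lebesgue. h q)\<bar> \<le> e * (LINT q:{s<..r}|lebesgue. G q)"
          unfolding H G by (simp add: distrib_left)
      qed
    next
      case (local s0)
      have "P s t" if stp: "t - s < \<delta> / 2" for s t
        unfolding P_def
      proof (intro impI, elim conjE)
        assume st: "a \<le> s" "s \<le> t" "t \<le> b"
        have sub: "{s<..t} \<subseteq> {a..b}" "{s<..t} \<in> sets lebesgue" using st by auto
        obtain \<theta> where \<theta>: "\<And>j. j < k \<Longrightarrow> \<theta> j \<in> {0..1}"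
          "\<phi> (x t) - \<phi> (x s) = (\<Sum>j<k. ?\<psi> j (hybrid k x j (s, t, \<theta> j)) * (x t j - x s j))"
          using C1_increment[OF \<phi>, where x=x and t=t and s=s, OF x0] by blast
        define c where "c j = ?\<psi> j (hybrid k x j (s, t, \<theta> j))" for j
        have near: "\<bar>c j - ?\<psi> j (x r)\<bar> \<le> e" if j: "j < k" and r: "r \<in> {s<..t}" for j r
        proof -
          have "dist (s, t, \<theta> j) (r, r, \<theta> j) \<le> dist s r + dist t r"
            using norm_Pair_le[of "s - r" "(t - r, 0)"] by (simp add: dist_norm)
          also have "\<dots> < d j" using r stp \<delta>(2)[OF j] by (auto simp: dist_real_def)
          finally have "dist (?\<psi> j (hybrid k x j (s, t, \<theta> j))) (?\<psi> j (hybrid k x j (r, r, \<theta> j))) < e"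
            using d(2)[OF j, of "(r, r, \<theta> j)" "(s, t, \<theta> j)"] \<theta>(1)[OF j] st r by auto
          then show ?thesis by (simp add: hyb_r c_def dist_real_def)
        qed
        have ci: "set_integrable lebesgue {s<..t} (\<lambda>r. \<Sum>j<k. c j * g j r)"
          unfolding set_integrable_def scaleR_sum_right
          using set_integrable_mult_right[OF set_integrable_subset[OF gi sub(2,1)]]
          by (intro Bochner_Integration.integrable_sum) (auto simp: set_integrable_def)
        have inc: "\<phi> (x t) - \<phi> (x s) = (LINT r:{s<..t}|lebesgue. \<Sum>j<k. c j * g j r)"
        proof -
          have "(LINT r:{s<..t}|lebesgue. \<Sum>j<k. c j * g j r) = (\<Sum>j<k. LINT r:{s<..t}|lebesgue. c j * g j r)"
            unfolding set_lebesgue_integral_def scaleR_sum_right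
            by (rule Bochner_Integration.integral_sum)
               (use set_integrable_mult_right[OF set_integrable_subset[OF gi sub(2,1)]] in \<open>auto simp: set_integrable_def\<close>)
          also have "\<dots> = (\<Sum>j<k. c j * (x t j - x s j))"
            using st by (intro sum.cong refl) (simp add: xg)
          finally show ?thesis using \<theta>(2) by (simp add: c_def)
        qed
        have hs: "set_integrable lebesgue {s<..t} h" and Gs: "set_integrable lebesgue {s<..t} G"
          using hsi[OF sub] gsi[OF sub] by (simp_all add: h_def[abs_def] G_def[abs_def])
        have "\<phi> (x t) - \<phi> (x s) - (LINT r:{s<..t}|lebesgue. h r) = (LINT r:{s<..t}|lebesgue. (\<Sum>j<k. c j * g j r) - h r)"
          unfolding inc using ci hs by (simp add: set_integral_diff)
        also have "\<bar>\<dots>\<bar> \<le> (LINT r:{s<..t}|lebesgue. \<bar>(\<Sum>j<k. c j * g j r) - h r\<bar>)"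
          unfolding set_lebesgue_integral_def
          using integral_abs_bound[of lebesgue "\<lambda>r. indicator {s<..t} r *\<^sub>R ((\<Sum>j<k. c j * g j r) - h r)"]
          by (simp add: abs_mult)
        also have "\<dots> \<le> (LINT r:{s<..t}|lebesgue. e * G r)"
        proof (rule set_integral_mono)
          show "set_integrable lebesgue {s<..t} (\<lambda>r. \<bar>(\<Sum>j<k. c j * g j r) - h r\<bar>)"
            using ci hs by (intro set_integrable_abs) (simp add: set_integral_diff)
          show "set_integrable lebesgue {s<..t} (\<lambda>r. e * G r)" using Gs by simp
          fix r assume r: "r \<in> {s<..t}"
          have "\<bar>(\<Sum>j<k. c j * g j r) - h r\<bar> = \<bar>\<Sum>j<k. (c j - ?\<psi> j (x r)) * g j r\<bar>"
            by (simp add: h_def sum_subtractf left_diff_distrib)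
          also have "\<dots> \<le> (\<Sum>j<k. \<bar>(c j - ?\<psi> j (x r)) * g j r\<bar>)" by (rule sum_abs)
          also have "\<dots> \<le> (\<Sum>j<k. e * \<bar>g j r\<bar>)"
            unfolding abs_mult by (intro sum_mono mult_right_mono near r) auto
          finally show "\<bar>(\<Sum>j<k. c j * g j r) - h r\<bar> \<le> e * G r" by (simp add: G_def sum_distrib_left)
        qed
        finally show "\<bar>\<phi> (x t) - \<phi> (x s) - (LINT r:{s<..t}|lebesgue. h r)\<bar> \<le> e * (LINT r:{s<..t}|lebesgue. G r)" by simp
      qed
      then show ?case using \<delta>(1) by (intro exI[of _ "\<delta> / 2"]) auto
    qed
    then show ?thesis using ab by (simp add: P_def)
  qed
  define L where "L = (LINT r:{a<..b}|lebesgue. G r)"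
  have L0: "0 \<le> L"
    unfolding L_def set_lebesgue_integral_def by (intro integral_nonneg_AE) (auto simp: G_def sum_nonneg)
  have "\<bar>\<phi> (x b) - \<phi> (x a) - (LINT r:{a<..b}|lebesgue. h r)\<bar> \<le> 0"
  proof (rule field_le_epsilon)
    fix e :: real assume e: "e > 0"
    \<comment> \<open>\<open>L\<close> may be zero, hence the divisor \<open>L + 1\<close>.\<close>
    have "\<bar>\<phi> (x b) - \<phi> (x a) - (LINT r:{a<..b}|lebesgue. h r)\<bar> \<le> (e / (L + 1)) * L"
      unfolding L_def by (rule le) (use e L0 in \<open>simp add: L_def\<close>)
    also have "\<dots> \<le> e" using e L0 by (simp add: divide_simps mult_left_mono)
    finally show "\<bar>\<phi> (x b) - \<phi> (x a) - (LINT r:{a<..b}|lebesgue. h r)\<bar> \<le> 0 + e" by simp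
  qed
  then show ?thesis by (simp add: h_def)
qed

text \<open>On the compact support continuity gives the bounds. Off it \<phi> vanishes near the
  point along every coordinate line, so the partial derivatives are zero there.\<close>

lemma C1_compact_support_bounded:
  assumes \<phi>: "C1_compact_support k \<phi>"
  obtains M where "\<And>y. y \<in> topspace (Euclidean_space k) \<Longrightarrow> \<bar>\<phi> y\<bar> \<le> M"
    "\<And>y j. j < k \<Longrightarrow> y \<in> topspace (Euclidean_space k) \<Longrightarrow> \<bar>coord_deriv \<phi> j y\<bar> \<le> M"
proof -
  let ?E = "Euclidean_space k"
  define K where "K = ?E closure_of {x \<in> topspace ?E. \<phi> x \<noteq> 0}"
  have K: "compactin ?E K" using \<phi> by (simp add: C1_compact_support_def K_def)
  have sub: "{x \<in> topspace ?E. \<phi> x \<noteq> 0} \<subseteq> K" unfolding K_def by (rule closure_of_subset) auto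
  have bd: "\<exists>M. \<forall>y\<in>K. \<bar>h y\<bar> \<le> M" if "continuous_map ?E euclideanreal h" for h
  proof -
    have "compact (h ` K)" using image_compactin[OF K that] by simp
    then have "bounded (h ` K)" by (rule compact_imp_bounded)
    then show ?thesis unfolding bounded_iff by auto
  qed
  have out: "coord_deriv \<phi> j y = 0" if j: "j < k" and y: "y \<in> topspace ?E" "y \<notin> K" for j y
  proof -
    have up: "continuous_map euclideanreal ?E (\<lambda>s. y(j := s))"
    proof -
      have eq: "(\<lambda>s. y(j := s)) = (\<lambda>s i. if i < k then (if i = j then s else y i) else 0)"
        using y j by (auto simp: fun_eq_iff topspace_Euclidean_space)
      have "continuous_on UNIV (\<lambda>s. if i = j then s else y i)" for i by (cases "i = j") (auto intro: continuous_intros)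
      then show ?thesis unfolding eq continuous_map_componentwise_Euclidean_space by simp
    qed
    have "openin ?E (topspace ?E - K)" unfolding K_def by (intro openin_diff) auto
    from openin_continuous_map_preimage[OF up this]
    have "open {s. y(j := s) \<in> topspace ?E - K}" by simp
    moreover have "y j \<in> {s. y(j := s) \<in> topspace ?E - K}" using y by simp
    ultimately have "\<forall>\<^sub>F s in nhds (y j). y(j := s) \<in> topspace ?E - K"
      using eventually_nhds by blast
    then have "\<forall>\<^sub>F s in nhds (y j). \<phi> (y(j := s)) = 0"
      by eventually_elim (use sub in auto)
    then have "deriv (\<lambda>s. \<phi> (y(j := s))) (y j) = deriv (\<lambda>s. 0) (y j)"
      by (rule deriv_cong_ev) simp
    then show ?thesis by (simp add: coord_deriv_def)
  qed
  obtain M0 where M0: "\<forall>y\<in>K. \<bar>\<phi> y\<bar> \<le> M0"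
    using bd[of \<phi>] \<phi> by (auto simp: C1_compact_support_def)
  have "\<exists>M. \<forall>y\<in>K. \<bar>coord_deriv \<phi> j y\<bar> \<le> M" if "j < k" for j
    using bd[of "coord_deriv \<phi> j"] \<phi> that by (auto simp: C1_compact_support_def)
  then obtain M1 where M1: "\<And>j y. j < k \<Longrightarrow> y \<in> K \<Longrightarrow> \<bar>coord_deriv \<phi> j y\<bar> \<le> M1 j" by metis
  define M where "M = \<bar>M0\<bar> + (\<Sum>j<k. \<bar>M1 j\<bar>)"
  have Mj: "\<bar>M1 j\<bar> \<le> M" if "j < k" for j
    unfolding M_def using member_le_sum[of j "{..<k}" "\<lambda>j. \<bar>M1 j\<bar>"] that by simp
  have Mn: "0 \<le> M" "\<bar>M0\<bar> \<le> M" unfolding M_def by (auto intro: sum_nonneg add_nonneg_nonneg)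
  show ?thesis
  proof (rule that[of M])
    fix y assume y: "y \<in> topspace ?E"
    show "\<bar>\<phi> y\<bar> \<le> M"
    proof (cases "y \<in> K")
      case True then show ?thesis using M0 Mn(2) by force
    next
      case False then show ?thesis using sub y Mn by auto
    qed
    show "\<bar>coord_deriv \<phi> j y\<bar> \<le> M" if j: "j < k" for j
    proof (cases "y \<in> K")
      case True then show ?thesis using M1[OF j True] Mj[OF j] by linarith
    next
      case False then show ?thesis using out[OF j y] Mn by simp
    qed
  qed
qed

lemma continuous_on_indefinite_integral:
  fixes g :: "real \<Rightarrow> real"
  assumes gi: "set_integrable lebesgue {a..b} g"
  shows "continuous_on {a..b} (\<lambda>s. LINT r:{a<..s}|lebesgue. g r)"
proof (rule continuous_on_sequentiallyI)
  fix u s assume u: "\<forall>n. u n \<in> {a..b}" "s \<in> {a..b}" "u \<longlonglongrightarrow> s"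
  show "(\<lambda>n. LINT r:{a<..u n}|lebesgue. g r) \<longlonglongrightarrow> (LINT r:{a<..s}|lebesgue. g r)"
    unfolding set_lebesgue_integral_def
  proof (rule integral_dominated_convergence)
    show "integrable lebesgue (\<lambda>r. \<bar>indicator {a..b} r *\<^sub>R g r\<bar>)"
      using gi by (simp add: set_integrable_def)
    show "AE r in lebesgue. norm (indicator {a<..u n} r *\<^sub>R g r) \<le> \<bar>indicator {a..b} r *\<^sub>R g r\<bar>" for n
      using u(1) by (intro AE_I2) (auto simp: indicator_def dest: spec[of _ n])
    have "set_integrable lebesgue {a<..t} g" if "t \<in> {a..b}" for t
      by (rule set_integrable_subset[OF gi]) (use that in auto)
    then show "(\<lambda>r. indicator {a<..s} r *\<^sub>R g r) \<in> borel_measurable lebesgue"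
      "(\<lambda>r. indicator {a<..u n} r *\<^sub>R g r) \<in> borel_measurable lebesgue" for n
      using u by (auto simp: set_integrable_def)
    have "AE r in lebesgue. r \<noteq> s" by (rule AE_completion) (rule AE_lborel_singleton)
    then show "AE r in lebesgue. (\<lambda>n. indicator {a<..u n} r *\<^sub>R g r) \<longlonglongrightarrow> indicator {a<..s} r *\<^sub>R g r"
    proof eventually_elim
      case (elim r)
      have "\<forall>\<^sub>F n in sequentially. indicat_real {a<..u n} r = indicator {a<..s} r"
      proof (cases "r < s")
        case True
        then have "\<forall>\<^sub>F n in sequentially. r < u n" using u(3) by (simp add: order_tendstoD)
        then show ?thesis by eventually_elim (use True in \<open>auto simp: indicator_def\<close>)
      next
        case False
        then have "s < r" using elim by simp
        then have "\<forall>\<^sub>F n in sequentially. u n < r" using u(3) by (simp add: order_tendstoD)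
        then show ?thesis by eventually_elim (use \<open>s < r\<close> in \<open>auto simp: indicator_def\<close>)
      qed
      then have "\<forall>\<^sub>F n in sequentially. indicator {a<..s} r *\<^sub>R g r = indicator {a<..u n} r *\<^sub>R g r"
        by eventually_elim simp
      then show ?case by (rule Lim_transform_eventually[OF tendsto_const])
    qed
  qed
qed

section \<open>Composing the energy of a path with an energy function\<close>

lemma energy_function_deriv_nonneg:
  assumes "energy_function \<psi> \<psi>'" "0 \<le> y"
  shows "0 \<le> \<psi>' y"
proof -
  have "(\<psi> has_real_derivative \<psi>' y) (at y within {0..})" and mono: "mono_on {0..} \<psi>"
    using assms by (auto simp: energy_function_def)
  then have "((\<lambda>z. (\<psi> z - \<psi> y) / (z - y)) \<longlongrightarrow> \<psi>' y) (at y within {0..})"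
    by (simp add: has_field_derivative_iff)
  then have "((\<lambda>z. (\<psi> z - \<psi> y) / (z - y)) \<longlongrightarrow> \<psi>' y) (at_right y)"
    by (rule tendsto_within_subset) (use assms(2) in auto)
  moreover have "\<forall>\<^sub>F z in at_right y. 0 \<le> (\<psi> z - \<psi> y) / (z - y)"
    using eventually_at_right_less[of y]
  proof eventually_elim
    case (elim z)
    then have "\<psi> y \<le> \<psi> z" using mono_onD[OF mono, of y z] assms(2) by simp
    then show ?case using elim by simp
  qed
  ultimately show ?thesis by (rule tendsto_lowerbound) (simp add: trivial_limit_at_right_real)
qed

text \<open>The energy can rise as well as fall over an interval, so both orders of \<open>A\<close>
  and \<open>B\<close> have to be covered.\<close>

lemma energy_function_mvt:
  assumes e: "energy_function \<psi> \<psi>'" and AB: "0 \<le> A" "0 \<le> B"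
  shows "\<exists>\<xi>. min A B \<le> \<xi> \<and> \<xi> \<le> max A B \<and> \<psi> B - \<psi> A = \<psi>' \<xi> * (B - A)"
proof -
  have d: "(\<psi> has_derivative (*) (\<psi>' x)) (at x within {u..v})" if "0 \<le> u" "u \<le> x" for x u v
  proof (rule has_derivative_subset)
    show "(\<psi> has_derivative (*) (\<psi>' x)) (at x within {0..})"
      using e that by (simp add: energy_function_def has_field_derivative_def)
  qed (use that in auto)
  have *: "\<exists>\<xi>\<in>{u<..<v}. \<psi> v - \<psi> u = \<psi>' \<xi> * (v - u)" if "0 \<le> u" "u < v" for u v
    by (rule mvt_simple[OF that(2)]) (use d that in auto)
  consider "A = B" | "A < B" | "B < A" by linarith
  then show ?thesis
  proof cases
    case 1 then show ?thesis by auto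
  next
    case 2
    then obtain \<xi> where "\<xi> \<in> {A<..<B}" "\<psi> B - \<psi> A = \<psi>' \<xi> * (B - A)" using * AB by blast
    then show ?thesis by (intro exI[of _ \<xi>]) auto
  next
    case 3
    then obtain \<xi> where "\<xi> \<in> {B<..<A}" "\<psi> A - \<psi> B = \<psi>' \<xi> * (A - B)" using * AB by blast
    then show ?thesis by (intro exI[of _ \<xi>]) (auto simp: algebra_simps)
  qed
qed

text \<open>The bound on \<open>B - A\<close> is one-sided and survives because the intermediate
  value of \<psi>' is nonnegative. Inside the interval \<theta> stays close to one number
  \<open>l\<close>, so that this value may be exchanged for \<psi>' along \<theta> at the cost of
  \<epsilon>. The end values \<open>A\<close> and \<open>B\<close> are free, which allows one-sided
  limits in place of values of \<theta>.\<close>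

lemma energy_piece:
  fixes g \<theta> :: "real \<Rightarrow> real"
  assumes e: "energy_function \<psi> \<psi>'" and st: "s \<le> t"
    and gi: "set_integrable lebesgue {s<..t} g" and hi: "set_integrable lebesgue {s<..t} (\<lambda>r. \<psi>' (\<theta> r) * g r)"
    and \<theta>: "\<And>r. s < r \<Longrightarrow> r < t \<Longrightarrow> 0 \<le> \<theta> r \<and> \<bar>\<theta> r - l\<bar> < \<eta>"
    and AB: "0 \<le> A" "0 \<le> B" "\<bar>A - l\<bar> < \<eta>" "\<bar>B - l\<bar> < \<eta>" "B - A \<le> (LINT r:{s<..t}|lebesgue. g r)"
    and near: "\<And>y. 0 \<le> y \<Longrightarrow> \<bar>y - l\<bar> < \<eta> \<Longrightarrow> \<bar>\<psi>' y - \<psi>' l\<bar> \<le> \<epsilon> / 2"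
  shows "\<psi> B - \<psi> A \<le> (LINT r:{s<..t}|lebesgue. \<psi>' (\<theta> r) * g r) + \<epsilon> * (LINT r:{s<..t}|lebesgue. \<bar>g r\<bar>)"
proof -
  obtain \<xi> where \<xi>: "min A B \<le> \<xi>" "\<xi> \<le> max A B" "\<psi> B - \<psi> A = \<psi>' \<xi> * (B - A)"
    using energy_function_mvt[OF e AB(1,2)] by blast
  have \<xi>0: "0 \<le> \<xi>" "\<bar>\<xi> - l\<bar> < \<eta>" using \<xi>(1,2) AB by (auto simp: min_def max_def abs_less_iff split: if_splits)
  have "\<psi> B - \<psi> A \<le> \<psi>' \<xi> * (LINT r:{s<..t}|lebesgue. g r)"
    unfolding \<xi>(3) by (intro mult_left_mono AB energy_function_deriv_nonneg[OF e \<xi>0(1)])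
  also have "\<dots> = (LINT r:{s<..t}|lebesgue. \<psi>' \<xi> * g r)" by simp
  also have "\<dots> \<le> (LINT r:{s<..t}|lebesgue. \<psi>' (\<theta> r) * g r + \<epsilon> * \<bar>g r\<bar>)"
  proof (rule set_integral_mono_AE)
    show "set_integrable lebesgue {s<..t} (\<lambda>r. \<psi>' \<xi> * g r)" using gi by simp
    show "set_integrable lebesgue {s<..t} (\<lambda>r. \<psi>' (\<theta> r) * g r + \<epsilon> * \<bar>g r\<bar>)"
      using hi set_integrable_abs[OF gi] by simp
    have "AE r in lebesgue. r \<noteq> t" by (rule AE_completion) (rule AE_lborel_singleton)
    then show "AE r\<in>{s<..t} in lebesgue. \<psi>' \<xi> * g r \<le> \<psi>' (\<theta> r) * g r + \<epsilon> * \<bar>g r\<bar>"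
    proof eventually_elim
      case (elim r)
      show ?case
      proof
        assume "r \<in> {s<..t}"
        then have "s < r" "r < t" using elim by auto
        then have r: "0 \<le> \<theta> r" "\<bar>\<theta> r - l\<bar> < \<eta>" using \<theta>[of r] by auto
        have "\<bar>\<psi>' \<xi> - \<psi>' (\<theta> r)\<bar> \<le> \<epsilon>"
          using near[OF \<xi>0] near[OF r] by linarith
        then have "(\<psi>' \<xi> - \<psi>' (\<theta> r)) * g r \<le> \<epsilon> * \<bar>g r\<bar>"
          using mult_right_mono[of "\<bar>\<psi>' \<xi> - \<psi>' (\<theta> r)\<bar>" \<epsilon> "\<bar>g r\<bar>"] abs_ge_self[of "(\<psi>' \<xi> - \<psi>' (\<theta> r)) * g r"]
          by (simp add: abs_mult)
        then show "\<psi>' \<xi> * g r \<le> \<psi>' (\<theta> r) * g r + \<epsilon> * \<bar>g r\<bar>" by (simp add: left_diff_distrib)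
      qed
    qed
  qed
  also have "\<dots> = (LINT r:{s<..t}|lebesgue. \<psi>' (\<theta> r) * g r) + \<epsilon> * (LINT r:{s<..t}|lebesgue. \<bar>g r\<bar>)"
    using hi set_integrable_abs[OF gi] by simp
  finally show ?thesis .
qed

text \<open>The energy of a Leray-Hopf solution is, along the good times, a nonincreasing function plus an
  integral; the infimum extends that monotone part to all times, where it has one-sided limits.\<close>

lemma energy_chain:
  fixes g \<theta> :: "real \<Rightarrow> real"
  assumes e: "energy_function \<psi> \<psi>'" and ab: "a \<le> b"
    and gi: "set_integrable lebesgue {a..b} g"
    and \<theta>0: "\<And>s. a \<le> s \<Longrightarrow> s \<le> b \<Longrightarrow> 0 \<le> \<theta> s"
    and hi: "set_integrable lebesgue {a..b} (\<lambda>r. \<psi>' (\<theta> r) * g r)"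
    and good: "AE s in lebesgue. s \<in> {a..b} \<longrightarrow> Good s" "Good a"
    and mono: "\<And>s t. Good s \<Longrightarrow> a \<le> s \<Longrightarrow> s \<le> t \<Longrightarrow> t \<le> b \<Longrightarrow> \<theta> t - \<theta> s \<le> (LINT r:{s<..t}|lebesgue. g r)"
  shows "\<psi> (\<theta> b) \<le> \<psi> (\<theta> a) + (LINT r:{a<..b}|lebesgue. \<psi>' (\<theta> r) * g r)"
proof -
  define G where "G s = (LINT r:{a<..s}|lebesgue. g r)" for s
  have Gd: "G t - G s = (LINT r:{s<..t}|lebesgue. g r)" if "a \<le> s" "s \<le> t" "t \<le> b" for s t
    unfolding G_def using set_integral_Ioc_add[OF gi, of a s t] that by simp
  define m where "m s = \<theta> s - G s" for s
  have m_mono: "m t \<le> m s" if "Good s" "a \<le> s" "s \<le> t" "t \<le> b" for s t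
    using mono[OF that] Gd[OF that(2-4)] by (simp add: m_def)
  define R where "R s = {r. Good r \<and> a \<le> r \<and> r \<le> s}" for s
  define M where "M s = Inf (m ` R s)" for s
  have Rne: "a \<in> R s" if "a \<le> s" for s using that good(2) by (simp add: R_def)
  have low: "m s \<le> y" if "a \<le> s" "s \<le> b" "y \<in> m ` R s" for s y
    using that m_mono by (auto simp: R_def)
  have bdd: "bdd_below (m ` R s)" if "a \<le> s" "s \<le> b" for s
    using low[OF that] by (intro bdd_belowI)
  have M_low: "m s \<le> M s" if "a \<le> s" "s \<le> b" for s
    unfolding M_def using Rne[OF that(1)] low[OF that] by (intro cInf_greatest) auto
  have M_good: "M s = m s" if "Good s" "a \<le> s" "s \<le> b" for s
  proof (rule antisym)
    show "M s \<le> m s" unfolding M_def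
      by (rule cInf_lower[OF _ bdd[OF that(2,3)]]) (use that in \<open>auto simp: R_def\<close>)
  qed (rule M_low[OF that(2,3)])
  have M_anti: "M t \<le> M s" if "a \<le> s" "s \<le> t" "t \<le> b" for s t
    unfolding M_def using that Rne[of s]
    by (intro cInf_superset_mono bdd) (auto simp: R_def)
  \<comment> \<open>It equals \<theta> at good times, hence almost everywhere and at
    \<open>a\<close>, and dominates \<theta> at all other times. Since \<psi> is nondecreasing, an
    estimate for \<Theta> gives the one for \<theta>.\<close>
  define \<Theta> where "\<Theta> s = G s + M s" for s
  have \<Theta>_good: "\<Theta> s = \<theta> s" if "Good s" "a \<le> s" "s \<le> b" for s
    using M_good[OF that] by (simp add: \<Theta>_def m_def)
  have \<Theta>_ge: "\<theta> s \<le> \<Theta> s" if "a \<le> s" "s \<le> b" for s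
    using M_low[OF that] by (simp add: \<Theta>_def m_def)
  have \<Theta>0: "0 \<le> \<Theta> s" if "a \<le> s" "s \<le> b" for s
    using \<Theta>_ge[OF that] \<theta>0[OF that] by linarith
  have aeeq: "AE r in lebesgue. indicator {a..b} r *\<^sub>R (\<psi>' (\<Theta> r) * g r) = indicator {a..b} r *\<^sub>R (\<psi>' (\<theta> r) * g r)"
    using good(1) by eventually_elim (auto simp: \<Theta>_good indicator_def)
  then have aeeq': "AE r in lebesgue. indicator {a..b} r *\<^sub>R (\<psi>' (\<theta> r) * g r) = indicator {a..b} r *\<^sub>R (\<psi>' (\<Theta> r) * g r)"
    by eventually_elim (rule sym)
  have hi': "set_integrable lebesgue {a..b} (\<lambda>r. \<psi>' (\<Theta> r) * g r)"
    unfolding set_integrable_def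
  proof (rule integrable_cong_AE_imp)
    show "integrable lebesgue (\<lambda>r. indicator {a..b} r *\<^sub>R (\<psi>' (\<theta> r) * g r))" using hi by (simp add: set_integrable_def)
    show "AE r in lebesgue. indicator {a..b} r *\<^sub>R (\<psi>' (\<theta> r) * g r) = indicator {a..b} r *\<^sub>R (\<psi>' (\<Theta> r) * g r)"
      by (rule aeeq')
    have "(\<lambda>r. indicator {a..b} r *\<^sub>R (\<psi>' (\<theta> r) * g r)) \<in> borel_measurable lebesgue"
      using hi by (simp add: set_integrable_def)
    then show "(\<lambda>r. indicator {a..b} r *\<^sub>R (\<psi>' (\<Theta> r) * g r)) \<in> borel_measurable lebesgue"
      by (rule borel_measurable_AE[OF _ aeeq'])
  qed
  have mono\<psi>: "\<psi> u \<le> \<psi> v" if "0 \<le> u" "u \<le> v" for u v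
    using e that mono_onD[of "{0..}" \<psi> u v] by (simp add: energy_function_def)
  have Gc: "\<exists>d>0. \<forall>t\<in>{a..b}. \<bar>t - s\<bar> < d \<longrightarrow> \<bar>G t - G s\<bar> < \<eta>" if "a \<le> s" "s \<le> b" "0 < \<eta>" for s \<eta>
  proof -
    have "continuous_on {a..b} G"
      unfolding G_def by (rule continuous_on_indefinite_integral[OF gi])
    then have "\<exists>d>0. \<forall>t\<in>{a..b}. dist t s < d \<longrightarrow> dist (G t) (G s) < \<eta>"
      unfolding continuous_on_iff using that by simp
    then show ?thesis by (simp add: dist_real_def)
  qed
  have le: "\<psi> (\<Theta> b) - \<psi> (\<Theta> a) \<le> (LINT r:{a<..b}|lebesgue. \<psi>' (\<Theta> r) * g r) + \<epsilon> * (LINT r:{a<..b}|lebesgue. \<bar>g r\<bar>)"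
    if \<epsilon>: "0 < \<epsilon>" for \<epsilon>
  proof -
    define P where "P s t \<longleftrightarrow> (a \<le> s \<and> s \<le> t \<and> t \<le> b \<longrightarrow>
      \<psi> (\<Theta> t) - \<psi> (\<Theta> s) \<le> (LINT r:{s<..t}|lebesgue. \<psi>' (\<Theta> r) * g r) + \<epsilon> * (LINT r:{s<..t}|lebesgue. \<bar>g r\<bar>))" for s t
    have trans: "P s r" if "P s t" "P t r" "s \<le> t" "t \<le> r" for s t r
      unfolding P_def
    proof (intro impI, elim conjE)
      assume st: "a \<le> s" "s \<le> r" "r \<le> b"
      have H: "(LINT q:{s<..r}|lebesgue. \<psi>' (\<Theta> q) * g q) = (LINT q:{s<..t}|lebesgue. \<psi>' (\<Theta> q) * g q) + (LINT q:{t<..r}|lebesgue. \<psi>' (\<Theta> q) * g q)"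
        using that st by (intro set_integral_Ioc_add[OF hi']) auto
      have K: "(LINT q:{s<..r}|lebesgue. \<bar>g q\<bar>) = (LINT q:{s<..t}|lebesgue. \<bar>g q\<bar>) + (LINT q:{t<..r}|lebesgue. \<bar>g q\<bar>)"
        using that st by (intro set_integral_Ioc_add[OF set_integrable_abs[OF gi]]) auto
      have "\<psi> (\<Theta> t) - \<psi> (\<Theta> s) \<le> (LINT q:{s<..t}|lebesgue. \<psi>' (\<Theta> q) * g q) + \<epsilon> * (LINT q:{s<..t}|lebesgue. \<bar>g q\<bar>)"
        "\<psi> (\<Theta> r) - \<psi> (\<Theta> t) \<le> (LINT q:{t<..r}|lebesgue. \<psi>' (\<Theta> q) * g q) + \<epsilon> * (LINT q:{t<..r}|lebesgue. \<bar>g q\<bar>)"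
        using that st by (auto simp: P_def)
      then show "\<psi> (\<Theta> r) - \<psi> (\<Theta> s) \<le> (LINT q:{s<..r}|lebesgue. \<psi>' (\<Theta> q) * g q) + \<epsilon> * (LINT q:{s<..r}|lebesgue. \<bar>g q\<bar>)"
        unfolding H K by (simp add: distrib_left)
    qed
    have near: "\<exists>\<eta>>0. \<forall>y. 0 \<le> y \<and> \<bar>y - l\<bar> < \<eta> \<longrightarrow> \<bar>\<psi>' y - \<psi>' l\<bar> \<le> \<epsilon> / 2" if "0 \<le> l" for l
    proof -
      have "continuous_on {0..} \<psi>'" using e by (simp add: energy_function_def)
      then have "\<forall>x\<in>{0..}. \<forall>e>0. \<exists>d>0. \<forall>y\<in>{0..}. dist y x < d \<longrightarrow> dist (\<psi>' y) (\<psi>' x) < e"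
        unfolding continuous_on_iff .
      from this[rule_format, of l "\<epsilon> / 2"]
      have "\<exists>d>0. \<forall>y\<in>{0..}. dist y l < d \<longrightarrow> dist (\<psi>' y) (\<psi>' l) < \<epsilon> / 2"
        using that \<epsilon> by (simp only: atLeast_iff half_gt_zero)
      then obtain d where "d > 0" "\<forall>y\<in>{0..}. dist y l < d \<longrightarrow> dist (\<psi>' y) (\<psi>' l) < \<epsilon> / 2" by blast
      then show ?thesis by (intro exI[of _ d]) (auto simp: dist_real_def less_imp_le)
    qed
    have sub: "set_integrable lebesgue {s<..t} g" "set_integrable lebesgue {s<..t} (\<lambda>r. \<psi>' (\<Theta> r) * g r)"
      if "a \<le> s" "t \<le> b" for s t
      using that by (auto intro!: set_integrable_subset[OF gi] set_integrable_subset[OF hi'])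
    \<comment> \<open>At \<open>s0\<close> the function \<Theta> may drop to its right limit
      \<open>l\<close>. The drop only lowers \<psi>, and \<open>energy_piece\<close> handles the
      rest of the interval with initial value \<open>l\<close>.\<close>
    have right: "\<exists>d>0. \<forall>t. s0 \<le> t \<and> t - s0 < d \<longrightarrow> P s0 t" if s0: "a \<le> s0" "s0 < b" for s0
    proof -
      define Mright where "Mright = Sup (M ` {s0<..b})"
      define l where "l = Mright + G s0"
      have bddM: "bdd_above (M ` {s0<..b})" using M_anti[of s0] s0 by (intro bdd_aboveI[of _ "M s0"]) auto
      have Mright_ge: "M t \<le> Mright" if "s0 < t" "t \<le> b" for t
        unfolding Mright_def using that by (intro cSup_upper bddM) auto
      have Mright_le: "Mright \<le> M s0" unfolding Mright_def using s0 M_anti[of s0] by (intro cSup_least) auto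
      have close: "\<exists>t1. s0 < t1 \<and> t1 \<le> b \<and> Mright - \<eta> < M t1" if "\<eta> > 0" for \<eta>
        using less_cSupD[of "M ` {s0<..b}" "Mright - \<eta>"] s0 that by (auto simp: Mright_def)
      have approx: "\<exists>d>0. \<forall>t. s0 < t \<and> t < s0 + d \<and> t \<le> b \<longrightarrow> \<bar>\<Theta> t - l\<bar> < \<eta>" if \<eta>: "\<eta> > 0" for \<eta>
      proof -
        obtain t1 where t1: "s0 < t1" "t1 \<le> b" "Mright - \<eta>/2 < M t1" using close[of "\<eta>/2"] \<eta> by auto
        obtain d where d: "d > 0" "\<forall>t\<in>{a..b}. \<bar>t - s0\<bar> < d \<longrightarrow> \<bar>G t - G s0\<bar> < \<eta>/2"
          using Gc[of s0 "\<eta>/2"] s0 \<eta> by auto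
        show ?thesis
        proof (intro exI[of _ "min d (t1 - s0)"] conjI allI impI)
          show "0 < min d (t1 - s0)" using d t1 by simp
          fix t assume t: "s0 < t \<and> t < s0 + min d (t1 - s0) \<and> t \<le> b"
          then have "\<bar>G t - G s0\<bar> < \<eta>/2" using d(2) s0 by auto
          moreover have "M t1 \<le> M t" using t t1 s0 by (intro M_anti) auto
          moreover have "M t \<le> Mright" using t by (intro Mright_ge) auto
          ultimately show "\<bar>\<Theta> t - l\<bar> < \<eta>" using t1(3) unfolding \<Theta>_def l_def by linarith
        qed
      qed
      have l0: "0 \<le> l"
      proof (rule ccontr)
        assume "\<not> 0 \<le> l"
        then obtain d where d: "d > 0" "\<forall>t. s0 < t \<and> t < s0 + d \<and> t \<le> b \<longrightarrow> \<bar>\<Theta> t - l\<bar> < - l"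
          using approx[of "- l"] by auto
        define t where "t = min b (s0 + d/2)"
        have "s0 < t" "t < s0 + d" "t \<le> b" using d(1) s0 by (auto simp: t_def)
        then have "\<bar>\<Theta> t - l\<bar> < - l" "0 \<le> \<Theta> t" using d(2) \<Theta>0[of t] s0 by auto
        then show False by linarith
      qed
      obtain \<eta> where \<eta>: "\<eta> > 0" "\<And>y. 0 \<le> y \<Longrightarrow> \<bar>y - l\<bar> < \<eta> \<Longrightarrow> \<bar>\<psi>' y - \<psi>' l\<bar> \<le> \<epsilon> / 2"
        using near[OF l0] by blast
      obtain d where d: "d > 0" "\<And>t. s0 < t \<Longrightarrow> t < s0 + d \<Longrightarrow> t \<le> b \<Longrightarrow> \<bar>\<Theta> t - l\<bar> < \<eta>"
        using approx[OF \<eta>(1)] by blast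
      have "P s0 t" if t: "s0 \<le> t" "t - s0 < d" for t
        unfolding P_def
      proof (intro impI, elim conjE)
        assume tb: "t \<le> b"
        show "\<psi> (\<Theta> t) - \<psi> (\<Theta> s0) \<le> (LINT r:{s0<..t}|lebesgue. \<psi>' (\<Theta> r) * g r) + \<epsilon> * (LINT r:{s0<..t}|lebesgue. \<bar>g r\<bar>)"
        proof (cases "s0 = t")
          case True
          then show ?thesis by (simp add: set_lebesgue_integral_def)
        next
          case False
          then have st: "s0 < t" using t by simp
          have "\<psi> (\<Theta> t) - \<psi> l \<le> (LINT r:{s0<..t}|lebesgue. \<psi>' (\<Theta> r) * g r) + \<epsilon> * (LINT r:{s0<..t}|lebesgue. \<bar>g r\<bar>)"
          proof (rule energy_piece[OF e t(1) sub[OF s0(1) tb] _ l0 _ _ _ _ \<eta>(2)])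
            show "0 \<le> \<Theta> r \<and> \<bar>\<Theta> r - l\<bar> < \<eta>" if "s0 < r" "r < t" for r
              using that \<Theta>0[of r] d(2)[of r] t tb s0 by auto
            show "0 \<le> \<Theta> t" using \<Theta>0 s0 st tb by simp
            show "\<bar>l - l\<bar> < \<eta>" using \<eta> by simp
            show "\<bar>\<Theta> t - l\<bar> < \<eta>" using d(2)[of t] st t tb by simp
            show "\<Theta> t - l \<le> (LINT r:{s0<..t}|lebesgue. g r)"
              using Gd[OF s0(1) t(1) tb] Mright_ge[OF st tb] by (simp add: \<Theta>_def l_def)
          qed
          moreover have "\<psi> l \<le> \<psi> (\<Theta> s0)"
            by (rule mono\<psi>[OF l0]) (simp add: l_def \<Theta>_def Mright_le)
          ultimately show ?thesis by linarith
        qed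
      qed
      then show ?thesis using d(1) by blast
    qed
    \<comment> \<open>The mirror image: \<open>energy_piece\<close> runs up to the left limit
      \<open>l\<close>, and the value at \<open>s0\<close> can only lie below it.\<close>
    have left: "\<exists>d>0. \<forall>s. s \<le> s0 \<and> s0 - s < d \<longrightarrow> P s s0" if s0: "a < s0" "s0 \<le> b" for s0
    proof -
      define Mleft where "Mleft = Inf (M ` {a..<s0})"
      define l where "l = Mleft + G s0"
      have bddM: "bdd_below (M ` {a..<s0})" using M_anti[of _ s0] s0 by (intro bdd_belowI[of _ "M s0"]) auto
      have Mleft_le: "Mleft \<le> M t" if "a \<le> t" "t < s0" for t
        unfolding Mleft_def using that by (intro cInf_lower bddM) auto
      have Mleft_ge: "M s0 \<le> Mleft" unfolding Mleft_def using s0 M_anti[of _ s0] by (intro cInf_greatest) auto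
      have close: "\<exists>t1. a \<le> t1 \<and> t1 < s0 \<and> M t1 < Mleft + \<eta>" if "\<eta> > 0" for \<eta>
        using cInf_lessD[of "M ` {a..<s0}" "Mleft + \<eta>"] s0 that by (auto simp: Mleft_def)
      have approx: "\<exists>d>0. \<forall>t. t < s0 \<and> s0 - d < t \<and> a \<le> t \<longrightarrow> \<bar>\<Theta> t - l\<bar> < \<eta>" if \<eta>: "\<eta> > 0" for \<eta>
      proof -
        obtain t1 where t1: "a \<le> t1" "t1 < s0" "M t1 < Mleft + \<eta>/2" using close[of "\<eta>/2"] \<eta> by auto
        obtain d where d: "d > 0" "\<forall>t\<in>{a..b}. \<bar>t - s0\<bar> < d \<longrightarrow> \<bar>G t - G s0\<bar> < \<eta>/2"
          using Gc[of s0 "\<eta>/2"] s0 \<eta> by auto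
        show ?thesis
        proof (intro exI[of _ "min d (s0 - t1)"] conjI allI impI)
          show "0 < min d (s0 - t1)" using d t1 by simp
          fix t assume t: "t < s0 \<and> s0 - min d (s0 - t1) < t \<and> a \<le> t"
          then have "\<bar>G t - G s0\<bar> < \<eta>/2" using d(2) s0 by auto
          moreover have "M t \<le> M t1" using t t1 s0 by (intro M_anti) auto
          moreover have "Mleft \<le> M t" using t by (intro Mleft_le) auto
          ultimately show "\<bar>\<Theta> t - l\<bar> < \<eta>" using t1(3) unfolding \<Theta>_def l_def by linarith
        qed
      qed
      have ls: "\<Theta> s0 \<le> l" using Mleft_ge by (simp add: \<Theta>_def l_def)
      have l0: "0 \<le> l" using ls \<Theta>0[of s0] s0 by simp
      obtain \<eta> where \<eta>: "\<eta> > 0" "\<And>y. 0 \<le> y \<Longrightarrow> \<bar>y - l\<bar> < \<eta> \<Longrightarrow> \<bar>\<psi>' y - \<psi>' l\<bar> \<le> \<epsilon> / 2"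
        using near[OF l0] by blast
      obtain d where d: "d > 0" "\<And>t. t < s0 \<Longrightarrow> s0 - d < t \<Longrightarrow> a \<le> t \<Longrightarrow> \<bar>\<Theta> t - l\<bar> < \<eta>"
        using approx[OF \<eta>(1)] by blast
      have "P s s0" if t: "s \<le> s0" "s0 - s < d" for s
        unfolding P_def
      proof (intro impI, elim conjE)
        assume sa: "a \<le> s"
        show "\<psi> (\<Theta> s0) - \<psi> (\<Theta> s) \<le> (LINT r:{s<..s0}|lebesgue. \<psi>' (\<Theta> r) * g r) + \<epsilon> * (LINT r:{s<..s0}|lebesgue. \<bar>g r\<bar>)"
        proof (cases "s0 = s")
          case True
          then show ?thesis by (simp add: set_lebesgue_integral_def)
        next
          case False
          then have st: "s < s0" using t by simp
          have "\<psi> l - \<psi> (\<Theta> s) \<le> (LINT r:{s<..s0}|lebesgue. \<psi>' (\<Theta> r) * g r) + \<epsilon> * (LINT r:{s<..s0}|lebesgue. \<bar>g r\<bar>)"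
          proof (rule energy_piece[OF e t(1) sub[OF sa s0(2)] _ _ l0 _ _ _ \<eta>(2)])
            show "0 \<le> \<Theta> r \<and> \<bar>\<Theta> r - l\<bar> < \<eta>" if "s < r" "r < s0" for r
              using that \<Theta>0[of r] d(2)[of r] t sa s0 by auto
            show "0 \<le> \<Theta> s" using \<Theta>0 s0 st sa by simp
            show "\<bar>l - l\<bar> < \<eta>" using \<eta> by simp
            show "\<bar>\<Theta> s - l\<bar> < \<eta>" using d(2)[of s] st t sa by simp
            show "l - \<Theta> s \<le> (LINT r:{s<..s0}|lebesgue. g r)"
              using Gd[OF sa t(1) s0(2)] Mleft_le[OF sa st] by (simp add: \<Theta>_def l_def)
          qed
          moreover have "\<psi> (\<Theta> s0) \<le> \<psi> l"
            by (rule mono\<psi>[OF _ ls]) (use \<Theta>0[of s0] s0 in simp)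
          ultimately show ?thesis by linarith
        qed
      qed
      then show ?thesis using d(1) by blast
    qed
    have "P a b"
      using ab
    proof (induction rule: Bolzano)
      case (trans s t r)
      then show ?case by (rule \<open>\<And>s t r. P s t \<Longrightarrow> P t r \<Longrightarrow> s \<le> t \<Longrightarrow> t \<le> r \<Longrightarrow> P s r\<close>)
    next
      case (local s0)
      have "\<exists>d>0. \<forall>t. s0 \<le> t \<and> t - s0 < d \<longrightarrow> P s0 t"
      proof (cases "s0 < b")
        case False
        then have "P s0 t" if "s0 \<le> t" for t
          using that local by (auto simp: P_def set_lebesgue_integral_def)
        then show ?thesis by (intro exI[of _ 1]) auto
      qed (use right local in auto)
      then obtain d1 where d1: "d1 > 0" "\<And>t. s0 \<le> t \<Longrightarrow> t - s0 < d1 \<Longrightarrow> P s0 t" by blast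
      have "\<exists>d>0. \<forall>s. s \<le> s0 \<and> s0 - s < d \<longrightarrow> P s s0"
      proof (cases "a < s0")
        case False
        then have "P s s0" if "s \<le> s0" for s
          using that local by (auto simp: P_def set_lebesgue_integral_def)
        then show ?thesis by (intro exI[of _ 1]) auto
      qed (use left local in auto)
      then obtain d2 where d2: "d2 > 0" "\<And>s. s \<le> s0 \<Longrightarrow> s0 - s < d2 \<Longrightarrow> P s s0" by blast
      have "P s t" if "s \<le> s0" "s0 \<le> t" "t - s < min d1 d2" for s t
        by (rule trans[of s s0 t]) (use that d1(2)[of t] d2(2)[of s] in auto)
      then show ?case using d1(1) d2(1) by (intro exI[of _ "min d1 d2"]) auto
    qed
    then show ?thesis using ab by (simp add: P_def)
  qed
  define L where "L = (LINT r:{a<..b}|lebesgue. \<bar>g r\<bar>)"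
  have L0: "0 \<le> L"
    unfolding L_def set_lebesgue_integral_def by (intro integral_nonneg_AE) auto
  have "\<psi> (\<Theta> b) - \<psi> (\<Theta> a) \<le> (LINT r:{a<..b}|lebesgue. \<psi>' (\<Theta> r) * g r)"
  proof (rule field_le_epsilon)
    fix e :: real assume e: "e > 0"
    have "\<psi> (\<Theta> b) - \<psi> (\<Theta> a) \<le> (LINT r:{a<..b}|lebesgue. \<psi>' (\<Theta> r) * g r) + (e / (L + 1)) * L"
      unfolding L_def by (rule le) (use e L0 in \<open>simp add: L_def\<close>)
    moreover have "(e / (L + 1)) * L \<le> e" using e L0 by (simp add: divide_simps mult_left_mono)
    ultimately show "\<psi> (\<Theta> b) - \<psi> (\<Theta> a) \<le> (LINT r:{a<..b}|lebesgue. \<psi>' (\<Theta> r) * g r) + e" by linarith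
  qed
  moreover have "\<psi> (\<theta> b) \<le> \<psi> (\<Theta> b)" using \<theta>0[of b] \<Theta>_ge[of b] ab by (intro mono\<psi>) auto
  moreover have "\<psi> (\<Theta> a) = \<psi> (\<theta> a)" using \<Theta>_good[OF good(2)] ab by simp
  moreover have "(LINT r:{a<..b}|lebesgue. \<psi>' (\<Theta> r) * g r) = (LINT r:{a<..b}|lebesgue. \<psi>' (\<theta> r) * g r)"
    unfolding set_lebesgue_integral_def
  proof (rule integral_cong_AE)
    have i: "set_integrable lebesgue {a<..b} (\<lambda>r. \<psi>' (\<Theta> r) * g r)" "set_integrable lebesgue {a<..b} (\<lambda>r. \<psi>' (\<theta> r) * g r)"
      by (auto intro!: set_integrable_subset[OF hi'] set_integrable_subset[OF hi])
    show "(\<lambda>r. indicator {a<..b} r *\<^sub>R (\<psi>' (\<Theta> r) * g r)) \<in> borel_measurable lebesgue"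
      "(\<lambda>r. indicator {a<..b} r *\<^sub>R (\<psi>' (\<theta> r) * g r)) \<in> borel_measurable lebesgue"
      using i by (auto simp: set_integrable_def)
    show "AE r in lebesgue. indicator {a<..b} r *\<^sub>R (\<psi>' (\<Theta> r) * g r) = indicator {a<..b} r *\<^sub>R (\<psi>' (\<theta> r) * g r)"
      using good(1) by eventually_elim (auto simp: \<Theta>_good indicator_def)
  qed
  ultimately show ?thesis by linarith
qed

section \<open>Testing in time\<close>

text \<open>The antiderivative of a bump carried by the unit interval, divided by its total
  integral.\<close>

lemma smooth_step:
  obtains \<Phi> \<eta> :: "real \<Rightarrow> real" where
    "\<And>s. (\<Phi> has_real_derivative \<eta> s) (at s)" "smooth \<Phi>" "continuous_on UNIV \<eta>" "\<And>s. 0 \<le> \<eta> s"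
    "\<And>s. s \<le> 0 \<Longrightarrow> \<Phi> s = 0" "\<And>s. 1 \<le> s \<Longrightarrow> \<Phi> s = 1" "\<And>s. s \<le> 0 \<or> 1 \<le> s \<Longrightarrow> \<eta> s = 0"
    "\<And>s. 0 \<le> \<Phi> s" "\<And>s. \<Phi> s \<le> 1"
proof -
  define \<beta> where "\<beta> s = bump s * bump (1 - s)" for s
  have sm1: "smooth (\<lambda>s::real. bump (1 + s \<bullet> (-1)))" by (rule smooth_affine[OF smooth_bump])
  have sm: "smooth \<beta>"
    unfolding \<beta>_def[abs_def] using smooth_mult[OF smooth_bump sm1] by simp
  have \<beta>c: "continuous_on S \<beta>" for S by (rule smooth_continuous[OF sm])
  have \<beta>0: "0 \<le> \<beta> s" "s \<le> 0 \<or> 1 \<le> s \<Longrightarrow> \<beta> s = 0" "0 < s \<Longrightarrow> s < 1 \<Longrightarrow> 0 < \<beta> s" for s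
    by (auto simp: \<beta>_def bump_simps)
  \<comment> \<open>The lower limit -1 leaves the points s >= 0 interior to the interval of
    integration, which gives two-sided derivatives there.\<close>
  define \<Psi> where "\<Psi> s = integral {-1..s} \<beta>" for s
  have \<Psi>0: "\<Psi> s = 0" if "s \<le> 0" for s
  proof -
    have "integral {-1..s} \<beta> = integral {-1..s} (\<lambda>x. 0)"
      by (rule Henstock_Kurzweil_Integration.integral_cong) (use that \<beta>0(2) in auto)
    then show ?thesis by (simp add: \<Psi>_def)
  qed
  have d: "(\<Psi> has_real_derivative \<beta> s) (at s)" for s
  proof (cases "s < 0")
    case True
    have "((\<lambda>x. 0) has_real_derivative \<beta> s) (at s)" using True \<beta>0(2) by simp
    then show ?thesis
      by (rule has_field_derivative_transform_within_open[of _ _ _ "{..<0}"]) (use True \<Psi>0 in auto)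
  next
    case False
    have "((\<lambda>x. integral {-1..x} \<beta>) has_real_derivative \<beta> s) (at s within {-1..s+1})"
      by (rule integral_has_real_derivative[OF \<beta>c]) (use False in auto)
    moreover have "at s within {-1..s+1} = at s" by (rule at_within_interior) (use False in auto)
    ultimately show ?thesis by (simp add: \<Psi>_def[abs_def])
  qed
  have incr: "\<Psi> s \<le> \<Psi> t" if "s \<le> t" for s t
    by (rule DERIV_nonneg_imp_nondecreasing[OF that]) (use d \<beta>0(1) in blast)
  have "\<exists>z>0. z < 1 \<and> \<Psi> 1 - \<Psi> 0 = (1 - 0) * \<beta> z" by (rule MVT2) (use d in auto)
  then have pos: "0 < \<Psi> 1" using \<beta>0(3) \<Psi>0[of 0] by auto
  have \<Psi>1: "\<Psi> s = \<Psi> 1" if "1 \<le> s" for s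
  proof (cases "s = 1")
    case False
    then have "\<exists>z>1. z < s \<and> \<Psi> s - \<Psi> 1 = (s - 1) * \<beta> z" using that by (intro MVT2) (use d in auto)
    then show ?thesis using \<beta>0(2) by auto
  qed simp
  have "smooth \<Psi>" by (rule smooth_real_antiderivative[OF d sm])
  then have sm\<Psi>: "smooth (\<lambda>s. (1 / \<Psi> 1) * \<Psi> s)" by (rule smooth_mult[OF smooth_const])
  show ?thesis
  proof (rule that[of "\<lambda>s. (1 / \<Psi> 1) * \<Psi> s" "\<lambda>s. (1 / \<Psi> 1) * \<beta> s"])
    show "((\<lambda>s. (1 / \<Psi> 1) * \<Psi> s) has_real_derivative (1 / \<Psi> 1) * \<beta> s) (at s)" for s
      by (rule DERIV_cmult[OF d])
    show "continuous_on UNIV (\<lambda>s. (1 / \<Psi> 1) * \<beta> s)" by (intro continuous_intros \<beta>c)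
    show "(1 / \<Psi> 1) * \<Psi> s \<le> 1" for s
    proof -
      have "\<Psi> s \<le> \<Psi> 1" using incr[of s 1] \<Psi>1[of s] by linarith
      then show ?thesis using pos by simp
    qed
    show "0 \<le> (1 / \<Psi> 1) * \<Psi> s" for s
    proof -
      have "0 \<le> \<Psi> s" using incr[of 0 s] \<Psi>0[of 0] \<Psi>0[of s] by (cases "0 \<le> s") auto
      then show ?thesis using pos by simp
    qed
    show "(1 / \<Psi> 1) * \<Psi> s = 1" if "1 \<le> s" for s using \<Psi>1[OF that] pos by simp
  qed (use sm\<Psi> \<Psi>0 \<beta>0 pos in auto)
qed

text \<open>The kernel has mass one, by the fundamental theorem applied to \<Phi>, and is carried by
  the interval from \<open>c\<close> to \<open>c + 1 / n\<close>. It averages over the right of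
  \<open>c\<close> alone, so continuity from the right at \<open>c\<close> is what counts.\<close>

lemma approximate_identity:
  fixes \<Phi> \<eta> U :: "real \<Rightarrow> real"
  assumes d: "\<And>s. (\<Phi> has_real_derivative \<eta> s) (at s)" and \<eta>: "continuous_on UNIV \<eta>" "\<And>s. 0 \<le> \<eta> s"
    and \<Phi>: "\<Phi> 0 = 0" "\<Phi> 1 = 1" and off: "\<And>s. s \<le> 0 \<or> 1 \<le> s \<Longrightarrow> \<eta> s = 0"
    and J: "{c..c + \<delta>} \<subseteq> J" "0 < \<delta>" and U: "continuous_on {c..c + \<delta>} U"
  shows "(\<lambda>n. LINT s:J|lebesgue. (real n * \<eta> (real n * (s - c))) * U s) \<longlonglongrightarrow> U c"
proof (rule LIMSEQ_I)
  fix r :: real assume r: "r > 0"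
  obtain d' where d': "d' > 0" "\<And>s. s \<in> {c..c + \<delta>} \<Longrightarrow> dist s c < d' \<Longrightarrow> dist (U s) (U c) < r / 2"
    using U r J(2) unfolding continuous_on_iff by (metis atLeastAtMost_iff half_gt_zero le_add_same_cancel1 less_imp_le order_refl)
  obtain N where N: "1 / real (Suc N) < min d' \<delta>" using nat_approx_posE[of "min d' \<delta>"] d' J by auto
  have "norm ((LINT s:J|lebesgue. (real n * \<eta> (real n * (s - c))) * U s) - U c) < r" if n: "Suc N \<le> n" for n
  proof -
    have n0: "0 < real n" using n by simp
    have n1: "1 / real n < d'" "1 / real n < \<delta>"
    proof -
      have "1 / real n \<le> 1 / real (Suc N)" using n by (intro divide_left_mono) auto
      then show "1 / real n < d'" "1 / real n < \<delta>" using N by auto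
    qed
    define A where "A = {c..c + 1 / real n}"
    define h where "h s = real n * \<eta> (real n * (s - c))" for s
    have h0: "h s = 0" if "s \<notin> A" for s
    proof -
      have "real n * (s - c) \<le> 0 \<or> 1 \<le> real n * (s - c)"
        using that n0 by (auto simp: A_def not_le mult_le_0_iff field_simps)
      then show ?thesis using off by (auto simp: h_def)
    qed
    have hnn: "0 \<le> h s" for s using \<eta>(2) n0 by (simp add: h_def)
    have hc: "continuous_on S h" for S
      unfolding h_def by (intro continuous_intros continuous_on_compose2[OF \<eta>(1)]) auto
    have AJ: "A \<subseteq> J" "A \<subseteq> {c..c + \<delta>}" using n1 J by (auto simp: A_def)
    have eq: "(LINT s:J|lebesgue. h s * U s) = (LINT s:A|lebesgue. h s * U s)"
      unfolding set_lebesgue_integral_def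
      by (rule Bochner_Integration.integral_cong) (use AJ h0 in \<open>auto simp: indicator_def\<close>)
    have Uc: "continuous_on A U" using U AJ(2) by (rule continuous_on_subset)
    have i1: "set_integrable lborel A h" "set_integrable lborel A (\<lambda>s. h s * U s)" "set_integrable lborel A (\<lambda>s. h s * U c)"
      unfolding A_def by (intro borel_integrable_atLeastAtMost' continuous_intros hc Uc[unfolded A_def])+
    have leb: "(LINT s:A|lebesgue. g s) = (LINT s:A|lborel. g s)" if "set_integrable lborel A g" for g :: "real \<Rightarrow> real"
      unfolding set_lebesgue_integral_def by (rule integral_completion) (use that in \<open>auto simp: set_integrable_def\<close>)
    have one: "(LINT s:A|lborel. h s) = 1"
    proof -
      have "((\<lambda>s. \<Phi> (real n * (s - c))) has_real_derivative h s) (at s)" for s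
      proof -
        have "((\<lambda>s. real n * (s - c)) has_real_derivative real n) (at s)" by (auto intro!: derivative_eq_intros)
        from DERIV_chain2[OF d this] show ?thesis by (simp add: h_def mult.commute)
      qed
      moreover have "isCont h s" for s using hc[of UNIV] by (simp add: continuous_on_eq_continuous_at)
      ultimately have "(LBINT s. h s * indicator {c..c + 1 / real n} s) = \<Phi> (real n * (c + 1 / real n - c)) - \<Phi> (real n * (c - c))"
        using n0 by (intro integral_FTC_Icc_real) auto
      then show ?thesis using n0 \<Phi> by (simp add: set_lebesgue_integral_def A_def mult.commute)
    qed
    have "(LINT s:A|lborel. h s * U s) - U c = (LINT s:A|lborel. h s * U s) - (LINT s:A|lborel. h s * U c)"
      using one by simp
    also have "\<dots> = (LINT s:A|lborel. h s * U s - h s * U c)" using i1 by (simp add: set_integral_diff)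
    also have "\<bar>\<dots>\<bar> \<le> (LINT s:A|lborel. \<bar>h s * U s - h s * U c\<bar>)"
      unfolding set_lebesgue_integral_def
      using integral_abs_bound[of lborel "\<lambda>s. indicator A s *\<^sub>R (h s * U s - h s * U c)"] by (simp add: abs_mult)
    also have "\<dots> \<le> (LINT s:A|lborel. h s * (r / 2))"
    proof (rule set_integral_mono)
      show "set_integrable lborel A (\<lambda>s. \<bar>h s * U s - h s * U c\<bar>)"
        using i1 by (intro set_integrable_abs) (simp add: set_integral_diff)
      show "set_integrable lborel A (\<lambda>s. h s * (r / 2))" using i1 by simp
      fix s assume s: "s \<in> A"
      then have "dist s c < d'" using n1(1) by (auto simp: A_def dist_real_def)
      then have "\<bar>U s - U c\<bar> \<le> r / 2" using d'(2)[of s] s AJ(2) by (auto simp: dist_real_def)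
      then have "h s * \<bar>U s - U c\<bar> \<le> h s * (r / 2)" by (intro mult_left_mono hnn)
      then show "\<bar>h s * U s - h s * U c\<bar> \<le> h s * (r / 2)"
        using hnn[of s] by (simp add: right_diff_distrib[symmetric] abs_mult)
    qed
    also have "\<dots> = r / 2" using one by simp
    finally have "\<bar>(LINT s:A|lborel. h s * U s) - U c\<bar> \<le> r / 2" .
    then show ?thesis using r eq leb[OF i1(2)] by (simp add: h_def)
  qed
  then show "\<exists>no. \<forall>n\<ge>no. norm ((LINT s:J|lebesgue. (real n * \<eta> (real n * (s - c))) * U s) - U c) < r" by blast
qed

text \<open>The test functions climb from 0 to 1 just after \<open>a\<close> and descend just after
  \<open>b\<close>. Their derivatives are two approximate identities, and the functions themselves
  converge to the indicator of the half-open interval. Both ramps lie to the right of their points,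
  so that the extra room \<delta> is required beyond \<open>b\<close> only. The last hypothesis
  serves to split the integral into the contributions of the two ramps.\<close>

lemma distributional_derivative_integral:
  fixes U K :: "real \<Rightarrow> real"
  assumes ab: "a \<le> b" and J: "{a..b + \<delta>} \<subseteq> J" "0 < \<delta>"
    and U: "continuous_on {a..b + \<delta>} U" and K: "set_integrable lebesgue {a..b + \<delta>} K"
    and test: "\<And>\<phi>. \<phi> \<in> test_functions J \<Longrightarrow> (LINT s:J|lebesgue. deriv \<phi> s * U s) = - (LINT s:J|lebesgue. \<phi> s * K s)"
    and Ui: "\<And>h. continuous_on UNIV h \<Longrightarrow> (\<And>s. s \<notin> {a..b + \<delta>} \<Longrightarrow> h s = 0) \<Longrightarrow> set_integrable lebesgue J (\<lambda>s. h s * U s)"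
  shows "U b - U a = (LINT s:{a<..b}|lebesgue. K s)"
proof (cases "a = b")
  case True
  then show ?thesis by (simp add: set_lebesgue_integral_def)
next
  case False
  then have ab': "a < b" using ab by simp
  obtain \<Phi> \<eta> :: "real \<Rightarrow> real" where st:
    "\<And>s. (\<Phi> has_real_derivative \<eta> s) (at s)" "smooth \<Phi>" "continuous_on UNIV \<eta>" "\<And>s. 0 \<le> \<eta> s"
    "\<And>s. s \<le> 0 \<Longrightarrow> \<Phi> s = 0" "\<And>s. 1 \<le> s \<Longrightarrow> \<Phi> s = 1" "\<And>s. s \<le> 0 \<or> 1 \<le> s \<Longrightarrow> \<eta> s = 0"
    "\<And>s. 0 \<le> \<Phi> s" "\<And>s. \<Phi> s \<le> 1"
    using smooth_step by blast
  define \<phi> where "\<phi> n s = \<Phi> (real n * (s - a)) - \<Phi> (real n * (s - b))" for n s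
  define h where "h n c s = real n * \<eta> (real n * (s - c))" for n c s
  obtain N where N: "1 / real (Suc N) < min \<delta> (b - a)" using nat_approx_posE[of "min \<delta> (b - a)"] J ab' by auto
  have nN: "0 < real n \<and> 1 / real n < \<delta> \<and> 1 / real n < b - a" if n: "Suc N \<le> n" for n
  proof -
    have "1 / real n \<le> 1 / real (Suc N)" using n by (intro divide_left_mono) auto
    then show ?thesis using N n by auto
  qed
  have dphi: "(\<phi> n has_real_derivative h n a s - h n b s) (at s)" for n s
  proof -
    have "((\<lambda>s. \<Phi> (real n * (s - c))) has_real_derivative h n c s) (at s)" for c
    proof -
      have "((\<lambda>s. real n * (s - c)) has_real_derivative real n) (at s)" by (auto intro!: derivative_eq_intros)
      from DERIV_chain2[OF st(1) this] show ?thesis by (simp add: h_def mult.commute)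
    qed
    from DERIV_diff[OF this this] show ?thesis by (simp add: \<phi>_def[abs_def])
  qed
  have \<phi>off: "\<phi> n s = 0" if n: "Suc N \<le> n" and s: "s \<notin> {a..b + 1 / real n}" for n s
  proof -
    have n0: "0 < real n" using nN[OF n] by simp
    consider "s < a" | "b + 1 / real n < s" using s by fastforce
    then show ?thesis
    proof cases
      case 1
      then have "real n * (s - a) \<le> 0" "real n * (s - b) \<le> 0" using n0 ab by (auto simp: mult_le_0_iff)
      then show ?thesis by (simp add: \<phi>_def st)
    next
      case 2
      then have "1 \<le> real n * (s - b)" using n0 by (simp add: field_simps)
      moreover have "real n * (s - b) \<le> real n * (s - a)" using n0 ab by (intro mult_left_mono) auto
      ultimately show ?thesis by (simp add: \<phi>_def st)
    qed
  qed
  have hoff: "h n c s = 0" if n: "Suc N \<le> n" and c: "c \<in> {a, b}" and s: "s \<notin> {a..b + \<delta>}" for n c s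
  proof -
    have n0: "0 < real n" "1 / real n < \<delta>" using nN[OF n] by auto
    consider "s < a" | "b + 1 / real n < s" using s n0 by fastforce
    then have "real n * (s - c) \<le> 0 \<or> 1 \<le> real n * (s - c)"
    proof cases
      case 1
      then show ?thesis using n0 c ab by (auto simp: mult_le_0_iff)
    next
      case 2
      then have "1 \<le> real n * (s - b)" using n0 by (simp add: field_simps)
      moreover have "real n * (s - b) \<le> real n * (s - c)" using n0 ab c by (intro mult_left_mono) auto
      ultimately show ?thesis by simp
    qed
    then show ?thesis using st(7) by (auto simp: h_def)
  qed
  have tf: "\<phi> n \<in> test_functions J" if n: "Suc N \<le> n" for n
  proof -
    have "smooth (\<lambda>s. \<Phi> (- real n * c + s \<bullet> real n))" for c by (rule smooth_affine[OF st(2)])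
    then have "smooth (\<lambda>s. \<Phi> (real n * (s - c)))" for c by (simp add: algebra_simps)
    from smooth_add[OF this smooth_mult[OF smooth_const[of "-1"] this]]
    have sm: "smooth (\<phi> n)" by (simp add: \<phi>_def[abs_def])
    have sub: "{s. \<phi> n s \<noteq> 0} \<subseteq> {a..b + 1 / real n}" using \<phi>off[OF n] by blast
    have cl: "closure {s. \<phi> n s \<noteq> 0} \<subseteq> {a..b + 1 / real n}" by (rule closure_minimal[OF sub]) simp
    then have "{a..b + 1 / real n} \<inter> closure {s. \<phi> n s \<noteq> 0} = closure {s. \<phi> n s \<noteq> 0}" by blast
    with compact_Int_closed[OF compact_Icc[of a "b + 1 / real n"] closed_closure[of "{s. \<phi> n s \<noteq> 0}"]]
    have "compact (closure {s. \<phi> n s \<noteq> 0})" by (simp only:)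
    moreover have "{a..b + 1 / real n} \<subseteq> J" using J nN[OF n] by auto
    ultimately show ?thesis using sm cl by (auto simp: test_functions_def)
  qed
  have Ua: "(\<lambda>n. LINT s:J|lebesgue. h n a s * U s) \<longlonglongrightarrow> U a"
    unfolding h_def
    by (rule approximate_identity[OF st(1,3,4) st(5)[of 0] st(6)[of 1] st(7), where \<delta>="b + \<delta> - a"])
       (use J U ab in auto)
  have Ub: "(\<lambda>n. LINT s:J|lebesgue. h n b s * U s) \<longlonglongrightarrow> U b"
    unfolding h_def
    by (rule approximate_identity[OF st(1,3,4) st(5)[of 0] st(6)[of 1] st(7), where \<delta>=\<delta>])
       (use J ab in \<open>auto intro: continuous_on_subset[OF U]\<close>)
  have lhs: "(LINT s:J|lebesgue. deriv (\<phi> n) s * U s) = (LINT s:J|lebesgue. h n a s * U s) - (LINT s:J|lebesgue. h n b s * U s)"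
    if n: "Suc N \<le> n" for n
  proof -
    have hi: "set_integrable lebesgue J (\<lambda>s. h n c s * U s)" if "c \<in> {a, b}" for c
    proof (rule Ui)
      show "continuous_on UNIV (h n c)"
        unfolding h_def[abs_def] by (intro continuous_intros continuous_on_compose2[OF st(3)]) auto
    qed (rule hoff[OF n that])
    have "deriv (\<phi> n) s = h n a s - h n b s" for s by (rule DERIV_imp_deriv[OF dphi])
    then show ?thesis using hi[of a] hi[of b] by (simp add: left_diff_distrib set_integral_diff)
  qed
  have "(\<lambda>n. LINT s:J|lebesgue. deriv (\<phi> n) s * U s) \<longlonglongrightarrow> U a - U b"
  proof (rule Lim_transform_eventually[OF tendsto_diff[OF Ua Ub]])
    show "\<forall>\<^sub>F n in sequentially. (LINT s:J|lebesgue. h n a s * U s) - (LINT s:J|lebesgue. h n b s * U s) = (LINT s:J|lebesgue. deriv (\<phi> n) s * U s)"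
      using lhs by (intro eventually_sequentiallyI[of "Suc N"]) simp
  qed
  moreover have "(\<lambda>n. LINT s:J|lebesgue. deriv (\<phi> n) s * U s) \<longlonglongrightarrow> - (LINT s:{a<..b}|lebesgue. K s)"
  proof (rule Lim_transform_eventually)
    show "(\<lambda>n. - (\<integral>s. indicator {a..b + \<delta>} s *\<^sub>R (\<phi> n s * K s) \<partial>lebesgue)) \<longlonglongrightarrow> - (LINT s:{a<..b}|lebesgue. K s)"
      unfolding set_lebesgue_integral_def
    proof (intro tendsto_minus integral_dominated_convergence)
      show "integrable lebesgue (\<lambda>s. \<bar>indicator {a..b + \<delta>} s *\<^sub>R K s\<bar>)" using K by (simp add: set_integrable_def)
      have "set_integrable lebesgue {a<..b} K" by (rule set_integrable_subset[OF K]) (use J in auto)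
      then show "(\<lambda>s. indicator {a<..b} s *\<^sub>R K s) \<in> borel_measurable lebesgue" by (auto simp: set_integrable_def)
      have "\<bar>\<phi> n s\<bar> \<le> 1" for n s
        using st(8,9)[of "real n * (s - a)"] st(8,9)[of "real n * (s - b)"] by (simp add: \<phi>_def abs_le_iff)
      then show "AE s in lebesgue. norm (indicator {a..b + \<delta>} s *\<^sub>R (\<phi> n s * K s)) \<le> \<bar>indicator {a..b + \<delta>} s *\<^sub>R K s\<bar>" for n
        by (intro AE_I2) (auto simp: indicator_def abs_mult mult_left_le_one_le)
      show "(\<lambda>s. indicator {a..b + \<delta>} s *\<^sub>R (\<phi> n s * K s)) \<in> borel_measurable lebesgue" for n
      proof -
        have "continuous_on UNIV (\<phi> n)"
          using dphi by (auto intro!: continuous_at_imp_continuous_on DERIV_isCont)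
        then have "\<phi> n \<in> borel_measurable lebesgue" by (simp add: borel_measurable_continuous_onI measurable_completion)
        moreover have "(\<lambda>s. indicator {a..b + \<delta>} s *\<^sub>R K s) \<in> borel_measurable lebesgue" using K by (auto simp: set_integrable_def)
        ultimately have "(\<lambda>s. \<phi> n s * (indicator {a..b + \<delta>} s *\<^sub>R K s)) \<in> borel_measurable lebesgue" by (rule borel_measurable_times)
        then show ?thesis by (simp add: mult.left_commute)
      qed
      show "AE s in lebesgue. (\<lambda>n. indicator {a..b + \<delta>} s *\<^sub>R (\<phi> n s * K s)) \<longlonglongrightarrow> indicator {a<..b} s *\<^sub>R K s"
      proof (rule AE_I2)
        fix s :: real
        have step: "(\<lambda>n. \<Phi> (real n * (s - c))) \<longlonglongrightarrow> (if c < s then 1 else 0)" for c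
        proof (cases "c < s")
          case True
          obtain m where m: "1 / (s - c) \<le> real m" using real_arch_simple by blast
          have "\<forall>\<^sub>F n in sequentially. \<Phi> (real n * (s - c)) = 1"
          proof (rule eventually_sequentiallyI[of m])
            fix n assume "m \<le> n"
            then have "1 / (s - c) \<le> real n" using m by linarith
            then have "1 \<le> real n * (s - c)" using True by (simp add: pos_divide_le_eq)
            then show "\<Phi> (real n * (s - c)) = 1" by (rule st(6))
          qed
          then show ?thesis using True by (simp add: tendsto_eventually)
        next
          case False
          then have "\<Phi> (real n * (s - c)) = 0" for n by (intro st(5)) (simp add: mult_le_0_iff)
          then show ?thesis using False by simp
        qed
        have "(\<lambda>n. indicator {a..b + \<delta>} s *\<^sub>R (\<phi> n s * K s)) \<longlonglongrightarrow>
            indicator {a..b + \<delta>} s *\<^sub>R (((if a < s then 1 else 0) - (if b < s then 1 else 0)) * K s)"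
          unfolding \<phi>_def by (intro tendsto_intros step)
        moreover have "indicator {a..b + \<delta>} s *\<^sub>R (((if a < s then 1 else 0) - (if b < s then 1 else 0)) * K s) = indicator {a<..b} s *\<^sub>R K s"
          using ab J(2) by (auto simp: indicator_def)
        ultimately show "(\<lambda>n. indicator {a..b + \<delta>} s *\<^sub>R (\<phi> n s * K s)) \<longlonglongrightarrow> indicator {a<..b} s *\<^sub>R K s" by (simp only:)
      qed
    qed
    show "\<forall>\<^sub>F n in sequentially. - (\<integral>s. indicator {a..b + \<delta>} s *\<^sub>R (\<phi> n s * K s) \<partial>lebesgue) = (LINT s:J|lebesgue. deriv (\<phi> n) s * U s)"
    proof (rule eventually_sequentiallyI[of "Suc N"])
      fix n assume n: "Suc N \<le> n"
      have "indicator {a..b + \<delta>} s *\<^sub>R (\<phi> n s * K s) = indicator J s *\<^sub>R (\<phi> n s * K s)" for s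
        using \<phi>off[OF n, of s] J nN[OF n] by (cases "s \<in> {a..b + \<delta>}") (auto simp: indicator_def)
      then show "- (\<integral>s. indicator {a..b + \<delta>} s *\<^sub>R (\<phi> n s * K s) \<partial>lebesgue) = (LINT s:J|lebesgue. deriv (\<phi> n) s * U s)"
        using test[OF tf[OF n]] by (simp only: set_lebesgue_integral_def)
    qed
  qed
  ultimately have "U a - U b = - (LINT s:{a<..b}|lebesgue. K s)" by (rule LIMSEQ_unique)
  then show ?thesis by simp
qed

section \<open>Measurability on path space\<close>

context flow
begin

text \<open>The subbasis admits degenerate intervals with c = d, so that the weak coordinate at a
  single time is continuous on the path space.\<close>

lemma paths_inner_openin:
  assumes t: "t \<in> I" and v: "v \<in> H" and S: "open (S :: real set)"
  shows "openin (path_topology I) {u \<in> topspace (path_topology I). u t \<bullet> v \<in> S}"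
proof (subst openin_subopen, rule ballI)
  fix w assume w: "w \<in> {u \<in> topspace (path_topology I). u t \<bullet> v \<in> S}"
  then obtain e where e: "e > 0" "ball (w t \<bullet> v) e \<subseteq> S" using S by (auto elim: openE)
  have top: "topspace (path_topology I) \<subseteq> paths I"
    unfolding path_topology_def topology_generated_by_topspace by blast
  define W where "W = {u \<in> paths I. \<forall>s\<in>{t..t}. \<bar>(u s - w s) \<bullet> v\<bar> < e}"
  have "openin (path_topology I) W"
    unfolding path_topology_def W_def
  proof (rule topology_generated_by_Basis, rule CollectI, intro exI conjI)
    show "{u \<in> paths I. \<forall>s\<in>{t..t}. \<bar>(u s - w s) \<bullet> v\<bar> < e} = {u \<in> paths I. \<forall>s\<in>{t..t}. \<bar>(u s - w s) \<bullet> v\<bar> < e}" ..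
    show "w \<in> paths I" using w top by auto
  qed (use t v e(1) in auto)
  moreover have "w \<in> W" using w top e(1) by (auto simp: W_def)
  moreover have "W \<subseteq> {u \<in> topspace (path_topology I). u t \<bullet> v \<in> S}"
  proof
    fix u assume u: "u \<in> W"
    then have "\<bar>u t \<bullet> v - w t \<bullet> v\<bar> < e" by (simp add: W_def inner_diff_left)
    then have "u t \<bullet> v \<in> S" using e(2) by (auto simp: dist_real_def abs_minus_commute)
    then show "u \<in> {u \<in> topspace (path_topology I). u t \<bullet> v \<in> S}"
      using u openin_subset[OF \<open>openin (path_topology I) W\<close>] by auto
  qed
  ultimately show "\<exists>T. openin (path_topology I) T \<and> w \<in> T \<and> T \<subseteq> {u \<in> topspace (path_topology I). u t \<bullet> v \<in> S}" by blast
qed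

lemma space_paths:
  assumes "sets \<rho> = sets (borel_of (path_topology I))"
  shows "space \<rho> = topspace (path_topology I)" "u \<in> space \<rho> \<Longrightarrow> u \<in> paths I"
proof -
  have "{U. openin (path_topology I) U} \<subseteq> Pow (topspace (path_topology I))" by (auto dest: openin_subset)
  then show sp: "space \<rho> = topspace (path_topology I)"
    using sets_eq_imp_space_eq[OF assms] by (simp add: borel_of_def space_measure_of)
  have "topspace (path_topology I) \<subseteq> paths I"
    unfolding path_topology_def topology_generated_by_topspace by blast
  then show "u \<in> space \<rho> \<Longrightarrow> u \<in> paths I" using sp by blast
qed

lemma eval_inner_measurable:
  assumes sets: "sets \<rho> = sets (borel_of (path_topology I))" and t: "t \<in> I" and v: "v \<in> H"
  shows "(\<lambda>u. u t \<bullet> v) \<in> borel_measurable \<rho>"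
proof (rule borel_measurableI)
  fix S :: "real set" assume "open S"
  have sub: "{U. openin (path_topology I) U} \<subseteq> Pow (topspace (path_topology I))" by (auto dest: openin_subset)
  have "{u \<in> topspace (path_topology I). u t \<bullet> v \<in> S} \<in> sets \<rho>"
    unfolding sets borel_of_def sets_measure_of[OF sub]
    by (rule sigma_sets.Basic) (use paths_inner_openin[OF t v \<open>open S\<close>] in simp)
  moreover have "(\<lambda>u. u t \<bullet> v) -` S \<inter> space \<rho> = {u \<in> topspace (path_topology I). u t \<bullet> v \<in> S}"
    using space_paths(1)[OF sets] by auto
  ultimately show "(\<lambda>u. u t \<bullet> v) -` S \<inter> space \<rho> \<in> sets \<rho>" by simp
qed

text \<open>The path topology controls weak coordinates only; Borel measurability for the norm comes
  from separability, through \<open>borel_measurable_weakI\<close>.\<close>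

lemma eval_measurable:
  assumes sets: "sets \<rho> = sets (borel_of (path_topology I))" and t: "t \<in> I"
  shows "(\<lambda>u. u t) \<in> borel_measurable \<rho>"
proof (rule borel_measurable_weakI[OF subspace_H])
  show "u t \<in> H" if "u \<in> space \<rho>" for u
    using space_paths(2)[OF sets that] t by (simp add: paths_def weakly_continuous_def)
qed (rule eval_inner_measurable[OF sets t])

lemma eval_measurable_H:
  assumes sets: "sets \<rho> = sets (borel_of (path_topology I))" and t: "t \<in> I"
  shows "(\<lambda>u. u t) \<in> measurable \<rho> borel_H"
  unfolding borel_H_def
proof (rule measurable_restrict_space2[OF _ eval_measurable[OF assms]])
  show "(\<lambda>u. u t) \<in> space \<rho> \<rightarrow> H"
    using space_paths(2)[OF sets] t by (auto simp: paths_def weakly_continuous_def)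
qed

end

text \<open>Without a least element the interval continues below each of its points; hence a point
  outside the interior can only be the greatest element.\<close>

lemma interval_open_left_interior:
  assumes I: "interval_open_left I" and t: "t \<in> I"
  shows "\<exists>t'. t' < t \<and> t' \<in> interior I" and "t \<notin> interior I \<Longrightarrow> s \<in> I \<Longrightarrow> s \<le> t"
proof -
  have int: "is_interval I" and nm: "\<And>t0. t0 \<in> I \<Longrightarrow> \<exists>s\<in>I. s < t0"
    using I by (auto simp: interval_open_left_def left_endpoint_in_def not_le)
  have inner: "r \<in> interior I" if "p \<in> I" "q \<in> I" "p < r" "r < q" for p q r
  proof -
    have "{p<..<q} \<subseteq> I"
      using int that unfolding is_interval_1 by (meson greaterThanLessThan_iff less_imp_le subsetI)
    then show ?thesis using that by (intro interiorI[of "{p<..<q}"]) auto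
  qed
  obtain t' where t': "t' \<in> I" "t' < t" using nm[OF t] by blast
  obtain t'' where t'': "t'' \<in> I" "t'' < t'" using nm[OF t'(1)] by blast
  show "\<exists>t'. t' < t \<and> t' \<in> interior I"
    using inner[OF t''(1) t t''(2) t'(2)] t'(2) by blast
  show "s \<le> t" if "t \<notin> interior I" "s \<in> I"
    using inner[OF t'(1) that(2) t'(2)] that(1) by (meson not_le)
qed

lemma interval_open_left_boundary:
  assumes "interval_open_left I"
  obtains b where "I - interior I \<subseteq> {b}"
proof (cases "I - interior I = {}")
  case False
  then obtain b where b: "b \<in> I" "b \<notin> interior I" by blast
  show ?thesis
  proof (rule that[of b], rule subsetI)
    fix x assume "x \<in> I - interior I"
    then have "x \<le> b" "b \<le> x"
      using interval_open_left_interior(2)[OF assms] b by auto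
    then show "x \<in> {b}" by simp
  qed
qed (use that in blast)

lemma interval_open_left_borel:
  assumes "interval_open_left I"
  shows "I \<in> sets borel"
proof -
  obtain b where b: "I - interior I \<subseteq> {b}" using interval_open_left_boundary[OF assms] .
  have "I = interior I \<union> (I - interior I)" using interior_subset by blast
  moreover have "interior I \<in> sets borel" by simp
  moreover have "I - interior I \<in> sets borel" using b by (metis borel_singleton sets.empty_sets subset_singletonD)
  ultimately show ?thesis by (metis sets.Un)
qed

lemma sigma_finite_lebesgue: "sigma_finite_measure (lebesgue :: real measure)"
proof
  show "\<exists>A. countable A \<and> A \<subseteq> sets (lebesgue :: real measure) \<and> \<Union>A = space lebesgue \<and> (\<forall>a\<in>A. emeasure lebesgue a \<noteq> \<infinity>)"
  proof (intro exI[of _ "range (\<lambda>n::nat. {- real n..real n})"] conjI ballI)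
    show "\<Union> (range (\<lambda>n::nat. {- real n..real n})) = space lebesgue"
    proof -
      have "x \<in> \<Union> (range (\<lambda>n::nat. {- real n..real n}))" for x :: real
      proof -
        obtain n :: nat where "\<bar>x\<bar> \<le> real n" using real_arch_simple by blast
        then show ?thesis by (intro UN_I[of n]) auto
      qed
      then show ?thesis by auto
    qed
  qed auto
qed

context flow
begin

text \<open>Times are rounded down to a grid of mesh 1/(n + 1). Only countably many evaluation times
  occur at each stage, and weak continuity of the paths passes to the limit. Rounding down
  eventually stays in \<open>I\<close> since \<open>I\<close> continues to the left of every
  point.\<close>

lemma eval_pair_measurable:
  assumes sets: "sets \<rho> = sets (borel_of (path_topology I))" and I: "interval_open_left I"
  shows "(\<lambda>p. snd p (fst p)) \<in> borel_measurable (lebesgue_on I \<Otimes>\<^sub>M \<rho>)"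
proof (rule borel_measurable_weakI[OF subspace_H])
  have sp: "space (lebesgue_on I \<Otimes>\<^sub>M \<rho>) = I \<times> space \<rho>"
    by (simp add: space_pair_measure space_restrict_space)
  show "snd p (fst p) \<in> H" if "p \<in> space (lebesgue_on I \<Otimes>\<^sub>M \<rho>)" for p
    using that space_paths(2)[OF sets] by (auto simp: sp paths_def weakly_continuous_def)
  fix v assume v: "v \<in> H"
  obtain t1 where t1: "t1 \<in> I" using I by (auto simp: interval_open_left_def)
  \<comment> \<open>The point \<open>t1\<close> is a default for times whose grid point falls
    outside \<open>I\<close>; for a fixed time it is used at finitely many stages only.\<close>
  define G where "G n = insert t1 (I \<inter> range (\<lambda>k::int. of_int k / real (Suc n)))" for n :: nat
  define r where "r n t = of_int \<lfloor>t * real (Suc n)\<rfloor> / real (Suc n)" for n :: nat and t :: real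
  define e where "e n t = (if r n t \<in> G n then r n t else t1)" for n t
  have Gc: "countable (G n)" for n unfolding G_def by auto
  have GI: "G n \<subseteq> I" for n using t1 by (auto simp: G_def)
  have Gb: "G n \<in> sets borel" for n by (rule sets.countable[OF _ Gc]) (simp)
  have rm [measurable]: "r n \<in> borel_measurable borel" for n unfolding r_def[abs_def] by measurable
  have em: "e n \<in> borel_measurable borel" for n
    unfolding e_def[abs_def] using Gb by measurable
  have eG: "e n t \<in> G n" for n t by (auto simp: e_def G_def)
  have meas: "(\<lambda>p. snd p (e n (fst p)) \<bullet> v) \<in> borel_measurable (lebesgue_on I \<Otimes>\<^sub>M \<rho>)" for n
  proof (rule measurable_compose_countable'[OF _ _ Gc[of n], where f="\<lambda>i p. snd p i \<bullet> v"])
    show "(\<lambda>p. snd p i \<bullet> v) \<in> borel_measurable (lebesgue_on I \<Otimes>\<^sub>M \<rho>)" if "i \<in> G n" for i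
      using measurable_compose[OF measurable_snd eval_inner_measurable[OF sets _ v, of i]] GI that by auto
    have "e n \<in> measurable (lebesgue_on I) (count_space (G n))"
    proof (subst measurable_count_space_eq_countable[OF Gc], intro conjI ballI)
      show "e n -` {a} \<inter> space (lebesgue_on I) \<in> sets (lebesgue_on I)" for a
      proof -
        have "e n -` {a} \<in> sets borel" using measurable_sets[OF em, of "{a}"] by simp
        then have "e n -` {a} \<in> sets lebesgue" by simp
        then have "I \<inter> e n -` {a} \<in> sets (lebesgue_on I)" by (auto simp: sets_restrict_space)
        then show ?thesis by (simp add: space_restrict_space Int_commute)
      qed
    qed (use eG in auto)
    then show "(\<lambda>p. e n (fst p)) \<in> measurable (lebesgue_on I \<Otimes>\<^sub>M \<rho>) (count_space (G n))"
      by (rule measurable_compose[OF measurable_fst])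
  qed
  show "(\<lambda>p. snd p (fst p) \<bullet> v) \<in> borel_measurable (lebesgue_on I \<Otimes>\<^sub>M \<rho>)"
  proof (rule borel_measurable_LIMSEQ_real[OF _ meas])
    fix p assume p: "p \<in> space (lebesgue_on I \<Otimes>\<^sub>M \<rho>)"
    define t where "t = fst p"
    define u where "u = snd p"
    have t: "t \<in> I" and u: "u \<in> paths I" using p space_paths(2)[OF sets] by (auto simp: sp t_def u_def)
    obtain t' where t': "t' < t" "t' \<in> I" using interval_open_left_interior(1)[OF I t] interior_subset by blast
    have rb: "t - 1 / real (Suc n) \<le> r n t" "r n t \<le> t" for n
    proof -
      have "of_int \<lfloor>t * real (Suc n)\<rfloor> \<le> t * real (Suc n)" "t * real (Suc n) - 1 \<le> of_int \<lfloor>t * real (Suc n)\<rfloor>"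
        by linarith+
      then have "r n t \<le> (t * real (Suc n)) / real (Suc n)" "(t * real (Suc n) - 1) / real (Suc n) \<le> r n t"
        unfolding r_def by (intro divide_right_mono; simp)+
      then show "t - 1 / real (Suc n) \<le> r n t" "r n t \<le> t" by (simp_all add: diff_divide_distrib)
    qed
    have lim0: "(\<lambda>n. t - 1 / real (Suc n)) \<longlonglongrightarrow> t" by real_asymp
    have rl: "(\<lambda>n. r n t) \<longlonglongrightarrow> t"
      by (rule tendsto_sandwich[OF _ _ lim0 tendsto_const]) (use rb in auto)
    then have "\<forall>\<^sub>F n in sequentially. t' < r n t" using t'(1) by (rule order_tendstoD)
    then have ev: "\<forall>\<^sub>F n in sequentially. r n t = e n t"
    proof eventually_elim
      case (elim n)
      have "r n t \<in> I"
        using I t t' rb(2)[of n] elim unfolding interval_open_left_def is_interval_1 by (meson less_imp_le)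
      then have "r n t \<in> G n" by (auto simp: G_def r_def)
      then show ?case by (simp add: e_def)
    qed
    have el: "(\<lambda>n. e n t) \<longlonglongrightarrow> t" by (rule Lim_transform_eventually[OF rl ev])
    have "continuous_on I (\<lambda>t. u t \<bullet> v)" using u v by (simp add: paths_def weakly_continuous_def)
    moreover have "\<forall>\<^sub>F n in sequentially. e n t \<in> I"
      using subsetD[OF GI eG] by (intro always_eventually allI)
    ultimately have "(\<lambda>n. u (e n t) \<bullet> v) \<longlonglongrightarrow> u t \<bullet> v"
      by (rule continuous_on_tendsto_compose[OF _ el t])
    then show "(\<lambda>n. snd p (e n (fst p)) \<bullet> v) \<longlonglongrightarrow> snd p (fst p) \<bullet> v" by (simp only: t_def u_def)
  qed
qed

end

section \<open>The energy inequality in mean\<close>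

text \<open>A right end point of the interval is not interior, and there the weak formulation says
  nothing directly; it is reached as a limit of interior rational times.\<close>

lemma rational_sequence_from_left:
  fixes a b :: real
  assumes "a < b"
  obtains q :: "nat \<Rightarrow> real" where "\<And>n. q n \<in> \<rat>" "\<And>n. a < q n" "\<And>n. q n < b" "q \<longlonglongrightarrow> b"
proof -
  have "\<exists>x\<in>\<rat>. max a (b - 1 / real (Suc n)) < x \<and> x < b" for n
    using assms by (intro Rats_dense_in_real) auto
  then obtain q where q: "\<And>n. q n \<in> \<rat>" "\<And>n. max a (b - 1 / real (Suc n)) < q n" "\<And>n. q n < b" by metis
  have lim: "(\<lambda>n. b - 1 / real (Suc n)) \<longlonglongrightarrow> b" by real_asymp
  have "b - 1 / real (Suc n) \<le> q n" "q n \<le> b" "a < q n" for n using q(2,3)[of n] by auto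
  then have "q \<longlonglongrightarrow> b" by (intro tendsto_sandwich[OF _ _ lim tendsto_const]) auto
  then show ?thesis using that q by auto
qed

locale vishik_fursikov = flow \<Omega> \<V> \<nu> f for \<Omega> \<V> \<nu> f +
  fixes I :: "real set" and \<rho> :: "(real \<Rightarrow> l2field) measure"
  assumes nu_pos: "\<nu> > 0" and open_left: "interval_open_left I"
    and f_Linf: "Linf_H I f" and rho_vf: "Vishik_Fursikov_measure I \<rho>"
begin

abbreviation T :: "real measure" where "T \<equiv> lebesgue_on I"

section \<open>Null sets and measurability in time and path\<close>

lemma sets_rho: "sets \<rho> = sets (borel_of (path_topology I))"
  using rho_vf by (simp add: Vishik_Fursikov_measure_def)

lemma rho_prob: "prob_space \<rho>" using rho_vf by (simp add: Vishik_Fursikov_measure_def)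

lemma I_borel: "I \<in> sets borel" by (rule interval_open_left_borel[OF open_left])

lemma I_lebesgue [simp]: "I \<in> sets lebesgue" using I_borel by simp

lemma I_sub: "a \<in> I \<Longrightarrow> d \<in> I \<Longrightarrow> {a..d} \<subseteq> I"
  using open_left unfolding interval_open_left_def is_interval_1 by (meson atLeastAtMost_iff subsetI)

lemma space_T: "space T = I" by (simp add: space_restrict_space)

lemma sigma_finite_T: "sigma_finite_measure T"
  by (rule sigma_finite_measure_restrict_space[OF sigma_finite_lebesgue I_lebesgue])

lemma pair_sigma: "pair_sigma_finite T \<rho>"
  using sigma_finite_T prob_space_imp_sigma_finite[OF rho_prob] by (simp add: pair_sigma_finite_def)

lemma T_set_integral:
  fixes g :: "real \<Rightarrow> real"
  assumes "X \<subseteq> I"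
  shows "(\<integral>s. indicator X s * g s \<partial>T) = (LINT s:X|lebesgue. g s)"
    and "integrable T (\<lambda>s. indicator X s * g s) \<longleftrightarrow> set_integrable lebesgue X g"
proof -
  have eq: "(\<lambda>s. indicator I s *\<^sub>R (indicator X s * g s)) = (\<lambda>s. indicator X s *\<^sub>R g s)"
    using assms by (auto simp: fun_eq_iff indicator_def)
  show "(\<integral>s. indicator X s * g s \<partial>T) = (LINT s:X|lebesgue. g s)"
    unfolding set_lebesgue_integral_def by (subst integral_restrict_space) (simp_all only: eq, simp)
  show "integrable T (\<lambda>s. indicator X s * g s) \<longleftrightarrow> set_integrable lebesgue X g"
    unfolding set_integrable_def by (subst integrable_restrict_space) (simp_all only: eq, simp)
qed

lemma T_nn_integral:
  assumes "X \<subseteq> I"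
  shows "(\<integral>\<^sup>+s. g s * indicator X s \<partial>T) = (\<integral>\<^sup>+s\<in>X. g s \<partial>lebesgue)"
  using assms by (subst nn_integral_restrict_space) (auto intro!: nn_integral_cong simp: indicator_def)

lemma indicator_T:
  "{a..d} \<in> sets lebesgue \<Longrightarrow> indicator {a..d} \<in> borel_measurable T"
  by (rule measurable_restrict_space1) (rule borel_measurable_indicator)

lemma AE_T: "(AE s in T. P s) \<longleftrightarrow> (AE s in lebesgue. s \<in> I \<longrightarrow> P s)"
  by (subst AE_restrict_space_iff) simp_all

lemma AE_T_interior: "AE s in T. s \<in> interior I"
proof -
  obtain d where d: "I - interior I \<subseteq> {d}" using interval_open_left_boundary[OF open_left] .
  have "AE s in lebesgue. s \<noteq> d" by (rule AE_completion) (rule AE_lborel_singleton)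
  then show ?thesis unfolding AE_T by eventually_elim (use d in auto)
qed

lemma AE_lebesgue_on_interior: "(AE s in lebesgue_on (interior I). P s) \<Longrightarrow> (AE s in T. P s)"
proof -
  assume "AE s in lebesgue_on (interior I). P s"
  then have "AE s in lebesgue. s \<in> interior I \<longrightarrow> P s" by (subst (asm) AE_restrict_space_iff) auto
  moreover have "AE s in lebesgue. s \<in> I \<longrightarrow> s \<in> interior I" using AE_T_interior by (simp add: AE_T)
  ultimately show ?thesis unfolding AE_T by eventually_elim auto
qed

text \<open>Compact subintervals with rational ends are countably many and cover the interior, and
  the boundary is null.\<close>

lemma AE_T_exhaust:
  assumes "\<And>a d. {a..d} \<subseteq> I \<Longrightarrow> a < d \<Longrightarrow> AE s in lebesgue. s \<in> {a..d} \<longrightarrow> P s"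
  shows "AE s in T. P s"
proof -
  define D where "D = {(a, d). a \<in> \<rat> \<and> d \<in> \<rat> \<and> a < d \<and> {a..d} \<subseteq> I}"
  have "countable D" by (rule countable_subset[of _ "\<rat> \<times> \<rat>"]) (auto simp: D_def countable_rat)
  then have "AE s in lebesgue. \<forall>p\<in>D. s \<in> {fst p..snd p} \<longrightarrow> P s"
    by (subst AE_ball_countable) (use assms in \<open>auto simp: D_def\<close>)
  moreover have "AE s in lebesgue. s \<in> I \<longrightarrow> s \<in> interior I" using AE_T_interior by (simp add: AE_T)
  ultimately show ?thesis unfolding AE_T
  proof eventually_elim
    case (elim s)
    show ?case
    proof
      assume "s \<in> I"
      then have "s \<in> interior I" using elim by simp
      then obtain e where e: "e > 0" "cball s e \<subseteq> I" using mem_interior_cball by blast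
      obtain a where a: "a \<in> \<rat>" "s - e < a" "a < s" using Rats_dense_in_real[of "s - e" s] e by auto
      obtain d where d: "d \<in> \<rat>" "s < d" "d < s + e" using Rats_dense_in_real[of s "s + e"] e by auto
      have "{a..d} \<subseteq> cball s e" using a d by (auto simp: dist_real_def)
      then have "(a, d) \<in> D" using a d e by (auto simp: D_def)
      then have "s \<in> {a..d} \<longrightarrow> P s" using elim by force
      then show "P s" using a d by simp
    qed
  qed
qed

text \<open>Supplies good initial times before a given time: a set of full measure meets the open
  interval that \<open>I\<close> contains to the left of \<open>t\<close>.\<close>

lemma AE_T_pick:
  assumes "AE s in T. P s" "t \<in> I"
  obtains t' where "t' < t" "t' \<in> I" "P t'"
proof -
  obtain t0 where t0: "t0 < t" "t0 \<in> I" using interval_open_left_interior(1)[OF open_left assms(2)] interior_subset by blast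
  have sub: "{t0<..<t} \<subseteq> I" using I_sub[OF t0(2) assms(2)] by auto
  have "\<exists>t'\<in>{t0<..<t}. P t'"
  proof (rule ccontr)
    assume "\<not> (\<exists>t'\<in>{t0<..<t}. P t')"
    note none = this
    have "AE s in lebesgue. s \<notin> {t0<..<t}"
      using assms(1) unfolding AE_T by eventually_elim (use sub none in auto)
    then have "{t0<..<t} \<in> null_sets lebesgue" by (subst AE_iff_null_sets) auto
    then have "emeasure lebesgue {t0<..<t} = 0" by auto
    then show False using t0 by simp
  qed
  then show ?thesis using that sub by (meson greaterThanLessThan_iff subsetD)
qed

lemma f_meas [measurable]: "f \<in> borel_measurable T"
  using f_Linf by (simp add: Linf_H_def)

lemma f_bounded:
  obtains C where "C \<ge> 0" "AE s in T. norm (f s) \<le> C"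
proof -
  obtain C where "AE s in T. norm (f s) \<le> C" using f_Linf unfolding Linf_H_def by blast
  then show ?thesis by (intro that[of "max C 0"]) (auto elim: eventually_mono)
qed

abbreviation M :: "(real \<times> (real \<Rightarrow> l2field)) measure" where "M \<equiv> T \<Otimes>\<^sub>M \<rho>"

lemma eval_M [measurable]: "(\<lambda>p. snd p (fst p)) \<in> borel_measurable M"
  by (rule eval_pair_measurable[OF sets_rho open_left])

lemma eval_rho [measurable]: "t \<in> I \<Longrightarrow> (\<lambda>u. u t) \<in> borel_measurable \<rho>"
  by (rule eval_measurable[OF sets_rho])

definition \<theta> :: "(real \<Rightarrow> l2field) \<Rightarrow> real \<Rightarrow> real" where "\<theta> u s = (norm (u s))\<^sup>2"
text \<open>\<open>enn2real\<close> sends the infinite value off \<open>V\<close> to zero, which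
  yields a real function that is jointly measurable in time and path and agrees with the squared
  gradient norm whenever the path is in \<open>V\<close>.\<close>

definition dis :: "(real \<Rightarrow> l2field) \<Rightarrow> real \<Rightarrow> real" where "dis u s = enn2real (V_norm_sq (u s))"
definition pow :: "(real \<Rightarrow> l2field) \<Rightarrow> real \<Rightarrow> real" where "pow u s = f s \<bullet> u s"

lemma M_measurable [measurable]:
  "(\<lambda>p. \<theta> (snd p) (fst p)) \<in> borel_measurable M" "(\<lambda>p. dis (snd p) (fst p)) \<in> borel_measurable M"
  "(\<lambda>p. pow (snd p) (fst p)) \<in> borel_measurable M" "(\<lambda>p. V_norm_sq (snd p (fst p))) \<in> borel_measurable M"
proof -
  show [measurable]: "(\<lambda>p. V_norm_sq (snd p (fst p))) \<in> borel_measurable M"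
    by (rule measurable_compose[OF eval_M V_norm_sq_borel])
  have [measurable]: "(\<lambda>p. f (fst p)) \<in> borel_measurable M"
    by (rule measurable_compose[OF measurable_fst f_meas])
  show "(\<lambda>p. \<theta> (snd p) (fst p)) \<in> borel_measurable M" unfolding \<theta>_def by measurable
  show "(\<lambda>p. dis (snd p) (fst p)) \<in> borel_measurable M" unfolding dis_def by measurable
  show "(\<lambda>p. pow (snd p) (fst p)) \<in> borel_measurable M" unfolding pow_def by measurable
qed

lemma section_T: "g \<in> measurable M N \<Longrightarrow> u \<in> space \<rho> \<Longrightarrow> (\<lambda>s. g (s, u)) \<in> measurable T N"
  by (rule measurable_Pair1)

lemma section_rho: "g \<in> measurable M N \<Longrightarrow> t \<in> I \<Longrightarrow> (\<lambda>u. g (t, u)) \<in> measurable \<rho> N"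
  using measurable_Pair2[of g T \<rho> N t] unfolding space_T by blast

lemma path_measurable:
  assumes "u \<in> space \<rho>"
  shows "\<theta> u \<in> borel_measurable T" "dis u \<in> borel_measurable T" "pow u \<in> borel_measurable T"
  using section_T[OF M_measurable(1) assms] section_T[OF M_measurable(2) assms] section_T[OF M_measurable(3) assms]
  by simp_all

lemma set_measurable_T:
  assumes "g \<in> borel_measurable T" "X \<subseteq> I" "X \<in> sets lebesgue"
  shows "set_borel_measurable lebesgue X (g :: real \<Rightarrow> real)"
proof -
  have "(\<lambda>s. indicator I s *\<^sub>R g s) \<in> borel_measurable lebesgue"
    using borel_measurable_restrict_space_iff[of I lebesgue g] assms(1) by simp
  then have "(\<lambda>s. indicator X s *\<^sub>R (indicator I s *\<^sub>R g s)) \<in> borel_measurable lebesgue"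
    by (rule borel_measurable_scaleR[OF borel_measurable_indicator[OF assms(3)]])
  moreover have "(\<lambda>s. indicator X s *\<^sub>R (indicator I s *\<^sub>R g s)) = (\<lambda>s. indicator X s *\<^sub>R g s)"
    using assms(2) by (auto simp: fun_eq_iff indicator_def)
  ultimately show ?thesis by (simp add: set_borel_measurable_def)
qed

lemma dis_V: "u s \<in> V \<Longrightarrow> dis u s = (V_norm (u s))\<^sup>2" "u s \<in> V \<Longrightarrow> V_norm_sq (u s) = ennreal (dis u s)"
  "0 \<le> dis u s"
  by (simp_all add: dis_def V_norm_sq_def)

lemma AE_U_sharp: "AE u in \<rho>. u \<in> U_sharp I \<and> u \<in> space \<rho>"
proof -
  have "U_sharp I \<in> sets \<rho>" "emeasure \<rho> (space \<rho> - U_sharp I) = 0"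
    using rho_vf by (auto simp: Vishik_Fursikov_measure_def carried_by_def)
  then have "AE u in \<rho>. u \<notin> space \<rho> - U_sharp I"
    by (intro AE_not_in) (auto simp: null_sets_def)
  then show ?thesis using AE_space by eventually_elim auto
qed

lemma U_sharp_V: "u \<in> U_sharp I \<Longrightarrow> AE s in T. u s \<in> V"
  by (rule AE_lebesgue_on_interior) (simp add: U_sharp_def weak_solution_def L2_loc_V_def)

text \<open>A path in \<open>U_sharp I\<close> is a weak solution on the interior only, which limits
  this to intervals inside the interior. Up to a right end point integrability will hold for almost
  every path, by \<open>dominated_fubini\<close>.\<close>

lemma U_sharp_dis_integrable:
  assumes u: "u \<in> U_sharp I" "u \<in> space \<rho>" and ab: "{a..d} \<subseteq> interior I"
  shows "set_integrable lebesgue {a..d} (dis u)"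
proof -
  have abI: "{a..d} \<subseteq> I" using ab interior_subset by blast
  have "(\<integral>\<^sup>+s\<in>{a..d}. ennreal ((V_norm (u s))\<^sup>2) \<partial>lebesgue) < \<infinity>"
    using u ab by (simp add: U_sharp_def weak_solution_def L2_loc_V_def L1_loc_def)
  moreover have "(\<integral>\<^sup>+s. ennreal (norm (indicator {a..d} s *\<^sub>R dis u s)) \<partial>lebesgue) = (\<integral>\<^sup>+s\<in>{a..d}. ennreal ((V_norm (u s))\<^sup>2) \<partial>lebesgue)"
  proof (rule nn_integral_cong_AE)
    show "AE s in lebesgue. ennreal (norm (indicator {a..d} s *\<^sub>R dis u s)) = ennreal ((V_norm (u s))\<^sup>2) * indicator {a..d} s"
      using U_sharp_V[OF u(1)] unfolding AE_T
      by eventually_elim (use abI in \<open>auto simp: indicator_def dis_V\<close>)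
  qed
  moreover have "(\<lambda>s. indicator {a..d} s *\<^sub>R dis u s) \<in> borel_measurable lebesgue"
    using set_measurable_T[OF path_measurable(2)[OF u(2)] abI] by (simp add: set_borel_measurable_def)
  ultimately show ?thesis unfolding set_integrable_def by (intro integrableI_bounded) simp_all
qed

lemma U_sharp_\<theta>_integrable:
  assumes u: "u \<in> U_sharp I" "u \<in> space \<rho>" and ab: "{a..d} \<subseteq> interior I"
  shows "set_integrable lebesgue {a..d} (\<theta> u)"
proof -
  have abI: "{a..d} \<subseteq> I" using ab interior_subset by blast
  obtain C where "AE s in lebesgue_on {a..d}. ennreal (norm (u s)) \<le> ennreal C"
    using u(1) ab unfolding U_sharp_def weak_solution_def Linf_loc_H_def Linf_loc_def by blast
  then have C: "AE s in lebesgue. s \<in> {a..d} \<longrightarrow> ennreal (norm (u s)) \<le> ennreal C"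
    by (subst (asm) AE_restrict_space_iff) auto
  show ?thesis unfolding set_integrable_def
  proof (rule Bochner_Integration.integrable_bound)
    show "integrable lebesgue (\<lambda>s. (max C 0)\<^sup>2 * indicator {a..d} s :: real)"
      by (intro integrable_mult_right integrable_real_indicator) (auto simp: emeasure_lborel_Icc_eq)
    show "(\<lambda>s. indicator {a..d} s *\<^sub>R \<theta> u s) \<in> borel_measurable lebesgue"
      using set_measurable_T[OF path_measurable(1)[OF u(2)] abI] by (simp add: set_borel_measurable_def)
    show "AE s in lebesgue. norm (indicator {a..d} s *\<^sub>R \<theta> u s) \<le> norm ((max C 0)\<^sup>2 * indicator {a..d} s :: real)"
      using C
    proof eventually_elim
      case (elim s)
      show ?case
      proof (cases "s \<in> {a..d}")
        case True
        then have "ennreal (norm (u s)) \<le> ennreal (max C 0)" using elim by (auto intro: order_trans ennreal_leI)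
        then have "norm (u s) \<le> max C 0" by (subst (asm) ennreal_le_iff) auto
        then have "(norm (u s))\<^sup>2 \<le> (max C 0)\<^sup>2" by (intro power_mono) auto
        then show ?thesis using True by (simp add: \<theta>_def)
      qed simp
    qed
  qed
qed

lemma pow_le: "norm (f s) \<le> C \<Longrightarrow> \<bar>pow u s\<bar> \<le> C * (1 + \<theta> u s)"
proof -
  assume C: "norm (f s) \<le> C"
  have "\<bar>pow u s\<bar> \<le> norm (f s) * norm (u s)" unfolding pow_def by (rule Cauchy_Schwarz_ineq2)
  also have "\<dots> \<le> C * norm (u s)" using C by (intro mult_right_mono) auto
  also have "norm (u s) \<le> 1 + \<theta> u s"
    using mult_le_sum_squares[of 1 "norm (u s)"] by (simp add: \<theta>_def)
  finally show ?thesis using C norm_ge_zero[of "f s"] by (simp add: mult_left_mono)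
qed

lemma pow_integrable:
  assumes u: "u \<in> space \<rho>" and ab: "{a..d} \<subseteq> I" and th: "set_integrable lebesgue {a..d} (\<theta> u)"
  shows "set_integrable lebesgue {a..d} (pow u)"
    and "\<And>C. set_integrable lebesgue {a..d} (\<lambda>s. C * (1 + \<theta> u s))"
proof -
  have one: "set_integrable lebesgue {a..d} (\<lambda>s. 1 :: real)"
    unfolding set_integrable_def by (simp add: emeasure_lborel_Icc_eq)
  then show maj: "set_integrable lebesgue {a..d} (\<lambda>s. C * (1 + \<theta> u s))" for C using th by simp
  obtain C where C: "C \<ge> 0" "AE s in T. norm (f s) \<le> C" using f_bounded .
  show "set_integrable lebesgue {a..d} (pow u)"
    unfolding set_integrable_def
  proof (rule Bochner_Integration.integrable_bound)
    show "integrable lebesgue (\<lambda>s. indicator {a..d} s *\<^sub>R (C * (1 + \<theta> u s)))" using maj[of C] by (simp add: set_integrable_def)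
    show "(\<lambda>s. indicator {a..d} s *\<^sub>R pow u s) \<in> borel_measurable lebesgue"
      using set_measurable_T[OF path_measurable(3)[OF u] ab] by (simp add: set_borel_measurable_def)
    show "AE s in lebesgue. norm (indicator {a..d} s *\<^sub>R pow u s) \<le> norm (indicator {a..d} s *\<^sub>R (C * (1 + \<theta> u s)))"
      using C(2) unfolding AE_T
    proof eventually_elim
      case (elim s)
      show ?case
      proof (cases "s \<in> {a..d}")
        case True
        then have "\<bar>pow u s\<bar> \<le> C * (1 + \<theta> u s)" using elim ab by (intro pow_le) auto
        then show ?thesis using True by simp
      qed simp
    qed
  qed
qed

text \<open>By weak lower semicontinuity of the norm it suffices to compare with later rational times, so that
  the exceptional sets are unions of countably many.\<close>

definition En :: "(real \<Rightarrow> l2field) \<Rightarrow> real \<Rightarrow> real \<Rightarrow> bool" where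
  "En u s q \<longleftrightarrow> \<theta> u q / 2 + \<nu> * (LINT r:{s..q}|lebesgue. dis u r) \<le> \<theta> u s / 2 + (LINT r:{s..q}|lebesgue. pow u r)"

definition good :: "(real \<Rightarrow> l2field) \<Rightarrow> real \<Rightarrow> bool" where
  "good u s \<longleftrightarrow> s \<in> interior I \<and> (\<forall>q\<in>\<rat> \<inter> interior I. s < q \<longrightarrow> En u s q)"

lemma U_sharp_good:
  assumes u: "u \<in> U_sharp I" "u \<in> space \<rho>"
  shows "AE s in T. good u s"
proof -
  have "AE t' in lebesgue_on (interior I). \<forall>t\<in>interior I. t > t' \<longrightarrow>
      (norm (u t))\<^sup>2 / 2 + \<nu> * (LINT s:{t'..t}|lebesgue. (V_norm (u s))\<^sup>2)
        \<le> (norm (u t'))\<^sup>2 / 2 + (LINT s:{t'..t}|lebesgue. f s \<bullet> u s)"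
    using u(1) by (simp add: U_sharp_def weak_solution_def)
  from AE_lebesgue_on_interior[OF this] AE_T_interior show ?thesis
  proof eventually_elim
    case (elim s)
    show ?case unfolding good_def
    proof (intro conjI ballI impI)
      show "s \<in> interior I" by (rule elim(2))
      fix q assume q: "q \<in> \<rat> \<inter> interior I" "s < q"
      have sI: "s \<in> I" "q \<in> I" using q elim(2) interior_subset by auto
      have sub: "{s..q} \<subseteq> I" by (rule I_sub[OF sI])
      \<comment> \<open>\<open>V_norm\<close> and \<open>dis\<close> may differ when the path is
        outside \<open>V\<close>, but such times form a null set.\<close>
      have "(LINT r:{s..q}|lebesgue. (V_norm (u r))\<^sup>2) = (LINT r:{s..q}|lebesgue. dis u r)"
        unfolding set_lebesgue_integral_def
      proof (rule integral_cong_AE)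
        have ae: "AE r in lebesgue. indicator {s..q} r *\<^sub>R dis u r = indicator {s..q} r *\<^sub>R (V_norm (u r))\<^sup>2"
          using U_sharp_V[OF u(1)] unfolding AE_T by eventually_elim (use sub in \<open>auto simp: indicator_def dis_V\<close>)
        then show "AE r in lebesgue. indicator {s..q} r *\<^sub>R (V_norm (u r))\<^sup>2 = indicator {s..q} r *\<^sub>R dis u r"
          by eventually_elim (rule sym)
        show m: "(\<lambda>r. indicator {s..q} r *\<^sub>R dis u r) \<in> borel_measurable lebesgue"
          using set_measurable_T[OF path_measurable(2)[OF u(2)] sub] by (simp add: set_borel_measurable_def)
        show "(\<lambda>r. indicator {s..q} r *\<^sub>R (V_norm (u r))\<^sup>2) \<in> borel_measurable lebesgue"
          by (rule borel_measurable_AE[OF m ae])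
      qed
      then show "En u s q" using elim(1) q unfolding En_def \<theta>_def pow_def by auto
    qed
  qed
qed

text \<open>For a fixed rational final time the inequality defines a measurable set of pairs of a
  time and a path. Almost every path satisfies it at almost every time, so the two quantifiers may
  be exchanged; afterwards the countably many final times are collected.\<close>

lemma good_times: "AE t in T. t \<in> interior I \<and> (AE u in \<rho>. good u t)"
proof -
  interpret P: pair_sigma_finite T \<rho> by (rule pair_sigma)
  have "AE t in T. AE u in \<rho>. t < q \<longrightarrow> En u t q" if q: "q \<in> \<rat> \<inter> interior I" for q
  proof -
    have qI: "q \<in> I" using q interior_subset by auto
    \<comment> \<open>Writing the integral over all of \<open>T\<close> with an indicator turns the
      varying initial time into a parameter of the integrand, so that measurability in the parameter
      applies.\<close>
    define L where "L g p = (\<integral>s. indicator {fst p..q} s * g (snd p) s \<partial>T)" for g :: "(real \<Rightarrow> l2field) \<Rightarrow> real \<Rightarrow> real" and p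
    have Lm: "L g \<in> borel_measurable M" if g: "(\<lambda>p. g (snd p) (fst p)) \<in> borel_measurable M" for g
    proof -
      have [measurable]: "(\<lambda>s. s) \<in> measurable T borel" by (rule measurable_restrict_space1) (simp add: measurable_completion)
      have fm [measurable]: "(\<lambda>z. fst (fst z)) \<in> borel_measurable (M \<Otimes>\<^sub>M T)" "(\<lambda>z. snd z) \<in> borel_measurable (M \<Otimes>\<^sub>M T)"
        by measurable
      have "(\<lambda>z. (snd z, snd (fst z))) \<in> measurable (M \<Otimes>\<^sub>M T) M" by measurable
      from measurable_compose[OF this g]
      have gm [measurable]: "(\<lambda>z. g (snd (fst z)) (snd z)) \<in> borel_measurable (M \<Otimes>\<^sub>M T)" by simp
      have "(\<lambda>z. (if fst (fst z) \<le> snd z \<and> snd z \<le> q then 1 else 0) * g (snd (fst z)) (snd z)) \<in> borel_measurable (M \<Otimes>\<^sub>M T)"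
        by measurable
      moreover have "(\<lambda>z. (if fst (fst z) \<le> snd z \<and> snd z \<le> q then 1 else 0) * g (snd (fst z)) (snd z)) =
          case_prod (\<lambda>p s. indicator {fst p..q} s * g (snd p) s)"
        by (auto simp: fun_eq_iff indicator_def)
      ultimately have "case_prod (\<lambda>p s. indicator {fst p..q} s * g (snd p) s) \<in> borel_measurable (M \<Otimes>\<^sub>M T)" by simp
      then show ?thesis unfolding L_def[abs_def] by (rule sigma_finite_measure.borel_measurable_lebesgue_integral[OF sigma_finite_T])
    qed
    have Leq: "L g (t, u) = (LINT r:{t..q}|lebesgue. g u r)" if "t \<in> I" for g t u
      unfolding L_def using T_set_integral(1)[OF I_sub[OF that qI]] by simp
    have qm [measurable]: "(\<lambda>p. \<theta> (snd p) q) \<in> borel_measurable M"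
      unfolding \<theta>_def
      by (rule borel_measurable_power[OF measurable_compose[OF measurable_compose[OF measurable_snd eval_rho[OF qI]] borel_measurable_norm]])
    have [measurable]: "(\<lambda>p. fst p) \<in> borel_measurable M"
      by (rule measurable_compose[OF measurable_fst]) (rule measurable_restrict_space1, simp add: measurable_completion)
    have "{p \<in> space M. fst p < q \<longrightarrow> \<theta> (snd p) q / 2 + \<nu> * L dis p \<le> \<theta> (snd p) (fst p) / 2 + L pow p} \<in> sets M"
      using Lm[OF M_measurable(2)] Lm[OF M_measurable(3)] M_measurable(1) qm by measurable
    moreover have "{p \<in> space M. fst p < q \<longrightarrow> \<theta> (snd p) q / 2 + \<nu> * L dis p \<le> \<theta> (snd p) (fst p) / 2 + L pow p}
      = {p \<in> space M. fst p < q \<longrightarrow> En (snd p) (fst p) q}"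
      by (auto simp: En_def space_pair_measure space_T Leq)
    ultimately have ms: "{p \<in> space M. fst p < q \<longrightarrow> En (snd p) (fst p) q} \<in> sets M" by simp
    have "AE u in \<rho>. AE t in T. t < q \<longrightarrow> En u t q"
      using AE_U_sharp
    proof eventually_elim
      case (elim u)
      from U_sharp_good[of u] elim have "AE t in T. good u t" by simp
      then show ?case by eventually_elim (use q in \<open>auto simp: good_def\<close>)
    qed
    then show ?thesis using P.AE_commute[OF ms] by simp
  qed
  then have "AE t in T. \<forall>q\<in>\<rat> \<inter> interior I. AE u in \<rho>. t < q \<longrightarrow> En u t q"
    by (subst AE_ball_countable) (auto intro: countable_Int1 countable_rat)
  then show ?thesis using AE_T_interior
  proof eventually_elim
    case (elim t)
    have "AE u in \<rho>. \<forall>q\<in>\<rat> \<inter> interior I. t < q \<longrightarrow> En u t q"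
      by (subst AE_ball_countable) (use elim in \<open>auto intro: countable_Int1 countable_rat\<close>)
    then show ?case using elim(2) by (auto simp: good_def elim: eventually_mono)
  qed
qed

section \<open>Local integrability of the mean dissipation\<close>

definition m2 :: "real \<Rightarrow> ennreal" where "m2 t = (\<integral>\<^sup>+u. ennreal (\<theta> u t) \<partial>\<rho>)"

lemma m2_Linf_loc: "Linf_loc I m2"
proof -
  have "(\<integral>\<^sup>+u\<in>U_sharp I. ennreal ((norm (u t))\<^sup>2) \<partial>\<rho>) = m2 t" for t
    unfolding m2_def
  proof (rule nn_integral_cong_AE)
    show "AE u in \<rho>. ennreal ((norm (u t))\<^sup>2) * indicator (U_sharp I) u = ennreal (\<theta> u t)"
      using AE_U_sharp by eventually_elim (simp add: \<theta>_def)
  qed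
  then show ?thesis using rho_vf by (simp add: Vishik_Fursikov_measure_def)
qed

lemma m2_finite: "AE t in T. m2 t < \<infinity>"
proof (rule AE_T_exhaust)
  fix a d assume ab: "{a..d} \<subseteq> I" "a < d"
  then obtain C where "AE t in lebesgue_on {a..d}. m2 t \<le> ennreal C" using m2_Linf_loc unfolding Linf_loc_def by blast
  then have "AE t in lebesgue. t \<in> {a..d} \<longrightarrow> m2 t \<le> ennreal C" by (subst (asm) AE_restrict_space_iff) auto
  then show "AE t in lebesgue. t \<in> {a..d} \<longrightarrow> m2 t < \<infinity>"
    by eventually_elim (auto intro: le_less_trans)
qed

lemma m2_measurable: "m2 \<in> borel_measurable T"
  using m2_Linf_loc by (simp add: Linf_loc_def)

lemma m2_integral_finite:
  assumes ab: "{a..d} \<subseteq> I"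
  shows "(\<integral>\<^sup>+s\<in>{a..d}. (1 + m2 s) \<partial>lebesgue) < \<infinity>"
proof -
  obtain C where "AE t in lebesgue_on {a..d}. m2 t \<le> ennreal C" using m2_Linf_loc ab unfolding Linf_loc_def by blast
  then have ae: "AE t in lebesgue. t \<in> {a..d} \<longrightarrow> m2 t \<le> ennreal C" by (subst (asm) AE_restrict_space_iff) auto
  have "(\<integral>\<^sup>+s\<in>{a..d}. (1 + m2 s) \<partial>lebesgue) \<le> (\<integral>\<^sup>+s\<in>{a..d}. (1 + ennreal C) \<partial>lebesgue)"
    by (rule nn_integral_mono_AE) (use ae in eventually_elim, auto simp: indicator_def intro: add_left_mono)
  also have "\<dots> = (1 + ennreal C) * emeasure lebesgue {a..d}" by (rule nn_integral_cmult_indicator) simp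
  also have "\<dots> < \<infinity>" by (auto simp: ennreal_mult_less_top emeasure_lborel_Icc_eq)
  finally show ?thesis .
qed

definition W :: "real \<Rightarrow> ennreal" where "W s = (\<integral>\<^sup>+u. V_norm_sq (u s) \<partial>\<rho>)"

lemma W_measurable [measurable]: "W \<in> borel_measurable T"
proof -
  interpret S: sigma_finite_measure \<rho> by (rule prob_space_imp_sigma_finite[OF rho_prob])
  have "case_prod (\<lambda>s u. V_norm_sq (u s)) \<in> borel_measurable M"
    using M_measurable(4) by (simp add: case_prod_beta')
  then show ?thesis unfolding W_def[abs_def] by (rule S.borel_measurable_nn_integral)
qed

lemma tonelli:
  assumes g: "(\<lambda>p. g (snd p) (fst p)) \<in> borel_measurable M" and X: "X \<subseteq> I" "X \<in> sets lebesgue"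
  shows "(\<integral>\<^sup>+u. (\<integral>\<^sup>+s\<in>X. g u s \<partial>lebesgue) \<partial>\<rho>) = (\<integral>\<^sup>+s\<in>X. (\<integral>\<^sup>+u. g u s \<partial>\<rho>) \<partial>lebesgue)"
proof -
  interpret P: pair_sigma_finite T \<rho> by (rule pair_sigma)
  have Am: "indicator X \<in> borel_measurable T"
    by (rule measurable_restrict_space1) (use X in simp)
  have im: "(\<lambda>p. indicator X (fst p) :: ennreal) \<in> borel_measurable M"
    by (rule measurable_compose[OF measurable_fst Am])
  have "(\<lambda>p. g (snd p) (fst p) * indicator X (fst p)) \<in> borel_measurable M"
    by (rule borel_measurable_times_ennreal[OF g im])
  then have m: "case_prod (\<lambda>s u. g u s * indicator X s) \<in> borel_measurable M" by (simp add: case_prod_beta')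
  have "(\<integral>\<^sup>+u. (\<integral>\<^sup>+s\<in>X. g u s \<partial>lebesgue) \<partial>\<rho>) = (\<integral>\<^sup>+u. (\<integral>\<^sup>+s. g u s * indicator X s \<partial>T) \<partial>\<rho>)"
    by (simp only: T_nn_integral[OF X(1)])
  also have "\<dots> = (\<integral>\<^sup>+s. (\<integral>\<^sup>+u. g u s * indicator X s \<partial>\<rho>) \<partial>T)" by (rule P.Fubini'[OF m])
  also have "\<dots> = (\<integral>\<^sup>+s. (\<integral>\<^sup>+u. g u s \<partial>\<rho>) * indicator X s \<partial>T)"
  proof (rule nn_integral_cong)
    fix s assume "s \<in> space T"
    then have "(\<lambda>u. g u s) \<in> borel_measurable \<rho>" using section_rho[OF g, of s] by (simp add: space_T)
    then show "(\<integral>\<^sup>+u. g u s * indicator X s \<partial>\<rho>) = (\<integral>\<^sup>+u. g u s \<partial>\<rho>) * indicator X s" by (rule nn_integral_multc)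
  qed
  also have "\<dots> = (\<integral>\<^sup>+s\<in>X. (\<integral>\<^sup>+u. g u s \<partial>\<rho>) \<partial>lebesgue)" by (rule T_nn_integral[OF X(1)])
  finally show ?thesis .
qed

text \<open>The final energy in the inequality is dropped, the work of the force is bounded by the
  energy, and the result is averaged. Everything is kept in the extended nonnegative reals because
  finiteness of the left-hand side is the point at issue.\<close>

lemma W_rational_bound:
  assumes t': "t' \<in> interior I" "AE u in \<rho>. good u t'" and q: "q \<in> \<rat> \<inter> interior I" "t' < q"
    and C: "C \<ge> 0" "AE s in T. norm (f s) \<le> C"
  shows "ennreal \<nu> * (\<integral>\<^sup>+s\<in>{t'..q}. W s \<partial>lebesgue) \<le> m2 t' + ennreal C * (\<integral>\<^sup>+s\<in>{t'..q}. (1 + m2 s) \<partial>lebesgue)"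
proof -
  have I: "t' \<in> I" "q \<in> I" using t' q interior_subset by auto
  have sub: "{t'..q} \<subseteq> I" by (rule I_sub[OF I])
  have subJ: "{t'..q} \<subseteq> interior I"
  proof
    fix x assume x: "x \<in> {t'..q}"
    show "x \<in> interior I"
    proof (rule ccontr)
      assume "x \<notin> interior I"
      then have "q \<le> x" using interval_open_left_interior(2)[OF open_left, of x q] x sub I by auto
      then show False using x q \<open>x \<notin> interior I\<close> by auto
    qed
  qed
  have path: "AE u in \<rho>. ennreal \<nu> * (\<integral>\<^sup>+s\<in>{t'..q}. V_norm_sq (u s) \<partial>lebesgue)
      \<le> ennreal (\<theta> u t') + (\<integral>\<^sup>+s\<in>{t'..q}. ennreal C * (1 + ennreal (\<theta> u s)) \<partial>lebesgue)"
    using AE_U_sharp t'(2)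
  proof eventually_elim
    case (elim u)
    then have u: "u \<in> U_sharp I" "u \<in> space \<rho>" by auto
    have th: "set_integrable lebesgue {t'..q} (\<theta> u)" by (rule U_sharp_\<theta>_integrable[OF u subJ])
    have di: "set_integrable lebesgue {t'..q} (dis u)" by (rule U_sharp_dis_integrable[OF u subJ])
    note pi = pow_integrable[OF u(2) sub th]
    have "En u t' q" using elim(2) q by (simp add: good_def)
    then have "\<nu> * (LINT r:{t'..q}|lebesgue. dis u r) \<le> \<theta> u t' / 2 + (LINT r:{t'..q}|lebesgue. pow u r)"
      unfolding En_def using zero_le_power2[of "norm (u q)"] unfolding \<theta>_def by linarith
    also have "(LINT r:{t'..q}|lebesgue. pow u r) \<le> (LINT r:{t'..q}|lebesgue. C * (1 + \<theta> u r))"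
    proof (rule set_integral_mono_AE[OF pi(1) pi(2)[of C]])
      show "AE s\<in>{t'..q} in lebesgue. pow u s \<le> C * (1 + \<theta> u s)"
        using C(2) unfolding AE_T
      proof eventually_elim
        case (elim s)
        show ?case
        proof
          assume "s \<in> {t'..q}"
          then have "\<bar>pow u s\<bar> \<le> C * (1 + \<theta> u s)" using elim sub by (intro pow_le) auto
          then show "pow u s \<le> C * (1 + \<theta> u s)" by simp
        qed
      qed
    qed
    finally have le: "\<nu> * (LINT r:{t'..q}|lebesgue. dis u r) \<le> \<theta> u t' / 2 + (LINT r:{t'..q}|lebesgue. C * (1 + \<theta> u r))" by simp
    have nn: "ennreal (LINT r:{t'..q}|lebesgue. h r) = (\<integral>\<^sup>+r\<in>{t'..q}. ennreal (h r) \<partial>lebesgue)"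
      if "set_integrable lebesgue {t'..q} h" "\<And>r. 0 \<le> h r" for h :: "real \<Rightarrow> real"
    proof -
      have "(\<integral>\<^sup>+r. ennreal (indicator {t'..q} r *\<^sub>R h r) \<partial>lebesgue) = ennreal (\<integral>r. indicator {t'..q} r *\<^sub>R h r \<partial>lebesgue)"
        by (rule nn_integral_eq_integral) (use that in \<open>auto simp: set_integrable_def\<close>)
      moreover have "ennreal (indicator {t'..q} r *\<^sub>R h r) = ennreal (h r) * indicator {t'..q} r" for r
        by (simp add: indicator_def)
      ultimately show ?thesis by (simp add: set_lebesgue_integral_def)
    qed
    have \<theta>nn: "0 \<le> \<theta> u s" for s by (simp add: \<theta>_def)
    have L0: "0 \<le> (LINT r:{t'..q}|lebesgue. dis u r)" "0 \<le> (LINT r:{t'..q}|lebesgue. C * (1 + \<theta> u r))"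
      unfolding set_lebesgue_integral_def using C(1) \<theta>nn by (auto intro!: integral_nonneg_AE simp: dis_V(3))
    have "ennreal \<nu> * (\<integral>\<^sup>+s\<in>{t'..q}. V_norm_sq (u s) \<partial>lebesgue) = ennreal \<nu> * (\<integral>\<^sup>+s\<in>{t'..q}. ennreal (dis u s) \<partial>lebesgue)"
    proof (rule arg_cong[where f="\<lambda>x. ennreal \<nu> * x"], rule nn_integral_cong_AE)
      show "AE s in lebesgue. V_norm_sq (u s) * indicator {t'..q} s = ennreal (dis u s) * indicator {t'..q} s"
        using U_sharp_V[OF u(1)] unfolding AE_T by eventually_elim (use sub in \<open>auto simp: indicator_def dis_V(2)\<close>)
    qed
    also have "\<dots> = ennreal (\<nu> * (LINT r:{t'..q}|lebesgue. dis u r))"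
      using nn[OF di] L0 nu_pos by (simp add: dis_V(3) ennreal_mult)
    also have "\<dots> \<le> ennreal (\<theta> u t' + (LINT r:{t'..q}|lebesgue. C * (1 + \<theta> u r)))"
      using le \<theta>nn[of t'] by (intro ennreal_leI) linarith
    also have "\<dots> = ennreal (\<theta> u t') + ennreal (LINT r:{t'..q}|lebesgue. C * (1 + \<theta> u r))"
      using \<theta>nn L0 by (intro ennreal_plus) auto
    also have "ennreal (LINT r:{t'..q}|lebesgue. C * (1 + \<theta> u r)) = (\<integral>\<^sup>+r\<in>{t'..q}. ennreal (C * (1 + \<theta> u r)) \<partial>lebesgue)"
      using C(1) \<theta>nn by (intro nn[OF pi(2)]) (simp add: add_nonneg_nonneg)
    also have "\<dots> = (\<integral>\<^sup>+s\<in>{t'..q}. ennreal C * (1 + ennreal (\<theta> u s)) \<partial>lebesgue)"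
    proof -
      have "ennreal (C * (1 + \<theta> u r)) = ennreal C * (1 + ennreal (\<theta> u r))" for r
        using C(1) \<theta>nn[of r] by (subst ennreal_mult) auto
      then show ?thesis by simp
    qed
    finally show ?case .
  qed
  have Vm: "(\<lambda>p. V_norm_sq (snd p (fst p))) \<in> borel_measurable M" by (rule M_measurable(4))
  have \<theta>m: "(\<lambda>p. ennreal C * (1 + ennreal (\<theta> (snd p) (fst p)))) \<in> borel_measurable M"
    using M_measurable(1) by measurable
  have \<theta>s: "(\<lambda>u. ennreal (\<theta> u s)) \<in> borel_measurable \<rho>" if "s \<in> I" for s
    using section_rho[OF M_measurable(1) that] by simp
  have inner: "(\<integral>\<^sup>+u. ennreal C * (1 + ennreal (\<theta> u s)) \<partial>\<rho>) = ennreal C * (1 + m2 s)" if "s \<in> I" for s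
    using \<theta>s[OF that] prob_space.emeasure_space_1[OF rho_prob]
    by (simp add: nn_integral_cmult nn_integral_add m2_def)
  have "ennreal \<nu> * (\<integral>\<^sup>+s\<in>{t'..q}. W s \<partial>lebesgue) = ennreal \<nu> * (\<integral>\<^sup>+u. (\<integral>\<^sup>+s\<in>{t'..q}. V_norm_sq (u s) \<partial>lebesgue) \<partial>\<rho>)"
    unfolding W_def using tonelli[OF Vm sub] by simp
  also have "\<dots> = (\<integral>\<^sup>+u. ennreal \<nu> * (\<integral>\<^sup>+s\<in>{t'..q}. V_norm_sq (u s) \<partial>lebesgue) \<partial>\<rho>)"
  proof (rule nn_integral_cmult[symmetric])
    interpret S: sigma_finite_measure T by (rule sigma_finite_T)
    have im: "indicator {t'..q} \<in> borel_measurable T" by (rule indicator_T) simp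
    have "(\<lambda>p. V_norm_sq (snd p (fst p)) * indicator {t'..q} (fst p)) \<in> borel_measurable M"
      by (rule borel_measurable_times_ennreal[OF Vm measurable_compose[OF measurable_fst im]])
    from measurable_pair_swap[OF this] have "(\<lambda>z. V_norm_sq (fst z (snd z)) * indicator {t'..q} (snd z)) \<in> borel_measurable (\<rho> \<Otimes>\<^sub>M T)"
      by (simp add: case_prod_beta')
    then have "(\<lambda>u. \<integral>\<^sup>+s. V_norm_sq (u s) * indicator {t'..q} s \<partial>T) \<in> borel_measurable \<rho>"
      by (intro S.borel_measurable_nn_integral) (simp add: case_prod_beta')
    then show "(\<lambda>u. \<integral>\<^sup>+s\<in>{t'..q}. V_norm_sq (u s) \<partial>lebesgue) \<in> borel_measurable \<rho>" by (simp only: T_nn_integral[OF sub])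
  qed
  also have "\<dots> \<le> (\<integral>\<^sup>+u. ennreal (\<theta> u t') + (\<integral>\<^sup>+s\<in>{t'..q}. ennreal C * (1 + ennreal (\<theta> u s)) \<partial>lebesgue) \<partial>\<rho>)"
    by (rule nn_integral_mono_AE[OF path])
  also have "\<dots> = m2 t' + (\<integral>\<^sup>+u. (\<integral>\<^sup>+s\<in>{t'..q}. ennreal C * (1 + ennreal (\<theta> u s)) \<partial>lebesgue) \<partial>\<rho>)"
    unfolding m2_def
  proof (rule nn_integral_add[OF \<theta>s[OF I(1)]])
    interpret S: sigma_finite_measure T by (rule sigma_finite_T)
    have im: "indicator {t'..q} \<in> borel_measurable T" by (rule indicator_T) simp
    have "(\<lambda>p. ennreal C * (1 + ennreal (\<theta> (snd p) (fst p))) * indicator {t'..q} (fst p)) \<in> borel_measurable M"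
      by (rule borel_measurable_times_ennreal[OF \<theta>m measurable_compose[OF measurable_fst im]])
    from measurable_pair_swap[OF this] have "(\<lambda>z. ennreal C * (1 + ennreal (\<theta> (fst z) (snd z))) * indicator {t'..q} (snd z)) \<in> borel_measurable (\<rho> \<Otimes>\<^sub>M T)"
      by (simp add: case_prod_beta')
    then have "(\<lambda>u. \<integral>\<^sup>+s. ennreal C * (1 + ennreal (\<theta> u s)) * indicator {t'..q} s \<partial>T) \<in> borel_measurable \<rho>"
      by (intro S.borel_measurable_nn_integral) (simp add: case_prod_beta')
    then show "(\<lambda>u. \<integral>\<^sup>+s\<in>{t'..q}. ennreal C * (1 + ennreal (\<theta> u s)) \<partial>lebesgue) \<in> borel_measurable \<rho>" by (simp only: T_nn_integral[OF sub])
  qed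
  also have "(\<integral>\<^sup>+u. (\<integral>\<^sup>+s\<in>{t'..q}. ennreal C * (1 + ennreal (\<theta> u s)) \<partial>lebesgue) \<partial>\<rho>)
      = (\<integral>\<^sup>+s\<in>{t'..q}. (\<integral>\<^sup>+u. ennreal C * (1 + ennreal (\<theta> u s)) \<partial>\<rho>) \<partial>lebesgue)"
    by (rule tonelli[OF \<theta>m sub]) simp
  also have "\<dots> = (\<integral>\<^sup>+s. ennreal C * ((1 + m2 s) * indicator {t'..q} s) \<partial>T)"
    unfolding T_nn_integral[OF sub, symmetric]
    by (intro nn_integral_cong) (simp add: inner space_T mult.assoc)
  also have "\<dots> = ennreal C * (\<integral>\<^sup>+s. (1 + m2 s) * indicator {t'..q} s \<partial>T)"
  proof (rule nn_integral_cmult)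
    have im: "indicator {t'..q} \<in> borel_measurable T" by (rule indicator_T) simp
    show "(\<lambda>s. (1 + m2 s) * indicator {t'..q} s) \<in> borel_measurable T"
      by (intro borel_measurable_times_ennreal borel_measurable_add m2_measurable im) simp
  qed
  also have "\<dots> = ennreal C * (\<integral>\<^sup>+s\<in>{t'..q}. (1 + m2 s) \<partial>lebesgue)" by (simp only: T_nn_integral[OF sub])
  finally show ?thesis .
qed

text \<open>The interval is enlarged to the left so as to begin at a good time of finite mean
  energy, which exists because \<open>I\<close> has no left end point. On the right, where
  \<open>d\<close> may be an end point, the bounds up to rational times before \<open>d\<close> are
  uniform and Fatou's lemma concludes.\<close>

lemma W_locally_integrable:
  assumes ab: "{a..d} \<subseteq> I"
  shows "(\<integral>\<^sup>+s\<in>{a..d}. W s \<partial>lebesgue) < \<infinity>"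
proof (cases "a \<le> d")
  case True
  then have I: "a \<in> I" "d \<in> I" using ab by auto
  obtain C where C: "C \<ge> 0" "AE s in T. norm (f s) \<le> C" using f_bounded .
  have "AE t in T. (t \<in> interior I \<and> (AE u in \<rho>. good u t)) \<and> m2 t < \<infinity>"
    using good_times m2_finite by eventually_elim simp
  from AE_T_pick[OF this I(1)] obtain t' where t': "t' < a" "t' \<in> interior I" "AE u in \<rho>. good u t'" "m2 t' < \<infinity>" by blast
  have t'I: "t' \<in> I" using t'(2) interior_subset by auto
  have sub: "{t'..d} \<subseteq> I" by (rule I_sub[OF t'I I(2)])
  have t'b: "t' < d" using t'(1) True by simp
  obtain q :: "nat \<Rightarrow> real" where q: "\<And>n. q n \<in> \<rat>" "\<And>n. t' < q n" "\<And>n. q n < d" "q \<longlonglongrightarrow> d"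
    using rational_sequence_from_left[OF t'b] by blast
  define R where "R = m2 t' + ennreal C * (\<integral>\<^sup>+s\<in>{t'..d}. (1 + m2 s) \<partial>lebesgue)"
  have R: "R < \<infinity>"
    unfolding R_def using t'(4) m2_integral_finite[OF sub] by (auto simp: ennreal_mult_less_top)
  have bound: "ennreal \<nu> * (\<integral>\<^sup>+s\<in>{t'..q n}. W s \<partial>lebesgue) \<le> R" for n
  proof -
    have "q n \<in> I" using sub q(2,3)[of n] by auto
    moreover have "\<not> d \<le> q n" using q(3)[of n] by simp
    ultimately have "q n \<in> interior I" using interval_open_left_interior(2)[OF open_left, of "q n" d] I by blast
    then have "ennreal \<nu> * (\<integral>\<^sup>+s\<in>{t'..q n}. W s \<partial>lebesgue) \<le> m2 t' + ennreal C * (\<integral>\<^sup>+s\<in>{t'..q n}. (1 + m2 s) \<partial>lebesgue)"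
      using q by (intro W_rational_bound t' C) auto
    also have "\<dots> \<le> R"
      unfolding R_def using q(3)[of n]
      by (intro add_left_mono mult_left_mono nn_integral_mono) (auto simp: indicator_def)
    finally show ?thesis .
  qed
  have Wm: "(\<lambda>s. W s * indicator {t'..x} s) \<in> borel_measurable T" for x
    by (rule borel_measurable_times_ennreal[OF W_measurable indicator_T]) simp
  have "ennreal \<nu> * (\<integral>\<^sup>+s\<in>{a..d}. W s \<partial>lebesgue) \<le> ennreal \<nu> * (\<integral>\<^sup>+s. W s * indicator {t'..d} s \<partial>T)"
    unfolding T_nn_integral[OF sub] using t'(1)
    by (intro mult_left_mono nn_integral_mono) (auto simp: indicator_def)
  also have "(\<integral>\<^sup>+s. W s * indicator {t'..d} s \<partial>T) \<le> (\<integral>\<^sup>+s. liminf (\<lambda>n. W s * indicator {t'..q n} s) \<partial>T)"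
  proof (rule nn_integral_mono_AE)
    have "AE s in T. s \<noteq> d"
      unfolding AE_T by (rule AE_mp[OF AE_completion[OF AE_lborel_singleton[of d]]]) simp
    then show "AE s in T. W s * indicator {t'..d} s \<le> liminf (\<lambda>n. W s * indicator {t'..q n} s)"
    proof eventually_elim
      case (elim s)
      show ?case
      proof (cases "s \<in> {t'..d}")
        case True
        then have "\<forall>\<^sub>F n in sequentially. s < q n" using elim q(4) by (intro order_tendstoD(1)) auto
        then have "\<forall>\<^sub>F n in sequentially. W s * indicator {t'..d} s \<le> W s * indicator {t'..q n} s"
          by eventually_elim (use True in \<open>auto simp: indicator_def\<close>)
        then show ?thesis by (rule Liminf_bounded)
      qed simp
    qed
  qed
  also have "\<dots> \<le> liminf (\<lambda>n. \<integral>\<^sup>+s. W s * indicator {t'..q n} s \<partial>T)" by (rule nn_integral_liminf[OF Wm])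
  also have "ennreal \<nu> * \<dots> \<le> R"
  proof -
    have subq: "{t'..q n} \<subseteq> I" for n using sub q(3)[of n] by auto
    have "(\<integral>\<^sup>+s. W s * indicator {t'..q n} s \<partial>T) \<le> R / ennreal \<nu>" for n
    proof -
      have "ennreal \<nu> * x / ennreal \<nu> = x" for x
        using mult_divide_eq_ennreal[of "ennreal \<nu>" x] nu_pos by (simp add: mult.commute)
      then show ?thesis
        using divide_right_mono_ennreal[OF bound[of n], of "ennreal \<nu>"] unfolding T_nn_integral[OF subq] by metis
    qed
    then have "liminf (\<lambda>n. \<integral>\<^sup>+s. W s * indicator {t'..q n} s \<partial>T) \<le> liminf (\<lambda>n::nat. R / ennreal \<nu>)"
      by (intro Liminf_mono always_eventually allI)
    then have "liminf (\<lambda>n. \<integral>\<^sup>+s. W s * indicator {t'..q n} s \<partial>T) \<le> R / ennreal \<nu>" by (simp add: Liminf_const)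
    then have "ennreal \<nu> * liminf (\<lambda>n. \<integral>\<^sup>+s. W s * indicator {t'..q n} s \<partial>T) \<le> ennreal \<nu> * (R / ennreal \<nu>)"
      by (intro mult_left_mono) auto
    then show ?thesis using nu_pos by (simp add: ennreal_times_divide mult_divide_eq_ennreal mult.commute)
  qed
  finally have "ennreal \<nu> * (\<integral>\<^sup>+s\<in>{a..d}. W s \<partial>lebesgue) \<le> R" by (simp add: mult_left_mono)
  from le_less_trans[OF this R] show ?thesis using nu_pos by (auto simp: ennreal_mult_less_top)
qed simp

end

section \<open>The Liouville equation\<close>

lemma Icc_Ioc_integral:
  fixes g :: "real \<Rightarrow> real"
  shows "(LINT s:{a<..d}|lebesgue. g s) = (LINT s:{a..d}|lebesgue. g s)"
    and "(LINT s:{a<..<d}|lebesgue. g s) = (LINT s:{a..d}|lebesgue. g s)"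
    and "set_integrable lebesgue {a<..<d} g \<longleftrightarrow> set_integrable lebesgue {a..d} g"
proof -
  show "(LINT s:{a<..d}|lebesgue. g s) = (LINT s:{a..d}|lebesgue. g s)"
    unfolding set_lebesgue_integral_def
    by (rule integral_discrete_difference[where X="{a, d}"]) (auto simp: indicator_def)
  show "(LINT s:{a<..<d}|lebesgue. g s) = (LINT s:{a..d}|lebesgue. g s)"
    unfolding set_lebesgue_integral_def
    by (rule integral_discrete_difference[where X="{a, d}"]) (auto simp: indicator_def)
  show "set_integrable lebesgue {a<..<d} g \<longleftrightarrow> set_integrable lebesgue {a..d} g"
    unfolding set_integrable_def
    by (rule integrable_discrete_difference[where X="{a, d}"]) (auto simp: indicator_def)
qed

lemma continuous_map_coords: "continuous_map euclidean (Euclidean_space k) (coords k v)"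
  unfolding coords_def[abs_def] continuous_map_componentwise_Euclidean_space
  by (auto intro!: continuous_intros)

context vishik_fursikov
begin

lemma AE_M_I:
  assumes "{p \<in> space M. P p} \<in> sets M" "AE s in T. AE u in \<rho>. P (s, u)"
  shows "AE p in M. P p"
proof -
  interpret P: pair_sigma_finite T \<rho> by (rule pair_sigma)
  show ?thesis by (rule P.AE_pair_measure[OF assms])
qed

lemma AE_M_fst:
  assumes "AE s in T. P s"
  shows "AE p in M. P (fst p)"
proof -
  \<comment> \<open>The cylinder over a measurable null set is measurable, as \<open>AE_M_I\<close>
    requires.\<close>
  obtain N where N: "{s \<in> space T. \<not> P s} \<subseteq> N" "N \<in> null_sets T"
    using assms unfolding eventually_ae_filter by blast
  have "AE p in M. fst p \<notin> N"
  proof (rule AE_M_I)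
    have Ns: "N \<in> sets T" using N(2) by (rule null_setsD2)
    show "{p \<in> space M. fst p \<notin> N} \<in> sets M" using Ns by measurable
    show "AE s in T. AE u in \<rho>. fst (s, u) \<notin> N" using AE_not_in[OF N(2)] by eventually_elim simp
  qed
  moreover have "AE p in M. p \<in> space M" by (rule AE_space)
  ultimately show ?thesis
    by eventually_elim (use N(1) in \<open>auto simp: space_pair_measure\<close>)
qed

lemma V_sets_M: "{p \<in> space M. snd p (fst p) \<in> V} \<in> sets M"
  using measurable_sets[OF eval_M V_borel] by (simp add: vimage_def Int_def conj_commute)

lemma AE_T_rho_V: "AE s in T. AE u in \<rho>. u s \<in> V"
proof -
  interpret P: pair_sigma_finite T \<rho> by (rule pair_sigma)
  have "AE u in \<rho>. AE s in T. u s \<in> V" using AE_U_sharp by eventually_elim (simp add: U_sharp_V)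
  then show ?thesis using P.AE_commute[of "\<lambda>s u. u s \<in> V"] V_sets_M by simp
qed

lemma AE_M_V: "AE p in M. snd p (fst p) \<in> V"
  by (rule AE_M_I[OF V_sets_M]) (use AE_T_rho_V in simp)

text \<open>Integrands controlled by the energy and the dissipation, to which Fubini's theorem applies on
  compact time intervals.\<close>

definition dominated :: "(real \<times> (real \<Rightarrow> l2field) \<Rightarrow> real) \<Rightarrow> bool" where
  "dominated g \<longleftrightarrow> g \<in> borel_measurable M \<and>
     (\<exists>C. AE p in M. \<bar>g p\<bar> \<le> C * (1 + \<theta> (snd p) (fst p) + dis (snd p) (fst p)))"

lemma \<theta>_nonneg: "0 \<le> \<theta> u s" by (simp add: \<theta>_def)

lemma dominated_simple: "dominated (\<lambda>p. \<theta> (snd p) (fst p))" "dominated (\<lambda>p. dis (snd p) (fst p))"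
  unfolding dominated_def
  by (auto intro!: M_measurable exI[of _ "1::real"] AE_I2 simp: dis_V(3) \<theta>_nonneg)

lemma dominated_pow: "dominated (\<lambda>p. pow (snd p) (fst p))"
proof -
  obtain C where C: "C \<ge> 0" "AE s in T. norm (f s) \<le> C" using f_bounded .
  have "AE p in M. \<bar>pow (snd p) (fst p)\<bar> \<le> C * (1 + \<theta> (snd p) (fst p) + dis (snd p) (fst p))"
    using AE_M_fst[OF C(2)]
  proof eventually_elim
    case (elim p)
    have "\<bar>pow (snd p) (fst p)\<bar> \<le> C * (1 + \<theta> (snd p) (fst p))" by (rule pow_le[OF elim])
    also have "\<dots> \<le> C * (1 + \<theta> (snd p) (fst p) + dis (snd p) (fst p))"
      by (rule mult_left_mono[OF _ C(1)]) (simp add: dis_V(3))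
    finally show ?case .
  qed
  then show ?thesis using M_measurable(3) unfolding dominated_def by blast
qed

lemma dominated_zero: "dominated (\<lambda>p. 0)"
  unfolding dominated_def by (auto intro!: exI[of _ "0::real"])

lemma dominated_add:
  assumes "dominated g" "dominated h"
  shows "dominated (\<lambda>p. g p + h p)"
proof -
  obtain C where C: "AE p in M. \<bar>g p\<bar> \<le> C * (1 + \<theta> (snd p) (fst p) + dis (snd p) (fst p))"
    using assms(1) unfolding dominated_def by blast
  obtain D where D: "AE p in M. \<bar>h p\<bar> \<le> D * (1 + \<theta> (snd p) (fst p) + dis (snd p) (fst p))"
    using assms(2) unfolding dominated_def by blast
  have "AE p in M. \<bar>g p + h p\<bar> \<le> (C + D) * (1 + \<theta> (snd p) (fst p) + dis (snd p) (fst p))"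
    using C D
  proof eventually_elim
    case (elim p)
    have "\<bar>g p + h p\<bar> \<le> \<bar>g p\<bar> + \<bar>h p\<bar>" by (rule abs_triangle_ineq)
    also have "\<dots> \<le> C * (1 + \<theta> (snd p) (fst p) + dis (snd p) (fst p)) + D * (1 + \<theta> (snd p) (fst p) + dis (snd p) (fst p))"
      by (rule add_mono[OF elim])
    finally show ?case by (simp only: distrib_right)
  qed
  moreover have "(\<lambda>p. g p + h p) \<in> borel_measurable M"
    using assms unfolding dominated_def by (intro borel_measurable_add) auto
  ultimately show ?thesis unfolding dominated_def by blast
qed

lemma dominated_sum: "(\<And>j. j < (k::nat) \<Longrightarrow> dominated (g j)) \<Longrightarrow> dominated (\<lambda>p. \<Sum>j<k. g j p)"
proof (induction k)
  case 0 then show ?case by (simp add: dominated_zero)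
next
  case (Suc k)
  have "dominated (\<lambda>p. \<Sum>j<k. g j p)" by (rule Suc.IH) (use Suc.prems in simp)
  from dominated_add[OF this Suc.prems[of k]] show ?case by simp
qed

lemma dominated_mult_bounded:
  assumes g: "dominated g" and h: "h \<in> borel_measurable M" "\<And>p. \<bar>h p\<bar> \<le> K"
  shows "dominated (\<lambda>p. h p * g p)"
proof -
  obtain C where C: "AE p in M. \<bar>g p\<bar> \<le> C * (1 + \<theta> (snd p) (fst p) + dis (snd p) (fst p))"
    using g unfolding dominated_def by blast
  have K: "0 \<le> K" using h(2) abs_ge_zero order_trans by blast
  have "AE p in M. \<bar>h p * g p\<bar> \<le> (K * C) * (1 + \<theta> (snd p) (fst p) + dis (snd p) (fst p))"
    using C
  proof eventually_elim
    case (elim p)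
    have "\<bar>h p * g p\<bar> \<le> K * (C * (1 + \<theta> (snd p) (fst p) + dis (snd p) (fst p)))"
      unfolding abs_mult by (rule mult_mono[OF h(2) elim K]) simp
    then show ?case by (simp add: mult.assoc)
  qed
  moreover have "(\<lambda>p. h p * g p) \<in> borel_measurable M"
    using g h(1) unfolding dominated_def by (intro borel_measurable_times) auto
  ultimately show ?thesis unfolding dominated_def by blast
qed

text \<open>The majorant is integrated in the extended reals with \<open>V_norm_sq\<close> in place
  of \<open>dis\<close>, which agrees with it almost everywhere. Over a compact strip of times its
  integral is finite by \<open>m2_integral_finite\<close> and
  \<open>W_locally_integrable\<close>.\<close>

lemma dominated_integrable:
  assumes g: "dominated g" and X: "X \<in> sets lebesgue" "X \<subseteq> {a..d}" "{a..d} \<subseteq> I"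
  shows "integrable M (\<lambda>p. indicator X (fst p) * g p)"
proof -
  obtain C0 where C0: "AE p in M. \<bar>g p\<bar> \<le> C0 * (1 + \<theta> (snd p) (fst p) + dis (snd p) (fst p))"
    using g unfolding dominated_def by blast
  define C where "C = max C0 0"
  have C: "0 \<le> C" by (simp add: C_def)
  define N where "N p = (1 + ennreal (\<theta> (snd p) (fst p)) + V_norm_sq (snd p (fst p))) * indicator {a..d} (fst p)" for p
  have ind: "(\<lambda>p. indicator {a..d} (fst p) :: ennreal) \<in> borel_measurable M"
    by (rule measurable_compose[OF measurable_fst indicator_T]) simp
  have Nm: "N \<in> borel_measurable M"
    unfolding N_def[abs_def] using M_measurable(1,4) ind by measurable
  interpret S: sigma_finite_measure \<rho> by (rule prob_space_imp_sigma_finite[OF rho_prob])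
  have "(\<integral>\<^sup>+p. N p \<partial>M) = (\<integral>\<^sup>+s. (\<integral>\<^sup>+u. N (s, u) \<partial>\<rho>) \<partial>T)" by (rule S.nn_integral_fst[OF Nm, symmetric])
  also have "\<dots> = (\<integral>\<^sup>+s. ((1 + m2 s) * indicator {a..d} s) + W s * indicator {a..d} s \<partial>T)"
  proof (rule nn_integral_cong)
    fix s assume "s \<in> space T"
    then have s: "s \<in> I" by (simp add: space_T)
    have [measurable]: "(\<lambda>u. ennreal (\<theta> u s)) \<in> borel_measurable \<rho>" "(\<lambda>u. V_norm_sq (u s)) \<in> borel_measurable \<rho>"
      using section_rho[OF M_measurable(1) s] section_rho[OF M_measurable(4) s] by simp_all
    have "(\<integral>\<^sup>+u. N (s, u) \<partial>\<rho>) = (\<integral>\<^sup>+u. (1 + ennreal (\<theta> u s) + V_norm_sq (u s)) \<partial>\<rho>) * indicator {a..d} s"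
      unfolding N_def by (simp add: nn_integral_multc)
    also have "(\<integral>\<^sup>+u. (1 + ennreal (\<theta> u s) + V_norm_sq (u s)) \<partial>\<rho>) = 1 + m2 s + W s"
      using prob_space.emeasure_space_1[OF rho_prob] by (simp add: nn_integral_add m2_def W_def)
    finally show "(\<integral>\<^sup>+u. N (s, u) \<partial>\<rho>) = ((1 + m2 s) * indicator {a..d} s) + W s * indicator {a..d} s"
      by (simp add: distrib_right)
  qed
  also have "\<dots> = (\<integral>\<^sup>+s. (1 + m2 s) * indicator {a..d} s \<partial>T) + (\<integral>\<^sup>+s. W s * indicator {a..d} s \<partial>T)"
  proof (rule nn_integral_add)
    have im: "indicator {a..d} \<in> borel_measurable T" by (rule indicator_T) simp
    show "(\<lambda>s. (1 + m2 s) * indicator {a..d} s) \<in> borel_measurable T"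
      by (intro borel_measurable_times_ennreal borel_measurable_add m2_measurable im) simp
    show "(\<lambda>s. W s * indicator {a..d} s) \<in> borel_measurable T"
      by (rule borel_measurable_times_ennreal[OF W_measurable im])
  qed
  also have "\<dots> < \<infinity>"
    unfolding T_nn_integral[OF X(3)] using m2_integral_finite[OF X(3)] W_locally_integrable[OF X(3)]
    by (simp add: ennreal_add_less_top)
  finally have fin: "(\<integral>\<^sup>+p. N p \<partial>M) < \<infinity>" .
  have Xm: "indicator X \<in> borel_measurable T"
    by (rule measurable_restrict_space1) (rule borel_measurable_indicator[OF X(1)])
  show ?thesis
  proof (rule integrableI_bounded)
    show "(\<lambda>p. indicator X (fst p) * g p) \<in> borel_measurable M"
      using g unfolding dominated_def
      by (intro borel_measurable_times measurable_compose[OF measurable_fst Xm]) auto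
    have "(\<integral>\<^sup>+p. ennreal (norm (indicator X (fst p) * g p)) \<partial>M) \<le> (\<integral>\<^sup>+p. ennreal C * N p \<partial>M)"
    proof (rule nn_integral_mono_AE)
      show "AE p in M. ennreal (norm (indicator X (fst p) * g p)) \<le> ennreal C * N p"
        using C0 AE_M_V
      proof eventually_elim
        case (elim p)
        show ?case
        proof (cases "fst p \<in> X")
          case True
          define m where "m = 1 + \<theta> (snd p) (fst p) + dis (snd p) (fst p)"
          have m0: "0 \<le> m" using \<theta>_nonneg dis_V(3) by (simp add: m_def)
          have "\<bar>g p\<bar> \<le> C0 * m" using elim(1) by (simp add: m_def)
          also have "\<dots> \<le> C * m" by (rule mult_right_mono[OF _ m0]) (simp add: C_def)
          finally have "ennreal \<bar>g p\<bar> \<le> ennreal C * ennreal m"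
            using C m0 by (simp add: ennreal_mult[symmetric] ennreal_leI)
          also have "ennreal m = 1 + ennreal (\<theta> (snd p) (fst p)) + V_norm_sq (snd p (fst p))"
            unfolding m_def dis_V(2)[of "snd p" "fst p", OF elim(2)] using \<theta>_nonneg dis_V(3) by (simp add: ennreal_plus)
          finally show ?thesis using True X(2) by (auto simp: N_def abs_mult)
        qed simp
      qed
    qed
    also have "\<dots> = ennreal C * (\<integral>\<^sup>+p. N p \<partial>M)" by (rule nn_integral_cmult[OF Nm])
    also have "\<dots> < \<infinity>" using fin by (simp add: ennreal_mult_less_top)
    finally show "(\<integral>\<^sup>+p. ennreal (norm (indicator X (fst p) * g p)) \<partial>M) < \<infinity>" .
  qed
qed

lemma dominated_fubini:
  assumes g: "dominated g" and X: "X \<in> sets lebesgue" "X \<subseteq> {a..d}" "{a..d} \<subseteq> I"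
  shows "AE u in \<rho>. set_integrable lebesgue X (\<lambda>s. g (s, u))"
    and "AE s in T. s \<in> X \<longrightarrow> integrable \<rho> (\<lambda>u. g (s, u))"
    and "set_integrable lebesgue X (\<lambda>s. \<integral>u. g (s, u) \<partial>\<rho>)"
    and "integrable \<rho> (\<lambda>u. LINT s:X|lebesgue. g (s, u))"
    and "(\<integral>u. (LINT s:X|lebesgue. g (s, u)) \<partial>\<rho>) = (LINT s:X|lebesgue. (\<integral>u. g (s, u) \<partial>\<rho>))"
proof -
  interpret P: pair_sigma_finite T \<rho> by (rule pair_sigma)
  have XI: "X \<subseteq> I" using X by blast
  let ?h = "\<lambda>s u. indicator X s * g (s, u)"
  have int: "integrable M (case_prod ?h)"
    using dominated_integrable[OF g X] by (simp add: case_prod_beta')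
  show "AE u in \<rho>. set_integrable lebesgue X (\<lambda>s. g (s, u))"
    using P.AE_integrable_snd[OF int] unfolding T_set_integral(2)[OF XI] .
  show "AE s in T. s \<in> X \<longrightarrow> integrable \<rho> (\<lambda>u. g (s, u))"
    using P.AE_integrable_fst'[OF int] by eventually_elim (auto simp: indicator_def)
  have eq: "(\<integral>u. ?h s u \<partial>\<rho>) = indicator X s * (\<integral>u. g (s, u) \<partial>\<rho>)" for s by simp
  show "set_integrable lebesgue X (\<lambda>s. \<integral>u. g (s, u) \<partial>\<rho>)"
    using P.integrable_fst'[OF int] unfolding case_prod_conv eq T_set_integral(2)[OF XI] .
  show "integrable \<rho> (\<lambda>u. LINT s:X|lebesgue. g (s, u))"
    using P.integrable_snd[OF int] unfolding T_set_integral(1)[OF XI] .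
  show "(\<integral>u. (LINT s:X|lebesgue. g (s, u)) \<partial>\<rho>) = (LINT s:X|lebesgue. (\<integral>u. g (s, u) \<partial>\<rho>))"
    using P.Fubini_integral[OF int] unfolding eq T_set_integral(1)[OF XI] .
qed

lemma dominated_AE_integrable: "dominated g \<Longrightarrow> AE s in T. integrable \<rho> (\<lambda>u. g (s, u))"
proof (rule AE_T_exhaust)
  fix a d assume g: "dominated g" and ad: "{a..d} \<subseteq> I" "a < d"
  have "AE s in T. s \<in> {a..d} \<longrightarrow> integrable \<rho> (\<lambda>u. g (s, u))" by (rule dominated_fubini(2)[OF g _ _ ad(1)]) auto
  then show "AE s in lebesgue. s \<in> {a..d} \<longrightarrow> integrable \<rho> (\<lambda>u. g (s, u))"
    unfolding AE_T by eventually_elim (use ad in auto)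
qed

text \<open>The value zero off \<open>V\<close> makes this a total Borel function of the field and
  matches the convention for the integrand in \<open>statistical_solution\<close>.\<close>

definition F_ext :: "l2field \<Rightarrow> real \<Rightarrow> l2field \<Rightarrow> real" where
  "F_ext v s u = (if u \<in> V then F s u v else 0)"

lemma F_ext_measurable:
  assumes v: "v \<in> V"
  shows "(\<lambda>p. F_ext v (fst p) (snd p)) \<in> borel_measurable (T \<Otimes>\<^sub>M borel)"
proof -
  have ext: "(\<lambda>u. if u \<in> V then h u else 0) \<in> borel_measurable borel"
    if "h \<in> borel_measurable (restrict_space borel V)" for h :: "l2field \<Rightarrow> real"
    using that by (intro measurable_If_restrict_space_iff[THEN iffD2]) auto
  note [measurable] = V_borel ext[OF b_borel[OF v]] ext[OF V_inner_borel[of v]] f_meas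
  have eq: "F_ext v (fst p) (snd p) = (if snd p \<in> V then f (fst p) \<bullet> v else 0)
      - \<nu> * (if snd p \<in> V then V_inner (snd p) v else 0) - (if snd p \<in> V then b (snd p) (snd p) v else 0)" for p
    by (simp add: F_ext_def F_eq[OF v])
  have "(\<lambda>p. (if snd p \<in> V then f (fst p) \<bullet> v else 0)) \<in> borel_measurable (T \<Otimes>\<^sub>M borel)"
    by measurable
  moreover have "(\<lambda>p. (if snd p \<in> V then V_inner (snd p) v else 0)) \<in> borel_measurable (T \<Otimes>\<^sub>M borel)"
    by (rule measurable_compose[OF measurable_snd ext[OF V_inner_borel]])
  moreover have "(\<lambda>p. (if snd p \<in> V then b (snd p) (snd p) v else 0)) \<in> borel_measurable (T \<Otimes>\<^sub>M borel)"
    by (rule measurable_compose[OF measurable_snd ext[OF b_borel[OF v]]])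
  ultimately show ?thesis unfolding eq
    by (intro borel_measurable_diff borel_measurable_times borel_measurable_const)
qed

lemma F_ext_measurable_M:
  assumes v: "v \<in> V"
  shows "(\<lambda>p. F_ext v (fst p) (snd p (fst p))) \<in> borel_measurable M"
  using measurable_compose[OF measurable_Pair[OF measurable_fst eval_M] F_ext_measurable[OF v]] by simp

lemma N_sq_eq: "u s \<in> V \<Longrightarrow> N_sq (u s) = \<theta> u s + dis u s"
  by (simp add: N_sq_def \<theta>_def dis_def V_norm_sq_eq sum_nonneg)

lemma F_ext_bound:
  assumes v: "v \<in> V"
  obtains C where "C \<ge> 0" "AE s in T. \<forall>u. \<bar>F_ext v s (u s)\<bar> \<le> C * (1 + \<theta> u s + dis u s)"
proof -
  obtain K where K: "AE s in T. norm (f s) \<le> K" using f_bounded by blast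
  obtain C where C: "C \<ge> 0" "\<And>s u. u \<in> V \<Longrightarrow> norm (f s) \<le> K \<Longrightarrow> \<bar>F s u v\<bar> \<le> C * (1 + N_sq u)"
    using F_bound[OF v nu_pos] by blast
  have "AE s in T. \<forall>u. \<bar>F_ext v s (u s)\<bar> \<le> C * (1 + \<theta> u s + dis u s)"
    using K
  proof eventually_elim
    case (elim s)
    show ?case
    proof
      fix u :: "real \<Rightarrow> l2field"
      show "\<bar>F_ext v s (u s)\<bar> \<le> C * (1 + \<theta> u s + dis u s)"
      proof (cases "u s \<in> V")
        case True
        then show ?thesis using C(2)[OF True elim] N_sq_eq[of u s, OF True] by (simp add: F_ext_def add.assoc)
      next
        case False
        then show ?thesis using C(1) \<theta>_nonneg[of u s] dis_V(3)[of u s] by (simp add: F_ext_def)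
      qed
    qed
  qed
  then show ?thesis using that C(1) by blast
qed

lemma dominated_F_ext:
  assumes v: "v \<in> V"
  shows "dominated (\<lambda>p. F_ext v (fst p) (snd p (fst p)))"
proof -
  obtain C where "AE s in T. \<forall>u. \<bar>F_ext v s (u s)\<bar> \<le> C * (1 + \<theta> u s + dis u s)" using F_ext_bound[OF v] .
  from AE_M_fst[OF this]
  have "AE p in M. \<bar>F_ext v (fst p) (snd p (fst p))\<bar> \<le> C * (1 + \<theta> (snd p) (fst p) + dis (snd p) (fst p))"
    by eventually_elim blast
  then show ?thesis using F_ext_measurable_M[OF v] unfolding dominated_def by blast
qed

lemma F_ext_path_integrable:
  assumes v: "v \<in> V" and u: "u \<in> space \<rho>" and ad: "{a..d} \<subseteq> I"
    and i: "set_integrable lebesgue {a..d} (\<theta> u)" "set_integrable lebesgue {a..d} (dis u)"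
  shows "set_integrable lebesgue {a..d} (\<lambda>s. F_ext v s (u s))"
proof -
  obtain C where C: "C \<ge> 0" "AE s in T. \<forall>u. \<bar>F_ext v s (u s)\<bar> \<le> C * (1 + \<theta> u s + dis u s)" using F_ext_bound[OF v] .
  have one: "set_integrable lebesgue {a..d} (\<lambda>s. 1 :: real)"
    unfolding set_integrable_def by (simp add: emeasure_lborel_Icc_eq)
  have "set_integrable lebesgue {a..d} (\<lambda>s. 1 + \<theta> u s + dis u s)"
    by (rule set_integral_add(1)[OF set_integral_add(1)[OF one i(1)] i(2)])
  then have maj: "set_integrable lebesgue {a..d} (\<lambda>s. C * (1 + \<theta> u s + dis u s))"
    by (rule set_integrable_mult_right)
  have m: "(\<lambda>s. F_ext v s (u s)) \<in> borel_measurable T" using section_T[OF F_ext_measurable_M[OF v] u] by simp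
  show ?thesis unfolding set_integrable_def
  proof (rule Bochner_Integration.integrable_bound[OF maj[unfolded set_integrable_def]])
    show "(\<lambda>s. indicator {a..d} s *\<^sub>R F_ext v s (u s)) \<in> borel_measurable lebesgue"
      using set_measurable_T[OF m ad] by (simp add: set_borel_measurable_def)
    show "AE s in lebesgue. norm (indicator {a..d} s *\<^sub>R F_ext v s (u s)) \<le> norm (indicator {a..d} s *\<^sub>R (C * (1 + \<theta> u s + dis u s)))"
      using C(2) unfolding AE_T
    proof eventually_elim
      case (elim s)
      show ?case
      proof (cases "s \<in> {a..d}")
        case True
        then have "\<bar>F_ext v s (u s)\<bar> \<le> C * (1 + \<theta> u s + dis u s)" using elim ad by blast
        then show ?thesis using True by simp
      qed simp
    qed
  qed
qed

section \<open>The tested equation along a path\<close>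

lemma path_inner_continuous:
  assumes "u \<in> space \<rho>" "v \<in> H"
  shows "continuous_on I (\<lambda>t. u t \<bullet> v)"
  using space_paths(2)[OF sets_rho assms(1)] assms(2) by (simp add: paths_def weakly_continuous_def)

lemma interior_Icc:
  assumes "s \<in> interior I" "t \<in> interior I"
  shows "{s..t} \<subseteq> interior I"
proof
  fix x assume x: "x \<in> {s..t}"
  have I: "s \<in> I" "t \<in> I" using assms interior_subset by auto
  have xI: "x \<in> I" using I_sub[OF I] x by auto
  show "x \<in> interior I"
  proof (rule ccontr)
    assume n: "x \<notin> interior I"
    have "t \<le> x" using interval_open_left_interior(2)[OF open_left xI n I(2)] .
    then show False using x n assms(2) by auto
  qed
qed

text \<open>The equation holds in the distribution sense on the interior; since that set is open,
  there is room beyond \<open>t\<close> for the test functions of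
  \<open>distributional_derivative_integral\<close>.\<close>

lemma path_identity_interior:
  assumes u: "u \<in> U_sharp I" "u \<in> space \<rho>" and v: "v \<in> V"
    and st: "s \<in> interior I" "t \<in> interior I" "s \<le> t"
  shows "u t \<bullet> v - u s \<bullet> v = (LINT r:{s<..t}|lebesgue. F_ext v r (u r))"
proof -
  let ?J = "interior I"
  obtain \<delta> where \<delta>: "\<delta> > 0" "cball t \<delta> \<subseteq> ?J" using st(2) open_contains_cball[of ?J] by auto
  have td: "t + \<delta> \<in> ?J" using \<delta> by (auto simp: dist_real_def subset_iff)
  have sub: "{s..t + \<delta>} \<subseteq> ?J" by (rule interior_Icc[OF st(1) td])
  have subI: "{s..t + \<delta>} \<subseteq> I" using sub interior_subset by blast
  have K: "set_integrable lebesgue {s..t + \<delta>} (\<lambda>r. F_ext v r (u r))"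
    by (rule F_ext_path_integrable[OF v u(2) subI U_sharp_\<theta>_integrable[OF u sub] U_sharp_dis_integrable[OF u sub]])
  have vH: "v \<in> H" using v V_subset_H by blast
  have U: "continuous_on {s..t + \<delta>} (\<lambda>t. u t \<bullet> v)"
    by (rule continuous_on_subset[OF path_inner_continuous[OF u(2) vH] subI])
  have m: "(\<lambda>s. F_ext v s (u s)) \<in> borel_measurable T" using section_T[OF F_ext_measurable_M[OF v] u(2)] by simp
  show ?thesis
  proof (rule distributional_derivative_integral[OF st(3) sub \<delta>(1) U K])
    fix \<phi> :: "real \<Rightarrow> real" assume \<phi>: "\<phi> \<in> test_functions ?J"
    have "distrib_time_deriv ?J u (\<lambda>s. F s (u s))" using u(1) by (simp add: U_sharp_def weak_solution_def)
    then have "(LINT s:?J|lebesgue. deriv \<phi> s * (u s \<bullet> v)) = - (LINT s:?J|lebesgue. \<phi> s * F s (u s) v)"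
      using \<phi> v unfolding distrib_time_deriv_def by simp
    \<comment> \<open>The path lies in \<open>V\<close> at almost every time, so \<open>F\<close>
      may be replaced by its measurable extension under the integral.\<close>
    also have "(LINT s:?J|lebesgue. \<phi> s * F s (u s) v) = (LINT s:?J|lebesgue. \<phi> s * F_ext v s (u s))"
      unfolding set_lebesgue_integral_def
    proof (rule integral_cong_AE)
      have "AE s in lebesgue. s \<in> ?J \<longrightarrow> u s \<in> V"
        using U_sharp_V[OF u(1)] unfolding AE_T by eventually_elim (use interior_subset in blast)
      then have ae: "AE s in lebesgue. indicator ?J s *\<^sub>R (\<phi> s * F_ext v s (u s)) = indicator ?J s *\<^sub>R (\<phi> s * F s (u s) v)"
        by eventually_elim (simp add: F_ext_def indicator_def)
      then show "AE s in lebesgue. indicator ?J s *\<^sub>R (\<phi> s * F s (u s) v) = indicator ?J s *\<^sub>R (\<phi> s * F_ext v s (u s))"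
        by eventually_elim (rule sym)
      have "set_borel_measurable lebesgue ?J (\<lambda>s. F_ext v s (u s))"
        by (rule set_measurable_T[OF m interior_subset]) simp
      moreover have "\<phi> \<in> borel_measurable lebesgue"
      proof -
        have "smooth \<phi>" using \<phi> by (simp add: test_functions_def)
        then have "continuous_on UNIV \<phi>" by (rule smooth_continuous)
        then show ?thesis by (intro measurable_completion) (simp add: borel_measurable_continuous_onI)
      qed
      ultimately have "(\<lambda>s. \<phi> s * (indicator ?J s *\<^sub>R F_ext v s (u s))) \<in> borel_measurable lebesgue"
        unfolding set_borel_measurable_def by (intro borel_measurable_times)
      moreover have "(\<lambda>s. \<phi> s * (indicator ?J s *\<^sub>R F_ext v s (u s))) = (\<lambda>s. indicator ?J s *\<^sub>R (\<phi> s * F_ext v s (u s)))"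
        by (simp add: fun_eq_iff)
      ultimately show m': "(\<lambda>s. indicator ?J s *\<^sub>R (\<phi> s * F_ext v s (u s))) \<in> borel_measurable lebesgue" by simp
      show "(\<lambda>s. indicator ?J s *\<^sub>R (\<phi> s * F s (u s) v)) \<in> borel_measurable lebesgue"
        by (rule borel_measurable_AE[OF m' ae])
    qed
    finally show "(LINT s:?J|lebesgue. deriv \<phi> s * (u s \<bullet> v)) = - (LINT s:?J|lebesgue. \<phi> s * F_ext v s (u s))" .
  next
    fix h :: "real \<Rightarrow> real" assume h: "continuous_on UNIV h" "\<And>r. r \<notin> {s..t + \<delta>} \<Longrightarrow> h r = 0"
    have "continuous_on {s..t + \<delta>} (\<lambda>r. h r * (u r \<bullet> v))"
      by (rule continuous_on_mult[OF continuous_on_subset[OF h(1) subset_UNIV] U])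
    then have "set_integrable lborel {s..t + \<delta>} (\<lambda>r. h r * (u r \<bullet> v))" by (rule borel_integrable_atLeastAtMost')
    then have "integrable lebesgue (\<lambda>r. indicator {s..t + \<delta>} r *\<^sub>R (h r * (u r \<bullet> v)))"
      unfolding set_integrable_def by (subst integrable_completion) (auto dest: borel_measurable_integrable)
    moreover have "indicator {s..t + \<delta>} r *\<^sub>R (h r * (u r \<bullet> v)) = indicator ?J r *\<^sub>R (h r * (u r \<bullet> v))" for r
    proof (cases "r \<in> {s..t + \<delta>}")
      case True
      then show ?thesis using sub by auto
    next
      case False
      then show ?thesis using h(2)[OF False] by simp
    qed
    ultimately show "set_integrable lebesgue ?J (\<lambda>r. h r * (u r \<bullet> v))" unfolding set_integrable_def by (simp only:)
  qed
qed

lemma Icc_left_interior: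
  assumes "a \<in> I" "d \<in> I" "a \<le> r" "r < d"
  shows "r \<in> interior I"
proof (rule ccontr)
  assume n: "r \<notin> interior I"
  have "r \<in> I" using I_sub[OF assms(1,2)] assms by auto
  from interval_open_left_interior(2)[OF open_left this n assms(2)] show False using assms(4) by simp
qed

text \<open>Extends the identity to a right end point \<open>d\<close> by weak continuity on the
  left-hand side and absolute continuity of the integral on the right. Integrability up to
  \<open>d\<close> is a hypothesis since the notion of weak solution on the interior does not
  provide it.\<close>

lemma path_identity:
  assumes u: "u \<in> U_sharp I" "u \<in> space \<rho>" and v: "v \<in> V" and ad: "a \<in> I" "d \<in> I"
    and i: "set_integrable lebesgue {a..d} (\<theta> u)" "set_integrable lebesgue {a..d} (dis u)"
    and st: "a \<le> s" "s \<le> t" "t \<le> d"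
  shows "u t \<bullet> v - u s \<bullet> v = (LINT r:{s<..t}|lebesgue. F_ext v r (u r))"
proof (cases "s = t")
  case True
  then show ?thesis by (simp add: set_lebesgue_integral_def)
next
  case False
  then have lt: "s < t" using st by simp
  have sub: "{a..d} \<subseteq> I" by (rule I_sub[OF ad])
  have vH: "v \<in> H" using v V_subset_H by blast
  have tI: "t \<in> I" "s \<in> I" using st sub by auto
  have K: "set_integrable lebesgue {a..d} (\<lambda>r. F_ext v r (u r))" by (rule F_ext_path_integrable[OF v u(2) sub i])
  have K': "set_integrable lebesgue {s..t} (\<lambda>r. F_ext v r (u r))"
    by (rule set_integrable_subset[OF K]) (use st in auto)
  obtain q :: "nat \<Rightarrow> real" where q: "\<And>n. s < q n" "\<And>n. q n < t" "q \<longlonglongrightarrow> t"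
    using rational_sequence_from_left[OF lt] by metis
  have sJ: "s \<in> interior I" by (rule Icc_left_interior[OF tI(2) tI(1) order_refl lt])
  have qJ: "q n \<in> interior I" for n
    by (rule Icc_left_interior[OF tI(2) tI(1)]) (use q(1,2)[of n] in auto)
  have eq: "u (q n) \<bullet> v - u s \<bullet> v = (LINT r:{s<..q n}|lebesgue. F_ext v r (u r))" for n
    by (rule path_identity_interior[OF u v sJ qJ]) (use q(1)[of n] in simp)
  have c: "continuous_on {s..t} (\<lambda>x. LINT r:{s<..x}|lebesgue. F_ext v r (u r))"
    by (rule continuous_on_indefinite_integral[OF K'])
  have "(\<lambda>n. LINT r:{s<..q n}|lebesgue. F_ext v r (u r)) \<longlonglongrightarrow> (LINT r:{s<..t}|lebesgue. F_ext v r (u r))"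
    by (rule continuous_on_tendsto_compose[OF c q(3)]) (use q lt in \<open>auto simp: less_imp_le\<close>)
  moreover have "(\<lambda>n. u (q n) \<bullet> v - u s \<bullet> v) \<longlonglongrightarrow> u t \<bullet> v - u s \<bullet> v"
  proof (rule tendsto_diff[OF _ tendsto_const])
    show "(\<lambda>n. u (q n) \<bullet> v) \<longlonglongrightarrow> u t \<bullet> v"
      by (rule continuous_on_tendsto_compose[OF path_inner_continuous[OF u(2) vH] q(3) tI(1)])
        (use qJ interior_subset in \<open>auto intro: always_eventually\<close>)
  qed
  ultimately show ?thesis unfolding eq by (rule LIMSEQ_unique[symmetric])
qed

section \<open>Cylindrical functions along paths and in the mean\<close>

definition liouville :: "((nat \<Rightarrow> real) \<Rightarrow> real) \<Rightarrow> nat \<Rightarrow> (nat \<Rightarrow> l2field) \<Rightarrow> real \<Rightarrow> l2field \<Rightarrow> real" where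
  "liouville \<phi> k v s u = (if u \<in> V then F s u (cyl_deriv \<phi> k v u) else 0)"

text \<open>Linearity of \<open>F\<close> in the test field separates bounded coefficients from the
  dominated terms \<open>F_ext\<close>.\<close>

lemma liouville_sum:
  assumes "\<And>j. j < k \<Longrightarrow> v j \<in> V"
  shows "liouville \<phi> k v s u = (\<Sum>j<k. coord_deriv \<phi> j (coords k v u) * F_ext (v j) s u)"
proof (cases "u \<in> V")
  case True
  then show ?thesis using F_sum[OF True assms] by (simp add: liouville_def F_ext_def cyl_deriv_def)
qed (simp add: liouville_def F_ext_def)

lemma coords_borel:
  assumes "continuous_map (Euclidean_space k) euclideanreal h"
  shows "(\<lambda>u. h (coords k v u)) \<in> borel_measurable borel"
proof -
  have "continuous_map euclidean euclideanreal (h \<circ> coords k v)"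
    by (rule continuous_map_compose[OF continuous_map_coords assms])
  then have "continuous_on UNIV (\<lambda>u. h (coords k v u))" by (simp add: o_def)
  then show ?thesis by (rule borel_measurable_continuous_onI)
qed

lemma coords_space: "coords k v u \<in> topspace (Euclidean_space k)"
  by (simp add: coords_def topspace_Euclidean_space)

context
  fixes \<phi> :: "(nat \<Rightarrow> real) \<Rightarrow> real" and k :: nat and v :: "nat \<Rightarrow> l2field"
  assumes \<phi>: "C1_compact_support k \<phi>" and v: "\<And>j. j < k \<Longrightarrow> v j \<in> V"
begin

lemma liouville_eq: "liouville \<phi> k v s u = (\<Sum>j<k. coord_deriv \<phi> j (coords k v u) * F_ext (v j) s u)"
  by (rule liouville_sum) (rule v)

lemma cyl_borel: "cyl \<phi> k v \<in> borel_measurable borel"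
  using coords_borel[of k \<phi> v] \<phi> unfolding cyl_def[abs_def] C1_compact_support_def by blast

lemma coord_deriv_borel: "j < k \<Longrightarrow> (\<lambda>u. coord_deriv \<phi> j (coords k v u)) \<in> borel_measurable borel"
  using coords_borel[of k "coord_deriv \<phi> j" v] \<phi> unfolding C1_compact_support_def by blast

lemma liouville_borel: "s \<in> I \<Longrightarrow> liouville \<phi> k v s \<in> borel_measurable borel"
proof -
  assume s: "s \<in> I"
  have "(\<lambda>u. F_ext (v j) s u) \<in> borel_measurable borel" if "j < k" for j
    using measurable_Pair2[OF F_ext_measurable[OF v[OF that]], of s] s by (simp add: space_T)
  then have "(\<lambda>u. \<Sum>j<k. coord_deriv \<phi> j (coords k v u) * F_ext (v j) s u) \<in> borel_measurable borel"
    using coord_deriv_borel by (intro borel_measurable_sum borel_measurable_times) auto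
  moreover have "liouville \<phi> k v s = (\<lambda>u. \<Sum>j<k. coord_deriv \<phi> j (coords k v u) * F_ext (v j) s u)"
    by (rule ext) (rule liouville_eq)
  ultimately show ?thesis by simp
qed

lemma dominated_liouville: "dominated (\<lambda>p. liouville \<phi> k v (fst p) (snd p (fst p)))"
proof -
  obtain K where K: "\<And>y j. j < k \<Longrightarrow> y \<in> topspace (Euclidean_space k) \<Longrightarrow> \<bar>coord_deriv \<phi> j y\<bar> \<le> K"
    using C1_compact_support_bounded[OF \<phi>] by metis
  have "dominated (\<lambda>p. coord_deriv \<phi> j (coords k v (snd p (fst p))) * F_ext (v j) (fst p) (snd p (fst p)))" if j: "j < k" for j
    by (rule dominated_mult_bounded[OF dominated_F_ext[OF v[OF j]] measurable_compose[OF eval_M coord_deriv_borel[OF j]] K[OF j coords_space]])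
  then have "dominated (\<lambda>p. \<Sum>j<k. coord_deriv \<phi> j (coords k v (snd p (fst p))) * F_ext (v j) (fst p) (snd p (fst p)))"
    by (rule dominated_sum)
  then show ?thesis unfolding liouville_eq .
qed

lemma cyl_path:
  assumes u: "u \<in> U_sharp I" "u \<in> space \<rho>" and ad: "a \<in> I" "d \<in> I" "a \<le> d"
    and i: "set_integrable lebesgue {a..d} (\<theta> u)" "set_integrable lebesgue {a..d} (dis u)"
  shows "cyl \<phi> k v (u d) - cyl \<phi> k v (u a) = (LINT r:{a<..d}|lebesgue. liouville \<phi> k v r (u r))"
  unfolding cyl_def liouville_eq
proof (rule chain_rule_C1[OF \<phi> ad(3)])
  have sub: "{a..d} \<subseteq> I" by (rule I_sub[OF ad(1,2)])
  fix j
  show "set_integrable lebesgue {a..d} (\<lambda>r. F_ext (v j) r (u r))" if j: "j < k"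
    by (rule F_ext_path_integrable[OF v[OF j] u(2) sub i])
  show "coords k v (u t) j - coords k v (u s) j = (LINT r:{s<..t}|lebesgue. F_ext (v j) r (u r))"
    if j: "j < k" and "a \<le> s" "s \<le> t" "t \<le> d" for s t
    using path_identity[OF u v[OF j] ad(1,2) i that(2-4)] j by (simp add: coords_def)
  show "continuous_on {a..d} (\<lambda>t. coords k v (u t) j)" if j: "j < k"
  proof -
    have "v j \<in> H" using v[OF j] V_subset_H by blast
    from continuous_on_subset[OF path_inner_continuous[OF u(2) this] sub] show ?thesis using j by (simp add: coords_def)
  qed
  show "coords k v (u t) j = 0" if "k \<le> j" for t using that by (simp add: coords_def)
qed

lemma liouville_identity:
  assumes ad: "a \<in> I" "d \<in> I" "a \<le> d"
  shows "set_integrable lebesgue {a..d} (\<lambda>s. \<integral>u. liouville \<phi> k v s (u s) \<partial>\<rho>)"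
    and "(\<integral>u. cyl \<phi> k v (u d) \<partial>\<rho>) - (\<integral>u. cyl \<phi> k v (u a) \<partial>\<rho>) = (LINT s:{a..d}|lebesgue. (\<integral>u. liouville \<phi> k v s (u s) \<partial>\<rho>))"
proof -
  have sub: "{a..d} \<subseteq> I" by (rule I_sub[OF ad(1,2)])
  have X: "{a..d} \<in> sets lebesgue" by simp
  note fub = dominated_fubini[OF dominated_liouville X order_refl sub, unfolded fst_conv snd_conv]
  show "set_integrable lebesgue {a..d} (\<lambda>s. \<integral>u. liouville \<phi> k v s (u s) \<partial>\<rho>)" by (rule fub(3))
  obtain K where K: "\<And>y. y \<in> topspace (Euclidean_space k) \<Longrightarrow> \<bar>\<phi> y\<bar> \<le> K"
    using C1_compact_support_bounded[OF \<phi>] by metis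
  interpret prob_space \<rho> by (rule rho_prob)
  have ci: "integrable \<rho> (\<lambda>u. cyl \<phi> k v (u t))" if "t \<in> I" for t
    by (rule integrable_const_bound[of _ K])
      (use K[OF coords_space] measurable_compose[OF eval_rho[OF that] cyl_borel] in \<open>auto simp: cyl_def\<close>)
  have "(\<integral>u. cyl \<phi> k v (u d) \<partial>\<rho>) - (\<integral>u. cyl \<phi> k v (u a) \<partial>\<rho>) = (\<integral>u. cyl \<phi> k v (u d) - cyl \<phi> k v (u a) \<partial>\<rho>)"
    by (rule Bochner_Integration.integral_diff[OF ci ci, symmetric]) (use ad in auto)
  also have "\<dots> = (\<integral>u. (LINT s:{a..d}|lebesgue. liouville \<phi> k v s (u s)) \<partial>\<rho>)"
  proof (rule integral_cong_AE)
    show "(\<lambda>u. cyl \<phi> k v (u d) - cyl \<phi> k v (u a)) \<in> borel_measurable \<rho>"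
      using ci[OF ad(1)] ci[OF ad(2)] by (intro borel_measurable_diff borel_measurable_integrable)
    show "(\<lambda>u. LINT s:{a..d}|lebesgue. liouville \<phi> k v s (u s)) \<in> borel_measurable \<rho>"
      by (rule borel_measurable_integrable[OF fub(4)])
    show "AE u in \<rho>. cyl \<phi> k v (u d) - cyl \<phi> k v (u a) = (LINT s:{a..d}|lebesgue. liouville \<phi> k v s (u s))"
      using AE_U_sharp dominated_fubini(1)[OF dominated_simple(1) X order_refl sub] dominated_fubini(1)[OF dominated_simple(2) X order_refl sub]
    proof eventually_elim
      case (elim u)
      then show ?case using cyl_path[of u, OF _ _ ad] by (simp add: Icc_Ioc_integral(1))
    qed
  qed
  also have "\<dots> = (LINT s:{a..d}|lebesgue. (\<integral>u. liouville \<phi> k v s (u s) \<partial>\<rho>))" by (rule fub(5))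
  finally show "(\<integral>u. cyl \<phi> k v (u d) \<partial>\<rho>) - (\<integral>u. cyl \<phi> k v (u a) \<partial>\<rho>) = (LINT s:{a..d}|lebesgue. (\<integral>u. liouville \<phi> k v s (u s) \<partial>\<rho>))" .
qed

end

end

section \<open>The mean energy inequality for energy functions\<close>

text \<open>\<open>energy_function\<close> constrains \<psi> and \<psi>' on the half-line only, so
  measurability is stated after clipping the argument at zero.\<close>

lemma half_line_borel:
  fixes h :: "real \<Rightarrow> real"
  assumes "continuous_on {0..} h"
  shows "(\<lambda>x. h (max 0 x)) \<in> borel_measurable borel"
  by (rule borel_measurable_continuous_onI, rule continuous_on_compose2[OF assms])
    (auto intro!: continuous_intros)

lemma energy_function_borel:
  assumes e: "energy_function \<psi> \<psi>'"
  shows "(\<lambda>x. \<psi> (max 0 x)) \<in> borel_measurable borel" "(\<lambda>x. \<psi>' (max 0 x)) \<in> borel_measurable borel"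
proof -
  have "continuous_on {0..} \<psi>"
    using e unfolding energy_function_def continuous_on_eq_continuous_within by (auto intro: DERIV_continuous)
  then show "(\<lambda>x. \<psi> (max 0 x)) \<in> borel_measurable borel" by (rule half_line_borel)
  have "continuous_on {0..} \<psi>'" using e by (simp add: energy_function_def)
  then show "(\<lambda>x. \<psi>' (max 0 x)) \<in> borel_measurable borel" by (rule half_line_borel)
qed

text \<open>The bounded derivative gives linear growth, so that a finite mean energy makes \<psi> of
  the energy integrable.\<close>

lemma energy_function_bound:
  assumes e: "energy_function \<psi> \<psi>'"
  obtains K where "K \<ge> 0" "\<And>x. 0 \<le> x \<Longrightarrow> \<bar>\<psi>' x\<bar> \<le> K" "\<And>x. 0 \<le> x \<Longrightarrow> \<psi> x \<le> \<psi> 0 + K * x"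
proof -
  have "bounded (\<psi>' ` {0..})" using e by (simp add: energy_function_def)
  then obtain K where K: "K > 0" "\<And>x. 0 \<le> x \<Longrightarrow> \<bar>\<psi>' x\<bar> \<le> K" unfolding bounded_pos by auto
  have "\<psi> x \<le> \<psi> 0 + K * x" if x: "0 \<le> x" for x
  proof -
    obtain \<xi> where \<xi>: "min 0 x \<le> \<xi>" "\<psi> x - \<psi> 0 = \<psi>' \<xi> * (x - 0)"
      using energy_function_mvt[OF e order_refl x] by blast
    have "\<psi>' \<xi> \<le> K" using K(2)[of \<xi>] \<xi>(1) x by (simp add: min_def)
    then have "\<psi>' \<xi> * x \<le> K * x" using x by (rule mult_right_mono)
    then show ?thesis using \<xi>(2) by simp
  qed
  then show ?thesis using that[of K] K by simp
qed

text \<open>Both orientations occur because the Liouville equation is demanded for two times in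
  either order.\<close>

lemma interval_integral_Icc:
  fixes g :: "real \<Rightarrow> real"
  shows "a \<le> d \<Longrightarrow> (LINT s=ereal a..ereal d|lebesgue. g s) = (LINT s:{a..d}|lebesgue. g s)"
    and "a \<le> d \<Longrightarrow> (LINT s=ereal d..ereal a|lebesgue. g s) = - (LINT s:{a..d}|lebesgue. g s)"
    and "a \<le> d \<Longrightarrow> interval_lebesgue_integrable lebesgue (ereal a) (ereal d) g \<longleftrightarrow> set_integrable lebesgue {a..d} g"
    and "a \<le> d \<Longrightarrow> interval_lebesgue_integrable lebesgue (ereal d) (ereal a) g \<longleftrightarrow> set_integrable lebesgue {a..d} g"
proof -
  assume ad: "a \<le> d"
  show "(LINT s=ereal a..ereal d|lebesgue. g s) = (LINT s:{a..d}|lebesgue. g s)"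
    using ad by (simp add: interval_lebesgue_integral_def Icc_Ioc_integral(2))
  show "interval_lebesgue_integrable lebesgue (ereal a) (ereal d) g \<longleftrightarrow> set_integrable lebesgue {a..d} g"
    using ad by (simp add: interval_lebesgue_integrable_def Icc_Ioc_integral(3))
  show "(LINT s=ereal d..ereal a|lebesgue. g s) = - (LINT s:{a..d}|lebesgue. g s)"
  proof (cases "a = d")
    case True
    have "(LINT s:{d..d}|lebesgue. g s) = (LINT s:{d<..d}|lebesgue. g s)" by (rule Icc_Ioc_integral(1)[symmetric])
    then show ?thesis using True by (simp add: interval_lebesgue_integral_def set_lebesgue_integral_def)
  next
    case False
    then show ?thesis using ad by (simp add: interval_lebesgue_integral_def Icc_Ioc_integral(2))
  qed
  show "interval_lebesgue_integrable lebesgue (ereal d) (ereal a) g \<longleftrightarrow> set_integrable lebesgue {a..d} g"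
  proof (cases "a = d")
    case True
    have "set_integrable lebesgue {d..d} g \<longleftrightarrow> set_integrable lebesgue {d<..<d} g" by (rule Icc_Ioc_integral(3)[symmetric])
    then show ?thesis using True by (simp add: interval_lebesgue_integrable_def)
  next
    case False
    then show ?thesis using ad by (simp add: interval_lebesgue_integrable_def Icc_Ioc_integral(3))
  qed
qed

lemma Linf_loc_cong:
  assumes "\<And>t. t \<in> I \<Longrightarrow> g t = h t" "Linf_loc I h"
  shows "Linf_loc I g"
  unfolding Linf_loc_def
proof (intro conjI allI impI)
  show "g \<in> borel_measurable (lebesgue_on I)"
    using assms by (subst measurable_cong[of _ g h]) (auto simp: Linf_loc_def)
  fix a d assume ad: "{a..d} \<subseteq> I"
  then obtain C where "AE t in lebesgue_on {a..d}. h t \<le> ennreal C" using assms(2) unfolding Linf_loc_def by blast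
  then have "AE t in lebesgue_on {a..d}. g t \<le> ennreal C"
    using AE_space
  proof eventually_elim
    case (elim t)
    then have "t \<in> I" using ad by auto
    then show ?case using assms(1) elim by simp
  qed
  then show "\<exists>C. AE t in lebesgue_on {a..d}. g t \<le> ennreal C" by blast
qed

context vishik_fursikov
begin

text \<open>A good time is compared by definition with rational interior times only. To reach any
  later \<open>t\<close>, the weak limit is tested against \<open>u t\<close> itself, and 2 (u q . u
  t) <= |u q|^2 + |u t|^2 plays the part of lower semicontinuity.\<close>

lemma good_increment:
  assumes u: "u \<in> U_sharp I" "u \<in> space \<rho>" and ad: "a \<in> I" "d \<in> I"
    and i: "set_integrable lebesgue {a..d} (\<theta> u)" "set_integrable lebesgue {a..d} (dis u)"
    and good: "good u s" and st: "a \<le> s" "s \<le> t" "t \<le> d"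
  shows "\<theta> u t - \<theta> u s \<le> (LINT r:{s<..t}|lebesgue. 2 * (pow u r - \<nu> * dis u r))"
proof (cases "s = t")
  case True
  then show ?thesis by (simp add: set_lebesgue_integral_def)
next
  case False
  then have lt: "s < t" using st by simp
  let ?g = "\<lambda>r. 2 * (pow u r - \<nu> * dis u r)"
  have sub: "{a..d} \<subseteq> I" by (rule I_sub[OF ad])
  have tI: "t \<in> I" "s \<in> I" using st sub by auto
  have pi: "set_integrable lebesgue {s..x} (pow u)" and di: "set_integrable lebesgue {s..x} (dis u)"
    if "x \<le> t" for x
  proof -
    show "set_integrable lebesgue {s..x} (pow u)"
      by (rule set_integrable_subset[OF pow_integrable(1)[OF u(2) sub i(1)]]) (use st that in auto)
    show "set_integrable lebesgue {s..x} (dis u)"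
      by (rule set_integrable_subset[OF i(2)]) (use st that in auto)
  qed
  have gi: "set_integrable lebesgue {s..x} ?g" if "x \<le> t" for x
    by (intro set_integrable_mult_right set_integral_diff(1) pi di that)
  have geq: "(LINT r:{s<..x}|lebesgue. ?g r) = 2 * ((LINT r:{s..x}|lebesgue. pow u r) - \<nu> * (LINT r:{s..x}|lebesgue. dis u r))"
    if "x \<le> t" for x
  proof -
    have "(LINT r:{s..x}|lebesgue. pow u r - \<nu> * dis u r)
        = (LINT r:{s..x}|lebesgue. pow u r) - (LINT r:{s..x}|lebesgue. \<nu> * dis u r)"
      by (rule set_integral_diff(2)[OF pi[OF that]]) (intro set_integrable_mult_right di that)
    then show ?thesis unfolding Icc_Ioc_integral(1) set_integral_mult_right by simp
  qed
  obtain q :: "nat \<Rightarrow> real" where q: "\<And>n. q n \<in> \<rat>" "\<And>n. s < q n" "\<And>n. q n < t" "q \<longlonglongrightarrow> t"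
    using rational_sequence_from_left[OF lt] by metis
  have qJ: "q n \<in> interior I" for n
    by (rule Icc_left_interior[OF tI(2) tI(1)]) (use q(2,3)[of n] in auto)
  define c where "c x = \<theta> u s + (LINT r:{s<..x}|lebesgue. ?g r)" for x
  have le: "\<theta> u (q n) \<le> c (q n)" for n
  proof -
    have qt: "q n \<le> t" using q(3)[of n] by simp
    have "En u s (q n)" using good q(1,2) qJ unfolding good_def by blast
    then show ?thesis unfolding En_def c_def geq[OF qt] by argo
  qed
  have uH: "u t \<in> H" using space_paths(2)[OF sets_rho u(2)] tI by (simp add: paths_def weakly_continuous_def)
  have cc: "continuous_on {s..t} (\<lambda>x. LINT r:{s<..x}|lebesgue. ?g r)"
    by (rule continuous_on_indefinite_integral[OF gi[OF order_refl]])
  have "(\<lambda>n. LINT r:{s<..q n}|lebesgue. ?g r) \<longlonglongrightarrow> (LINT r:{s<..t}|lebesgue. ?g r)"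
    by (rule continuous_on_tendsto_compose[OF cc q(4)]) (use q lt in \<open>auto simp: less_imp_le\<close>)
  then have lim1: "(\<lambda>n. (c (q n) + \<theta> u t) / 2) \<longlonglongrightarrow> (c t + \<theta> u t) / 2"
    unfolding c_def by (intro tendsto_intros) auto
  have lim2: "(\<lambda>n. u (q n) \<bullet> u t) \<longlonglongrightarrow> u t \<bullet> u t"
    by (rule continuous_on_tendsto_compose[OF path_inner_continuous[OF u(2) uH] q(4) tI(1)])
      (use qJ interior_subset in \<open>auto intro: always_eventually\<close>)
  have "u (q n) \<bullet> u t \<le> (c (q n) + \<theta> u t) / 2" for n
  proof -
    have "0 \<le> (norm (u (q n) - u t))\<^sup>2" by simp
    also have "\<dots> = \<theta> u (q n) + \<theta> u t - 2 * (u (q n) \<bullet> u t)"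
      by (simp add: \<theta>_def power2_norm_eq_inner inner_diff_left inner_diff_right inner_commute)
    finally show ?thesis using le[of n] by simp
  qed
  then have "u t \<bullet> u t \<le> (c t + \<theta> u t) / 2" by (intro LIMSEQ_le[OF lim2 lim1]) blast
  then have "\<theta> u t \<le> c t" by (simp add: \<theta>_def power2_norm_eq_inner)
  then show ?thesis by (simp add: c_def)
qed

context
  fixes \<psi> \<psi>' :: "real \<Rightarrow> real"
  assumes e: "energy_function \<psi> \<psi>'"
begin

lemma \<psi>_max: "\<psi> (\<theta> u s) = \<psi> (max 0 (\<theta> u s))" "\<psi>' (\<theta> u s) = \<psi>' (max 0 (\<theta> u s))"
  using \<theta>_nonneg[of u s] by (simp_all add: max_def)

lemma \<psi>_deriv_nonneg: "0 \<le> \<psi>' (\<theta> u s)" by (rule energy_function_deriv_nonneg[OF e \<theta>_nonneg])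

lemma \<psi>_nonneg: "0 \<le> \<psi> (\<theta> u s)" using e \<theta>_nonneg[of u s] by (simp add: energy_function_def)

lemma \<psi>_deriv_measurable: "(\<lambda>p. \<psi>' (\<theta> (snd p) (fst p))) \<in> borel_measurable M"
  unfolding \<psi>_max by (rule measurable_compose[OF M_measurable(1) energy_function_borel(2)[OF e]])

lemma dominated_\<psi>: "dominated (\<lambda>p. \<psi>' (\<theta> (snd p) (fst p)) * pow (snd p) (fst p))"
  "dominated (\<lambda>p. \<psi>' (\<theta> (snd p) (fst p)) * dis (snd p) (fst p))"
proof -
  obtain K where K: "\<And>x. 0 \<le> x \<Longrightarrow> \<bar>\<psi>' x\<bar> \<le> K" using energy_function_bound[OF e] by metis
  show "dominated (\<lambda>p. \<psi>' (\<theta> (snd p) (fst p)) * pow (snd p) (fst p))"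
    by (rule dominated_mult_bounded[OF dominated_pow \<psi>_deriv_measurable K[OF \<theta>_nonneg]])
  show "dominated (\<lambda>p. \<psi>' (\<theta> (snd p) (fst p)) * dis (snd p) (fst p))"
    by (rule dominated_mult_bounded[OF dominated_simple(2) \<psi>_deriv_measurable K[OF \<theta>_nonneg]])
qed

text \<open>An instance of \<open>energy_chain\<close> with rate 2 (\<open>pow\<close> - \<nu>
  \<open>dis\<close>), where the factor 2 turns the balance of half the energy into one for
  \<theta>; \<psi>' is bounded, so the product remains integrable.\<close>

lemma energy_path:
  assumes u: "u \<in> U_sharp I" "u \<in> space \<rho>" and ad: "a \<in> I" "d \<in> I" "a \<le> d"
    and i: "set_integrable lebesgue {a..d} (\<theta> u)" "set_integrable lebesgue {a..d} (dis u)"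
    and good: "good u a"
  shows "\<psi> (\<theta> u d) + 2 * \<nu> * (LINT s:{a..d}|lebesgue. \<psi>' (\<theta> u s) * dis u s)
    \<le> \<psi> (\<theta> u a) + 2 * (LINT s:{a..d}|lebesgue. \<psi>' (\<theta> u s) * pow u s)"
proof -
  let ?g = "\<lambda>r. 2 * (pow u r - \<nu> * dis u r)"
  have sub: "{a..d} \<subseteq> I" by (rule I_sub[OF ad(1,2)])
  note pi = pow_integrable(1)[OF u(2) sub i(1)]
  have gi: "set_integrable lebesgue {a..d} ?g"
    by (intro set_integrable_mult_right set_integral_diff(1) pi i(2))
  obtain K where K: "\<And>x. 0 \<le> x \<Longrightarrow> \<bar>\<psi>' x\<bar> \<le> K" using energy_function_bound[OF e] by metis
  have "(\<lambda>r. \<psi>' (\<theta> u r)) \<in> borel_measurable T"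
    unfolding \<psi>_max by (rule measurable_compose[OF path_measurable(1)[OF u(2)] energy_function_borel(2)[OF e]])
  then have hm: "set_borel_measurable lebesgue {a..d} (\<lambda>r. \<psi>' (\<theta> u r))"
    by (rule set_measurable_T[OF _ sub]) simp
  have bd: "set_integrable lebesgue {a..d} (\<lambda>r. \<psi>' (\<theta> u r) * g r)" if "set_integrable lebesgue {a..d} g" for g
    by (rule set_integrable_mult_bounded[OF that hm K[OF \<theta>_nonneg]])
  have "AE s in lebesgue. s \<in> {a..d} \<longrightarrow> good u s"
    using U_sharp_good[OF u] unfolding AE_T by eventually_elim (use sub in blast)
  note chain = energy_chain[OF e ad(3) gi \<theta>_nonneg bd[OF gi] this good good_increment[OF u ad(1,2) i]]
  have "\<psi> (\<theta> u d) \<le> \<psi> (\<theta> u a) + (LINT r:{a<..d}|lebesgue. \<psi>' (\<theta> u r) * ?g r)"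
    by (rule chain)
  also have "(LINT r:{a<..d}|lebesgue. \<psi>' (\<theta> u r) * ?g r)
      = (LINT r:{a..d}|lebesgue. 2 * (\<psi>' (\<theta> u r) * pow u r) - (2 * \<nu>) * (\<psi>' (\<theta> u r) * dis u r))"
    unfolding Icc_Ioc_integral(1) by (simp add: algebra_simps)
  also have "\<dots> = (LINT r:{a..d}|lebesgue. 2 * (\<psi>' (\<theta> u r) * pow u r)) - (LINT r:{a..d}|lebesgue. (2 * \<nu>) * (\<psi>' (\<theta> u r) * dis u r))"
    by (rule set_integral_diff(2)) (intro set_integrable_mult_right bd pi i(2))+
  finally show ?thesis unfolding set_integral_mult_right by simp
qed

text \<open>Only the initial mean energy is assumed finite. Integrability at time \<open>d\<close>
  is a conclusion: the inequality for paths bounds \<psi> of the final energy by integrable terms,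
  the dissipation being nonnegative.\<close>

lemma mean_energy:
  assumes ad: "a \<in> interior I" "d \<in> I" "a \<le> d" and good: "AE u in \<rho>. good u a" "m2 a < \<infinity>"
  shows "integrable \<rho> (\<lambda>u. \<psi> (\<theta> u a))" "integrable \<rho> (\<lambda>u. \<psi> (\<theta> u d))"
    and "(\<integral>u. \<psi> (\<theta> u d) \<partial>\<rho>) / 2 + \<nu> * (\<integral>u. (LINT s:{a..d}|lebesgue. \<psi>' (\<theta> u s) * dis u s) \<partial>\<rho>)
      \<le> (\<integral>u. \<psi> (\<theta> u a) \<partial>\<rho>) / 2 + (LINT s:{a..d}|lebesgue. (\<integral>u. \<psi>' (\<theta> u s) * pow u s \<partial>\<rho>))"
proof -
  have aI: "a \<in> I" using ad(1) interior_subset by blast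
  have sub: "{a..d} \<subseteq> I" by (rule I_sub[OF aI ad(2)])
  have X: "{a..d} \<in> sets lebesgue" by simp
  note fub = dominated_fubini[OF _ X order_refl sub]
  note fp = fub[OF dominated_\<psi>(1), unfolded fst_conv snd_conv] and fd = fub[OF dominated_\<psi>(2), unfolded fst_conv snd_conv]
  define P where "P u = (LINT s:{a..d}|lebesgue. \<psi>' (\<theta> u s) * pow u s)" for u
  define D where "D u = (LINT s:{a..d}|lebesgue. \<psi>' (\<theta> u s) * dis u s)" for u
  have Pi: "integrable \<rho> P" and Di: "integrable \<rho> D"
    using fp(4) fd(4) by (simp_all add: P_def[abs_def] D_def[abs_def])
  obtain K where K: "K \<ge> 0" "\<And>x. 0 \<le> x \<Longrightarrow> \<psi> x \<le> \<psi> 0 + K * x" using energy_function_bound[OF e] by metis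
  have \<psi>m: "(\<lambda>u. \<psi> (\<theta> u t)) \<in> borel_measurable \<rho>" if "t \<in> I" for t
    unfolding \<psi>_max by (rule measurable_compose[OF _ energy_function_borel(1)[OF e]])
      (use section_rho[OF M_measurable(1) that] in simp)
  interpret prob_space \<rho> by (rule rho_prob)
  have \<theta>m: "(\<lambda>u. \<theta> u a) \<in> borel_measurable \<rho>" using section_rho[OF M_measurable(1) aI] by simp
  have \<theta>i: "integrable \<rho> (\<lambda>u. \<theta> u a)"
    by (rule integrableI_nonneg[OF \<theta>m]) (use good(2) in \<open>auto simp: \<theta>_nonneg m2_def\<close>)
  show ai: "integrable \<rho> (\<lambda>u. \<psi> (\<theta> u a))"
  proof (rule Bochner_Integration.integrable_bound[of _ "\<lambda>u. \<psi> 0 + K * \<theta> u a"])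
    show "integrable \<rho> (\<lambda>u. \<psi> 0 + K * \<theta> u a)" using \<theta>i by simp
    have "norm (\<psi> (\<theta> u a)) \<le> norm (\<psi> 0 + K * \<theta> u a)" for u
      using \<psi>_nonneg[of u a] K(2)[OF \<theta>_nonneg[of u a]] by simp
    then show "AE u in \<rho>. norm (\<psi> (\<theta> u a)) \<le> norm (\<psi> 0 + K * \<theta> u a)" by simp
  qed (rule \<psi>m[OF aI])
  have path: "AE u in \<rho>. \<psi> (\<theta> u d) + 2 * \<nu> * D u \<le> \<psi> (\<theta> u a) + 2 * P u"
    using AE_U_sharp good(1) fub(1)[OF dominated_simple(1)] fub(1)[OF dominated_simple(2)]
  proof eventually_elim
    case (elim u)
    then show ?case unfolding P_def D_def by (intro energy_path aI ad(2,3)) simp_all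
  qed
  have Dn: "0 \<le> D u" for u
    unfolding D_def set_lebesgue_integral_def
    by (rule integral_nonneg_AE) (simp add: \<psi>_deriv_nonneg dis_V(3))
  show di: "integrable \<rho> (\<lambda>u. \<psi> (\<theta> u d))"
  proof (rule Bochner_Integration.integrable_bound[of _ "\<lambda>u. \<psi> (\<theta> u a) + 2 * P u"])
    show "integrable \<rho> (\<lambda>u. \<psi> (\<theta> u a) + 2 * P u)" using ai Pi by simp
    show "AE u in \<rho>. norm (\<psi> (\<theta> u d)) \<le> norm (\<psi> (\<theta> u a) + 2 * P u)"
      using path
    proof eventually_elim
      case (elim u)
      have "0 \<le> 2 * \<nu> * D u" using nu_pos Dn by simp
      then show ?case using elim \<psi>_nonneg[of u d] by simp
    qed
  qed (rule \<psi>m[OF ad(2)])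
  have "(\<integral>u. \<psi> (\<theta> u d) + 2 * \<nu> * D u \<partial>\<rho>) \<le> (\<integral>u. \<psi> (\<theta> u a) + 2 * P u \<partial>\<rho>)"
    by (rule integral_mono_AE[OF _ _ path]) (use ai di Pi Di in simp_all)
  then have "(\<integral>u. \<psi> (\<theta> u d) \<partial>\<rho>) + 2 * \<nu> * (\<integral>u. D u \<partial>\<rho>) \<le> (\<integral>u. \<psi> (\<theta> u a) \<partial>\<rho>) + 2 * (\<integral>u. P u \<partial>\<rho>)"
    using ai di Pi Di by simp
  moreover have "(\<integral>u. P u \<partial>\<rho>) = (LINT s:{a..d}|lebesgue. (\<integral>u. \<psi>' (\<theta> u s) * pow u s \<partial>\<rho>))"
    unfolding P_def by (rule fp(5))
  ultimately show "(\<integral>u. \<psi> (\<theta> u d) \<partial>\<rho>) / 2 + \<nu> * (\<integral>u. (LINT s:{a..d}|lebesgue. \<psi>' (\<theta> u s) * dis u s) \<partial>\<rho>)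
      \<le> (\<integral>u. \<psi> (\<theta> u a) \<partial>\<rho>) / 2 + (LINT s:{a..d}|lebesgue. (\<integral>u. \<psi>' (\<theta> u s) * pow u s \<partial>\<rho>))"
    unfolding D_def by simp
qed

text \<open>Connects the extended double integral in the definition of a statistical solution with
  the real one of \<open>mean_energy\<close>; Tonelli's theorem exchanges the integrals, and
  \<open>dominated_fubini\<close> provides finiteness.\<close>

lemma mean_dissipation:
  assumes ad: "a \<in> I" "d \<in> I"
  shows "(\<integral>\<^sup>+s\<in>{a..d}. (\<integral>\<^sup>+u. ennreal (\<psi>' (\<theta> u s)) * V_norm_sq (u s) \<partial>\<rho>) \<partial>lebesgue)
    = ennreal (\<integral>u. (LINT s:{a..d}|lebesgue. \<psi>' (\<theta> u s) * dis u s) \<partial>\<rho>)"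
proof -
  have sub: "{a..d} \<subseteq> I" by (rule I_sub[OF ad])
  have X: "{a..d} \<in> sets lebesgue" by simp
  note fd = dominated_fubini[OF dominated_\<psi>(2) X order_refl sub, unfolded fst_conv snd_conv]
  have nn: "0 \<le> \<psi>' (\<theta> u s) * dis u s" for u s by (simp add: \<psi>_deriv_nonneg dis_V(3))
  have m: "(\<lambda>p. \<psi>' (\<theta> (snd p) (fst p)) * dis (snd p) (fst p)) \<in> borel_measurable M"
    using dominated_\<psi>(2) by (simp add: dominated_def)
  have "(\<integral>\<^sup>+s\<in>{a..d}. (\<integral>\<^sup>+u. ennreal (\<psi>' (\<theta> u s)) * V_norm_sq (u s) \<partial>\<rho>) \<partial>lebesgue)
      = (\<integral>\<^sup>+s\<in>{a..d}. (\<integral>\<^sup>+u. ennreal (\<psi>' (\<theta> u s) * dis u s) \<partial>\<rho>) \<partial>lebesgue)"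
  proof (rule nn_integral_cong_AE)
    show "AE s in lebesgue. (\<integral>\<^sup>+u. ennreal (\<psi>' (\<theta> u s)) * V_norm_sq (u s) \<partial>\<rho>) * indicator {a..d} s
        = (\<integral>\<^sup>+u. ennreal (\<psi>' (\<theta> u s) * dis u s) \<partial>\<rho>) * indicator {a..d} s"
      using AE_T_rho_V unfolding AE_T
    proof eventually_elim
      case (elim s)
      show ?case
      proof (cases "s \<in> {a..d}")
        case True
        then have "AE u in \<rho>. u s \<in> V" using elim sub by blast
        then have "AE u in \<rho>. ennreal (\<psi>' (\<theta> u s)) * V_norm_sq (u s) = ennreal (\<psi>' (\<theta> u s) * dis u s)"
          by eventually_elim (simp add: dis_V(2,3) ennreal_mult \<psi>_deriv_nonneg)
        from nn_integral_cong_AE[OF this] show ?thesis by simp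
      qed simp
    qed
  qed
  also have "\<dots> = (\<integral>\<^sup>+u. (\<integral>\<^sup>+s\<in>{a..d}. ennreal (\<psi>' (\<theta> u s) * dis u s) \<partial>lebesgue) \<partial>\<rho>)"
    by (rule tonelli[symmetric, OF _ sub X]) (use m in simp)
  also have "\<dots> = (\<integral>\<^sup>+u. ennreal (LINT s:{a..d}|lebesgue. \<psi>' (\<theta> u s) * dis u s) \<partial>\<rho>)"
  proof (rule nn_integral_cong_AE)
    show "AE u in \<rho>. (\<integral>\<^sup>+s\<in>{a..d}. ennreal (\<psi>' (\<theta> u s) * dis u s) \<partial>lebesgue)
        = ennreal (LINT s:{a..d}|lebesgue. \<psi>' (\<theta> u s) * dis u s)"
      using fd(1)
    proof eventually_elim
      case (elim u)
      have "(\<integral>\<^sup>+s. ennreal (indicator {a..d} s *\<^sub>R (\<psi>' (\<theta> u s) * dis u s)) \<partial>lebesgue)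
          = ennreal (\<integral>s. indicator {a..d} s *\<^sub>R (\<psi>' (\<theta> u s) * dis u s) \<partial>lebesgue)"
        by (rule nn_integral_eq_integral) (use elim nn in \<open>auto simp: set_integrable_def\<close>)
      moreover have "ennreal (indicator {a..d} s *\<^sub>R (\<psi>' (\<theta> u s) * dis u s))
          = ennreal (\<psi>' (\<theta> u s) * dis u s) * indicator {a..d} s" for s
        by (simp add: indicator_def)
      ultimately show ?case by (simp only: set_lebesgue_integral_def)
    qed
  qed
  also have "\<dots> = ennreal (\<integral>u. (LINT s:{a..d}|lebesgue. \<psi>' (\<theta> u s) * dis u s) \<partial>\<rho>)"
  proof (rule nn_integral_eq_integral[OF fd(4)])
    have "0 \<le> (LINT s:{a..d}|lebesgue. \<psi>' (\<theta> u s) * dis u s)" for u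
      unfolding set_lebesgue_integral_def by (rule integral_nonneg_AE) (simp add: nn)
    then show "AE u in \<rho>. 0 \<le> (LINT s:{a..d}|lebesgue. \<psi>' (\<theta> u s) * dis u s)" by simp
  qed
  finally show ?thesis .
qed

end

section \<open>The projections form a statistical solution\<close>

lemma eval_H: "t \<in> I \<Longrightarrow> (\<lambda>u. u t) \<in> measurable \<rho> borel_H"
  by (rule eval_measurable_H[OF sets_rho])

lemma borel_H_sub: "h \<in> borel_measurable borel \<Longrightarrow> h \<in> borel_measurable borel_H"
  unfolding borel_H_def by (rule measurable_restrict_space1)

lemma nn_integral_proj:
  assumes "t \<in> I" "h \<in> borel_measurable borel"
  shows "(\<integral>\<^sup>+u. h u \<partial>proj \<rho> t) = (\<integral>\<^sup>+u. h (u t) \<partial>\<rho>)"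
  unfolding proj_def by (rule nn_integral_distr[OF eval_H[OF assms(1)]]) (simp add: borel_H_sub[OF assms(2)])

lemma integral_proj:
  fixes h :: "l2field \<Rightarrow> real"
  assumes "t \<in> I" "h \<in> borel_measurable borel"
  shows "(\<integral>u. h u \<partial>proj \<rho> t) = (\<integral>u. h (u t) \<partial>\<rho>)"
    and "integrable (proj \<rho> t) h \<longleftrightarrow> integrable \<rho> (\<lambda>u. h (u t))"
  unfolding proj_def
  by (rule integral_distr[OF eval_H[OF assms(1)] borel_H_sub[OF assms(2)]],
      rule integrable_distr_eq[OF eval_H[OF assms(1)] borel_H_sub[OF assms(2)]])

text \<open>Here \<Phi> is continuous on \<open>H\<close> only, so it is Borel for the trace
  \<sigma>-algebra, and evaluation has to be regarded as a map into \<open>borel_H\<close>.\<close>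

lemma proj_mean_measurable:
  fixes \<Phi> :: "l2field \<Rightarrow> real"
  assumes \<Phi>: "continuous_on H \<Phi>"
  shows "(\<lambda>t. \<integral>u. \<Phi> u \<partial>proj \<rho> t) \<in> borel_measurable T"
proof -
  have \<Phi>m: "\<Phi> \<in> borel_measurable borel_H"
    unfolding borel_H_def by (rule borel_measurable_continuous_on_restrict[OF \<Phi>])
  have "(\<lambda>p. snd p (fst p)) \<in> measurable M borel_H"
    unfolding borel_H_def
  proof (rule measurable_restrict_space2[OF _ eval_M])
    show "(\<lambda>p. snd p (fst p)) \<in> space M \<rightarrow> H"
      using space_paths(2)[OF sets_rho] by (auto simp: space_pair_measure space_T paths_def weakly_continuous_def)
  qed
  from measurable_compose[OF this \<Phi>m]
  have "case_prod (\<lambda>t u. \<Phi> (u t)) \<in> borel_measurable M" by (simp add: case_prod_beta')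
  then have "(\<lambda>t. \<integral>u. \<Phi> (u t) \<partial>\<rho>) \<in> borel_measurable T"
    by (rule sigma_finite_measure.borel_measurable_lebesgue_integral[OF prob_space_imp_sigma_finite[OF rho_prob]])
  moreover have "(\<integral>u. \<Phi> u \<partial>proj \<rho> t) = (\<integral>u. \<Phi> (u t) \<partial>\<rho>)" if "t \<in> space T" for t
    unfolding proj_def by (rule integral_distr[OF eval_H \<Phi>m]) (use that in \<open>simp add: space_T\<close>)
  ultimately show ?thesis by (subst measurable_cong[of T _ "\<lambda>t. \<integral>u. \<Phi> (u t) \<partial>\<rho>"])
qed

lemma proj_L1_loc: "L1_loc I (\<lambda>t. \<integral>\<^sup>+u. V_norm_sq u \<partial>proj \<rho> t)"
proof -
  have eq: "(\<integral>\<^sup>+u. V_norm_sq u \<partial>proj \<rho> t) = W t" if "t \<in> I" for t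
    unfolding W_def by (rule nn_integral_proj[OF that V_norm_sq_borel])
  have "(\<lambda>t. \<integral>\<^sup>+u. V_norm_sq u \<partial>proj \<rho> t) \<in> borel_measurable T"
    using W_measurable by (subst measurable_cong[of _ _ W]) (simp_all add: eq space_T)
  moreover have "(\<integral>\<^sup>+t\<in>{a..d}. (\<integral>\<^sup>+u. V_norm_sq u \<partial>proj \<rho> t) \<partial>lebesgue) < \<infinity>" if ad: "{a..d} \<subseteq> I" for a d
  proof -
    have "(\<integral>\<^sup>+t\<in>{a..d}. (\<integral>\<^sup>+u. V_norm_sq u \<partial>proj \<rho> t) \<partial>lebesgue) = (\<integral>\<^sup>+t\<in>{a..d}. W t \<partial>lebesgue)"
      by (rule nn_integral_cong) (use eq ad in \<open>auto simp: indicator_def\<close>)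
    then show ?thesis using W_locally_integrable[OF ad] by simp
  qed
  ultimately show ?thesis by (simp add: L1_loc_def)
qed

lemma proj_liouville:
  assumes \<phi>: "C1_compact_support k \<phi>" and v: "\<forall>j<k. v j \<in> V"
  shows "AE s in T. integrable (proj \<rho> s) (liouville \<phi> k v s)"
    and "t' \<in> I \<Longrightarrow> t \<in> I \<Longrightarrow> interval_lebesgue_integrable lebesgue (ereal t') (ereal t) (\<lambda>s. \<integral>u. liouville \<phi> k v s u \<partial>proj \<rho> s)"
    and "t' \<in> I \<Longrightarrow> t \<in> I \<Longrightarrow> (\<integral>u. cyl \<phi> k v u \<partial>proj \<rho> t) = (\<integral>u. cyl \<phi> k v u \<partial>proj \<rho> t')
      + (LINT s=ereal t'..ereal t|lebesgue. (\<integral>u. liouville \<phi> k v s u \<partial>proj \<rho> s))"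
proof -
  have v': "\<And>j. j < k \<Longrightarrow> v j \<in> V" using v by blast
  have Lb: "liouville \<phi> k v s \<in> borel_measurable borel" if "s \<in> I" for s by (rule liouville_borel[OF \<phi> _ that]) (rule v')
  have cb: "cyl \<phi> k v \<in> borel_measurable borel" by (rule cyl_borel[OF \<phi>]) (rule v')
  have ad: "dominated (\<lambda>p. liouville \<phi> k v (fst p) (snd p (fst p)))" by (rule dominated_liouville[OF \<phi>]) (rule v')
  have L: "set_integrable lebesgue {a..d} (\<lambda>s. \<integral>u. liouville \<phi> k v s u \<partial>proj \<rho> s)"
    "(\<integral>u. cyl \<phi> k v u \<partial>proj \<rho> d) - (\<integral>u. cyl \<phi> k v u \<partial>proj \<rho> a) = (LINT s:{a..d}|lebesgue. (\<integral>u. liouville \<phi> k v s u \<partial>proj \<rho> s))"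
    if "a \<in> I" "d \<in> I" "a \<le> d" for a d
  proof -
    have sub: "{a..d} \<subseteq> I" by (rule I_sub[OF that(1,2)])
    have eq: "(\<integral>u. liouville \<phi> k v s u \<partial>proj \<rho> s) = (\<integral>u. liouville \<phi> k v s (u s) \<partial>\<rho>)" if "s \<in> {a..d}" for s
      by (rule integral_proj(1)[OF _ Lb]) (use that sub in auto)
    have i: "set_integrable lebesgue {a..d} (\<lambda>s. \<integral>u. liouville \<phi> k v s (u s) \<partial>\<rho>)"
      by (rule liouville_identity(1)[OF \<phi> _ that]) (rule v')
    have l: "(\<integral>u. cyl \<phi> k v (u d) \<partial>\<rho>) - (\<integral>u. cyl \<phi> k v (u a) \<partial>\<rho>) = (LINT s:{a..d}|lebesgue. (\<integral>u. liouville \<phi> k v s (u s) \<partial>\<rho>))"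
      by (rule liouville_identity(2)[OF \<phi> _ that]) (rule v')
    have fe: "indicator {a..d} s *\<^sub>R (\<integral>u. liouville \<phi> k v s u \<partial>proj \<rho> s) = indicator {a..d} s *\<^sub>R (\<integral>u. liouville \<phi> k v s (u s) \<partial>\<rho>)" for s
      using eq[of s] by (simp add: indicator_def)
    show "set_integrable lebesgue {a..d} (\<lambda>s. \<integral>u. liouville \<phi> k v s u \<partial>proj \<rho> s)"
      using i unfolding set_integrable_def fe .
    show "(\<integral>u. cyl \<phi> k v u \<partial>proj \<rho> d) - (\<integral>u. cyl \<phi> k v u \<partial>proj \<rho> a) = (LINT s:{a..d}|lebesgue. (\<integral>u. liouville \<phi> k v s u \<partial>proj \<rho> s))"
      using l unfolding set_lebesgue_integral_def fe integral_proj(1)[OF that(1) cb] integral_proj(1)[OF that(2) cb] .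
  qed
  show "AE s in T. integrable (proj \<rho> s) (liouville \<phi> k v s)"
    using dominated_AE_integrable[OF ad] AE_space
  proof eventually_elim
    case (elim s)
    then have "s \<in> I" by (simp add: space_T)
    then show ?case using integral_proj(2)[OF _ Lb, of s s] elim by simp
  qed
  assume t: "t' \<in> I" "t \<in> I"
  show "interval_lebesgue_integrable lebesgue (ereal t') (ereal t) (\<lambda>s. \<integral>u. liouville \<phi> k v s u \<partial>proj \<rho> s)"
  proof (cases "t' \<le> t")
    case True
    then show ?thesis using L(1)[OF t True] by (simp add: interval_integral_Icc(3))
  next
    case False
    then have "t \<le> t'" by simp
    then show ?thesis using L(1)[OF t(2,1)] by (simp add: interval_integral_Icc(4))
  qed
  show "(\<integral>u. cyl \<phi> k v u \<partial>proj \<rho> t) = (\<integral>u. cyl \<phi> k v u \<partial>proj \<rho> t')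
      + (LINT s=ereal t'..ereal t|lebesgue. (\<integral>u. liouville \<phi> k v s u \<partial>proj \<rho> s))"
  proof (cases "t' \<le> t")
    case True
    then show ?thesis using L(2)[OF t True] by (simp add: interval_integral_Icc(1))
  next
    case False
    then have "t \<le> t'" by simp
    then show ?thesis using L(2)[OF t(2,1)] by (simp add: interval_integral_Icc(2))
  qed
qed

text \<open>One set serves all energy functions, as the definition of a statistical solution
  demands. The condition on \<open>m2\<close> makes the initial term finite, so that the mean
  inequality is one between real numbers.\<close>

definition energy_times :: "real set" where
  "energy_times = {t \<in> interior I. (AE u in \<rho>. good u t) \<and> m2 t < \<infinity>}"

lemma negligible_energy_times: "negligible (I - energy_times)"
proof -
  have "AE t in T. t \<in> energy_times"
    using good_times m2_finite by eventually_elim (simp add: energy_times_def)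
  then have "AE t in lebesgue. t \<in> I \<longrightarrow> t \<in> energy_times" by (simp add: AE_T)
  then obtain N where N: "{t \<in> space lebesgue. \<not> (t \<in> I \<longrightarrow> t \<in> energy_times)} \<subseteq> N" "N \<in> null_sets lebesgue"
    unfolding eventually_ae_filter by blast
  have "negligible N" using N(2) by (simp add: negligible_iff_null_sets)
  moreover have "I - energy_times \<subseteq> N" using N(1) by auto
  ultimately show ?thesis by (rule negligible_subset)
qed

lemma proj_energy:
  assumes e: "energy_function \<psi> \<psi>'"
  defines "K \<equiv> \<lambda>s u. \<psi>' ((norm u)\<^sup>2) * (f s \<bullet> u)"
  shows "AE s in T. integrable (proj \<rho> s) (K s)"
    and "t' \<in> energy_times \<Longrightarrow> t \<in> I \<Longrightarrow> t' \<le> t \<Longrightarrow> set_integrable lebesgue {t'..t} (\<lambda>s. \<integral>u. K s u \<partial>proj \<rho> s)"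
    and "t' \<in> energy_times \<Longrightarrow> t \<in> I \<Longrightarrow> t' \<le> t \<Longrightarrow>
      ereal (1/2) * enn2ereal (\<integral>\<^sup>+u. ennreal (\<psi> ((norm u)\<^sup>2)) \<partial>proj \<rho> t) +
      ereal \<nu> * enn2ereal (\<integral>\<^sup>+s\<in>{t'..t}. (\<integral>\<^sup>+u. ennreal (\<psi>' ((norm u)\<^sup>2)) * V_norm_sq u \<partial>proj \<rho> s) \<partial>lebesgue)
      \<le> ereal (1/2) * enn2ereal (\<integral>\<^sup>+u. ennreal (\<psi> ((norm u)\<^sup>2)) \<partial>proj \<rho> t') +
        ereal (LINT s:{t'..t}|lebesgue. (\<integral>u. K s u \<partial>proj \<rho> s))"
proof -
  have nm: "(\<lambda>u::l2field. (norm u)\<^sup>2) \<in> borel_measurable borel" by measurable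
  have mx: "max 0 ((norm u)\<^sup>2) = (norm u)\<^sup>2" for u :: l2field by simp
  have \<psi>b: "(\<lambda>u::l2field. \<psi> ((norm u)\<^sup>2)) \<in> borel_measurable borel" "(\<lambda>u::l2field. \<psi>' ((norm u)\<^sup>2)) \<in> borel_measurable borel"
    using measurable_compose[OF nm energy_function_borel(1)[OF e]] measurable_compose[OF nm energy_function_borel(2)[OF e]]
    unfolding mx .
  have Kb: "K s \<in> borel_measurable borel" for s
    unfolding K_def by (intro borel_measurable_times \<psi>b) measurable
  have Ks: "K s (u s) = \<psi>' (\<theta> u s) * pow u s" for s and u :: "real \<Rightarrow> l2field" by (simp add: K_def \<theta>_def pow_def)
  have Vb: "(\<lambda>u. ennreal (\<psi>' ((norm u)\<^sup>2)) * V_norm_sq u) \<in> borel_measurable borel"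
    by (rule borel_measurable_times_ennreal[OF _ V_norm_sq_borel]) (use \<psi>b(2) in simp)
  show "AE s in T. integrable (proj \<rho> s) (K s)"
    using dominated_AE_integrable[OF dominated_\<psi>(1)[OF e]] AE_space
  proof eventually_elim
    case (elim s)
    then have "s \<in> I" by (simp add: space_T)
    then show ?case using integral_proj(2)[OF _ Kb, of s s] elim by (simp add: Ks)
  qed
  assume t: "t' \<in> energy_times" "t \<in> I" "t' \<le> t"
  then have t': "t' \<in> interior I" "AE u in \<rho>. good u t'" "m2 t' < \<infinity>" by (auto simp: energy_times_def)
  have t'I: "t' \<in> I" using t'(1) interior_subset by blast
  have sub: "{t'..t} \<subseteq> I" by (rule I_sub[OF t'I t(2)])
  have fe: "indicator {t'..t} s *\<^sub>R (\<integral>u. K s u \<partial>proj \<rho> s) = indicator {t'..t} s *\<^sub>R (\<integral>u. \<psi>' (\<theta> u s) * pow u s \<partial>\<rho>)" for s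
  proof (cases "s \<in> {t'..t}")
    case True
    then have "(\<integral>u. K s u \<partial>proj \<rho> s) = (\<integral>u. K s (u s) \<partial>\<rho>)" by (intro integral_proj(1) Kb) (use sub in auto)
    then show ?thesis by (simp only: Ks)
  qed simp
  have fub: "set_integrable lebesgue {t'..t} (\<lambda>s. \<integral>u. \<psi>' (\<theta> u s) * pow u s \<partial>\<rho>)"
    using dominated_fubini(3)[OF dominated_\<psi>(1)[OF e] _ order_refl sub] by simp
  show "set_integrable lebesgue {t'..t} (\<lambda>s. \<integral>u. K s u \<partial>proj \<rho> s)"
    using fub unfolding set_integrable_def fe .
  note me = mean_energy[OF e t'(1) t(2,3) t'(2,3)]
  have \<psi>eq: "(\<integral>\<^sup>+u. ennreal (\<psi> ((norm u)\<^sup>2)) \<partial>proj \<rho> s) = ennreal (\<integral>u. \<psi> (\<theta> u s) \<partial>\<rho>)"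
    if "s \<in> I" "integrable \<rho> (\<lambda>u. \<psi> (\<theta> u s))" for s
  proof -
    have "(\<integral>\<^sup>+u. ennreal (\<psi> ((norm u)\<^sup>2)) \<partial>proj \<rho> s) = (\<integral>\<^sup>+u. ennreal (\<psi> (\<theta> u s)) \<partial>\<rho>)"
      unfolding \<theta>_def by (rule nn_integral_proj[OF that(1)]) (use \<psi>b(1) in simp)
    also have "\<dots> = ennreal (\<integral>u. \<psi> (\<theta> u s) \<partial>\<rho>)"
      by (rule nn_integral_eq_integral[OF that(2)]) (simp add: \<psi>_nonneg[OF e])
    finally show ?thesis .
  qed
  have pos: "0 \<le> (\<integral>u. \<psi> (\<theta> u s) \<partial>\<rho>)" for s by (rule integral_nonneg_AE) (simp add: \<psi>_nonneg[OF e])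
  let ?D = "\<integral>u. (LINT s:{t'..t}|lebesgue. \<psi>' (\<theta> u s) * dis u s) \<partial>\<rho>"
  have Dpos: "0 \<le> ?D"
    unfolding set_lebesgue_integral_def
    by (intro integral_nonneg_AE AE_I2) (simp add: \<psi>_deriv_nonneg[OF e] dis_V(3))
  have "(\<integral>\<^sup>+s\<in>{t'..t}. (\<integral>\<^sup>+u. ennreal (\<psi>' ((norm u)\<^sup>2)) * V_norm_sq u \<partial>proj \<rho> s) \<partial>lebesgue)
      = (\<integral>\<^sup>+s\<in>{t'..t}. (\<integral>\<^sup>+u. ennreal (\<psi>' (\<theta> u s)) * V_norm_sq (u s) \<partial>\<rho>) \<partial>lebesgue)"
  proof (rule nn_integral_cong)
    fix s
    show "(\<integral>\<^sup>+u. ennreal (\<psi>' ((norm u)\<^sup>2)) * V_norm_sq u \<partial>proj \<rho> s) * indicator {t'..t} s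
        = (\<integral>\<^sup>+u. ennreal (\<psi>' (\<theta> u s)) * V_norm_sq (u s) \<partial>\<rho>) * indicator {t'..t} s"
    proof (cases "s \<in> {t'..t}")
      case True
      then have "s \<in> I" using sub by blast
      from nn_integral_proj[OF this Vb] show ?thesis by (simp add: \<theta>_def)
    qed simp
  qed
  also have "\<dots> = ennreal ?D" by (rule mean_dissipation[OF e t'I t(2)])
  finally have D: "(\<integral>\<^sup>+s\<in>{t'..t}. (\<integral>\<^sup>+u. ennreal (\<psi>' ((norm u)\<^sup>2)) * V_norm_sq u \<partial>proj \<rho> s) \<partial>lebesgue) = ennreal ?D" .
  have P: "(LINT s:{t'..t}|lebesgue. (\<integral>u. K s u \<partial>proj \<rho> s)) = (LINT s:{t'..t}|lebesgue. (\<integral>u. \<psi>' (\<theta> u s) * pow u s \<partial>\<rho>))"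
    unfolding set_lebesgue_integral_def fe ..
  show "ereal (1/2) * enn2ereal (\<integral>\<^sup>+u. ennreal (\<psi> ((norm u)\<^sup>2)) \<partial>proj \<rho> t) +
      ereal \<nu> * enn2ereal (\<integral>\<^sup>+s\<in>{t'..t}. (\<integral>\<^sup>+u. ennreal (\<psi>' ((norm u)\<^sup>2)) * V_norm_sq u \<partial>proj \<rho> s) \<partial>lebesgue)
      \<le> ereal (1/2) * enn2ereal (\<integral>\<^sup>+u. ennreal (\<psi> ((norm u)\<^sup>2)) \<partial>proj \<rho> t') +
        ereal (LINT s:{t'..t}|lebesgue. (\<integral>u. K s u \<partial>proj \<rho> s))"
    unfolding D P \<psi>eq[OF t(2) me(2)] \<psi>eq[OF t'I me(1)] enn2ereal_ennreal[OF pos] enn2ereal_ennreal[OF Dpos]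
    using me(3) by simp
qed

theorem proj_statistical_solution: "statistical_solution I (proj \<rho>)"
  unfolding statistical_solution_def Let_def
proof (intro conjI ballI allI impI)
  fix t assume t: "t \<in> I"
  show "prob_space (proj \<rho> t)"
    unfolding proj_def by (rule prob_space.prob_space_distr[OF rho_prob eval_H[OF t]])
  show "sets (proj \<rho> t) = sets borel_H" by (simp add: proj_def)
next
  fix \<Phi> :: "l2field \<Rightarrow> real" assume "continuous_on H \<Phi> \<and> bounded (\<Phi> ` H)"
  then show "(\<lambda>t. \<integral>u. \<Phi> u \<partial>proj \<rho> t) \<in> borel_measurable T" by (intro proj_mean_measurable) simp
next
  show "Linf_loc I (\<lambda>t. \<integral>\<^sup>+u. ennreal ((norm u)\<^sup>2) \<partial>proj \<rho> t)"
    by (rule Linf_loc_cong[OF _ m2_Linf_loc]) (simp add: nn_integral_proj m2_def \<theta>_def)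
  show "L1_loc I (\<lambda>t. \<integral>\<^sup>+u. V_norm_sq u \<partial>proj \<rho> t)" by (rule proj_L1_loc)
next
  fix k \<phi> v assume "C1_compact_support k \<phi> \<and> (\<forall>j<k. v j \<in> V)"
  then have a: "C1_compact_support k \<phi>" "\<forall>j<k. v j \<in> V" by auto
  note L = proj_liouville[OF a, unfolded liouville_def[abs_def]]
  show "AE s in T. integrable (proj \<rho> s) (\<lambda>u. if u \<in> V then F s u (cyl_deriv \<phi> k v u) else 0)"
    by (rule L(1))
  fix t' t assume t: "t' \<in> I" "t \<in> I"
  show "interval_lebesgue_integrable lebesgue (ereal t') (ereal t)
      (\<lambda>s. \<integral>u. (if u \<in> V then F s u (cyl_deriv \<phi> k v u) else 0) \<partial>proj \<rho> s)" by (rule L(2)[OF t])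
  show "(\<integral>u. cyl \<phi> k v u \<partial>proj \<rho> t) = (\<integral>u. cyl \<phi> k v u \<partial>proj \<rho> t') +
      (LINT s=ereal t'..ereal t|lebesgue. (\<integral>u. (if u \<in> V then F s u (cyl_deriv \<phi> k v u) else 0) \<partial>proj \<rho> s))"
    by (rule L(3)[OF t])
next
  show "\<exists>I'\<subseteq>I. negligible (I - I') \<and>
      (\<forall>\<psi> \<psi>'. energy_function \<psi> \<psi>' \<longrightarrow>
         (AE s in T. integrable (proj \<rho> s) (\<lambda>u. \<psi>' ((norm u)\<^sup>2) * (f s \<bullet> u))) \<and>
         (\<forall>t'\<in>I'. \<forall>t\<in>I. t' \<le> t \<longrightarrow>
            set_integrable lebesgue {t'..t} (\<lambda>s. \<integral>u. \<psi>' ((norm u)\<^sup>2) * (f s \<bullet> u) \<partial>proj \<rho> s) \<and>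
            ereal (1/2) * enn2ereal (\<integral>\<^sup>+u. ennreal (\<psi> ((norm u)\<^sup>2)) \<partial>proj \<rho> t) +
            ereal \<nu> * enn2ereal (\<integral>\<^sup>+s\<in>{t'..t}. (\<integral>\<^sup>+u. ennreal (\<psi>' ((norm u)\<^sup>2)) * V_norm_sq u \<partial>proj \<rho> s) \<partial>lebesgue)
            \<le> ereal (1/2) * enn2ereal (\<integral>\<^sup>+u. ennreal (\<psi> ((norm u)\<^sup>2)) \<partial>proj \<rho> t') +
              ereal (LINT s:{t'..t}|lebesgue. (\<integral>u. \<psi>' ((norm u)\<^sup>2) * (f s \<bullet> u) \<partial>proj \<rho> s))))"
  proof (intro exI[of _ energy_times] conjI allI impI ballI)
    show "energy_times \<subseteq> I" using interior_subset by (auto simp: energy_times_def)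
    show "negligible (I - energy_times)" by (rule negligible_energy_times)
  next
    fix \<psi> \<psi>' assume "energy_function \<psi> \<psi>'"
    then show "AE s in T. integrable (proj \<rho> s) (\<lambda>u. \<psi>' ((norm u)\<^sup>2) * (f s \<bullet> u))"
      by (rule proj_energy(1))
  next
    fix \<psi> \<psi>' t' t assume "energy_function \<psi> \<psi>'" "t' \<in> energy_times" "t \<in> I" "t' \<le> t"
    then show "set_integrable lebesgue {t'..t} (\<lambda>s. \<integral>u. \<psi>' ((norm u)\<^sup>2) * (f s \<bullet> u) \<partial>proj \<rho> s)"
      by (rule proj_energy(2))
  next
    fix \<psi> \<psi>' t' t assume "energy_function \<psi> \<psi>'" "t' \<in> energy_times" "t \<in> I" "t' \<le> t"
    then show "ereal (1/2) * enn2ereal (\<integral>\<^sup>+u. ennreal (\<psi> ((norm u)\<^sup>2)) \<partial>proj \<rho> t) +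
            ereal \<nu> * enn2ereal (\<integral>\<^sup>+s\<in>{t'..t}. (\<integral>\<^sup>+u. ennreal (\<psi>' ((norm u)\<^sup>2)) * V_norm_sq u \<partial>proj \<rho> s) \<partial>lebesgue)
            \<le> ereal (1/2) * enn2ereal (\<integral>\<^sup>+u. ennreal (\<psi> ((norm u)\<^sup>2)) \<partial>proj \<rho> t') +
              ereal (LINT s:{t'..t}|lebesgue. (\<integral>u. \<psi>' ((norm u)\<^sup>2) * (f s \<bullet> u) \<partial>proj \<rho> s))"
      by (rule proj_energy(3))
  qed
next
  fix t0 \<psi> \<psi>' assume "left_endpoint_in I t0 \<and> energy_function \<psi> \<psi>'"
  then have False using open_left by (auto simp: interval_open_left_def)
  then show "(\<integral>\<^sup>+u. ennreal (\<psi> ((norm u)\<^sup>2)) \<partial>proj \<rho> t0) < \<infinity>"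
    and "((\<lambda>t. \<integral>\<^sup>+u. ennreal (\<psi> ((norm u)\<^sup>2)) \<partial>proj \<rho> t) \<longlongrightarrow>
           (\<integral>\<^sup>+u. ennreal (\<psi> ((norm u)\<^sup>2)) \<partial>proj \<rho> t0)) (at t0 within I)" by simp_all
qed

end

theorem theorem3p4:
  fixes \<Omega> :: "(real^3) set" and \<V> :: "(real^3 \<Rightarrow> real^3) set" and \<nu> :: real
    and I :: "real set" and f :: "real \<Rightarrow> l2field" and \<rho> :: "(real \<Rightarrow> l2field) measure"
  assumes "flow_setting \<Omega> \<V>"
    and "\<nu> > 0"
    and "interval_open_left I"
    and "navier_stokes.Linf_H \<Omega> \<V> I f"
    and "navier_stokes.Vishik_Fursikov_measure \<Omega> \<V> \<nu> f I \<rho>"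
  shows "navier_stokes.statistical_solution \<Omega> \<V> \<nu> f I (navier_stokes.proj \<Omega> \<V> \<rho>)"
proof -
  interpret vishik_fursikov \<Omega> \<V> \<nu> f I \<rho> by unfold_locales (fact assms)+
  show ?thesis by (rule proj_statistical_solution)
qed

end
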